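(* Assume the driver $f$ satisfies (f1)--(f5), and let $\varphi^n:C^d[0,T]\to\mathbb R$ be a sequence of bounded Lipschitz-continuous functions such that $\|\varphi^n-\varphi\|_\infty\to0$ for a bounded function $\varphi:C^d[0,T]\to\mathbb R$. Let $(Y^n,Z^n)$ be the solution of the BSDE with driver $f$ and terminal condition $\xi^n=\varphi^n(W)$ such that $Z^n$ is bounded. Then $$\Big\|\sup_t|Y^n_t-Y_t|\Big\|_{L^\infty}\to0\quad\text{and}\quad \mathbb E\Big[\sqrt{\int_0^T|Z^n_s-Z_s|^2ds}\Big]\to0,$$ where $(Y,Z,A)$ is a supersolution of the BSDE with driver $f$ and terminal condition $\xi=\varphi(W)$ such that $Y$ is bounded and continuous and $Z$ is a BMO process. If moreover $f$ is increasing or decreasing in $y$, then $(Y,Z,A)$ satisfies bounded comparison from above and hence is the minimal bounded supersolution of this BSDE.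
   Context: Setting. $T\in(0,\infty)$; $W$ is a $d$-dimensional Brownian motion on $(\Omega,\mathcal F,\mathbb P)$, $(\mathcal F_t)_{t\in[0,T]}$ its augmented filtration; (in)equalities between random variables hold a.s. $|\cdot|$ is the Euclidean norm, $C^d[0,T]$ the space of continuous $w:[0,T]\to\mathbb R^d$ with the supremum norm; Lipschitz is with respect to this norm, and $\|\varphi^n-\varphi\|_\infty=\sup_w|\varphi^n(w)-\varphi(w)|$. $\mathcal P$ is the predictable $\sigma$-algebra on $[0,T]\times C^d[0,T]$ for the filtration generated by the coordinate process. A driver is a $\mathcal P\otimes\mathcal B(\mathbb R)\otimes\mathcal B(\mathbb R^d)$-measurable function $f:[0,T]\times C^d[0,T]\times\mathbb R\times\mathbb R^d\to\mathbb R$. The BSDE with driver $f$ and ($\mathcal F_T$-measurable) terminal condition $\xi$ is $$Y_t=\xi+\int_t^Tf(s,W,Y_s,Z_s)ds-\int_t^TZ_s\,dW_s,\quad0\le t\le T,$$ where $Z_s\,dW_s=\sum_kZ^k_s\,dW^k_s$. A solution is a pair of predictable processes $(Y,Z)$ with values in $\mathbb R\times\mathbb R^d$ such that $\int_0^T|f(s,W,Y_s,Z_s)|ds<\infty$, $\int_0^T|Z_s|^2ds<\infty$ and the equation holds for all $t$. A supersolution is a triple of predictable processes $(Y,Z,A)$ with values in $\mathbb R\times\mathbb R^d\times\mathbb R$ such that $Y$ is RCLL (right-continuous with left limits), $A$ is increasing, RCLL and starts at $0$, the same integrability holds, and $Y_t=\xi+\int_t^Tf(s,W,Y_s,Z_s)ds-\int_t^TZ_s\,dW_s+A_T-A_t$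 for all $t$. "Increasing"/"decreasing" are in the weak sense. A supersolution $(Y,Z,A)$ of the BSDE with $(f,\xi)$ satisfies bounded comparison from above if for every supersolution $(Y',Z',A')$ of the BSDE with a driver $f'\ge f$ and terminal condition $\xi'\ge\xi$ such that $Y'$ is bounded, one has $Y'_t\ge Y_t$ for all $t$. A minimal bounded supersolution is a supersolution $(Y,Z,A)$ with $Y$ bounded such that $Y'_t\ge Y_t$ for all $t$ for every supersolution $(Y',Z',A')$ of the same BSDE with $Y'$ bounded. A $d$-dimensional predictable process $\mu$ is BMO if there is $C\in\mathbb R_+$ with $\mathbb E[\int_\tau^T|\mu_s|^2ds\mid\mathcal F_\tau]\le C$ for all $[0,T]$-valued stopping times $\tau$. Conditions on $f$: (f1) $f(t,w,y,z)$ is convex in $z$. (f2) $\sup_{t,w}|f(t,w,0,0)|<\infty$. (f3) There is $K\in\mathbb R_+$ with $|f(t,w_1,y_1,z)-f(t,w_2,y_2,z)|\le K(\sup_{0\le s\le t}|w_1(s)-w_2(s)|+|y_1-y_2|)$ for all $t,w_1,w_2,y_1,y_2,z$. (f4) For every $a\in\mathbb R_+$ there is $b\in\mathbb R_+$ with $|f(t,w,y,z_1)-f(t,w,y,z_2)|\le b|z_1-z_2|$ for all $t,w,y$ and all $|z_1|\vee|z_2|\le a$. (f5) $\inf_{w\in C^d[0,T],\,y\in[-c,c],\,z\in\mathbb R^d,\,t\in[0,T]}f(t,w,y,z)>-\infty$ for all $c\in\mathbb R_+$. Under (f1)--(f4), for every terminal condition $\varphi(W)$ with $\varphi$ Lipschitz-continuous,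 the BSDE has a unique solution $(Y,Z)$ with $Z$ bounded; this is the solution $(Y^n,Z^n)$ referred to. *)

theory Defs
  imports "HOL-Probability.Probability"
begin

section \<open>Filtrations, predictability and Brownian motion\<close>

text \<open>Time runs through \<open>{0..T}\<close> inside \<open>real\<close>; a process is a function of time and of the
  sample point, and its values at times outside \<open>{0..T}\<close> are never used.\<close>

definition natural_filtration ::
    "'a set \<Rightarrow> (real \<Rightarrow> 'a \<Rightarrow> 'b::topological_space) \<Rightarrow> real \<Rightarrow> 'a measure" where
  "natural_filtration \<Omega> X t = sigma \<Omega> {X s -` A \<inter> \<Omega> | s A. s \<in> {0..t} \<and> A \<in> sets borel}"

text \<open>The null sets are those of the completion, so that no completeness has to be assumed of the
  underlying probability space. Accordingly \<open>completion M\<close> is the probability measure used below.\<close>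

definition augmented_filtration ::
    "'w measure \<Rightarrow> (real \<Rightarrow> 'w \<Rightarrow> 'b::topological_space) \<Rightarrow> real \<Rightarrow> 'w measure" where
  "augmented_filtration M W t =
     sigma (space M) (sets (natural_filtration (space M) W t) \<union> null_sets (completion M))"

lemma space_natural_filtration [simp]: "space (natural_filtration \<Omega> X t) = \<Omega>"
  unfolding natural_filtration_def by (intro space_measure_of) auto

lemma sets_augmented_filtration:
  "sets (augmented_filtration M W t) =
     sigma_sets (space M) (sets (natural_filtration (space M) W t) \<union> null_sets (completion M))"
proof -
  have "sets (natural_filtration (space M) W t) \<subseteq> Pow (space M)"
    using sets.space_closed[of "natural_filtration (space M) W t"] by simp
  moreover have "null_sets (completion M) \<subseteq> Pow (space M)"
    using sets.space_closed[of "completion M"] by auto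
  ultimately show ?thesis
    unfolding augmented_filtration_def by (intro sets_measure_of) auto
qed

lemma space_augmented_filtration [simp]: "space (augmented_filtration M W t) = space M"
proof -
  have "sets (natural_filtration (space M) W t) \<subseteq> Pow (space M)"
    using sets.space_closed[of "natural_filtration (space M) W t"] by simp
  moreover have "null_sets (completion M) \<subseteq> Pow (space M)"
    using sets.space_closed[of "completion M"] by auto
  ultimately show ?thesis
    unfolding augmented_filtration_def by (intro space_measure_of) auto
qed

lemma sets_natural_filtration_mono:
  assumes "s \<le> t"
  shows "sets (natural_filtration \<Omega> X s) \<subseteq> sets (natural_filtration \<Omega> X t)"
proof -
  have "{X r -` A \<inter> \<Omega> | r A. r \<in> {0..s} \<and> A \<in> sets borel}
      \<subseteq> {X r -` A \<inter> \<Omega> | r A. r \<in> {0..t} \<and> A \<in> sets borel}"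
    using assms by fastforce
  then show ?thesis
    unfolding natural_filtration_def
    by (subst (1 2) sets_measure_of) (auto intro: sigma_sets_mono'[THEN subsetD])
qed

lemma filtration_augmented: "filtration (space M) (augmented_filtration M W)"
proof
  fix s t :: real assume "s \<le> t"
  then show "sets (augmented_filtration M W s) \<subseteq> sets (augmented_filtration M W t)"
    unfolding sets_augmented_filtration
    using sets_natural_filtration_mono[of s t "space M" W] by (intro sigma_sets_mono') auto
qed simp

definition predictable_sigma :: "real \<Rightarrow> 'a set \<Rightarrow> (real \<Rightarrow> 'a measure) \<Rightarrow> (real \<times> 'a) measure" where
  "predictable_sigma T \<Omega> F =
     sigma ({0..T} \<times> \<Omega>)
       ({{0} \<times> A | A. A \<in> sets (F 0)} \<union>
        {{s<..t} \<times> A | s t A. 0 \<le> s \<and> s < t \<and> t \<le> T \<and> A \<in> sets (F s)})"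

definition brownian_motion :: "'w measure \<Rightarrow> real \<Rightarrow> (real \<Rightarrow> 'w \<Rightarrow> real^'d) \<Rightarrow> bool" where
  "brownian_motion M T W \<longleftrightarrow>
     (\<forall>t\<in>{0..T}. W t \<in> borel_measurable M) \<and>
     (\<forall>\<omega>\<in>space M. continuous_on {0..T} (\<lambda>t. W t \<omega>)) \<and>
     (AE \<omega> in M. W 0 \<omega> = 0) \<and>
     (\<forall>s t. 0 \<le> s \<and> s < t \<and> t \<le> T \<longrightarrow>
        distributed M lborel (\<lambda>\<omega>. W t \<omega> - W s \<omega>)
          (\<lambda>x. ennreal (\<Prod>k\<in>UNIV. normal_density 0 (sqrt (t - s)) (x $ k))) \<and>
        prob_space.indep_set M (sets (natural_filtration (space M) W s))
          (sets (vimage_algebra (space M) (\<lambda>\<omega>. W t \<omega> - W s \<omega>) borel)))"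

abbreviation predictable ::
    "'w measure \<Rightarrow> real \<Rightarrow> (real \<Rightarrow> 'w \<Rightarrow> real^'d) \<Rightarrow> (real \<Rightarrow> 'w \<Rightarrow> 'b::topological_space) \<Rightarrow> bool" where
  "predictable M T W X \<equiv>
     (\<lambda>(t, \<omega>). X t \<omega>) \<in>
       borel_measurable (predictable_sigma T (space M) (augmented_filtration M W))"

definition bounded_process ::
    "'w measure \<Rightarrow> real \<Rightarrow> (real \<Rightarrow> 'w \<Rightarrow> 'b::real_normed_vector) \<Rightarrow> bool" where
  "bounded_process M T X \<longleftrightarrow>
     (\<exists>C. AE \<omega> in completion M. \<forall>t\<in>{0..T}. norm (X t \<omega>) \<le> C)"

definition rcll :: "real \<Rightarrow> (real \<Rightarrow> real) \<Rightarrow> bool" where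
  "rcll T x \<longleftrightarrow>
     (\<forall>t\<in>{0..<T}. (x \<longlongrightarrow> x t) (at_right t)) \<and>
     (\<forall>t\<in>{0<..T}. \<exists>l. (x \<longlongrightarrow> l) (at_left t))"

definition bmo :: "'w measure \<Rightarrow> real \<Rightarrow> (real \<Rightarrow> 'w \<Rightarrow> real^'d) \<Rightarrow> (real \<Rightarrow> 'w \<Rightarrow> real^'d) \<Rightarrow> bool" where
  "bmo M T W \<mu> \<longleftrightarrow>
     predictable M T W \<mu> \<and>
     (\<exists>C::real. 0 \<le> C \<and>
       (\<forall>\<tau>. stopping_time (augmented_filtration M W) \<tau> \<and> (\<forall>\<omega>\<in>space M. \<tau> \<omega> \<in> {0..T}) \<longrightarrow>
         (AE \<omega> in completion M.
            nn_cond_exp (completion M)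
              (filtration.pre_sigma (space M) (augmented_filtration M W) \<tau>)
              (\<lambda>\<omega>'. \<integral>\<^sup>+s\<in>{\<tau> \<omega>'..T}. ennreal ((norm (\<mu> s \<omega>'))\<^sup>2) \<partial>lborel) \<omega> \<le> ennreal C)))"

section \<open>The stochastic integral\<close>

definition simple_integrand ::
    "'w measure \<Rightarrow> real \<Rightarrow> (real \<Rightarrow> 'w \<Rightarrow> real^'d) \<Rightarrow> nat \<Rightarrow> (nat \<Rightarrow> real) \<Rightarrow> (nat \<Rightarrow> 'w \<Rightarrow> real^'d) \<Rightarrow> bool" where
  "simple_integrand M T W n \<tau> H \<longleftrightarrow>
     0 \<le> \<tau> 0 \<and> (\<forall>i<n. \<tau> i \<le> \<tau> (Suc i)) \<and> \<tau> n \<le> T \<and>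
     (\<forall>i<n. H i \<in> borel_measurable (augmented_filtration M W (\<tau> i)) \<and> bounded (H i ` space M))"

definition simple_process ::
    "nat \<Rightarrow> (nat \<Rightarrow> real) \<Rightarrow> (nat \<Rightarrow> 'w \<Rightarrow> real^'d) \<Rightarrow> real \<Rightarrow> 'w \<Rightarrow> real^'d" where
  "simple_process n \<tau> H s \<omega> = (\<Sum>i<n. indicator {\<tau> i<..\<tau> (Suc i)} s *\<^sub>R H i \<omega>)"

definition simple_integral ::
    "(real \<Rightarrow> 'w \<Rightarrow> real^'d) \<Rightarrow> nat \<Rightarrow> (nat \<Rightarrow> real) \<Rightarrow> (nat \<Rightarrow> 'w \<Rightarrow> real^'d) \<Rightarrow> real \<Rightarrow> 'w \<Rightarrow> real" where
  "simple_integral W n \<tau> H t \<omega> =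
     (\<Sum>i<n. H i \<omega> \<bullet> (W (min (\<tau> (Suc i)) t) \<omega> - W (min (\<tau> i) t) \<omega>))"

definition vanishes_in_prob :: "'w measure \<Rightarrow> (nat \<Rightarrow> 'w \<Rightarrow> ennreal) \<Rightarrow> bool" where
  "vanishes_in_prob P X \<longleftrightarrow>
     (\<forall>\<epsilon>>0. (\<lambda>k. measure P {\<omega> \<in> space P. \<epsilon> < X k \<omega>}) \<longlonglongrightarrow> 0)"

text \<open>\<open>ito_integral M T W Z I\<close>: the continuous adapted process \<open>I\<close> is (a version of) the stochastic
  integral process \<open>t \<mapsto> \<integral>\<^sub>0\<^sup>t Z\<^sub>s dW\<^sub>s\<close> of the predictable, pathwise square-integrable \<open>Z\<close>. This is the usual
  extension of the elementary integral by convergence in probability; such an \<open>I\<close> exists for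
  every such \<open>Z\<close> and is unique up to indistinguishability.\<close>

definition ito_integral ::
    "'w measure \<Rightarrow> real \<Rightarrow> (real \<Rightarrow> 'w \<Rightarrow> real^'d) \<Rightarrow> (real \<Rightarrow> 'w \<Rightarrow> real^'d) \<Rightarrow> (real \<Rightarrow> 'w \<Rightarrow> real) \<Rightarrow> bool" where
  "ito_integral M T W Z I \<longleftrightarrow>
     predictable M T W Z \<and>
     (AE \<omega> in completion M. set_integrable lborel {0..T} (\<lambda>s. (norm (Z s \<omega>))\<^sup>2)) \<and>
     (\<forall>t\<in>{0..T}. I t \<in> borel_measurable (augmented_filtration M W t)) \<and>
     (\<forall>\<omega>\<in>space M. continuous_on {0..T} (\<lambda>t. I t \<omega>)) \<and>
     (\<exists>n \<tau> H. (\<forall>k. simple_integrand M T W (n k) (\<tau> k) (H k)) \<and>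
        vanishes_in_prob (completion M)
          (\<lambda>k \<omega>. \<integral>\<^sup>+s\<in>{0..T}.
             ennreal ((norm (simple_process (n k) (\<tau> k) (H k) s \<omega> - Z s \<omega>))\<^sup>2) \<partial>lborel) \<and>
        vanishes_in_prob (completion M)
          (\<lambda>k \<omega>. SUP t\<in>{0..T}.
             ennreal \<bar>simple_integral W (n k) (\<tau> k) (H k) t \<omega> - I t \<omega>\<bar>))"

section \<open>Path space and drivers\<close>

text \<open>Members of the path space are \<open>undefined\<close> off \<open>{0..T}\<close>, so that they correspond one-to-one to
  the continuous functions on \<open>{0..T}\<close>.\<close>

definition path_space :: "real \<Rightarrow> (real \<Rightarrow> real^'d) set" where
  "path_space T = {w \<in> extensional {0..T}. continuous_on {0..T} w}"

definition sample_path :: "real \<Rightarrow> (real \<Rightarrow> 'w \<Rightarrow> real^'d) \<Rightarrow> 'w \<Rightarrow> real \<Rightarrow> real^'d" where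
  "sample_path T W \<omega> = restrict (\<lambda>t. W t \<omega>) {0..T}"

definition sup_dist :: "real \<Rightarrow> (real \<Rightarrow> real^'d) \<Rightarrow> (real \<Rightarrow> real^'d) \<Rightarrow> real" where
  "sup_dist t w1 w2 = (SUP s\<in>{0..t}. norm (w1 s - w2 s))"

definition path_lipschitz :: "real \<Rightarrow> ((real \<Rightarrow> real^'d) \<Rightarrow> real) \<Rightarrow> bool" where
  "path_lipschitz T \<phi> \<longleftrightarrow>
     (\<exists>L. \<forall>w1\<in>path_space T. \<forall>w2\<in>path_space T. \<bar>\<phi> w1 - \<phi> w2\<bar> \<le> L * sup_dist T w1 w2)"

type_synonym 'd driver_fun = "real \<Rightarrow> (real \<Rightarrow> real^'d) \<Rightarrow> real \<Rightarrow> real^'d \<Rightarrow> real"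

definition driver :: "real \<Rightarrow> ('d::finite) driver_fun \<Rightarrow> bool" where
  "driver T f \<longleftrightarrow>
     (\<lambda>((t, w), y, z). f t w y z) \<in> borel_measurable
       (predictable_sigma T (path_space T) (natural_filtration (path_space T) (\<lambda>s w. w s))
         \<Otimes>\<^sub>M (borel \<Otimes>\<^sub>M borel))"

definition f1 :: "real \<Rightarrow> ('d::finite) driver_fun \<Rightarrow> bool" where
  "f1 T f \<longleftrightarrow> (\<forall>t\<in>{0..T}. \<forall>w\<in>path_space T. \<forall>y. convex_on UNIV (\<lambda>z. f t w y z))"

definition f2 :: "real \<Rightarrow> ('d::finite) driver_fun \<Rightarrow> bool" where
  "f2 T f \<longleftrightarrow> bdd_above {\<bar>f t w 0 0\<bar> | t w. t \<in> {0..T} \<and> w \<in> path_space T}"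

definition f3 :: "real \<Rightarrow> ('d::finite) driver_fun \<Rightarrow> bool" where
  "f3 T f \<longleftrightarrow>
     (\<exists>K\<ge>0. \<forall>t\<in>{0..T}. \<forall>w1\<in>path_space T. \<forall>w2\<in>path_space T. \<forall>y1 y2 z.
        \<bar>f t w1 y1 z - f t w2 y2 z\<bar> \<le> K * (sup_dist t w1 w2 + \<bar>y1 - y2\<bar>))"

definition f4 :: "real \<Rightarrow> ('d::finite) driver_fun \<Rightarrow> bool" where
  "f4 T f \<longleftrightarrow>
     (\<forall>a\<ge>0. \<exists>b\<ge>0. \<forall>t\<in>{0..T}. \<forall>w\<in>path_space T. \<forall>y z1 z2. max (norm z1) (norm z2) \<le> a \<longrightarrow>
        \<bar>f t w y z1 - f t w y z2\<bar> \<le> b * norm (z1 - z2))"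

definition f5 :: "real \<Rightarrow> ('d::finite) driver_fun \<Rightarrow> bool" where
  "f5 T f \<longleftrightarrow>
     (\<forall>c\<ge>0. bdd_below {f t w y z | t w y z. t \<in> {0..T} \<and> w \<in> path_space T \<and> y \<in> {-c..c}})"

definition increasing_in_y :: "real \<Rightarrow> ('d::finite) driver_fun \<Rightarrow> bool" where
  "increasing_in_y T f \<longleftrightarrow> (\<forall>t\<in>{0..T}. \<forall>w\<in>path_space T. \<forall>z. mono (\<lambda>y. f t w y z))"

definition decreasing_in_y :: "real \<Rightarrow> ('d::finite) driver_fun \<Rightarrow> bool" where
  "decreasing_in_y T f \<longleftrightarrow> (\<forall>t\<in>{0..T}. \<forall>w\<in>path_space T. \<forall>z. antimono (\<lambda>y. f t w y z))"

section \<open>Solutions and supersolutions of BSDEs\<close>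

text \<open>The equation is required to hold for all \<open>t\<close> simultaneously outside one null set; for a
  solution, whose \<open>Y\<close> is not assumed to have regular paths, this makes \<open>Y\<close> continuous rather
  than just a modification of a continuous process.\<close>

definition bsde_equation ::
    "'w measure \<Rightarrow> real \<Rightarrow> (real \<Rightarrow> 'w \<Rightarrow> real^'d) \<Rightarrow> 'd driver_fun \<Rightarrow> ('w \<Rightarrow> real) \<Rightarrow>
     (real \<Rightarrow> 'w \<Rightarrow> real) \<Rightarrow> (real \<Rightarrow> 'w \<Rightarrow> real^'d) \<Rightarrow> (real \<Rightarrow> 'w \<Rightarrow> real) \<Rightarrow> bool" where
  "bsde_equation M T W f \<xi> Y Z A \<longleftrightarrow>
     (AE \<omega> in completion M.
        set_integrable lborel {0..T} (\<lambda>s. f s (sample_path T W \<omega>) (Y s \<omega>) (Z s \<omega>))) \<and>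
     (AE \<omega> in completion M. set_integrable lborel {0..T} (\<lambda>s. (norm (Z s \<omega>))\<^sup>2)) \<and>
     (\<exists>I. ito_integral M T W Z I \<and>
        (AE \<omega> in completion M. \<forall>t\<in>{0..T}.
           Y t \<omega> = \<xi> \<omega> + (LBINT s:{t..T}. f s (sample_path T W \<omega>) (Y s \<omega>) (Z s \<omega>))
                    - (I T \<omega> - I t \<omega>) + A T \<omega> - A t \<omega>))"

definition bsde_solution ::
    "'w measure \<Rightarrow> real \<Rightarrow> (real \<Rightarrow> 'w \<Rightarrow> real^'d) \<Rightarrow> 'd driver_fun \<Rightarrow> ('w \<Rightarrow> real) \<Rightarrow>
     (real \<Rightarrow> 'w \<Rightarrow> real) \<Rightarrow> (real \<Rightarrow> 'w \<Rightarrow> real^'d) \<Rightarrow> bool" where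
  "bsde_solution M T W f \<xi> Y Z \<longleftrightarrow>
     \<xi> \<in> borel_measurable (augmented_filtration M W T) \<and>
     predictable M T W Y \<and> predictable M T W Z \<and>
     bsde_equation M T W f \<xi> Y Z (\<lambda>_ _. 0)"

definition bsde_supersolution ::
    "'w measure \<Rightarrow> real \<Rightarrow> (real \<Rightarrow> 'w \<Rightarrow> real^'d) \<Rightarrow> 'd driver_fun \<Rightarrow> ('w \<Rightarrow> real) \<Rightarrow>
     (real \<Rightarrow> 'w \<Rightarrow> real) \<Rightarrow> (real \<Rightarrow> 'w \<Rightarrow> real^'d) \<Rightarrow> (real \<Rightarrow> 'w \<Rightarrow> real) \<Rightarrow> bool" where
  "bsde_supersolution M T W f \<xi> Y Z A \<longleftrightarrow>
     \<xi> \<in> borel_measurable (augmented_filtration M W T) \<and>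
     predictable M T W Y \<and> predictable M T W Z \<and> predictable M T W A \<and>
     (AE \<omega> in completion M. rcll T (\<lambda>t. Y t \<omega>)) \<and>
     (AE \<omega> in completion M.
        mono_on {0..T} (\<lambda>t. A t \<omega>) \<and> rcll T (\<lambda>t. A t \<omega>) \<and> A 0 \<omega> = 0) \<and>
     bsde_equation M T W f \<xi> Y Z A"

definition bounded_comparison_from_above ::
    "'w measure \<Rightarrow> real \<Rightarrow> (real \<Rightarrow> 'w \<Rightarrow> real^'d) \<Rightarrow> 'd driver_fun \<Rightarrow> ('w \<Rightarrow> real) \<Rightarrow>
     (real \<Rightarrow> 'w \<Rightarrow> real) \<Rightarrow> (real \<Rightarrow> 'w \<Rightarrow> real^'d) \<Rightarrow> (real \<Rightarrow> 'w \<Rightarrow> real) \<Rightarrow> bool" where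
  "bounded_comparison_from_above M T W f \<xi> Y Z A \<longleftrightarrow>
     bsde_supersolution M T W f \<xi> Y Z A \<and>
     (\<forall>f' \<xi>' Y' Z' A'.
        driver T f' \<and>
        (\<forall>t\<in>{0..T}. \<forall>w\<in>path_space T. \<forall>y z. f t w y z \<le> f' t w y z) \<and>
        (AE \<omega> in completion M. \<xi> \<omega> \<le> \<xi>' \<omega>) \<and>
        bsde_supersolution M T W f' \<xi>' Y' Z' A' \<and> bounded_process M T Y' \<longrightarrow>
        (AE \<omega> in completion M. \<forall>t\<in>{0..T}. Y t \<omega> \<le> Y' t \<omega>))"

definition minimal_bounded_supersolution ::
    "'w measure \<Rightarrow> real \<Rightarrow> (real \<Rightarrow> 'w \<Rightarrow> real^'d) \<Rightarrow> 'd driver_fun \<Rightarrow> ('w \<Rightarrow> real) \<Rightarrow>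
     (real \<Rightarrow> 'w \<Rightarrow> real) \<Rightarrow> (real \<Rightarrow> 'w \<Rightarrow> real^'d) \<Rightarrow> (real \<Rightarrow> 'w \<Rightarrow> real) \<Rightarrow> bool" where
  "minimal_bounded_supersolution M T W f \<xi> Y Z A \<longleftrightarrow>
     bsde_supersolution M T W f \<xi> Y Z A \<and> bounded_process M T Y \<and>
     (\<forall>Y' Z' A'.
        bsde_supersolution M T W f \<xi> Y' Z' A' \<and> bounded_process M T Y' \<longrightarrow>
        (AE \<omega> in completion M. \<forall>t\<in>{0..T}. Y t \<omega> \<le> Y' t \<omega>))"

end

theory Submission
  imports Defs
begin

text \<open>The proof avoids Ito's formula and changes of measure. It rests on the martingale property of
  \<open>exp (l * (I u - I t) - l\<^sup>2 / 2 * (qv u - qv t))\<close> for a stochastic integral \<open>I\<close> with quadratic variation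
  \<open>qv\<close>, first for simple integrands and then, as a submartingale inequality, whenever the exponent is
  bounded above. Expanding it at \<open>l = 0\<close> gives the isometry and a maximal inequality.

  Comparison: let \<open>U = Y - Y'\<close> be the difference of a solution with bounded \<open>Z\<close> and a bounded supersolution of
  an equation with a larger driver. Convexity in \<open>z\<close> makes the drift of \<open>U\<close> at most
  \<open>K * \<bar>U\<bar> + b * norm (Z - Z')\<close>, and the submartingale inequality with \<open>l\<close> large turns an upper
  bound \<open>U \<le> m\<close> into the better one \<open>U t \<le> e + K * (LBINT s:{t..T}. m s)\<close>, where \<open>e\<close> bounds the excess of
  the terminal value. Iterating yields \<open>U t \<le> e * exp (2 * K * (T - t))\<close>.

  Comparing solutions with each other shows that they are uniformly Cauchy. Their drifts are
  uniformly bounded below by (f5), hence uniformly bounded in \<open>L\<^sup>1\<close>, and the energy estimate for a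
  small process with drift in \<open>L\<^sup>1\<close> makes the \<open>Zn\<close> Cauchy in \<open>L\<^sup>2\<close>. In the limit Fatou's lemma for the drifts
  loses mass, which is collected by the increasing process.\<close>

section \<open>Brownian increments and the augmented filtration\<close>

text \<open>The obstacle is that \<open>f\<close> may grow faster than linearly in \<open>z\<close>,
  while the bounds on \<open>Zn n\<close> depend on \<open>n\<close>. Every constant into which
  these bounds enter must vanish from the final estimates. The slope \<open>b\<close> of
  \<open>f\<close> at a bounded \<open>Z\<close> only decides how large \<open>l\<close> has to be
  in the comparison argument. The bound on the drift of \<open>Yn n\<close> is multiplied by the
  mesh of a partition in the energy estimate and disappears as the mesh tends to 0. What survives is
  the Lipschitz constant \<open>K\<close> in \<open>y\<close>, a uniform bound on the
  \<open>Yn n\<close> and the lower bound on the drifts. Stochastic integrals are given only as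
  limits of elementary ones. Their properties are proved for simple integrands that are switched off
  before the quadratic variation exceeds a level, which supplies the integrability, and are then
  carried over path by path along an almost surely convergent subsequence. Stopping is restricted to
  finitely many times, because a simple integrand stopped in this way is still simple.\<close>

lemma AE_eq_measurable_null:
  fixes X Y :: "'a \<Rightarrow> 'b::topological_space"
  assumes X: "X \<in> borel_measurable F" and sp: "space F = space M"
    and null: "null_sets (completion M) \<subseteq> sets F"
    and eq: "AE x in completion M. X x = Y x"
  shows "Y \<in> borel_measurable F"
proof -
  obtain N where N': "{x\<in>space (completion M). \<not> X x = Y x} \<subseteq> N" "emeasure (completion M) N = 0" "N \<in> sets (completion M)"
    using AE_E[OF eq] by metis
  then have N: "N \<in> null_sets (completion M)" "{x\<in>space M. X x \<noteq> Y x} \<subseteq> N"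
    by (simp_all add: null_sets_def)
  have agree: "X x = Y x" if "x \<in> space M" "x \<notin> N" for x using N(2) that by blast
  show ?thesis
  proof (rule measurableI)
    fix A :: "'b set" assume A: "A \<in> sets borel"
    have "Y -` A \<inter> space F = (X -` A \<inter> space F - N) \<union> (Y -` A \<inter> space F \<inter> N)"
      by (rule set_eqI) (use agree sp in \<open>simp; metis\<close>)
    moreover have "X -` A \<inter> space F - N \<in> sets F"
      using measurable_sets[OF X A] N(1) null by (intro sets.Diff) blast+
    moreover have "Y -` A \<inter> space F \<inter> N \<in> null_sets (completion M)"
      using null_sets_completion_subset[of "Y -` A \<inter> space F \<inter> N" N] N by blast
    ultimately show "Y -` A \<inter> space F \<in> sets F" using null by (metis sets.Un subsetD)
  qed auto
qed

locale brownian =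
  fixes M :: "'w measure" and T :: real and W :: "real \<Rightarrow> 'w \<Rightarrow> real^'d"
  assumes prob_M: "prob_space M" and T_pos: "0 < T" and bm: "brownian_motion M T W"
begin

abbreviation P :: "'w measure" where "P \<equiv> completion M"
abbreviation F :: "real \<Rightarrow> 'w measure" where "F \<equiv> augmented_filtration M W"
abbreviation Fn :: "real \<Rightarrow> 'w measure" where "Fn \<equiv> natural_filtration (space M) W"

sublocale P: prob_space P
  using prob_M by (simp add: prob_space.prob_space_completion)

lemma W_meas: "t \<in> {0..T} \<Longrightarrow> W t \<in> borel_measurable M"
  using bm by (auto simp: brownian_motion_def)

lemma W_cont: "\<omega> \<in> space M \<Longrightarrow> continuous_on {0..T} (\<lambda>t. W t \<omega>)"
  using bm by (auto simp: brownian_motion_def)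

lemma sets_Fn: "sets (Fn t) = sigma_sets (space M) {W s -` A \<inter> space M | s A. s \<in> {0..t} \<and> A \<in> sets borel}"
  unfolding natural_filtration_def by (intro sets_measure_of) auto

lemma sets_Fn_sub: "t \<le> T \<Longrightarrow> sets (Fn t) \<subseteq> sets M"
  unfolding sets_Fn using W_meas
  by (intro sets.sigma_sets_subset) (auto intro!: measurable_sets)

lemma sets_F_sub: "t \<le> T \<Longrightarrow> sets (F t) \<subseteq> sets P"
  unfolding sets_augmented_filtration
  using sets_Fn_sub[of t] sets.sigma_sets_subset[of "sets (Fn t) \<union> null_sets P" P] by auto

lemma null_F: "null_sets P \<subseteq> sets (F t)"
  unfolding sets_augmented_filtration by auto

lemma sets_F_mono: "s \<le> t \<Longrightarrow> sets (F s) \<subseteq> sets (F t)"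
  using filtration.sets_F_mono[OF filtration_augmented] .

lemma F_mono: "X \<in> measurable (F s) N \<Longrightarrow> s \<le> t \<Longrightarrow> X \<in> measurable (F t) N"
  using sets_F_mono[of s t] unfolding measurable_def by (simp add: subset_iff)

lemma F_P: "X \<in> measurable (F s) N \<Longrightarrow> s \<le> T \<Longrightarrow> X \<in> measurable P N"
  using sets_F_sub[of s] unfolding measurable_def by (simp add: subset_iff)

lemma sets_FD: "A \<in> sets (F s) \<Longrightarrow> s \<le> T \<Longrightarrow> A \<in> sets P"
  using sets_F_sub by blast

lemma W_F: "s \<in> {0..t} \<Longrightarrow> W s \<in> borel_measurable (F t)"
proof (rule measurableI)
  fix A :: "(real^'d) set" assume "s \<in> {0..t}" "A \<in> sets borel"
  then have "W s -` A \<inter> space M \<in> sets (Fn t)" unfolding sets_Fn by blast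
  then show "W s -` A \<inter> space (F t) \<in> sets (F t)" unfolding sets_augmented_filtration by auto
qed auto

lemma F_AE_eq:
  fixes X Y :: "'w \<Rightarrow> 'b::topological_space"
  shows "X \<in> borel_measurable (F t) \<Longrightarrow> AE x in P. X x = Y x \<Longrightarrow> Y \<in> borel_measurable (F t)"
  using AE_eq_measurable_null[of X "F t" M Y] null_F by simp

lemma P_AE_eq:
  fixes X Y :: "'w \<Rightarrow> 'b::topological_space"
  shows "X \<in> borel_measurable P \<Longrightarrow> AE x in P. X x = Y x \<Longrightarrow> Y \<in> borel_measurable P"
  using AE_eq_measurable_null[of X P M Y] by (auto simp: null_sets_def)

text \<open>Independence of the increments is assumed for the natural filtration only. Events of the
  augmented filtration inherit it because each is a null set away from a natural one; the sets with
  this property form a sigma-algebra.\<close>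

lemma F_ex_natural:
  assumes "A \<in> sets (F t)" shows "\<exists>A'\<in>sets (Fn t). sym_diff A A' \<in> null_sets P"
  using assms unfolding sets_augmented_filtration
proof (induction rule: sigma_sets.induct)
  case (Basic a)
  then show ?case
  proof
    assume "a \<in> sets (Fn t)" then show ?thesis by (intro bexI[of _ a]) auto
  next
    assume "a \<in> null_sets P" then show ?thesis by (intro bexI[of _ "{}"]) auto
  qed
next
  case Empty then show ?case by (intro bexI[of _ "{}"]) auto
next
  case (Compl a)
  then obtain A' where A': "A'\<in>sets (Fn t)" "sym_diff a A' \<in> null_sets P" by auto
  have "A' \<subseteq> space M" using sets.sets_into_space[OF A'(1)] by simp
  moreover have "a \<subseteq> space M"
    using Compl(1) sets_augmented_filtration[of M W t] sets.sets_into_space[of a "F t"] by auto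
  ultimately have "sym_diff (space M - a) (space M - A') = sym_diff a A'" by auto
  moreover have "space M - A' \<in> sets (Fn t)" using sets.compl_sets[OF A'(1)] by simp
  ultimately show ?case using A' by metis
next
  case (Union a)
  then have "\<forall>i. \<exists>A'\<in>sets (Fn t). sym_diff (a i) A' \<in> null_sets P" by auto
  then obtain A' where A': "\<And>i. A' i \<in> sets (Fn t)" "\<And>i. sym_diff (a i) (A' i) \<in> null_sets P" by metis
  have "(\<Union>i. sym_diff (a i) (A' i)) \<in> null_sets P" using A' by (intro null_sets_UN) auto
  moreover have "sym_diff (\<Union>(range a)) (\<Union>i. A' i) \<subseteq> (\<Union>i. sym_diff (a i) (A' i))" by auto
  ultimately have "sym_diff (\<Union>(range a)) (\<Union>i. A' i) \<in> null_sets P"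
    using null_sets_completion_subset by blast
  then show ?case using A' by (intro bexI[of _ "\<Union>i. A' i"]) auto
qed

lemma incr_distributed:
  assumes "0 \<le> s" "s < t" "t \<le> T"
  shows "distributed M lborel (\<lambda>\<omega>. W t \<omega> - W s \<omega>)
          (\<lambda>x. ennreal (\<Prod>k\<in>UNIV. normal_density 0 (sqrt (t - s)) (x $ k)))"
  using bm assms by (auto simp: brownian_motion_def)

lemma incr_indep:
  assumes "0 \<le> s" "s < t" "t \<le> T" "A \<in> sets (F s)" "C \<in> sets borel"
  shows "P.prob (A \<inter> ((\<lambda>\<omega>. W t \<omega> - W s \<omega>) -` C \<inter> space M)) =
         P.prob A * P.prob ((\<lambda>\<omega>. W t \<omega> - W s \<omega>) -` C \<inter> space M)"
proof -
  interpret M: prob_space M by (rule prob_M)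
  let ?D = "(\<lambda>\<omega>. W t \<omega> - W s \<omega>) -` C \<inter> space M"
  obtain A' where A': "A' \<in> sets (Fn s)" "sym_diff A A' \<in> null_sets P"
    using F_ex_natural assms by blast
  have D: "?D \<in> sets (vimage_algebra (space M) (\<lambda>\<omega>. W t \<omega> - W s \<omega>) borel)"
    using assms(5) by (auto intro!: in_vimage_algebra)
  have DM: "?D \<in> sets M"
    using incr_distributed[OF assms(1-3)] assms(5) by (auto simp: distributed_def intro!: measurable_sets)
  have A'M: "A' \<in> sets M" using A' sets_Fn_sub[of s] assms by auto
  have AP: "A \<in> sets P" using assms sets_FD by auto
  have "M.indep_set (sets (Fn s)) (sets (vimage_algebra (space M) (\<lambda>\<omega>. W t \<omega> - W s \<omega>) borel))"
    using bm assms by (auto simp: brownian_motion_def)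
  then have "M.prob (A' \<inter> ?D) = M.prob A' * M.prob ?D"
    using A' D unfolding M.indep_sets2_eq by blast
  then have e: "P.prob (A' \<inter> ?D) = P.prob A' * P.prob ?D"
    using A'M DM by (simp add: measure_completion)
  have ae: "AE x in P. x \<in> A \<longleftrightarrow> x \<in> A'"
    using AE_not_in[OF A'(2)] by eventually_elim auto
  have "P.prob (A \<inter> ?D) = P.prob (A' \<inter> ?D)"
    using ae AP A'M DM by (intro P.finite_measure_eq_AE) auto
  moreover have "P.prob A = P.prob A'"
    using ae AP A'M by (intro P.finite_measure_eq_AE) auto
  ultimately show ?thesis using e by simp
qed

lemma incr_meas: "0 \<le> s \<Longrightarrow> s \<le> t \<Longrightarrow> (\<lambda>\<omega>. W t \<omega> - W s \<omega>) \<in> borel_measurable (F t)"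
  by (intro borel_measurable_diff W_F) auto

text \<open>Completing the square: the exponential factor turns the Gaussian density with variance
  \<open>t - s\<close> into the same density translated by \<open>(t - s) *\<^sub>R h\<close>, and
  Lebesgue measure is translation invariant.\<close>

lemma gaussian_shift:
  assumes st: "0 \<le> s" "s < t" "t \<le> T"
  shows "(\<integral>\<^sup>+x. ennreal (exp (h \<bullet> x - (norm h)\<^sup>2 * (t - s) / 2)) \<partial>distr P borel (\<lambda>\<omega>. W t \<omega> - W s \<omega>)) = 1"
proof -
  interpret M: prob_space M by (rule prob_M)
  let ?X = "\<lambda>\<omega>. W t \<omega> - W s \<omega>"
  let ?g = "\<lambda>x::real^'d. (\<Prod>k\<in>UNIV. normal_density 0 (sqrt (t - s)) (x $ k))"
  have d: "distributed M lborel ?X (\<lambda>x. ennreal (?g x))" using incr_distributed[OF st] .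
  have [measurable]: "?g \<in> borel_measurable borel" by simp
  have "distr P borel ?X = distr M lborel ?X"
    using W_meas[of t] W_meas[of s] st
    by (subst distr_completion) (auto intro!: distr_cong)
  also have "\<dots> = density lborel (\<lambda>x. ennreal (?g x))"
    using d by (simp add: distributed_def)
  finally have 1: "distr P borel ?X = density lborel (\<lambda>x. ennreal (?g x))" .
  \<comment> \<open>The total mass is 1 because \<open>?g\<close> is the density of a random
    variable; no Gaussian integral has to be computed.\<close>
  have g1: "(\<integral>\<^sup>+x. ennreal (?g x) \<partial>lborel) = 1"
  proof -
    have "emeasure (distr M lborel ?X) (space lborel) = 1"
      using M.prob_space_distr[of ?X lborel] d
      by (auto simp: distributed_def prob_space.emeasure_space_1 dest: prob_space.emeasure_space_1)
    then show ?thesis using d by (simp add: distributed_def emeasure_density)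
  qed
  let ?c = "(t - s) *\<^sub>R h"
  have key: "?g x * exp (h \<bullet> x - (norm h)\<^sup>2 * (t - s) / 2) = ?g (x - ?c)" for x
  proof -
    have e1: "exp (h \<bullet> x - (norm h)\<^sup>2 * (t - s) / 2) = (\<Prod>k\<in>UNIV. exp (h $ k * x $ k - (h $ k)\<^sup>2 * (t-s)/2))"
      by (subst exp_sum[symmetric])
        (simp_all add: inner_vec_def norm_vec_def L2_set_def sum_nonneg sum_subtractf sum_distrib_right
          sum_divide_distrib)
    have "normal_density 0 (sqrt (t - s)) (x $ k) * exp (h $ k * x $ k - (h $ k)\<^sup>2 * (t-s)/2)
       = normal_density 0 (sqrt (t - s)) ((x - ?c) $ k)" for k
    proof -
      have "(h $ k * x $ k - (h $ k)\<^sup>2 * (t-s)/2) + - (x $ k)\<^sup>2 / (2 * (t - s)) = - (x $ k - (t-s) * h $ k)\<^sup>2 / (2 * (t - s))"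
        using st by (simp add: field_simps power2_eq_square)
      then show ?thesis using st
        by (simp add: normal_density_def mult_exp_exp field_simps)
    qed
    then show ?thesis unfolding e1 by (simp add: prod.distrib[symmetric])
  qed
  have "(\<integral>\<^sup>+x. ennreal (exp (h \<bullet> x - (norm h)\<^sup>2 * (t - s) / 2)) \<partial>distr P borel ?X)
     = (\<integral>\<^sup>+x. ennreal (?g x) * ennreal (exp (h \<bullet> x - (norm h)\<^sup>2 * (t - s) / 2)) \<partial>lborel)"
    unfolding 1 by (subst nn_integral_density) auto
  also have "\<dots> = (\<integral>\<^sup>+x. ennreal (?g (x - ?c)) \<partial>lborel)"
    by (intro nn_integral_cong) (simp add: key ennreal_mult[symmetric] prod_nonneg)
  also have "\<dots> = (\<integral>\<^sup>+x. ennreal (?g (- ?c + x)) \<partial>lborel)" by simp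
  also have "\<dots> = (\<integral>\<^sup>+x. ennreal (?g x) \<partial>distr lborel borel ((+) (- ?c)))"
    by (subst nn_integral_distr) auto
  also have "\<dots> = 1" by (simp only: lborel_distr_plus g1)
  finally show ?thesis .
qed

text \<open>\<open>G\<close> and \<open>h\<close> are known at time \<open>s\<close>, so the pair is
  independent of the increment. The expectation becomes an iterated one, and for a frozen value of
  \<open>h\<close> the inner integral is 1 by \<open>gaussian_shift\<close>. With \<open>G\<close>
  in \<open>ennreal\<close>, Tonelli's theorem applies without an integrability condition.\<close>

lemma exp_increment:
  fixes G :: "'w \<Rightarrow> ennreal" and h :: "'w \<Rightarrow> real^'d"
  assumes st: "0 \<le> s" "s \<le> t" "t \<le> T"
    and G: "G \<in> borel_measurable (F s)" and h: "h \<in> borel_measurable (F s)"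
  shows "(\<integral>\<^sup>+\<omega>. G \<omega> * ennreal (exp (h \<omega> \<bullet> (W t \<omega> - W s \<omega>) - (norm (h \<omega>))\<^sup>2 * (t - s) / 2)) \<partial>P)
     = (\<integral>\<^sup>+\<omega>. G \<omega> \<partial>P)"
proof (cases "s = t")
  case False
  with st have st': "0 \<le> s" "s < t" "t \<le> T" by auto
  let ?V = "\<lambda>\<omega>. (G \<omega>, h \<omega>)" and ?X = "\<lambda>\<omega>. W t \<omega> - W s \<omega>"
  let ?S = "borel \<Otimes>\<^sub>M borel :: (ennreal \<times> (real^'d)) measure"
  have VF: "?V \<in> measurable (F s) ?S" using G h by simp
  have V[measurable]: "?V \<in> measurable P ?S" using F_P[OF VF] st by simp
  have X[measurable]: "?X \<in> borel_measurable P" using F_P[OF incr_meas] st by simp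
  interpret X: prob_space "distr P borel ?X" by (rule P.prob_space_distr) simp
  interpret V: prob_space "distr P ?S ?V" by (rule P.prob_space_distr) simp
  have D: "distr P ?S ?V \<Otimes>\<^sub>M distr P borel ?X = distr P (?S \<Otimes>\<^sub>M borel) (\<lambda>x. (?V x, ?X x))"
  proof (rule pair_measure_eqI)
    fix A B assume "A \<in> sets (distr P ?S ?V)" "B \<in> sets (distr P borel ?X)"
    then have AB: "A \<in> sets ?S" "B \<in> sets borel" by auto
    have AF: "?V -` A \<inter> space M \<in> sets (F s)" using measurable_sets[OF VF AB(1)] by simp
    have "(\<lambda>x. (?V x, ?X x)) -` (A \<times> B) \<inter> space P = (?V -` A \<inter> space M) \<inter> (?X -` B \<inter> space M)"
      by auto
    then show "emeasure (distr P ?S ?V) A * emeasure (distr P borel ?X) B =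
        emeasure (distr P (?S \<Otimes>\<^sub>M borel) (\<lambda>x. (?V x, ?X x))) (A \<times> B)"
      using AB incr_indep[OF st' AF AB(2)]
      by (simp add: emeasure_distr pair_measureI P.emeasure_eq_measure ennreal_mult[symmetric] measurable_Pair
        del: vimage_Int)
  qed (auto intro: X.sigma_finite_measure_axioms V.sigma_finite_measure_axioms cong: sets_pair_measure_cong)
  let ?f = "\<lambda>v. fst (fst v) * ennreal (exp (snd (fst v) \<bullet> snd v - (norm (snd (fst v)))\<^sup>2 * (t - s) / 2)) :: ennreal"
  have [measurable]: "?f \<in> borel_measurable (?S \<Otimes>\<^sub>M borel)" by measurable
  have "(\<integral>\<^sup>+\<omega>. G \<omega> * ennreal (exp (h \<omega> \<bullet> (W t \<omega> - W s \<omega>) - (norm (h \<omega>))\<^sup>2 * (t - s) / 2)) \<partial>P)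
      = (\<integral>\<^sup>+y. ?f y \<partial>distr P (?S \<Otimes>\<^sub>M borel) (\<lambda>x. (?V x, ?X x)))"
    by (subst nn_integral_distr) auto
  also have "\<dots> = (\<integral>\<^sup>+v. \<integral>\<^sup>+x. ?f (v, x) \<partial>distr P borel ?X \<partial>distr P ?S ?V)"
    unfolding D[symmetric] by (rule X.nn_integral_fst[symmetric]) simp
  also have "\<dots> = (\<integral>\<^sup>+v. fst v \<partial>distr P ?S ?V)"
    by (intro nn_integral_cong) (auto simp: nn_integral_cmult gaussian_shift[OF st'])
  also have "\<dots> = (\<integral>\<^sup>+\<omega>. G \<omega> \<partial>P)" by (subst nn_integral_distr) auto
  finally show ?thesis .
qed simp

end

section \<open>Simple integrands\<close>

text \<open>The quadratic variation of the elementary integral in closed form, which suits sums over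
  partitions; \<open>simple_qv_eq\<close> identifies it with \<open>qv\<close> of the step
  process.\<close>

definition simple_qv :: "nat \<Rightarrow> (nat \<Rightarrow> real) \<Rightarrow> (nat \<Rightarrow> 'w \<Rightarrow> real^'d) \<Rightarrow> real \<Rightarrow> 'w \<Rightarrow> real" where
  "simple_qv n \<tau> H t \<omega> = (\<Sum>i<n. (norm (H i \<omega>))\<^sup>2 * (min (\<tau> (Suc i)) t - min (\<tau> i) t))"

text \<open>The sum includes the index \<open>i\<close> itself: the partition is deterministic and
  \<open>H i\<close> is known at \<open>\<tau> i\<close>, so at that time one already knows the
  quadratic variation at \<open>\<tau> (Suc i)\<close> and can switch the integrand off before the
  level \<open>R\<close> is exceeded. Hence the truncation is adapted and does not
  overshoot.\<close>

definition trunc_integrand ::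
    "(nat \<Rightarrow> real) \<Rightarrow> (nat \<Rightarrow> 'w \<Rightarrow> real^'d) \<Rightarrow> real \<Rightarrow> nat \<Rightarrow> 'w \<Rightarrow> real^'d" where
  "trunc_integrand \<tau> H R i \<omega> =
     (if (\<Sum>k\<le>i. (norm (H k \<omega>))\<^sup>2 * (\<tau> (Suc k) - \<tau> k)) \<le> R then H i \<omega> else 0)"

lemma lift_mono_upto:
  fixes \<tau> :: "nat \<Rightarrow> real"
  assumes "\<And>i. i < n \<Longrightarrow> \<tau> i \<le> \<tau> (Suc i)" "i \<le> j" "j \<le> n"
  shows "\<tau> i \<le> \<tau> j"
  using assms(2,3)
proof (induction j rule: dec_induct)
  case (step j) then show ?case using assms(1)[of j] by auto
qed simp

lemma simple_integrandD:
  assumes "simple_integrand M T W n \<tau> H"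
  shows "i \<le> j \<Longrightarrow> j \<le> n \<Longrightarrow> \<tau> i \<le> \<tau> j" "i \<le> n \<Longrightarrow> 0 \<le> \<tau> i" "i \<le> n \<Longrightarrow> \<tau> i \<le> T"
    "i < n \<Longrightarrow> H i \<in> borel_measurable (augmented_filtration M W (\<tau> i))"
    "i < n \<Longrightarrow> bounded (H i ` space M)"
proof -
  have m: "\<tau> i \<le> \<tau> j" if "i \<le> j" "j \<le> n" for i j
    using lift_mono_upto[of n \<tau>] assms that by (simp add: simple_integrand_def)
  show "i \<le> j \<Longrightarrow> j \<le> n \<Longrightarrow> \<tau> i \<le> \<tau> j" using m .
  show "i \<le> n \<Longrightarrow> 0 \<le> \<tau> i" using m[of 0 i] assms by (simp add: simple_integrand_def)
  show "i \<le> n \<Longrightarrow> \<tau> i \<le> T" using m[of i n] assms by (simp add: simple_integrand_def)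
qed (use assms in \<open>auto simp: simple_integrand_def\<close>)

text \<open>Restricting to the times between \<open>s\<close> and \<open>t\<close> amounts to moving
  the partition points into that interval. Increments of elementary integrals over it can then be
  read as sums over the moved partition \<open>max s (min t (\<tau> i))\<close>.\<close>

lemma min_clamp:
  fixes \<phi> :: "real \<Rightarrow> 'a::ab_group_add"
  assumes "s \<le> t"
  shows "\<phi> (min x t) - \<phi> (min x s) = \<phi> (max s (min t x)) - \<phi> s"
  using assms by (cases "x \<le> s"; cases "x \<le> t"; cases "s = t") (auto simp: min_def max_def)

lemma simple_integral_diff:
  assumes "s \<le> t"
  shows "simple_integral W n \<tau> H t \<omega> - simple_integral W n \<tau> H s \<omega> =
     (\<Sum>i<n. H i \<omega> \<bullet> (W (max s (min t (\<tau> (Suc i)))) \<omega> - W (max s (min t (\<tau> i))) \<omega>))"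
proof -
  have e: "W (min x t) \<omega> - W (min x s) \<omega> = W (max s (min t x)) \<omega> - W s \<omega>" for x
    using min_clamp[OF assms, of "\<lambda>t. W t \<omega>" x] .
  have d: "(a - b) - (c - d) = (a - c) - (b - d)" for a b c d :: "real^'d" by simp
  have "(W (min x t) \<omega> - W (min y t) \<omega>) - (W (min x s) \<omega> - W (min y s) \<omega>)
      = W (max s (min t x)) \<omega> - W (max s (min t y)) \<omega>" for x y
    by (subst d) (simp add: e)
  then show ?thesis
    unfolding simple_integral_def sum_subtractf[symmetric] inner_diff_right[symmetric] by simp
qed

lemma simple_qv_diff:
  assumes "s \<le> t"
  shows "simple_qv n \<tau> H t \<omega> - simple_qv n \<tau> H s \<omega> =
     (\<Sum>i<n. (norm (H i \<omega>))\<^sup>2 * (max s (min t (\<tau> (Suc i))) - max s (min t (\<tau> i))))"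
proof -
  have e: "min x t = min x s + max s (min t x) - s" for x
    using min_clamp[OF assms, of "\<lambda>t. t" x] by linarith
  then have "(min x t - min y t) - (min x s - min y s) = max s (min t x) - max s (min t y)" for x y
    using e[of x] e[of y] by linarith
  then show ?thesis
    unfolding simple_qv_def sum_subtractf[symmetric] right_diff_distrib[symmetric] by simp
qed

lemma simple_qv_mono:
  assumes "simple_integrand M T W n \<tau> H" "s \<le> t"
  shows "simple_qv n \<tau> H s \<omega> \<le> simple_qv n \<tau> H t \<omega>"
proof -
  have "0 \<le> simple_qv n \<tau> H t \<omega> - simple_qv n \<tau> H s \<omega>"
    unfolding simple_qv_diff[OF assms(2)]
  proof (intro sum_nonneg mult_nonneg_nonneg)
    fix i assume "i \<in> {..<n}"
    then show "0 \<le> max s (min t (\<tau> (Suc i))) - max s (min t (\<tau> i))"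
      using simple_integrandD(1)[OF assms(1), of i "Suc i"] by (simp add: max.mono min.mono)
  qed simp
  then show ?thesis by simp
qed

lemma simple_qv_0:
  assumes "simple_integrand M T W n \<tau> H"
  shows "simple_qv n \<tau> H 0 \<omega> = 0"
  unfolding simple_qv_def
proof (intro sum.neutral ballI)
  fix i assume "i \<in> {..<n}"
  then have "min (\<tau> (Suc i)) 0 = 0" "min (\<tau> i) 0 = 0"
    using simple_integrandD(2)[OF assms, of i] simple_integrandD(2)[OF assms, of "Suc i"] by auto
  then show "(norm (H i \<omega>))\<^sup>2 * (min (\<tau> (Suc i)) 0 - min (\<tau> i) 0) = 0" by simp
qed

section \<open>Truncation at a level of the quadratic variation\<close>

lemma trunc_index:
  assumes s: "simple_integrand M T W n \<tau> H" and R: "0 \<le> R"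
  obtains m where "m \<le> n" "\<And>i. i < n \<Longrightarrow> trunc_integrand \<tau> H R i \<omega> = (if i < m then H i \<omega> else 0)"
    "simple_qv m \<tau> H T \<omega> \<le> R" "m < n \<Longrightarrow> R < simple_qv n \<tau> H T \<omega>"
proof -
  let ?S = "\<lambda>i. \<Sum>k<i. (norm (H k \<omega>))\<^sup>2 * (\<tau> (Suc k) - \<tau> k)"
  have S: "simple_qv i \<tau> H T \<omega> = ?S i" if "i \<le> n" for i
    unfolding simple_qv_def using simple_integrandD(3)[OF s] that
    by (intro sum.cong) (auto simp: min_def)
  have mono: "?S i \<le> ?S j" if "i \<le> j" "j \<le> n" for i j
    using that simple_integrandD(1)[OF s] by (intro sum_mono2) auto
  define m where "m = Max {i. i \<le> n \<and> ?S i \<le> R}"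
  have fin: "finite {i. i \<le> n \<and> ?S i \<le> R}" by simp
  have ne: "0 \<in> {i. i \<le> n \<and> ?S i \<le> R}" using R by simp
  have m: "m \<le> n" "?S m \<le> R" using Max_in[OF fin] ne unfolding m_def by blast+
  have mm: "i \<le> m" if "i \<le> n" "?S i \<le> R" for i using Max_ge[OF fin] that unfolding m_def by blast
  show ?thesis
  proof (rule that[OF m(1)])
    show "simple_qv m \<tau> H T \<omega> \<le> R" using S m by simp
    show "R < simple_qv n \<tau> H T \<omega>" if "m < n" using mm[of n] that S[of n] by fastforce
    fix i assume "i < n"
    have "(?S (Suc i) \<le> R) = (i < m)"
      using mono[of "Suc i" m] m mm[of "Suc i"] \<open>i < n\<close> by auto
    then show "trunc_integrand \<tau> H R i \<omega> = (if i < m then H i \<omega> else 0)"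
      unfolding trunc_integrand_def lessThan_Suc_atMost by auto
  qed
qed

text \<open>Quadratic variation grows with the index, so along one path the truncation keeps an
  initial segment of the summands, which amounts to stopping at the partition point where the
  segment ends. The time \<open>\<rho>\<close> is obtained for each \<open>\<omega>\<close>
  separately; adaptedness is taken care of by \<open>trunc_integrand\<close>.\<close>

lemma trunc_stopped:
  assumes s: "simple_integrand M T W n \<tau> H" and R: "0 \<le> R"
  obtains \<rho> where "0 \<le> \<rho>" "\<rho> \<le> T"
    "\<And>t. simple_integral W n \<tau> (trunc_integrand \<tau> H R) t \<omega> = simple_integral W n \<tau> H (min t \<rho>) \<omega>"
    "\<And>t. simple_qv n \<tau> (trunc_integrand \<tau> H R) t \<omega> = simple_qv n \<tau> H (min t \<rho>) \<omega>"
    "simple_qv n \<tau> H \<rho> \<omega> \<le> R"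
    "simple_qv n \<tau> H T \<omega> \<le> R \<Longrightarrow> \<rho> = T"
proof -
  obtain m where m: "m \<le> n" "\<And>i. i < n \<Longrightarrow> trunc_integrand \<tau> H R i \<omega> = (if i < m then H i \<omega> else 0)"
    "simple_qv m \<tau> H T \<omega> \<le> R" "m < n \<Longrightarrow> R < simple_qv n \<tau> H T \<omega>"
    using trunc_index[OF s R] by metis
  \<comment> \<open>If nothing is switched off, there must be no stopping before \<open>T\<close>,
    but \<open>\<tau> n\<close> may lie before \<open>T\<close>; hence the second case.\<close>
  define \<rho> where "\<rho> = (if m < n then \<tau> m else T)"
  have T: "\<tau> n \<le> T" using simple_integrandD(3)[OF s, of n] by simp
  have le: "\<tau> (Suc i) \<le> \<rho>" "\<tau> i \<le> \<rho>" if "i < m" for i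
    using simple_integrandD(1)[OF s, of "Suc i" m] simple_integrandD(1)[OF s, of "i" m]
      simple_integrandD(3)[OF s, of "Suc i"] simple_integrandD(3)[OF s, of "i"] that m(1)
    by (auto simp: \<rho>_def)
  have ge: "\<rho> \<le> \<tau> i" "\<rho> \<le> \<tau> (Suc i)" if "m \<le> i" "i < n" for i
    using simple_integrandD(1)[OF s, of m i] simple_integrandD(1)[OF s, of m "Suc i"] that by (auto simp: \<rho>_def)
  have "simple_qv n \<tau> H \<rho> \<omega> = simple_qv m \<tau> H T \<omega>"
  proof -
    have "simple_qv n \<tau> H \<rho> \<omega> = (\<Sum>i<n. if i < m then (norm (H i \<omega>))\<^sup>2 * (min (\<tau> (Suc i)) T - min (\<tau> i) T) else 0)"
      unfolding simple_qv_def
    proof (intro sum.cong refl)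
      fix i assume "i \<in> {..<n}"
      then show "(norm (H i \<omega>))\<^sup>2 * (min (\<tau> (Suc i)) \<rho> - min (\<tau> i) \<rho>) =
          (if i < m then (norm (H i \<omega>))\<^sup>2 * (min (\<tau> (Suc i)) T - min (\<tau> i) T) else 0)"
        using le[of i] ge[of i] simple_integrandD(3)[OF s, of "Suc i"] simple_integrandD(3)[OF s, of "i"]
        by (auto simp: min_def not_less)
    qed
    also have "\<dots> = simple_qv m \<tau> H T \<omega>"
      unfolding simple_qv_def using m(1) by (intro sum.mono_neutral_cong_right) auto
    finally show ?thesis .
  qed
  moreover have "simple_integral W n \<tau> (trunc_integrand \<tau> H R) t \<omega> = simple_integral W n \<tau> H (min t \<rho>) \<omega>" for t
    unfolding simple_integral_def
  proof (intro sum.cong refl)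
    fix i assume i: "i \<in> {..<n}"
    show "trunc_integrand \<tau> H R i \<omega> \<bullet> (W (min (\<tau> (Suc i)) t) \<omega> - W (min (\<tau> i) t) \<omega>)
      = H i \<omega> \<bullet> (W (min (\<tau> (Suc i)) (min t \<rho>)) \<omega> - W (min (\<tau> i) (min t \<rho>)) \<omega>)"
    proof (cases "i < m")
      case True
      then have "min (\<tau> (Suc i)) (min t \<rho>) = min (\<tau> (Suc i)) t" "min (\<tau> i) (min t \<rho>) = min (\<tau> i) t"
        using le[of i] by auto
      then show ?thesis using m(2)[of i] True i by simp
    next
      case False
      then have "min (\<tau> (Suc i)) (min t \<rho>) = min t \<rho>" "min (\<tau> i) (min t \<rho>) = min t \<rho>"
        using ge[of i] i by auto
      then show ?thesis using m(2)[of i] False i by simp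
    qed
  qed
  moreover have "simple_qv n \<tau> (trunc_integrand \<tau> H R) t \<omega> = simple_qv n \<tau> H (min t \<rho>) \<omega>" for t
    unfolding simple_qv_def
  proof (intro sum.cong refl)
    fix i assume i: "i \<in> {..<n}"
    show "(norm (trunc_integrand \<tau> H R i \<omega>))\<^sup>2 * (min (\<tau> (Suc i)) t - min (\<tau> i) t)
      = (norm (H i \<omega>))\<^sup>2 * (min (\<tau> (Suc i)) (min t \<rho>) - min (\<tau> i) (min t \<rho>))"
    proof (cases "i < m")
      case True
      then have "min (\<tau> (Suc i)) (min t \<rho>) = min (\<tau> (Suc i)) t" "min (\<tau> i) (min t \<rho>) = min (\<tau> i) t"
        using le[of i] by auto
      then show ?thesis using m(2)[of i] True i by simp
    next
      case False
      then have "min (\<tau> (Suc i)) (min t \<rho>) = min t \<rho>" "min (\<tau> i) (min t \<rho>) = min t \<rho>"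
        using ge[of i] i by auto
      then show ?thesis using m(2)[of i] False i by simp
    qed
  qed
  moreover have "0 \<le> \<rho>" "\<rho> \<le> T"
    using simple_integrandD(2,3)[OF s, of m] m(1) T simple_integrandD(2)[OF s, of n] by (simp_all add: \<rho>_def)
  moreover have "simple_qv n \<tau> H T \<omega> \<le> R \<Longrightarrow> \<rho> = T" using m(4) by (auto simp: \<rho>_def)
  ultimately show ?thesis using m(3) by (intro that[of \<rho>]) simp_all
qed

lemma trunc_simple_qv:
  assumes s: "simple_integrand M T W n \<tau> H" and R: "0 \<le> R"
  shows "simple_qv n \<tau> (trunc_integrand \<tau> H R) T \<omega> \<le> R"
  using trunc_stopped[OF s R, of \<omega>] by (metis min.absorb2)

section \<open>Exponential martingales of simple integrals\<close>

context brownian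
begin

lemma trunc_simple:
  assumes s: "simple_integrand M T W n \<tau> H"
  shows "simple_integrand M T W n \<tau> (trunc_integrand \<tau> H R)"
proof -
  have "trunc_integrand \<tau> H R i \<in> borel_measurable (F (\<tau> i))" if i: "i < n" for i
  proof -
    have [measurable]: "H k \<in> borel_measurable (F (\<tau> i))" if "k \<le> i" for k
      using F_mono[OF simple_integrandD(4)[OF s, of k]] simple_integrandD(1)[OF s, of k i] i that by auto
    have "(\<lambda>\<omega>. \<Sum>k\<le>i. (norm (H k \<omega>))\<^sup>2 * (\<tau> (Suc k) - \<tau> k)) \<in> borel_measurable (F (\<tau> i))"
      by (intro borel_measurable_sum) simp
    from borel_measurable_le[OF this borel_measurable_const]
    have "{\<omega> \<in> space (F (\<tau> i)). (\<Sum>k\<le>i. (norm (H k \<omega>))\<^sup>2 * (\<tau> (Suc k) - \<tau> k)) \<le> R} \<in> sets (F (\<tau> i))" .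
    then show ?thesis unfolding trunc_integrand_def by (intro measurable_If borel_measurable_const) simp_all
  qed
  moreover have "bounded (trunc_integrand \<tau> H R i ` space M)" if "i < n" for i
  proof -
    have "trunc_integrand \<tau> H R i ` space M \<subseteq> insert 0 (H i ` space M)" by (auto simp: trunc_integrand_def)
    then show ?thesis using simple_integrandD(5)[OF s that] bounded_subset bounded_insert by metis
  qed
  ultimately show ?thesis using s unfolding simple_integrand_def by auto
qed

text \<open>Induction on the number of increments: the last factor is integrated out by
  \<open>exp_increment\<close>, with everything before it as the weight \<open>G\<close>.
  Measurability of \<open>h i\<close> is asked on intervals of positive length only, because an
  interval that was collapsed into a point may carry an integrand that becomes known later.\<close>

lemma exp_sum_increments:
  fixes h :: "nat \<Rightarrow> 'w \<Rightarrow> real^'d"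
  assumes c: "\<And>i. i < n \<Longrightarrow> c i \<le> c (Suc i)" and s: "0 \<le> s" "s \<le> c 0" and T: "c n \<le> T"
    and h: "\<And>i. i < n \<Longrightarrow> c i < c (Suc i) \<Longrightarrow> h i \<in> borel_measurable (F (c i))"
    and B: "B \<in> sets (F s)"
  shows "(\<integral>\<^sup>+\<omega>. indicator B \<omega> * ennreal (exp (\<Sum>i<n. h i \<omega> \<bullet> (W (c (Suc i)) \<omega> - W (c i) \<omega>)
      - (norm (h i \<omega>))\<^sup>2 * (c (Suc i) - c i) / 2)) \<partial>P) = emeasure P B"
  using c T h
proof (induction n)
  case 0
  then show ?case using sets_FD[OF B] s by simp
next
  case (Suc n)
  let ?t = "\<lambda>i \<omega>. h i \<omega> \<bullet> (W (c (Suc i)) \<omega> - W (c i) \<omega>) - (norm (h i \<omega>))\<^sup>2 * (c (Suc i) - c i) / 2"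
  have mono: "c i \<le> c j" if "i \<le> j" "j \<le> Suc n" for i j
    using lift_mono_upto[of "Suc n" c] Suc.prems(1) that by blast
  have IH: "(\<integral>\<^sup>+\<omega>. indicator B \<omega> * ennreal (exp (\<Sum>i<n. ?t i \<omega>)) \<partial>P) = emeasure P B"
    using Suc.prems(1,3) order_trans[OF mono[of n "Suc n"] Suc.prems(2)] by (intro Suc.IH) auto
  have c0: "0 \<le> c i" if "i \<le> Suc n" for i using mono[of 0 i] that s by auto
  have t: "?t i \<in> borel_measurable (F (c (Suc i)))" if "i < Suc n" for i
  proof (cases "c i < c (Suc i)")
    case True
    have 1: "h i \<in> borel_measurable (F (c (Suc i)))" using F_mono Suc.prems(3) that True less_imp_le by blast
    have 2: "(\<lambda>\<omega>. W (c (Suc i)) \<omega> - W (c i) \<omega>) \<in> borel_measurable (F (c (Suc i)))"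
      using incr_meas[of "c i" "c (Suc i)"] True c0[of i] that by auto
    show ?thesis using 1 2 by measurable
  next
    case False
    then have "c (Suc i) = c i" using Suc.prems(1)[of i] that by auto
    then show ?thesis by simp
  qed
  have G: "(\<lambda>\<omega>. indicator B \<omega> * ennreal (exp (\<Sum>i<n. ?t i \<omega>))) \<in> borel_measurable (F (c n))"
  proof (intro borel_measurable_times_ennreal borel_measurable_indicator measurable_compose[OF _ measurable_ennreal]
    measurable_compose[OF _ borel_measurable_exp] borel_measurable_sum)
    show "B \<in> sets (F (c n))" using B sets_F_mono[of s "c n"] mono[of 0 n] s by auto
    show "?t i \<in> borel_measurable (F (c n))" if "i \<in> {..<n}" for i
      using F_mono[OF t[of i]] mono[of "Suc i" n] that by auto
  qed
  show ?case
  proof (cases "c n < c (Suc n)")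
    case True
    have "(\<integral>\<^sup>+\<omega>. indicator B \<omega> * ennreal (exp (\<Sum>i<Suc n. ?t i \<omega>)) \<partial>P) =
        (\<integral>\<^sup>+\<omega>. (indicator B \<omega> * ennreal (exp (\<Sum>i<n. ?t i \<omega>))) * ennreal (exp (?t n \<omega>)) \<partial>P)"
      by (intro nn_integral_cong) (simp add: exp_add ennreal_mult mult.assoc)
    also have "\<dots> = (\<integral>\<^sup>+\<omega>. indicator B \<omega> * ennreal (exp (\<Sum>i<n. ?t i \<omega>)) \<partial>P)"
      using Suc.prems True c0[of n] by (intro exp_increment G) auto
    finally show ?thesis using IH by simp
  next
    case False
    then have "c (Suc n) = c n" using Suc.prems(1)[of n] by auto
    then show ?thesis using IH by simp
  qed
qed

lemma simple_exp_martingale: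
  assumes sH: "simple_integrand M T W n \<tau> H" and st: "0 \<le> s" "s \<le> t" "t \<le> T" and B: "B \<in> sets (F s)"
  shows "(\<integral>\<^sup>+\<omega>. indicator B \<omega> * ennreal (exp (l * (simple_integral W n \<tau> H t \<omega> - simple_integral W n \<tau> H s \<omega>)
      - l\<^sup>2 / 2 * (simple_qv n \<tau> H t \<omega> - simple_qv n \<tau> H s \<omega>))) \<partial>P) = emeasure P B"
proof -
  let ?c = "\<lambda>i. max s (min t (\<tau> i))" and ?h = "\<lambda>i \<omega>. l *\<^sub>R H i \<omega>"
  have 1: "l * (simple_integral W n \<tau> H t \<omega> - simple_integral W n \<tau> H s \<omega>)
      - l\<^sup>2 / 2 * (simple_qv n \<tau> H t \<omega> - simple_qv n \<tau> H s \<omega>)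
     = (\<Sum>i<n. ?h i \<omega> \<bullet> (W (?c (Suc i)) \<omega> - W (?c i) \<omega>) - (norm (?h i \<omega>))\<^sup>2 * (?c (Suc i) - ?c i) / 2)" for \<omega>
    unfolding simple_integral_diff[OF st(2)] simple_qv_diff[OF st(2)] sum_distrib_left sum_subtractf
    by (auto simp: power_mult_distrib intro!: arg_cong2[where f="(-)"] sum.cong)
  show ?thesis unfolding 1
  proof (rule exp_sum_increments[where s = s])
    show "?c i \<le> ?c (Suc i)" if "i < n" for i
      using simple_integrandD(1)[OF sH, of i "Suc i"] that by (auto simp: min_def max_def)
    \<comment> \<open>An interval that survives the restriction to the times between
      \<open>s\<close> and \<open>t\<close> starts at or after \<open>\<tau> i\<close>, the time at
      which \<open>H i\<close> is known.\<close>
    fix i assume i: "i < n" "?c i < ?c (Suc i)"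
    then have "\<tau> i \<le> ?c i" by (auto simp: min_def max_def split: if_splits)
    then have "H i \<in> borel_measurable (F (?c i))" using simple_integrandD(4)[OF sH i(1)] F_mono by blast
    then show "?h i \<in> borel_measurable (F (?c i))" by simp
  qed (use st B in auto)
qed

end

section \<open>Refining and stopping simple integrands\<close>

lemma simple_process_eq:
  assumes "\<And>i. i < n \<Longrightarrow> \<tau> i \<le> \<tau> (Suc i)"
  shows "simple_process n \<tau> H s \<omega> = (\<Sum>i<n. (indicator {s..} (\<tau> (Suc i)) - indicator {s..} (\<tau> i) :: real) *\<^sub>R H i \<omega>)"
  unfolding simple_process_def
proof (intro sum.cong refl)
  fix i assume "i \<in> {..<n}"
  then have "\<tau> i \<le> \<tau> (Suc i)" using assms by simp
  then show "indicator {\<tau> i<..\<tau> (Suc i)} s *\<^sub>R H i \<omega> = (indicator {s..} (\<tau> (Suc i)) - indicator {s..} (\<tau> i) :: real) *\<^sub>R H i \<omega>"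
    by (auto simp: indicator_def)
qed

text \<open>Every interval of the coarse partition is a union of consecutive fine ones, over which
  the increments of \<open>\<phi>\<close> telescope. The bilinear map is kept general for two
  instances: inner products with \<open>\<phi>\<close> a stopped path give the elementary integral,
  and scalar multiples with \<open>\<phi>\<close> the indicator of \<open>{t..}\<close> give the
  step process, which is a sum of increments by \<open>simple_process_eq\<close>.\<close>

lemma refine_sum:
  fixes \<phi> :: "real \<Rightarrow> 'b::real_normed_vector" and r :: "'a::real_normed_vector \<Rightarrow> 'b \<Rightarrow> 'c::real_normed_vector"
  assumes r: "bounded_bilinear r"
    and S: "finite S" "\<tau> ` {..n} \<subseteq> S" and mono: "\<And>i. i < n \<Longrightarrow> \<tau> i \<le> \<tau> (Suc i)"
    and xs: "xs = sorted_list_of_set S"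
  shows "(\<Sum>j<card S - 1. r (\<Sum>i<n. if \<tau> i \<le> xs ! j \<and> xs ! Suc j \<le> \<tau> (Suc i) then H i else 0) (\<phi> (xs ! Suc j) - \<phi> (xs ! j)))
    = (\<Sum>i<n. r (H i) (\<phi> (\<tau> (Suc i)) - \<phi> (\<tau> i)))"
proof -
  interpret r: bounded_bilinear r by (rule r)
  let ?m = "card S - 1"
  have len: "length xs = card S" and set: "set xs = S"
    using S(1) xs by auto
  have ss: "sorted_wrt (<) xs" unfolding xs by simp
  have lt: "xs ! i \<le> xs ! j \<longleftrightarrow> i \<le> j" if "i < card S" "j < card S" for i j
    using sorted_wrt_nth_less[OF ss, of i j] sorted_wrt_nth_less[OF ss, of j i] that len
    by (cases i j rule: linorder_cases) auto
  have "(\<Sum>j<?m. r (\<Sum>i<n. if \<tau> i \<le> xs ! j \<and> xs ! Suc j \<le> \<tau> (Suc i) then H i else 0) (\<phi> (xs ! Suc j) - \<phi> (xs ! j)))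
     = (\<Sum>j<?m. \<Sum>i<n. if \<tau> i \<le> xs ! j \<and> xs ! Suc j \<le> \<tau> (Suc i) then r (H i) (\<phi> (xs ! Suc j) - \<phi> (xs ! j)) else 0)"
    by (auto simp: r.sum_left r.zero_left intro!: sum.cong)
  also have "\<dots> = (\<Sum>i<n. \<Sum>j<?m. if \<tau> i \<le> xs ! j \<and> xs ! Suc j \<le> \<tau> (Suc i) then r (H i) (\<phi> (xs ! Suc j) - \<phi> (xs ! j)) else 0)"
    by (rule sum.swap)
  also have "\<dots> = (\<Sum>i<n. r (H i) (\<phi> (\<tau> (Suc i)) - \<phi> (\<tau> i)))"
  proof (intro sum.cong refl)
    fix i assume i: "i \<in> {..<n}"
    have "\<tau> i \<in> set xs" "\<tau> (Suc i) \<in> set xs" using i S(2) set by auto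
    then obtain a b where a: "a < card S" "xs ! a = \<tau> i" and b: "b < card S" "xs ! b = \<tau> (Suc i)"
      unfolding in_set_conv_nth len by auto
    have ab: "a \<le> b" using lt[OF a(1) b(1)] a b mono[of i] i by simp
    have "(\<Sum>j<?m. if \<tau> i \<le> xs ! j \<and> xs ! Suc j \<le> \<tau> (Suc i) then r (H i) (\<phi> (xs ! Suc j) - \<phi> (xs ! j)) else 0)
        = (\<Sum>j<?m. if j \<in> {a..<b} then r (H i) (\<phi> (xs ! Suc j) - \<phi> (xs ! j)) else 0)"
    proof (intro sum.cong refl)
      fix j assume "j \<in> {..<?m}"
      then have "\<tau> i \<le> xs ! j \<and> xs ! Suc j \<le> \<tau> (Suc i) \<longleftrightarrow> j \<in> {a..<b}"
        using lt[of a j] lt[of "Suc j" b] a b by auto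
      then show "(if \<tau> i \<le> xs ! j \<and> xs ! Suc j \<le> \<tau> (Suc i) then r (H i) (\<phi> (xs ! Suc j) - \<phi> (xs ! j)) else 0)
        = (if j \<in> {a..<b} then r (H i) (\<phi> (xs ! Suc j) - \<phi> (xs ! j)) else 0)" by simp
    qed
    also have "\<dots> = (\<Sum>j\<in>{a..<b}. r (H i) (\<phi> (xs ! Suc j) - \<phi> (xs ! j)))"
      using b(1) by (subst sum.inter_restrict[symmetric]) (auto intro!: sum.cong)
    also have "\<dots> = r (H i) (\<Sum>j\<in>{a..<b}. \<phi> (xs ! Suc j) - \<phi> (xs ! j))"
      by (simp add: r.sum_right)
    also have "(\<Sum>j\<in>{a..<b}. \<phi> (xs ! Suc j) - \<phi> (xs ! j)) = \<phi> (xs ! b) - \<phi> (xs ! a)"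
      using sum_Suc_diff'[of a b "\<lambda>j. \<phi> (xs ! j)"] ab by simp
    finally show "(\<Sum>j<?m. if \<tau> i \<le> xs ! j \<and> xs ! Suc j \<le> \<tau> (Suc i) then r (H i) (\<phi> (xs ! Suc j) - \<phi> (xs ! j)) else 0)
        = r (H i) (\<phi> (\<tau> (Suc i)) - \<phi> (\<tau> i))" using a b by simp
  qed
  finally show ?thesis .
qed

text \<open>A fine interval has positive length and so lies in at most one coarse interval. The sum
  therefore picks a single value \<open>H i \<omega>\<close>, or 0 outside the coarse
  partition.\<close>

definition refine_integrand ::
    "nat \<Rightarrow> (nat \<Rightarrow> real) \<Rightarrow> (nat \<Rightarrow> 'w \<Rightarrow> real^'d) \<Rightarrow> real set \<Rightarrow> nat \<Rightarrow> 'w \<Rightarrow> real^'d" where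
  "refine_integrand n \<tau> H S j \<omega> = (\<Sum>i<n. if \<tau> i \<le> sorted_list_of_set S ! j \<and> sorted_list_of_set S ! Suc j \<le> \<tau> (Suc i) then H i \<omega> else 0)"

context brownian
begin

text \<open>Serves to put two integrands on a common partition, and to add the values of a stopping
  time to a partition. The last three claims say that the new partition points are consecutive
  elements of \<open>S\<close>, so that no element of \<open>S\<close> falls strictly inside one of
  the intervals.\<close>

lemma refine:
  assumes s: "simple_integrand M T W n \<tau> H" and S: "finite S" "\<tau> ` {..n} \<subseteq> S" "S \<subseteq> {0..T}"
  defines "m \<equiv> card S - 1" and "\<sigma> \<equiv> (!) (sorted_list_of_set S)" and "G \<equiv> refine_integrand n \<tau> H S"
  shows "simple_integrand M T W m \<sigma> G"
    "simple_process m \<sigma> G = simple_process n \<tau> H"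
    "simple_integral W m \<sigma> G = simple_integral W n \<tau> H"
    "\<And>i. i < m \<Longrightarrow> \<sigma> i < \<sigma> (Suc i)"
    "\<And>i. i \<le> m \<Longrightarrow> \<sigma> i \<in> S"
    "\<And>i x. i < m \<Longrightarrow> x \<in> S \<Longrightarrow> \<sigma> i < x \<Longrightarrow> \<sigma> (Suc i) \<le> x"
proof -
  have cS: "card S \<noteq> 0" using S by auto
  have len: "length (sorted_list_of_set S) = card S" and set: "set (sorted_list_of_set S) = S" using S(1) by auto
  show lt: "\<sigma> i < \<sigma> (Suc i)" if "i < m" for i
    using strict_sorted_list_of_set[of S] that len unfolding \<sigma>_def m_def
    by (metis Suc_less_eq Suc_pred' cS lessI not_gr_zero sorted_wrt_nth_less less_SucI)
  show inS: "\<sigma> i \<in> S" if "i \<le> m" for i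
    using that len set cS unfolding \<sigma>_def m_def by (metis Suc_pred' less_Suc_eq_le not_gr_zero nth_mem)
  have mono: "\<sigma> i \<le> \<sigma> j" if "i \<le> j" "j \<le> m" for i j
    using lift_mono_upto[of m \<sigma>] lt that by (meson less_imp_le)
  show "\<sigma> (Suc i) \<le> x" if h: "i < m" "x \<in> S" "\<sigma> i < x" for i x
  proof -
    obtain j where j: "j < card S" "\<sigma> j = x" using h(2) set len unfolding \<sigma>_def by (metis in_set_conv_nth)
    then have "\<not> j \<le> i" using mono[of j i] h by auto
    then show ?thesis using mono[of "Suc i" j] j m_def by auto
  qed
  show "simple_integral W m \<sigma> G = simple_integral W n \<tau> H"
  proof (intro ext)
    fix t \<omega>
    show "simple_integral W m \<sigma> G t \<omega> = simple_integral W n \<tau> H t \<omega>"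
      unfolding simple_integral_def G_def refine_integrand_def m_def \<sigma>_def
      by (rule refine_sum[OF bounded_bilinear_inner S(1,2), where \<phi> = "\<lambda>x. W (min x t) \<omega>" and H = "\<lambda>i. H i \<omega>"])
        (use simple_integrandD(1)[OF s] in auto)
  qed
  show "simple_process m \<sigma> G = simple_process n \<tau> H"
  proof (intro ext)
    fix t \<omega>
    show "simple_process m \<sigma> G t \<omega> = simple_process n \<tau> H t \<omega>"
      using lt refine_sum[OF bounded_bilinear.flip[OF bounded_bilinear_scaleR] S(1,2), where \<phi> = "\<lambda>x. indicator {t..} x" and H = "\<lambda>i. H i \<omega>"]
        simple_integrandD(1)[OF s]
      by (subst (1 2) simple_process_eq) (auto simp: less_imp_le G_def refine_integrand_def m_def \<sigma>_def)
  qed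
  show "simple_integrand M T W m \<sigma> G"
    unfolding simple_integrand_def
  proof (intro conjI allI impI)
    show "0 \<le> \<sigma> 0" "\<sigma> m \<le> T" using inS[of 0] inS[of m] S(3) by auto
    show "\<sigma> i \<le> \<sigma> (Suc i)" if "i < m" for i using lt[OF that] by simp
    fix j assume j: "j < m"
    show "G j \<in> borel_measurable (F (\<sigma> j))"
      unfolding G_def refine_integrand_def
    proof (intro borel_measurable_sum)
      fix i assume i: "i \<in> {..<n}"
      show "(\<lambda>\<omega>. if \<tau> i \<le> sorted_list_of_set S ! j \<and> sorted_list_of_set S ! Suc j \<le> \<tau> (Suc i) then H i \<omega> else 0)
         \<in> borel_measurable (F (\<sigma> j))"
        using F_mono[OF simple_integrandD(4)[OF s, of i], of "\<sigma> j"] i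
        by (cases "\<tau> i \<le> sorted_list_of_set S ! j") (auto simp: \<sigma>_def if_distrib cong: if_cong)
    qed
    have "\<exists>B. \<forall>\<omega>\<in>space M. norm (H i \<omega>) \<le> B" if "i < n" for i
      using simple_integrandD(5)[OF s that] by (auto simp: bounded_iff)
    then obtain B where B: "\<And>i \<omega>. i < n \<Longrightarrow> \<omega> \<in> space M \<Longrightarrow> norm (H i \<omega>) \<le> B i" by metis
    have "norm (G j \<omega>) \<le> (\<Sum>i<n. \<bar>B i\<bar>)" if "\<omega> \<in> space M" for \<omega>
      unfolding G_def refine_integrand_def using B that
      by (intro order_trans[OF norm_sum] sum_mono) (fastforce intro: order_trans)
    then show "bounded (G j ` space M)" by (auto simp: bounded_iff)
  qed
qed

lemma simple_diff:
  assumes s1: "simple_integrand M T W n \<tau> H" and s2: "simple_integrand M T W n' \<tau>' H'"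
  obtains m \<sigma> G where "simple_integrand M T W m \<sigma> G"
    "\<And>s \<omega>. simple_process m \<sigma> G s \<omega> = simple_process n \<tau> H s \<omega> - simple_process n' \<tau>' H' s \<omega>"
    "\<And>s \<omega>. simple_integral W m \<sigma> G s \<omega> = simple_integral W n \<tau> H s \<omega> - simple_integral W n' \<tau>' H' s \<omega>"
proof -
  let ?S = "\<tau> ` {..n} \<union> \<tau>' ` {..n'}"
  have S: "finite ?S" "\<tau> ` {..n} \<subseteq> ?S" "\<tau>' ` {..n'} \<subseteq> ?S" "?S \<subseteq> {0..T}"
    using simple_integrandD(2,3)[OF s1] simple_integrandD(2,3)[OF s2] by auto
  let ?G = "\<lambda>j \<omega>. refine_integrand n \<tau> H ?S j \<omega> - refine_integrand n' \<tau>' H' ?S j \<omega>"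
  note 1 = refine[OF s1 S(1,2,4)] and 2 = refine[OF s2 S(1,3,4)]
  show ?thesis
  proof (rule that[of "card ?S - 1" "(!) (sorted_list_of_set ?S)" ?G])
    show "simple_integrand M T W (card ?S - 1) ((!) (sorted_list_of_set ?S)) ?G"
      unfolding simple_integrand_def
    proof (intro conjI allI impI)
      fix j assume j: "j < card ?S - 1"
      show "?G j \<in> borel_measurable (F (sorted_list_of_set ?S ! j))"
        using simple_integrandD(4)[OF 1(1) j] simple_integrandD(4)[OF 2(1) j] by (rule borel_measurable_diff)
      show "bounded (?G j ` space M)"
        using simple_integrandD(5)[OF 1(1) j] simple_integrandD(5)[OF 2(1) j] by (rule bounded_minus_comp)
    qed (use 1(1) in \<open>auto simp: simple_integrand_def\<close>)
    show "simple_process (card ?S - 1) ((!) (sorted_list_of_set ?S)) ?G s \<omega> = simple_process n \<tau> H s \<omega> - simple_process n' \<tau>' H' s \<omega>" for s \<omega>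
      unfolding 1(2)[symmetric] 2(2)[symmetric] by (simp add: simple_process_def scaleR_diff_right sum_subtractf)
    show "simple_integral W (card ?S - 1) ((!) (sorted_list_of_set ?S)) ?G s \<omega> = simple_integral W n \<tau> H s \<omega> - simple_integral W n' \<tau>' H' s \<omega>" for s \<omega>
      unfolding 1(3)[symmetric] 2(3)[symmetric] by (simp add: simple_integral_def inner_diff_left sum_subtractf)
  qed
qed

text \<open>Once the finitely many values of \<open>\<sigma>\<close> are partition points, each
  interval lies entirely before or entirely after \<open>\<sigma> \<omega>\<close>, and which of the
  two holds is decided at its left end point. So the stopped integrand is again simple.\<close>

lemma simple_stop:
  assumes s: "simple_integrand M T W n \<tau> H" and R: "finite R" "R \<subseteq> {0..T}"
    and \<sigma>: "\<And>\<omega>. \<omega> \<in> space M \<Longrightarrow> \<sigma> \<omega> \<in> R" "\<And>t. t \<in> {0..T} \<Longrightarrow> {\<omega>\<in>space M. \<sigma> \<omega> \<le> t} \<in> sets (F t)"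
  obtains m \<rho> G where "simple_integrand M T W m \<rho> G"
    "\<And>s \<omega>. \<omega> \<in> space M \<Longrightarrow> simple_process m \<rho> G s \<omega> = (if s \<le> \<sigma> \<omega> then simple_process n \<tau> H s \<omega> else 0)"
    "\<And>s \<omega>. \<omega> \<in> space M \<Longrightarrow> simple_integral W m \<rho> G s \<omega> = simple_integral W n \<tau> H (min s (\<sigma> \<omega>)) \<omega>"
proof -
  let ?S = "\<tau> ` {..n} \<union> R"
  have S: "finite ?S" "\<tau> ` {..n} \<subseteq> ?S" "?S \<subseteq> {0..T}"
    using simple_integrandD(2,3)[OF s] R by auto
  let ?m = "card ?S - 1" and ?\<rho> = "(!) (sorted_list_of_set ?S)" and ?H = "refine_integrand n \<tau> H ?S"
  note r = refine[OF s S]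
  let ?G = "\<lambda>j \<omega>. if \<sigma> \<omega> \<le> ?\<rho> j then 0 else ?H j \<omega>"
  have key: "?\<rho> (Suc j) \<le> \<sigma> \<omega>" if "j < ?m" "\<omega> \<in> space M" "\<not> \<sigma> \<omega> \<le> ?\<rho> j" for j \<omega>
    using r(6)[OF that(1), of "\<sigma> \<omega>"] \<sigma>(1)[OF that(2)] that(3) by auto
  show ?thesis
  proof (rule that[of ?m ?\<rho> ?G])
    show "simple_integrand M T W ?m ?\<rho> ?G"
      unfolding simple_integrand_def
    proof (intro conjI allI impI)
      fix j assume j: "j < ?m"
      show "?G j \<in> borel_measurable (F (?\<rho> j))"
        using \<sigma>(2)[of "?\<rho> j"] r(5)[of j] j S(3) simple_integrandD(4)[OF r(1) j] by (intro measurable_If) auto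
      have "?G j ` space M \<subseteq> insert 0 (?H j ` space M)" by auto
      moreover have "bounded (insert 0 (?H j ` space M))"
        using simple_integrandD(5)[OF r(1) j] by (simp only: bounded_insert)
      ultimately show "bounded (?G j ` space M)" by (rule bounded_subset[rotated])
    qed (use r(1) in \<open>auto simp: simple_integrand_def\<close>)
    fix s \<omega> assume \<omega>: "\<omega> \<in> space M"
    have "simple_process ?m ?\<rho> ?G s \<omega> = (if s \<le> \<sigma> \<omega> then simple_process ?m ?\<rho> ?H s \<omega> else 0)"
    proof (cases "s \<le> \<sigma> \<omega>")
      case True
      then show ?thesis unfolding simple_process_def by (auto intro!: sum.cong simp: indicator_def)
    next
      case False
      have "indicator {?\<rho> j<..?\<rho> (Suc j)} s *\<^sub>R ?G j \<omega> = 0" if "j < ?m" for j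
        using key[OF that \<omega>] False by (auto simp: indicator_def)
      then show ?thesis unfolding simple_process_def using False by (simp only: if_False, intro sum.neutral ballI) blast
    qed
    then show "simple_process ?m ?\<rho> ?G s \<omega> = (if s \<le> \<sigma> \<omega> then simple_process n \<tau> H s \<omega> else 0)" unfolding r(2) .
    have "simple_integral W ?m ?\<rho> ?G s \<omega> = simple_integral W ?m ?\<rho> ?H (min s (\<sigma> \<omega>)) \<omega>"
      unfolding simple_integral_def
    proof (intro sum.cong refl)
      fix j assume j: "j \<in> {..<?m}"
      then have lt: "?\<rho> j < ?\<rho> (Suc j)" using r(4) by simp
      show "?G j \<omega> \<bullet> (W (min (?\<rho> (Suc j)) s) \<omega> - W (min (?\<rho> j) s) \<omega>) =
        ?H j \<omega> \<bullet> (W (min (?\<rho> (Suc j)) (min s (\<sigma> \<omega>))) \<omega> - W (min (?\<rho> j) (min s (\<sigma> \<omega>))) \<omega>)"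
      proof (cases "\<sigma> \<omega> \<le> ?\<rho> j")
        case True
        then have "min (?\<rho> (Suc j)) (min s (\<sigma> \<omega>)) = min s (\<sigma> \<omega>)" "min (?\<rho> j) (min s (\<sigma> \<omega>)) = min s (\<sigma> \<omega>)"
          using lt by auto
        then show ?thesis using True by simp
      next
        case False
        then have "?\<rho> (Suc j) \<le> \<sigma> \<omega>" using key[of j \<omega>] j \<omega> by simp
        then have "min (?\<rho> (Suc j)) (min s (\<sigma> \<omega>)) = min (?\<rho> (Suc j)) s" "min (?\<rho> j) (min s (\<sigma> \<omega>)) = min (?\<rho> j) s"
          using lt by auto
        then show ?thesis using False by simp
      qed
    qed
    then show "simple_integral W ?m ?\<rho> ?G s \<omega> = simple_integral W n \<tau> H (min s (\<sigma> \<omega>)) \<omega>" unfolding r(3) .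
  qed
qed

end

section \<open>Predictable processes\<close>

lemma vanishes_in_prob_AE_subseq:
  assumes P: "prob_space P" and X: "\<And>k. X k \<in> borel_measurable P" and v: "vanishes_in_prob P X"
  obtains r where "strict_mono (r::nat\<Rightarrow>nat)" "AE \<omega> in P. (\<lambda>k. X (r k) \<omega>) \<longlonglongrightarrow> 0"
proof -
  interpret prob_space P by (rule P)
  let ?e = "\<lambda>n::nat. ennreal ((1/2)^n)"
  have "\<exists>N. \<forall>k\<ge>N. measure P {\<omega> \<in> space P. ?e n < X k \<omega>} < (1/2)^n" for n
  proof -
    have "(\<lambda>k. measure P {\<omega> \<in> space P. ?e n < X k \<omega>}) \<longlonglongrightarrow> 0"
      using v by (auto simp: vanishes_in_prob_def)
    from order_tendstoD(2)[OF this, of "(1/2)^n"] show ?thesis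
      by (auto simp: eventually_sequentially)
  qed
  then obtain N where N: "\<And>n k. k \<ge> N n \<Longrightarrow> measure P {\<omega> \<in> space P. ?e n < X k \<omega>} < (1/2)^n" by metis
  define r where "r = rec_nat (N 0) (\<lambda>n m. max (Suc m) (N (Suc n)))"
  have r: "strict_mono r" unfolding r_def by (auto simp: strict_mono_Suc_iff)
  have rN: "r n \<ge> N n" for n by (cases n) (auto simp: r_def)
  let ?A = "\<lambda>n. {\<omega> \<in> space P. ?e n < X (r n) \<omega>}"
  have "AE \<omega> in P. eventually (\<lambda>n. \<omega> \<in> space P - ?A n) sequentially"
  proof (rule borel_cantelli_AE1)
    show "?A n \<in> sets P" for n using X by measurable
    show "emeasure P (?A n) < \<infinity>" for n by (simp add: less_top[symmetric])
    show "summable (\<lambda>n. measure P (?A n))"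
    proof (rule summable_comparison_test'[of "\<lambda>n. (1/2::real)^n" 0])
      show "norm (measure P (?A n)) \<le> (1/2)^n" for n using N[OF rN[of n]] by simp
    qed (simp add: summable_geometric)
  qed
  then have "AE \<omega> in P. (\<lambda>k. X (r k) \<omega>) \<longlonglongrightarrow> 0"
  proof eventually_elim
    fix \<omega> assume ev: "eventually (\<lambda>n. \<omega> \<in> space P - ?A n) sequentially"
    have "(\<lambda>n. (1/2::real)^n) \<longlonglongrightarrow> 0" by (rule LIMSEQ_power_zero) simp
    then have e0: "?e \<longlonglongrightarrow> 0" using tendsto_ennrealI by fastforce
    have "eventually (\<lambda>n. X (r n) \<omega> \<le> ?e n) sequentially"
      using ev by eventually_elim (auto simp: not_less)
    then show "(\<lambda>k. X (r k) \<omega>) \<longlonglongrightarrow> 0"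
      by (intro tendsto_sandwich[OF _ _ tendsto_const e0]) auto
  qed
  with r show ?thesis by (rule that)
qed

lemma AE_vanishes_in_prob:
  assumes P: "prob_space P" and X: "\<And>k. X k \<in> borel_measurable P" and v: "AE \<omega> in P. (\<lambda>k. X k \<omega>) \<longlonglongrightarrow> 0"
  shows "vanishes_in_prob P X"
  unfolding vanishes_in_prob_def
proof (intro allI impI)
  interpret prob_space P by (rule P)
  fix e :: ennreal assume e: "0 < e"
  let ?A = "\<lambda>k. {\<omega> \<in> space P. e < X k \<omega>}"
  have A[measurable]: "?A k \<in> sets P" for k using X by measurable
  have "(\<lambda>k. integral\<^sup>L P (indicator (?A k) :: _ \<Rightarrow> real)) \<longlonglongrightarrow> integral\<^sup>L P (\<lambda>_. 0)"
  proof (rule integral_dominated_convergence[where w = "\<lambda>_. 1"])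
    show "AE \<omega> in P. (\<lambda>k. indicator (?A k) \<omega> :: real) \<longlonglongrightarrow> 0"
      using v
    proof eventually_elim
      fix \<omega> assume "(\<lambda>k. X k \<omega>) \<longlonglongrightarrow> 0"
      then have "eventually (\<lambda>k. X k \<omega> < e) sequentially" using e order_tendstoD(2) by blast
      then have "eventually (\<lambda>k. indicator (?A k) \<omega> = (0::real)) sequentially"
        by eventually_elim (auto simp: indicator_def)
      then show "(\<lambda>k. indicator (?A k) \<omega> :: real) \<longlonglongrightarrow> 0" by (rule tendsto_eventually)
    qed
  qed (auto simp: indicator_def)
  then show "(\<lambda>k. measure P (?A k)) \<longlonglongrightarrow> 0" by simp
qed

text \<open>Continuity reduces the supremum to countably many times, which makes it measurable.
  Clamping the rationals to \<open>{0..T}\<close> turns them into a dense set of times that contains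
  both end points.\<close>

lemma SUP_abs_continuous_dense:
  fixes g :: "real \<Rightarrow> real"
  assumes T: "0 \<le> T" and g: "continuous_on {0..T} g"
  shows "(SUP t\<in>{0..T}. ennreal \<bar>g t\<bar>) = (SUP q. ennreal \<bar>g (max 0 (min T (real_of_rat q)))\<bar>)"
proof (rule antisym)
  show "(SUP q. ennreal \<bar>g (max 0 (min T (real_of_rat q)))\<bar>) \<le> (SUP t\<in>{0..T}. ennreal \<bar>g t\<bar>)"
    using T by (intro SUP_least SUP_upper) auto
  show "(SUP t\<in>{0..T}. ennreal \<bar>g t\<bar>) \<le> (SUP q. ennreal \<bar>g (max 0 (min T (real_of_rat q)))\<bar>)"
  proof (rule SUP_least)
    fix t assume t: "t \<in> {0..T}"
    have "t \<in> closure (\<rat>::real set)" by (simp add: Rats_closure_real)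
    then obtain x where x: "\<And>n. x n \<in> (\<rat>::real set)" "x \<longlonglongrightarrow> t" unfolding closure_sequential by blast
    have "(\<lambda>n. max 0 (min T (x n))) \<longlonglongrightarrow> max 0 (min T t)"
      using x(2) by (intro tendsto_max tendsto_min tendsto_const)
    then have "(\<lambda>n. max 0 (min T (x n))) \<longlonglongrightarrow> t" using t by simp
    then have "(\<lambda>n. g (max 0 (min T (x n)))) \<longlonglongrightarrow> g t"
      using g t T unfolding continuous_on_sequentially comp_def by auto
    then have "(\<lambda>n. ennreal \<bar>g (max 0 (min T (x n)))\<bar>) \<longlonglongrightarrow> ennreal \<bar>g t\<bar>"
      by (intro tendsto_ennrealI tendsto_rabs)
    then show "ennreal \<bar>g t\<bar> \<le> (SUP q. ennreal \<bar>g (max 0 (min T (real_of_rat q)))\<bar>)"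
    proof (rule LIMSEQ_le_const2, intro exI[of _ 0] allI impI)
      fix n obtain q where "x n = real_of_rat q" using x(1)[of n] by (auto elim: Rats_cases)
      then show "ennreal \<bar>g (max 0 (min T (x n)))\<bar> \<le> (SUP q. ennreal \<bar>g (max 0 (min T (real_of_rat q)))\<bar>)"
        by (auto intro: SUP_upper)
    qed
  qed
qed

lemma SUP_abs_measurable:
  fixes X :: "real \<Rightarrow> 'a \<Rightarrow> real"
  assumes T: "0 \<le> T" and X: "\<And>t. t \<in> {0..T} \<Longrightarrow> X t \<in> borel_measurable P"
    and c: "\<And>\<omega>. \<omega> \<in> space P \<Longrightarrow> continuous_on {0..T} (\<lambda>t. X t \<omega>)"
  shows "(\<lambda>\<omega>. SUP t\<in>{0..T}. ennreal \<bar>X t \<omega>\<bar>) \<in> borel_measurable P"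
proof -
  have "(\<lambda>\<omega>. SUP q. ennreal \<bar>X (max 0 (min T (real_of_rat q))) \<omega>\<bar>) \<in> borel_measurable P"
    using X T by (intro borel_measurable_SUP measurable_compose[OF _ measurable_ennreal] borel_measurable_abs) auto
  then show ?thesis
    using SUP_abs_continuous_dense[OF T c] by (simp cong: measurable_cong)
qed

lemma SUP_tendsto_uniform_limit:
  fixes f :: "nat \<Rightarrow> real \<Rightarrow> real"
  shows "(\<lambda>k. SUP t\<in>S. ennreal \<bar>f k t - g t\<bar>) \<longlonglongrightarrow> 0 \<longleftrightarrow> uniform_limit S f g sequentially"
proof
  assume l: "(\<lambda>k. SUP t\<in>S. ennreal \<bar>f k t - g t\<bar>) \<longlonglongrightarrow> 0"
  show "uniform_limit S f g sequentially" unfolding uniform_limit_iff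
  proof (intro allI impI)
    fix e :: real assume e: "0 < e"
    have "eventually (\<lambda>k. (SUP t\<in>S. ennreal \<bar>f k t - g t\<bar>) < ennreal e) sequentially"
      using order_tendstoD(2)[OF l, of "ennreal e"] e by simp
    then show "\<forall>\<^sub>F n in sequentially. \<forall>x\<in>S. dist (f n x) (g x) < e"
    proof eventually_elim
      case (elim k)
      show ?case
      proof
        fix x assume "x \<in> S"
        then have "ennreal \<bar>f k x - g x\<bar> < ennreal e"
          by (rule le_less_trans[OF SUP_upper[of x S "\<lambda>t. ennreal \<bar>f k t - g t\<bar>"] elim])
        then show "dist (f k x) (g x) < e" by (simp add: dist_real_def ennreal_less_iff)
      qed
    qed
  qed
next
  assume u: "uniform_limit S f g sequentially"
  show "(\<lambda>k. SUP t\<in>S. ennreal \<bar>f k t - g t\<bar>) \<longlonglongrightarrow> 0"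
  proof (rule order_tendstoI)
    fix a :: ennreal assume "0 < a"
    then obtain b where b: "0 < b" "b < a" using dense by blast
    then have fin: "b < \<infinity>" using less_trans top.not_eq_extremum by fastforce
    then obtain e where e: "b = ennreal e" "0 < e" using b by (cases b) (auto simp: ennreal_less_zero_iff)
    from u e have "\<forall>\<^sub>F n in sequentially. \<forall>x\<in>S. dist (f n x) (g x) < e" unfolding uniform_limit_iff by blast
    then show "eventually (\<lambda>k. (SUP t\<in>S. ennreal \<bar>f k t - g t\<bar>) < a) sequentially"
    proof eventually_elim
      case (elim k)
      then have "(SUP t\<in>S. ennreal \<bar>f k t - g t\<bar>) \<le> b" unfolding e(1)
        by (intro SUP_least ennreal_leI) (auto simp: dist_real_def less_imp_le)
      then show ?case using b(2) by (rule le_less_trans)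
    qed
  qed simp
qed

section \<open>Joint measurability and squared distances along a path\<close>

context brownian
begin

abbreviation L :: "real measure" where "L \<equiv> restrict_space lborel {0..T}"

lemma space_L: "space L = {0..T}" by (simp add: space_restrict_space)

lemma sets_L: "A \<in> sets borel \<Longrightarrow> A \<subseteq> {0..T} \<Longrightarrow> A \<in> sets L"
  by (auto simp: sets_restrict_space)

lemma finite_L: "finite_measure L"
  by (intro finite_measureI) (use T_pos in \<open>simp add: emeasure_restrict_space space_restrict_space emeasure_lborel_Icc_eq\<close>)

lemma sigma_finite_L: "sigma_finite_measure L"
  using finite_L by (rule finite_measure.axioms)

lemma nn_integral_L: "(\<integral>\<^sup>+s. g s \<partial>L) = (\<integral>\<^sup>+s\<in>{0..T}. g s \<partial>lborel)"
  by (rule nn_integral_restrict_space) simp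

lemma predictable_gen:
  "{{0} \<times> A | A. A \<in> sets (F 0)} \<union> {{s<..t} \<times> A | s t A. 0 \<le> s \<and> s < t \<and> t \<le> T \<and> A \<in> sets (F s)} \<subseteq> Pow ({0..T} \<times> space M)"
  using T_pos sets.sets_into_space[of _ "F s" for s] by fastforce

lemma space_predictable: "space (predictable_sigma T (space M) F) = {0..T} \<times> space M"
  unfolding predictable_sigma_def by (rule space_measure_of[OF predictable_gen])

lemma sets_predictable: "sets (predictable_sigma T (space M) F) = sigma_sets ({0..T} \<times> space M)
   ({{0} \<times> A | A. A \<in> sets (F 0)} \<union> {{s<..t} \<times> A | s t A. 0 \<le> s \<and> s < t \<and> t \<le> T \<and> A \<in> sets (F s)})"
  unfolding predictable_sigma_def by (rule sets_measure_of[OF predictable_gen])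

lemma predictable_rect: "0 \<le> s \<Longrightarrow> s < t \<Longrightarrow> t \<le> T \<Longrightarrow> A \<in> sets (F s) \<Longrightarrow> {s<..t} \<times> A \<in> sets (predictable_sigma T (space M) F)"
  unfolding sets_predictable by (rule sigma_sets.Basic) blast

lemma predictable_rect0: "A \<in> sets (F 0) \<Longrightarrow> {0} \<times> A \<in> sets (predictable_sigma T (space M) F)"
  unfolding sets_predictable by (rule sigma_sets.Basic) blast

text \<open>Through this inclusion predictable processes are jointly measurable for the product of
  Lebesgue measure and \<open>P\<close>, as Fubini's theorem requires.\<close>

lemma predictable_sub: "sets (predictable_sigma T (space M) F) \<subseteq> sets (L \<Otimes>\<^sub>M P)"
proof -
  have sp: "space (L \<Otimes>\<^sub>M P) = {0..T} \<times> space M" by (simp add: space_pair_measure space_L)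
  have "{0} \<times> A \<in> sets (L \<Otimes>\<^sub>M P)" if "A \<in> sets (F 0)" for A
    using T_pos sets_FD[OF that] by (intro pair_measureI sets_L) auto
  moreover have "{s<..t} \<times> A \<in> sets (L \<Otimes>\<^sub>M P)" if "0 \<le> s" "s < t" "t \<le> T" "A \<in> sets (F s)" for s t A
    using sets_FD[OF that(4)] that by (intro pair_measureI sets_L) auto
  ultimately show ?thesis
    unfolding sets_predictable sp[symmetric] by (intro sets.sigma_sets_subset) auto
qed

lemma predictable_pair: "X \<in> measurable (predictable_sigma T (space M) F) N \<Longrightarrow> X \<in> measurable (L \<Otimes>\<^sub>M P) N"
  using predictable_sub unfolding measurable_def by (simp add: space_predictable space_pair_measure space_L subset_iff)

lemma predictable_section: "predictable M T W X \<Longrightarrow> \<omega> \<in> space M \<Longrightarrow> (\<lambda>t. X t \<omega>) \<in> borel_measurable L"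
  using measurable_compose[OF measurable_Pair2'[of \<omega> P L] predictable_pair, of "\<lambda>(t,\<omega>). X t \<omega>" borel] by simp

lemma predictable_time_section:
  assumes t: "t \<in> {0..T}"
  shows "(\<lambda>\<omega>. (t, \<omega>)) \<in> measurable (F t) (predictable_sigma T (space M) F)"
  unfolding predictable_sigma_def
proof (rule measurable_measure_of[OF predictable_gen])
  fix y assume "y \<in> {{0} \<times> A | A. A \<in> sets (F 0)} \<union> {{s<..t} \<times> A | s t A. 0 \<le> s \<and> s < t \<and> t \<le> T \<and> A \<in> sets (F s)}"
  then consider A where "y = {0} \<times> A" "A \<in> sets (F 0)"
    | s u A where "y = {s<..u} \<times> A" "0 \<le> s" "A \<in> sets (F s)" by blast
  then show "(\<lambda>\<omega>. (t, \<omega>)) -` y \<inter> space (F t) \<in> sets (F t)"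
  proof cases
    case 1
    then have "(\<lambda>\<omega>. (t, \<omega>)) -` y \<inter> space (F t) = (if t = 0 then A else {})"
      using sets.sets_into_space[OF 1(2)] by auto
    then show ?thesis using 1 by auto
  next
    case 2
    then have "(\<lambda>\<omega>. (t, \<omega>)) -` y \<inter> space (F t) = (if t \<in> {s<..u} then A else {})"
      using sets.sets_into_space[OF 2(3)] by auto
    then show ?thesis using 2 sets_F_mono[of s t] by auto
  qed
qed (use t in auto)

lemma predictable_F: "predictable M T W X \<Longrightarrow> t \<in> {0..T} \<Longrightarrow> X t \<in> borel_measurable (F t)"
  using measurable_compose[OF predictable_time_section, of t "\<lambda>(t,\<omega>). X t \<omega>"] by simp

lemma predictable_P: "predictable M T W X \<Longrightarrow> t \<in> {0..T} \<Longrightarrow> X t \<in> borel_measurable P"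
  by (rule F_P[OF predictable_F]) auto

lemma step_predictable:
  fixes H :: "'w \<Rightarrow> 'b::real_normed_vector"
  assumes ab: "0 \<le> a" "b \<le> T" and H: "H \<in> borel_measurable (F a)"
  shows "(\<lambda>(t,\<omega>). indicator {a<..b} t *\<^sub>R H \<omega>) \<in> borel_measurable (predictable_sigma T (space M) F)"
proof (cases "a < b")
  case True
  let ?P = "predictable_sigma T (space M) F" and ?I = "{a<..b}"
  show ?thesis
  proof (rule measurableI)
    fix A :: "'b set" assume A: "A \<in> sets borel"
    let ?B = "?I \<times> (H -` A \<inter> space M)" and ?C = "?I \<times> space M"
    have B: "?B \<in> sets ?P" using measurable_sets[OF H A] ab True by (intro predictable_rect) auto
    have C: "?C \<in> sets ?P" using ab True sets.top[of "F a"] by (intro predictable_rect) auto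
    have "(\<lambda>(t,\<omega>). indicator ?I t *\<^sub>R H \<omega>) -` A \<inter> space ?P = ?B \<union> (if 0 \<in> A then space ?P - ?C else {})"
      using ab by (cases "0 \<in> A") (auto simp: space_predictable split: split_indicator_asm)
    then show "(\<lambda>(t,\<omega>). indicator ?I t *\<^sub>R H \<omega>) -` A \<inter> space ?P \<in> sets ?P" using B C by auto
  qed simp
next
  case False
  then have "(\<lambda>(t,\<omega>). indicator {a<..b} t *\<^sub>R H \<omega>) = (\<lambda>_. 0)" by (auto simp: indicator_def fun_eq_iff)
  then show ?thesis by simp
qed

lemma simple_process_predictable:
  assumes s: "simple_integrand M T W n \<tau> H"
  shows "predictable M T W (simple_process n \<tau> H)"
  unfolding simple_process_def split_def
proof (intro borel_measurable_sum)
  fix i assume "i \<in> {..<n}"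
  then show "(\<lambda>v. indicator {\<tau> i<..\<tau> (Suc i)} (fst v) *\<^sub>R H i (snd v)) \<in> borel_measurable (predictable_sigma T (space M) F)"
    using step_predictable[of "\<tau> i" "\<tau> (Suc i)" "H i"] simple_integrandD(2,4)[OF s, of i] simple_integrandD(3)[OF s, of "Suc i"]
    by (simp add: split_def)
qed

lemma simple_integral_F:
  assumes s: "simple_integrand M T W n \<tau> H" and t: "0 \<le> t"
  shows "simple_integral W n \<tau> H t \<in> borel_measurable (F t)"
  unfolding simple_integral_def
proof (intro borel_measurable_sum)
  fix i assume "i \<in> {..<n}"
  then have i: "i < n" by simp
  have i': "0 \<le> \<tau> i" "\<tau> i \<le> \<tau> (Suc i)" using simple_integrandD(1)[OF s, of i "Suc i"] simple_integrandD(2)[OF s, of i] i by auto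
  show "(\<lambda>\<omega>. H i \<omega> \<bullet> (W (min (\<tau> (Suc i)) t) \<omega> - W (min (\<tau> i) t) \<omega>)) \<in> borel_measurable (F t)"
  proof (cases "\<tau> i \<le> t")
    case True
    then have [measurable]: "H i \<in> borel_measurable (F t)" using F_mono[OF simple_integrandD(4)[OF s i]] by simp
    have [measurable]: "W (min (\<tau> (Suc i)) t) \<in> borel_measurable (F t)" "W (min (\<tau> i) t) \<in> borel_measurable (F t)"
      using i' t by (intro W_F; simp)+
    show ?thesis by measurable
  next
    case False
    then have "min (\<tau> (Suc i)) t = t" "min (\<tau> i) t = t" using i' by auto
    then show ?thesis by simp
  qed
qed

lemma simple_integral_cont:
  assumes s: "simple_integrand M T W n \<tau> H" and \<omega>: "\<omega> \<in> space M"
  shows "continuous_on {0..T} (\<lambda>t. simple_integral W n \<tau> H t \<omega>)"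
  unfolding simple_integral_def
proof (intro continuous_intros)
  fix i assume i: "i \<in> {..<n}"
  have c: "continuous_on {0..T} (\<lambda>t. W (min x t) \<omega>)" if "0 \<le> x" for x
    using that by (intro continuous_on_compose2[OF W_cont[OF \<omega>]] continuous_intros) auto
  show "continuous_on {0..T} (\<lambda>t. W (min (\<tau> (Suc i)) t) \<omega>)" "continuous_on {0..T} (\<lambda>t. W (min (\<tau> i) t) \<omega>)"
    using simple_integrandD(2)[OF s, of i] simple_integrandD(2)[OF s, of "Suc i"] i by (auto intro!: c)
qed

lemma F_AE_LIMSEQ:
  fixes X :: "nat \<Rightarrow> 'w \<Rightarrow> real"
  assumes "\<And>k. X k \<in> borel_measurable (F t)" "AE \<omega> in P. (\<lambda>k. X k \<omega>) \<longlonglongrightarrow> Y \<omega>"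
  shows "Y \<in> borel_measurable (F t)"
proof (rule F_AE_eq)
  show "(\<lambda>\<omega>. lim (\<lambda>k. X k \<omega>)) \<in> borel_measurable (F t)" using assms(1) by (rule borel_measurable_lim_metric)
  show "AE x in P. lim (\<lambda>k. X k x) = Y x" using assms(2) by eventually_elim (rule limI)
qed

text \<open>The squared L2 distance over \<open>{0..T}\<close> along one path, with value infinity
  allowed, so that convergence of integrands can be stated before square integrability is
  known.\<close>

definition sqdist :: "(real \<Rightarrow> 'w \<Rightarrow> real^'d) \<Rightarrow> (real \<Rightarrow> 'w \<Rightarrow> real^'d) \<Rightarrow> 'w \<Rightarrow> ennreal" where
  "sqdist X Y \<omega> = (\<integral>\<^sup>+s\<in>{0..T}. ennreal ((norm (X s \<omega> - Y s \<omega>))\<^sup>2) \<partial>lborel)"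

lemma nn_integral_time_measurable:
  fixes X :: "real \<Rightarrow> 'w \<Rightarrow> ennreal"
  assumes "(\<lambda>(t,\<omega>). X t \<omega>) \<in> borel_measurable (L \<Otimes>\<^sub>M P)"
  shows "(\<lambda>\<omega>. \<integral>\<^sup>+s\<in>{0..T}. X s \<omega> \<partial>lborel) \<in> borel_measurable P"
proof -
  interpret L: sigma_finite_measure L by (rule sigma_finite_L)
  have "(\<lambda>(\<omega>,t). X t \<omega>) \<in> borel_measurable (P \<Otimes>\<^sub>M L)"
    using measurable_compose[OF measurable_pair_swap' assms] by (simp add: split_def)
  then show ?thesis
    unfolding nn_integral_L[symmetric] by (intro L.borel_measurable_nn_integral) simp
qed

lemma sqdist_measurable:
  assumes "predictable M T W X" "predictable M T W Y"
  shows "sqdist X Y \<in> borel_measurable P"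
  unfolding sqdist_def
proof (rule nn_integral_time_measurable)
  have "(\<lambda>v. X (fst v) (snd v)) \<in> borel_measurable (L \<Otimes>\<^sub>M P)" "(\<lambda>v. Y (fst v) (snd v)) \<in> borel_measurable (L \<Otimes>\<^sub>M P)"
    using assms[THEN predictable_pair] by (auto simp: split_def)
  then show "(\<lambda>(s, \<omega>). ennreal ((norm (X s \<omega> - Y s \<omega>))\<^sup>2)) \<in> borel_measurable (L \<Otimes>\<^sub>M P)"
    unfolding split_def by measurable
qed

lemma sqdist_triangle:
  assumes "predictable M T W X" "predictable M T W Y" "predictable M T W Z" "\<omega> \<in> space M"
  shows "sqdist X Z \<omega> \<le> 2 * sqdist X Y \<omega> + 2 * sqdist Y Z \<omega>"
proof -
  have [measurable]: "(\<lambda>t. X t \<omega>) \<in> borel_measurable L" "(\<lambda>t. Y t \<omega>) \<in> borel_measurable L" "(\<lambda>t. Z t \<omega>) \<in> borel_measurable L"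
    using predictable_section assms by auto
  have sq: "(norm (a + b))\<^sup>2 \<le> 2 * (norm a)\<^sup>2 + 2 * (norm b)\<^sup>2" for a b :: "real^'d"
  proof -
    have "(norm (a + b))\<^sup>2 \<le> (norm a + norm b)\<^sup>2" by (intro power_mono norm_triangle_ineq) auto
    also have "\<dots> \<le> 2 * (norm a)\<^sup>2 + 2 * (norm b)\<^sup>2"
      using zero_le_power2[of "norm a - norm b"] by (simp add: power2_eq_square algebra_simps)
    finally show ?thesis .
  qed
  have "sqdist X Z \<omega> \<le> (\<integral>\<^sup>+s. 2 * ennreal ((norm (X s \<omega> - Y s \<omega>))\<^sup>2) + 2 * ennreal ((norm (Y s \<omega> - Z s \<omega>))\<^sup>2) \<partial>L)"
    unfolding sqdist_def nn_integral_L[symmetric]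
  proof (rule nn_integral_mono)
    fix s
    have "(norm (X s \<omega> - Z s \<omega>))\<^sup>2 \<le> 2 * (norm (X s \<omega> - Y s \<omega>))\<^sup>2 + 2 * (norm (Y s \<omega> - Z s \<omega>))\<^sup>2"
      using sq[of "X s \<omega> - Y s \<omega>" "Y s \<omega> - Z s \<omega>"] by simp
    then have "ennreal ((norm (X s \<omega> - Z s \<omega>))\<^sup>2) \<le> ennreal (2 * (norm (X s \<omega> - Y s \<omega>))\<^sup>2 + 2 * (norm (Y s \<omega> - Z s \<omega>))\<^sup>2)"
      by (rule ennreal_leI)
    then show "ennreal ((norm (X s \<omega> - Z s \<omega>))\<^sup>2) \<le> 2 * ennreal ((norm (X s \<omega> - Y s \<omega>))\<^sup>2) + 2 * ennreal ((norm (Y s \<omega> - Z s \<omega>))\<^sup>2)"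
      by (simp add: ennreal_mult)
  qed
  also have "\<dots> = 2 * sqdist X Y \<omega> + 2 * sqdist Y Z \<omega>"
    unfolding sqdist_def nn_integral_L[symmetric] by (simp add: nn_integral_add nn_integral_cmult)
  finally show ?thesis .
qed

end

text \<open>The intervals are disjoint, so at each time at most one summand differs from 0 and mixed
  terms vanish.\<close>

lemma norm_sq_simple_process:
  assumes "\<And>i. i < n \<Longrightarrow> \<tau> i \<le> \<tau> (Suc i)"
  shows "(norm (simple_process n \<tau> H s \<omega>))\<^sup>2 = (\<Sum>i<n. indicator {\<tau> i<..\<tau> (Suc i)} s * (norm (H i \<omega>))\<^sup>2)"
  using assms
proof (induction n)
  case (Suc n)
  have IH: "(norm (simple_process n \<tau> H s \<omega>))\<^sup>2 = (\<Sum>i<n. indicator {\<tau> i<..\<tau> (Suc i)} s * (norm (H i \<omega>))\<^sup>2)"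
    using Suc by simp
  have sp: "simple_process (Suc n) \<tau> H s \<omega> = simple_process n \<tau> H s \<omega> + indicator {\<tau> n<..\<tau> (Suc n)} s *\<^sub>R H n \<omega>"
    by (simp add: simple_process_def)
  show ?case
  proof (cases "\<tau> n < s")
    case True
    have "simple_process n \<tau> H s \<omega> = 0" unfolding simple_process_def
    proof (intro sum.neutral ballI)
      fix i assume "i \<in> {..<n}"
      then have "\<tau> (Suc i) \<le> \<tau> n" using lift_mono_upto[of "Suc n" \<tau> "Suc i" n] Suc.prems by auto
      then show "indicator {\<tau> i<..\<tau> (Suc i)} s *\<^sub>R H i \<omega> = 0" using True by simp
    qed
    then show ?thesis using IH sp by (simp add: power_mult_distrib indicator_def)
  next
    case False
    then show ?thesis using IH sp by simp
  qed
qed (simp add: simple_process_def)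

lemma set_integral_nonneg:
  fixes f :: "'a \<Rightarrow> real"
  assumes "\<And>x. x \<in> A \<Longrightarrow> 0 \<le> f x"
  shows "0 \<le> (LINT x:A|M. f x)"
  unfolding set_lebesgue_integral_def
  by (intro Bochner_Integration.integral_nonneg) (use assms in \<open>auto simp: indicator_def\<close>)

lemma integrable_interval_part:
  fixes a b c d e :: real
  shows "integrable lborel (\<lambda>x. indicat_real ({a..b} \<inter> {c<..d}) x * e)"
proof -
  have "emeasure lborel ({a..b} \<inter> {c<..d}) \<le> emeasure lborel {a..b}" by (rule emeasure_mono) auto
  also have "\<dots> < \<infinity>" by (cases "a \<le> b") (auto simp: emeasure_lborel_Icc_eq)
  finally show ?thesis by (intro integrable_mult_left integrable_real_indicator) auto
qed

text \<open>Young's inequality with weight \<open>d\<close>. A small \<open>d\<close> makes the part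
  with the fixed \<open>b\<close> small; the large factor \<open>1 / d\<close> falls on the
  difference, which tends to 0 in the application.\<close>

lemma square_diff_le:
  fixes a b :: "'a::real_normed_vector"
  assumes d: "0 < d"
  shows "\<bar>(norm a)\<^sup>2 - (norm b)\<^sup>2\<bar> \<le> (1 + 1/d) * (norm (a - b))\<^sup>2 + d * (norm b)\<^sup>2"
proof -
  let ?x = "norm (a - b)" and ?y = "norm b"
  have 1: "\<bar>norm a - ?y\<bar> \<le> ?x" by (rule norm_triangle_ineq3)
  have "\<bar>(norm a)\<^sup>2 - ?y\<^sup>2\<bar> = \<bar>norm a - ?y\<bar> * (norm a + ?y)"
    by (simp add: power2_eq_square square_diff_square_factored abs_mult)
  also have "\<dots> \<le> ?x * (?x + 2 * ?y)" using 1 by (intro mult_mono) auto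
  also have "\<dots> \<le> (1 + 1/d) * ?x\<^sup>2 + d * ?y\<^sup>2"
  proof -
    have "0 \<le> (?x - d * ?y)\<^sup>2 / d" using d by simp
    also have "\<dots> = ?x\<^sup>2 / d - 2 * ?x * ?y + d * ?y\<^sup>2" using d by (simp add: power2_eq_square field_simps)
    finally show ?thesis using d by (simp add: power2_eq_square algebra_simps)
  qed
  finally show ?thesis .
qed

section \<open>Quadratic variation\<close>

context brownian
begin

definition sq_int :: "(real \<Rightarrow> 'w \<Rightarrow> real^'d) \<Rightarrow> 'w \<Rightarrow> bool" where
  "sq_int Z \<omega> \<longleftrightarrow> set_integrable lborel {0..T} (\<lambda>s. (norm (Z s \<omega>))\<^sup>2)"

text \<open>The quadratic variation at time \<open>t\<close> of the stochastic integral of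
  \<open>Z\<close>. Where the square is not integrable the Bochner integral has the value 0, so
  monotonicity and additivity in time are claimed only under \<open>sq_int\<close>.\<close>

definition qv :: "(real \<Rightarrow> 'w \<Rightarrow> real^'d) \<Rightarrow> real \<Rightarrow> 'w \<Rightarrow> real" where
  "qv Z t \<omega> = (LBINT s:{0..t}. (norm (Z s \<omega>))\<^sup>2)"

lemma set_borel_L:
  fixes f :: "real \<Rightarrow> 'b::real_normed_vector"
  assumes "f \<in> borel_measurable L"
  shows "set_borel_measurable lborel {0..T} f"
  using assms unfolding set_borel_measurable_def
  by (subst (asm) borel_measurable_restrict_space_iff) auto

lemma nonneg_set_integrable_iff:
  fixes f :: "real \<Rightarrow> real"
  assumes f: "f \<in> borel_measurable L" and nn: "\<And>s. 0 \<le> f s"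
  shows "set_integrable lborel {0..T} f \<longleftrightarrow> (\<integral>\<^sup>+s\<in>{0..T}. ennreal (f s) \<partial>lborel) < \<infinity>"
proof -
  have m: "(\<lambda>x. indicat_real {0..T} x *\<^sub>R f x) \<in> borel_measurable lborel"
    using set_borel_L[OF f] by (simp add: set_borel_measurable_def)
  have "(\<integral>\<^sup>+x. ennreal (norm (indicat_real {0..T} x *\<^sub>R f x)) \<partial>lborel) = (\<integral>\<^sup>+s\<in>{0..T}. ennreal (f s) \<partial>lborel)"
    using nn by (intro nn_integral_cong) (auto simp: indicator_def)
  then show ?thesis unfolding set_integrable_def integrable_iff_bounded using m by simp
qed

lemma sq_measurable:
  assumes "predictable M T W Z" "\<omega> \<in> space M"
  shows "(\<lambda>s. (norm (Z s \<omega>))\<^sup>2) \<in> borel_measurable L"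
proof -
  have [measurable]: "(\<lambda>s. Z s \<omega>) \<in> borel_measurable L" using predictable_section[OF assms] .
  show ?thesis by measurable
qed

lemma sq_int_iff:
  assumes "predictable M T W Z" "\<omega> \<in> space M"
  shows "sq_int Z \<omega> \<longleftrightarrow> sqdist Z (\<lambda>_ _. 0) \<omega> < \<infinity>"
  unfolding sq_int_def sqdist_def using nonneg_set_integrable_iff[OF sq_measurable[OF assms]] by simp

lemma predictable_0: "predictable M T W (\<lambda>_ _. 0::'b::{topological_space,zero})"
  by simp

lemma predictable_diff:
  assumes "predictable M T W X" "predictable M T W Y"
  shows "predictable M T W (\<lambda>s \<omega>. X s \<omega> - Y s \<omega> :: 'b::{second_countable_topology,real_normed_vector})"
  using borel_measurable_diff[OF assms] by (simp add: split_def)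

lemma sq_int_close:
  assumes "predictable M T W X" "predictable M T W Y" "\<omega> \<in> space M" "sq_int Y \<omega>" "sqdist X Y \<omega> < \<infinity>"
  shows "sq_int X \<omega>"
proof -
  have "sqdist X (\<lambda>_ _. 0) \<omega> \<le> 2 * sqdist X Y \<omega> + 2 * sqdist Y (\<lambda>_ _. 0) \<omega>"
    by (rule sqdist_triangle[OF assms(1,2) predictable_0 assms(3)])
  also have "\<dots> < \<infinity>"
    using assms sq_int_iff[OF assms(2,3)] by (simp add: ennreal_mult_less_top)
  finally show ?thesis using sq_int_iff[OF assms(1,3)] by simp
qed

lemma sq_int_diff:
  assumes "predictable M T W X" "predictable M T W Y" "\<omega> \<in> space M" "sq_int X \<omega>" "sq_int Y \<omega>"
  shows "sq_int (\<lambda>s \<omega>. X s \<omega> - Y s \<omega>) \<omega>"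
proof -
  have "sqdist X Y \<omega> \<le> 2 * sqdist X (\<lambda>_ _. 0) \<omega> + 2 * sqdist (\<lambda>_ _. 0) Y \<omega>"
    by (rule sqdist_triangle[OF assms(1) predictable_0 assms(2,3)])
  also have "sqdist (\<lambda>_ _. 0) Y \<omega> = sqdist Y (\<lambda>_ _. 0) \<omega>" by (simp add: sqdist_def norm_minus_commute)
  also have "2 * sqdist X (\<lambda>_ _. 0) \<omega> + 2 * sqdist Y (\<lambda>_ _. 0) \<omega> < \<infinity>"
    using assms sq_int_iff[OF assms(1,3)] sq_int_iff[OF assms(2,3)] by (simp add: ennreal_mult_less_top)
  finally show ?thesis
    using sq_int_iff[OF predictable_diff[OF assms(1,2)] assms(3)] by (simp add: sqdist_def)
qed

lemma sq_int_sub: "sq_int Z \<omega> \<Longrightarrow> 0 \<le> a \<Longrightarrow> b \<le> T \<Longrightarrow> set_integrable lborel {a..b} (\<lambda>s. (norm (Z s \<omega>))\<^sup>2)"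
  unfolding sq_int_def by (erule set_integrable_subset) auto

lemma set_integral_split:
  fixes f :: "real \<Rightarrow> real"
  assumes "set_integrable lborel {0..T} f" "0 \<le> a" "a \<le> b" "b \<le> c" "c \<le> T"
  shows "(LBINT s:{a..c}. f s) = (LBINT s:{a..b}. f s) + (LBINT s:{b..c}. f s)"
proof -
  have i: "set_integrable lborel {x..y} f" if "0 \<le> x" "y \<le> T" for x y
    using assms(1) by (rule set_integrable_subset) (use that in auto)
  have "{a..c} = {a..b} \<union> {b..c}" using assms by auto
  moreover have "(LBINT s:{a..b} \<union> {b..c}. f s) = (LBINT s:{a..b}. f s) + (LBINT s:{b..c}. f s)"
    using AE_lborel_singleton[of b] i[of a b] i[of b c] assms
    by (intro set_integral_Un_AE) (auto elim!: eventually_mono)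
  ultimately show ?thesis by simp
qed

lemma qv_diff:
  assumes "sq_int Z \<omega>" "0 \<le> a" "a \<le> b" "b \<le> T"
  shows "qv Z b \<omega> - qv Z a \<omega> = (LBINT s:{a..b}. (norm (Z s \<omega>))\<^sup>2)"
  unfolding qv_def using set_integral_split[OF assms(1)[unfolded sq_int_def], of 0 a b] assms by simp

lemma qv_mono:
  assumes "sq_int Z \<omega>" "0 \<le> a" "a \<le> b" "b \<le> T"
  shows "qv Z a \<omega> \<le> qv Z b \<omega>"
proof -
  have "0 \<le> qv Z b \<omega> - qv Z a \<omega>" unfolding qv_diff[OF assms] by (rule set_integral_nonneg) simp
  then show ?thesis by simp
qed

lemma qv_nonneg: "0 \<le> qv Z t \<omega>"
  unfolding qv_def by (rule set_integral_nonneg) simp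

lemma qv_0: "qv Z 0 \<omega> = 0"
  unfolding qv_def set_lebesgue_integral_def
  by (rule integral_eq_zero_AE, rule AE_mp[OF AE_lborel_singleton[of 0]]) (auto simp: indicator_def)

lemma qv_measurable:
  assumes Z: "predictable M T W Z" and t: "t \<le> T"
  shows "qv Z t \<in> borel_measurable P"
proof -
  interpret L: sigma_finite_measure L by (rule sigma_finite_L)
  have [measurable]: "(\<lambda>v. Z (fst v) (snd v)) \<in> borel_measurable (L \<Otimes>\<^sub>M P)"
    using predictable_pair[OF Z] by (simp add: split_def)
  have [measurable]: "(\<lambda>v. Z (snd v) (fst v)) \<in> borel_measurable (P \<Otimes>\<^sub>M L)"
    using measurable_compose[OF measurable_pair_swap' predictable_pair[OF Z]] by (simp add: split_def)
  have [measurable]: "snd \<in> borel_measurable (P \<Otimes>\<^sub>M L)"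
    by (rule measurable_compose[OF measurable_snd]) (rule measurable_restrict_space1, simp)
  have "(\<lambda>\<omega>. \<integral>s. indicator {0..t} s *\<^sub>R (norm (Z s \<omega>))\<^sup>2 \<partial>L) \<in> borel_measurable P"
    by (intro L.borel_measurable_lebesgue_integral) (simp add: split_def, measurable)
  also have "(\<lambda>\<omega>. \<integral>s. indicator {0..t} s *\<^sub>R (norm (Z s \<omega>))\<^sup>2 \<partial>L) = qv Z t"
  proof
    fix \<omega>
    have "(\<integral>s. indicator {0..t} s *\<^sub>R (norm (Z s \<omega>))\<^sup>2 \<partial>L) = (\<integral>s. indicator {0..T} s *\<^sub>R (indicator {0..t} s *\<^sub>R (norm (Z s \<omega>))\<^sup>2) \<partial>lborel)"
      by (rule integral_restrict_space) simp
    also have "\<dots> = qv Z t \<omega>" unfolding qv_def set_lebesgue_integral_def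
      using t by (intro Bochner_Integration.integral_cong) (auto simp: indicator_def)
    finally show "(\<integral>s. indicator {0..t} s *\<^sub>R (norm (Z s \<omega>))\<^sup>2 \<partial>L) = qv Z t \<omega>" .
  qed
  finally show ?thesis .
qed

lemma simple_qv_eq:
  assumes s: "simple_integrand M T W n \<tau> H" and t: "0 \<le> t" "t \<le> T"
  shows "simple_qv n \<tau> H t \<omega> = qv (simple_process n \<tau> H) t \<omega>"
proof -
  have e: "(norm (simple_process n \<tau> H s \<omega>))\<^sup>2 = (\<Sum>i<n. indicator {\<tau> i<..\<tau> (Suc i)} s * (norm (H i \<omega>))\<^sup>2)" for s
    using norm_sq_simple_process[of n \<tau> H _ \<omega>] simple_integrandD(1)[OF s] by auto
  have "qv (simple_process n \<tau> H) t \<omega> = (\<integral>s. (\<Sum>i<n. indicator ({0..t} \<inter> {\<tau> i<..\<tau> (Suc i)}) s * (norm (H i \<omega>))\<^sup>2) \<partial>lborel)"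
    unfolding qv_def e set_lebesgue_integral_def
    unfolding real_scaleR_def sum_distrib_left indicator_inter_arith by (simp only: mult.assoc)
  also have "\<dots> = (\<Sum>i<n. measure lborel ({0..t} \<inter> {\<tau> i<..\<tau> (Suc i)}) * (norm (H i \<omega>))\<^sup>2)"
    by (subst Bochner_Integration.integral_sum) (simp_all only: integrable_interval_part, simp)
  also have "\<dots> = simple_qv n \<tau> H t \<omega>"
    unfolding simple_qv_def
  proof (intro sum.cong refl)
    fix i assume "i \<in> {..<n}"
    then have i: "0 \<le> \<tau> i" "\<tau> i \<le> \<tau> (Suc i)" using simple_integrandD(1)[OF s, of i "Suc i"] simple_integrandD(2)[OF s, of i] by auto
    have "{0..t} \<inter> {\<tau> i<..\<tau> (Suc i)} = {min (\<tau> i) t<..min (\<tau> (Suc i)) t}" using i by auto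
    then show "measure lborel ({0..t} \<inter> {\<tau> i<..\<tau> (Suc i)}) * (norm (H i \<omega>))\<^sup>2 = (norm (H i \<omega>))\<^sup>2 * (min (\<tau> (Suc i)) t - min (\<tau> i) t)"
      using i by (simp add: measure_lborel_Ioc)
  qed
  finally show ?thesis by simp
qed

lemma qv_uniform_limit:
  assumes Zk: "\<And>k. predictable M T W (Zk k)" and Z: "predictable M T W Z" and \<omega>: "\<omega> \<in> space M"
    and sq: "sq_int Z \<omega>" and lim: "(\<lambda>k. sqdist (Zk k) Z \<omega>) \<longlonglongrightarrow> 0"
  shows "uniform_limit {0..T} (\<lambda>k t. qv (Zk k) t \<omega>) (\<lambda>t. qv Z t \<omega>) sequentially"
  unfolding uniform_limit_iff
proof (intro allI impI)
  fix e :: real assume e: "0 < e"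
  define q where "q = (LBINT s:{0..T}. (norm (Z s \<omega>))\<^sup>2)"
  have q: "0 \<le> q" unfolding q_def by (rule set_integral_nonneg) simp
  \<comment> \<open>\<open>d\<close> keeps the term with the fixed \<open>Z\<close> below
    \<open>e / 2\<close>, with \<open>q + 1\<close> in place of \<open>q\<close> because
    \<open>q\<close> may be 0; \<open>e'\<close> then pays for the factor \<open>c\<close> on the
    difference. Both error terms are integrals over all of \<open>{0..T}\<close>, which makes the
    estimate uniform in time.\<close>
  define d where "d = e / (2 * (q + 1))"
  have d: "0 < d" "d * q < e / 2" using e q by (simp_all add: d_def field_simps)
  define c where "c = 1 + 1/d"
  have c: "0 < c" using d(1) by (auto simp: c_def intro: add_pos_pos)
  define e' where "e' = e / 2 / c"
  have e': "0 < e'" "c * e' = e / 2" using c e by (auto simp: e'_def)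
  have "eventually (\<lambda>k. sqdist (Zk k) Z \<omega> < ennreal e') sequentially"
    using order_tendstoD(2)[OF lim, of "ennreal e'"] e' by simp
  then show "\<forall>\<^sub>F n in sequentially. \<forall>t\<in>{0..T}. dist (qv (Zk n) t \<omega>) (qv Z t \<omega>) < e"
  proof eventually_elim
    case (elim k)
    let ?D = "\<lambda>s \<omega>. Zk k s \<omega> - Z s \<omega>"
    have fin: "sqdist (Zk k) Z \<omega> < \<infinity>" using elim by (rule less_trans) simp
    have sqk: "sq_int (Zk k) \<omega>" using sq_int_close[OF Zk Z \<omega> sq fin] .
    have sqd: "sq_int ?D \<omega>" by (rule sq_int_diff[OF Zk Z \<omega> sqk sq])
    have dk: "(LBINT s:{0..T}. (norm (?D s \<omega>))\<^sup>2) < e'"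
    proof -
      have "ennreal (LBINT s:{0..T}. (norm (?D s \<omega>))\<^sup>2) = (\<integral>\<^sup>+s. ennreal (indicator {0..T} s *\<^sub>R (norm (?D s \<omega>))\<^sup>2) \<partial>lborel)"
        using sqd unfolding sq_int_def set_integrable_def set_lebesgue_integral_def
        by (intro nn_integral_eq_integral[symmetric]) auto
      also have "\<dots> = sqdist (Zk k) Z \<omega>"
        unfolding sqdist_def by (intro nn_integral_cong) (auto simp: indicator_def)
      finally have E: "ennreal (LBINT s:{0..T}. (norm (?D s \<omega>))\<^sup>2) = sqdist (Zk k) Z \<omega>" .
      show ?thesis using elim unfolding E[symmetric]
        by (subst (asm) ennreal_less_iff) (auto intro: set_integral_nonneg)
    qed
    show ?case
    proof
      fix t assume t: "t \<in> {0..T}"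
      have i: "set_integrable lborel {0..t} (\<lambda>s. (norm (Zk k s \<omega>))\<^sup>2)" "set_integrable lborel {0..t} (\<lambda>s. (norm (Z s \<omega>))\<^sup>2)"
        using sq_int_sub[OF sqk, of 0 t] sq_int_sub[OF sq, of 0 t] t by auto
      have id: "set_integrable lborel {0..T} (\<lambda>s. c * (norm (?D s \<omega>))\<^sup>2 + d * (norm (Z s \<omega>))\<^sup>2)"
        using sqd sq unfolding sq_int_def by (intro set_integral_add(1) set_integrable_mult_right) auto
      have "\<bar>qv (Zk k) t \<omega> - qv Z t \<omega>\<bar> = \<bar>LBINT s:{0..t}. (norm (Zk k s \<omega>))\<^sup>2 - (norm (Z s \<omega>))\<^sup>2\<bar>"
        unfolding qv_def using set_integral_diff(2)[OF i] by simp
      also have "\<dots> \<le> (LBINT s:{0..t}. \<bar>(norm (Zk k s \<omega>))\<^sup>2 - (norm (Z s \<omega>))\<^sup>2\<bar>)"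
        using set_integral_norm_bound[OF set_integral_diff(1)[OF i]] by simp
      also have "\<dots> \<le> (LBINT s:{0..T}. c * (norm (?D s \<omega>))\<^sup>2 + d * (norm (Z s \<omega>))\<^sup>2)"
        unfolding set_lebesgue_integral_def
      proof (rule integral_mono_AE)
        show "integrable lborel (\<lambda>s. indicat_real {0..t} s *\<^sub>R \<bar>(norm (Zk k s \<omega>))\<^sup>2 - (norm (Z s \<omega>))\<^sup>2\<bar>)"
          using set_integrable_abs[OF set_integral_diff(1)[OF i]] by (simp add: set_integrable_def)
        show "integrable lborel (\<lambda>s. indicat_real {0..T} s *\<^sub>R (c * (norm (?D s \<omega>))\<^sup>2 + d * (norm (Z s \<omega>))\<^sup>2))"
          using id by (simp add: set_integrable_def)
        show "AE s in lborel. indicat_real {0..t} s *\<^sub>R \<bar>(norm (Zk k s \<omega>))\<^sup>2 - (norm (Z s \<omega>))\<^sup>2\<bar>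
            \<le> indicat_real {0..T} s *\<^sub>R (c * (norm (?D s \<omega>))\<^sup>2 + d * (norm (Z s \<omega>))\<^sup>2)"
        proof (rule AE_I2)
          fix s
          show "indicat_real {0..t} s *\<^sub>R \<bar>(norm (Zk k s \<omega>))\<^sup>2 - (norm (Z s \<omega>))\<^sup>2\<bar>
            \<le> indicat_real {0..T} s *\<^sub>R (c * (norm (?D s \<omega>))\<^sup>2 + d * (norm (Z s \<omega>))\<^sup>2)"
            using square_diff_le[OF d(1), folded c_def, of "Zk k s \<omega>" "Z s \<omega>"] t d(1) c by (auto simp: indicator_def)
        qed
      qed
      also have "\<dots> = c * (LBINT s:{0..T}. (norm (?D s \<omega>))\<^sup>2) + d * q"
        unfolding q_def using sqd sq unfolding sq_int_def
        by (subst set_integral_add(2)) (auto intro!: set_integrable_mult_right)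
      also have "\<dots> < c * e' + e / 2"
        using dk d c by (intro add_strict_mono mult_strict_left_mono add_pos_pos) auto
      also have "\<dots> = e" using e' by simp
      finally show "dist (qv (Zk k) t \<omega>) (qv Z t \<omega>) < e" by (simp add: dist_real_def)
    qed
  qed
qed

end

section \<open>The stochastic integral\<close>

lemma choice3: "\<forall>k. \<exists>a b c. Q k a b c \<Longrightarrow> \<exists>a b c. \<forall>k. Q k (a k) (b k) (c k)"
  by metis

context brownian
begin

text \<open>The pathwise form of the convergence that \<open>ito_integral\<close> requires in
  probability. By \<open>ito_approx\<close> it holds almost surely along a subsequence, and by
  \<open>ito_integralI\<close> it is sufficient, so later limits can be taken path by path.\<close>

definition ito_conv :: "(nat \<Rightarrow> nat) \<Rightarrow> (nat \<Rightarrow> nat \<Rightarrow> real) \<Rightarrow> (nat \<Rightarrow> nat \<Rightarrow> 'w \<Rightarrow> real^'d) \<Rightarrow>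
    (real \<Rightarrow> 'w \<Rightarrow> real^'d) \<Rightarrow> (real \<Rightarrow> 'w \<Rightarrow> real) \<Rightarrow> 'w \<Rightarrow> bool" where
  "ito_conv n \<tau> H Z I \<omega> \<longleftrightarrow> (\<lambda>k. sqdist (simple_process (n k) (\<tau> k) (H k)) Z \<omega>) \<longlonglongrightarrow> 0 \<and>
     uniform_limit {0..T} (\<lambda>k t. simple_integral W (n k) (\<tau> k) (H k) t \<omega>) (\<lambda>t. I t \<omega>) sequentially"

lemma ito_predictable: "ito_integral M T W Z I \<Longrightarrow> predictable M T W Z"
  by (simp add: ito_integral_def)

lemma ito_sq_int: "ito_integral M T W Z I \<Longrightarrow> AE \<omega> in P. sq_int Z \<omega>"
  by (simp add: ito_integral_def sq_int_def)

lemma ito_F: "ito_integral M T W Z I \<Longrightarrow> t \<in> {0..T} \<Longrightarrow> I t \<in> borel_measurable (F t)"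
  by (simp add: ito_integral_def)

lemma ito_P: "ito_integral M T W Z I \<Longrightarrow> t \<in> {0..T} \<Longrightarrow> I t \<in> borel_measurable P"
  by (rule F_P[OF ito_F]) auto

lemma ito_cont: "ito_integral M T W Z I \<Longrightarrow> \<omega> \<in> space M \<Longrightarrow> continuous_on {0..T} (\<lambda>t. I t \<omega>)"
  by (simp add: ito_integral_def)

lemma sup_dist_measurable:
  fixes X Y :: "real \<Rightarrow> 'w \<Rightarrow> real"
  assumes "\<And>t. t \<in> {0..T} \<Longrightarrow> X t \<in> borel_measurable P" "\<And>t. t \<in> {0..T} \<Longrightarrow> Y t \<in> borel_measurable P"
    and "\<And>\<omega>. \<omega> \<in> space M \<Longrightarrow> continuous_on {0..T} (\<lambda>t. X t \<omega>)" "\<And>\<omega>. \<omega> \<in> space M \<Longrightarrow> continuous_on {0..T} (\<lambda>t. Y t \<omega>)"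
  shows "(\<lambda>\<omega>. SUP t\<in>{0..T}. ennreal \<bar>X t \<omega> - Y t \<omega>\<bar>) \<in> borel_measurable P"
proof (rule SUP_abs_measurable[of T "\<lambda>t \<omega>. X t \<omega> - Y t \<omega>"])
  show "(\<lambda>\<omega>. X t \<omega> - Y t \<omega>) \<in> borel_measurable P" if "t \<in> {0..T}" for t
    using assms(1,2)[OF that] by (rule borel_measurable_diff)
  show "continuous_on {0..T} (\<lambda>t. X t \<omega> - Y t \<omega>)" if "\<omega> \<in> space P" for \<omega>
    using assms(3,4)[of \<omega>] that by (intro continuous_on_diff) auto
qed (use T_pos in simp)

lemma simple_integral_P:
  "simple_integrand M T W n \<tau> H \<Longrightarrow> t \<in> {0..T} \<Longrightarrow> simple_integral W n \<tau> H t \<in> borel_measurable P"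
  by (rule F_P[OF simple_integral_F]) auto

lemma ito_approx:
  assumes I: "ito_integral M T W Z I"
  obtains n \<tau> H where "\<And>k. simple_integrand M T W (n k) (\<tau> k) (H k)" "AE \<omega> in P. ito_conv n \<tau> H Z I \<omega>"
proof -
  obtain n \<tau> H where s: "\<And>k. simple_integrand M T W (n k) (\<tau> k) (H k)"
    and v1: "vanishes_in_prob P (\<lambda>k \<omega>. sqdist (simple_process (n k) (\<tau> k) (H k)) Z \<omega>)"
    and v2: "vanishes_in_prob P (\<lambda>k \<omega>. SUP t\<in>{0..T}. ennreal \<bar>simple_integral W (n k) (\<tau> k) (H k) t \<omega> - I t \<omega>\<bar>)"
    using I unfolding ito_integral_def sqdist_def by blast
  let ?D = "\<lambda>k \<omega>. sqdist (simple_process (n k) (\<tau> k) (H k)) Z \<omega>"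
  let ?S = "\<lambda>k \<omega>. SUP t\<in>{0..T}. ennreal \<bar>simple_integral W (n k) (\<tau> k) (H k) t \<omega> - I t \<omega>\<bar>"
  have D: "?D k \<in> borel_measurable P" for k
    using sqdist_measurable[OF simple_process_predictable[OF s] ito_predictable[OF I]] .
  have S: "?S k \<in> borel_measurable P" for k
    using simple_integral_P[OF s] ito_P[OF I] simple_integral_cont[OF s] ito_cont[OF I] by (intro sup_dist_measurable)
  obtain r where r: "strict_mono r" "AE \<omega> in P. (\<lambda>k. ?D (r k) \<omega>) \<longlonglongrightarrow> 0"
    using vanishes_in_prob_AE_subseq[OF P.prob_space_axioms D v1] by blast
  have "vanishes_in_prob P (\<lambda>k. ?S (r k))"
    using v2 LIMSEQ_subseq_LIMSEQ[OF _ r(1)] unfolding vanishes_in_prob_def comp_def by blast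
  then obtain r' where r': "strict_mono r'" "AE \<omega> in P. (\<lambda>k. ?S (r (r' k)) \<omega>) \<longlonglongrightarrow> 0"
    using vanishes_in_prob_AE_subseq[OF P.prob_space_axioms, of "\<lambda>k. ?S (r k)"] S by blast
  let ?q = "\<lambda>k. r (r' k)"
  show ?thesis
  proof (rule that[of "\<lambda>k. n (?q k)" "\<lambda>k. \<tau> (?q k)" "\<lambda>k. H (?q k)"])
    show "AE \<omega> in P. ito_conv (\<lambda>k. n (?q k)) (\<lambda>k. \<tau> (?q k)) (\<lambda>k. H (?q k)) Z I \<omega>"
      using r(2) r'(2)
    proof eventually_elim
      case (elim \<omega>)
      show ?case unfolding ito_conv_def
        using LIMSEQ_subseq_LIMSEQ[OF elim(1) r'(1)] elim(2) SUP_tendsto_uniform_limit by (auto simp: comp_def)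
    qed
  qed (rule s)
qed

text \<open>Adaptedness of \<open>I\<close> follows from the approximation: an almost sure limit of
  adapted elementary integrals is adapted because the filtration contains all null sets.\<close>

lemma ito_integralI:
  assumes Z: "predictable M T W Z" and sq: "AE \<omega> in P. sq_int Z \<omega>"
    and c: "\<And>\<omega>. \<omega> \<in> space M \<Longrightarrow> continuous_on {0..T} (\<lambda>t. I t \<omega>)"
    and s: "\<And>k. simple_integrand M T W (n k) (\<tau> k) (H k)" and conv: "AE \<omega> in P. ito_conv n \<tau> H Z I \<omega>"
  shows "ito_integral M T W Z I"
proof -
  have IF: "I t \<in> borel_measurable (F t)" if "t \<in> {0..T}" for t
  proof (rule F_AE_LIMSEQ)
    show "simple_integral W (n k) (\<tau> k) (H k) t \<in> borel_measurable (F t)" for k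
      using simple_integral_F[OF s] that by auto
    show "AE \<omega> in P. (\<lambda>k. simple_integral W (n k) (\<tau> k) (H k) t \<omega>) \<longlonglongrightarrow> I t \<omega>"
      using conv by eventually_elim (auto simp: ito_conv_def intro: tendsto_uniform_limitI[OF _ that])
  qed
  let ?D = "\<lambda>k \<omega>. sqdist (simple_process (n k) (\<tau> k) (H k)) Z \<omega>"
  let ?S = "\<lambda>k \<omega>. SUP t\<in>{0..T}. ennreal \<bar>simple_integral W (n k) (\<tau> k) (H k) t \<omega> - I t \<omega>\<bar>"
  have "vanishes_in_prob P ?D"
  proof (rule AE_vanishes_in_prob[OF P.prob_space_axioms])
    show "?D k \<in> borel_measurable P" for k
      using sqdist_measurable[OF simple_process_predictable[OF s] Z] .
    show "AE \<omega> in P. (\<lambda>k. ?D k \<omega>) \<longlonglongrightarrow> 0" using conv by eventually_elim (simp add: ito_conv_def)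
  qed
  moreover have "vanishes_in_prob P ?S"
  proof (rule AE_vanishes_in_prob[OF P.prob_space_axioms])
    show "?S k \<in> borel_measurable P" for k
      using simple_integral_P[OF s] F_P[OF IF] simple_integral_cont[OF s] c by (intro sup_dist_measurable) auto
    show "AE \<omega> in P. (\<lambda>k. ?S k \<omega>) \<longlonglongrightarrow> 0"
      using conv by eventually_elim (simp add: ito_conv_def SUP_tendsto_uniform_limit)
  qed
  ultimately have "\<exists>n \<tau> H. (\<forall>k. simple_integrand M T W (n k) (\<tau> k) (H k)) \<and>
        vanishes_in_prob P (\<lambda>k \<omega>. sqdist (simple_process (n k) (\<tau> k) (H k)) Z \<omega>) \<and>
        vanishes_in_prob P (\<lambda>k \<omega>. SUP t\<in>{0..T}. ennreal \<bar>simple_integral W (n k) (\<tau> k) (H k) t \<omega> - I t \<omega>\<bar>)"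
    using s by blast
  then show ?thesis
    using Z sq IF c unfolding ito_integral_def sq_int_def sqdist_def by blast
qed

text \<open>A diagonal argument: for each \<open>k\<close> a simple integrand is chosen whose
  process and integral miss \<open>Zk k\<close> and \<open>Ik k\<close> by more than
  \<open>(1/2)^k\<close> only with probability below \<open>(1/2)^k\<close>. By the Borel-Cantelli
  lemma these errors vanish almost surely, so the diagonal sequence follows \<open>Zk\<close> and
  \<open>Ik\<close> to their limits.\<close>

lemma ito_integral_closed:
  assumes Ik: "\<And>k. ito_integral M T W (Zk k) (Ik k)"
    and Z: "predictable M T W Z" and sq: "AE \<omega> in P. sq_int Z \<omega>"
    and c: "\<And>\<omega>. \<omega> \<in> space M \<Longrightarrow> continuous_on {0..T} (\<lambda>t. I t \<omega>)"
    and lim1: "AE \<omega> in P. (\<lambda>k. sqdist (Zk k) Z \<omega>) \<longlonglongrightarrow> 0"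
    and lim2: "AE \<omega> in P. uniform_limit {0..T} (\<lambda>k t. Ik k t \<omega>) (\<lambda>t. I t \<omega>) sequentially"
  shows "ito_integral M T W Z I"
proof -
  have IF: "I t \<in> borel_measurable (F t)" if "t \<in> {0..T}" for t
  proof (rule F_AE_LIMSEQ)
    show "Ik k t \<in> borel_measurable (F t)" for k using ito_F[OF Ik that] .
    show "AE \<omega> in P. (\<lambda>k. Ik k t \<omega>) \<longlonglongrightarrow> I t \<omega>"
      using lim2 by eventually_elim (rule tendsto_uniform_limitI[OF _ that])
  qed
  let ?D = "\<lambda>k n \<tau> H \<omega>. sqdist (simple_process n \<tau> H) (Zk k) \<omega>"
    and ?S = "\<lambda>k n \<tau> H \<omega>. SUP t\<in>{0..T}. ennreal \<bar>simple_integral W n \<tau> H t \<omega> - Ik k t \<omega>\<bar>"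
    and ?m = "\<lambda>k X. measure P {\<omega>\<in>space P. ennreal ((1/2)^k) < X \<omega>}"
  let ?Q = "\<lambda>k n \<tau> H. simple_integrand M T W n \<tau> H \<and> ?m k (?D k n \<tau> H) < (1/2)^k \<and> ?m k (?S k n \<tau> H) < (1/2)^k"
  have "\<exists>n \<tau> H. ?Q k n \<tau> H" for k
  proof -
    obtain n \<tau> H where s: "\<And>j. simple_integrand M T W (n j) (\<tau> j) (H j)"
      and v: "vanishes_in_prob P (\<lambda>j. ?D k (n j) (\<tau> j) (H j))" "vanishes_in_prob P (\<lambda>j. ?S k (n j) (\<tau> j) (H j))"
      using Ik[of k] unfolding ito_integral_def sqdist_def by blast
    have l: "\<forall>\<^sub>F j in sequentially. ?m k (X j) < (1/2)^k" if "vanishes_in_prob P X" for X :: "nat \<Rightarrow> 'w \<Rightarrow> ennreal"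
    proof (rule order_tendstoD(2))
      show "(\<lambda>j. ?m k (X j)) \<longlonglongrightarrow> 0" using that unfolding vanishes_in_prob_def by simp
    qed simp
    from eventually_happens'[OF trivial_limit_sequentially eventually_conj[OF l[OF v(1)] l[OF v(2)]]]
    show ?thesis using s by blast
  qed
  then have "\<forall>k. \<exists>n \<tau> H. ?Q k n \<tau> H" by blast
  from choice3[OF this] obtain n \<tau> H where H: "\<forall>k. ?Q k (n k) (\<tau> k) (H k)" by blast
  let ?D = "\<lambda>k \<omega>. sqdist (simple_process (n k) (\<tau> k) (H k)) (Zk k) \<omega>"
  let ?S = "\<lambda>k \<omega>. SUP t\<in>{0..T}. ennreal \<bar>simple_integral W (n k) (\<tau> k) (H k) t \<omega> - Ik k t \<omega>\<bar>"
  have s: "simple_integrand M T W (n k) (\<tau> k) (H k)" for k using H by blast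
  have D: "?D k \<in> borel_measurable P" for k
    using sqdist_measurable[OF simple_process_predictable[OF s] ito_predictable[OF Ik]] .
  have S: "?S k \<in> borel_measurable P" for k
    using simple_integral_P[OF s] ito_P[OF Ik] simple_integral_cont[OF s] ito_cont[OF Ik] by (intro sup_dist_measurable)
  have bc: "AE \<omega> in P. (\<lambda>k. X k \<omega>) \<longlonglongrightarrow> 0"
    if X: "\<And>k. X k \<in> borel_measurable P" and m: "\<And>k. measure P {\<omega>\<in>space P. ennreal ((1/2)^k) < X k \<omega>} < (1/2)^k"
    for X :: "nat \<Rightarrow> 'w \<Rightarrow> ennreal"
  proof -
    have "AE \<omega> in P. eventually (\<lambda>n. \<omega> \<in> space P - {\<omega>\<in>space P. ennreal ((1/2)^n) < X n \<omega>}) sequentially"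
    proof (rule borel_cantelli_AE1)
      show "{\<omega>\<in>space P. ennreal ((1/2)^n) < X n \<omega>} \<in> sets P" for n using X by measurable
      show "emeasure P {\<omega>\<in>space P. ennreal ((1/2)^n) < X n \<omega>} < \<infinity>" for n by (simp add: less_top[symmetric])
      show "summable (\<lambda>n. measure P {\<omega>\<in>space P. ennreal ((1/2)^n) < X n \<omega>})"
      proof (rule summable_comparison_test'[of "\<lambda>n. (1/2::real)^n" 0])
        show "norm (measure P {\<omega>\<in>space P. ennreal ((1/2)^n) < X n \<omega>}) \<le> (1/2)^n" for n using m[of n] by simp
      qed (simp add: summable_geometric)
    qed
    then show ?thesis
    proof eventually_elim
      fix \<omega> assume ev: "eventually (\<lambda>n. \<omega> \<in> space P - {\<omega>\<in>space P. ennreal ((1/2)^n) < X n \<omega>}) sequentially"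
      have "(\<lambda>n. (1/2::real)^n) \<longlonglongrightarrow> 0" by (rule LIMSEQ_power_zero) simp
      then have e0: "(\<lambda>n. ennreal ((1/2)^n)) \<longlonglongrightarrow> 0" using tendsto_ennrealI by fastforce
      have "eventually (\<lambda>n. X n \<omega> \<le> ennreal ((1/2)^n)) sequentially"
        using ev by eventually_elim (auto simp: not_less)
      then show "(\<lambda>k. X k \<omega>) \<longlonglongrightarrow> 0"
        by (intro tendsto_sandwich[OF _ _ tendsto_const e0]) auto
    qed
  qed
  have 1: "AE \<omega> in P. (\<lambda>k. ?D k \<omega>) \<longlonglongrightarrow> 0" using H by (intro bc D) blast
  have 2: "AE \<omega> in P. (\<lambda>k. ?S k \<omega>) \<longlonglongrightarrow> 0" using H by (intro bc S) blast
  have "AE \<omega> in P. ito_conv n \<tau> H Z I \<omega>"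
    using 1 2 lim1 lim2 AE_space
  proof eventually_elim
    case (elim \<omega>)
    have "(\<lambda>k. 2 * ?D k \<omega> + 2 * sqdist (Zk k) Z \<omega>) \<longlonglongrightarrow> 2 * 0 + 2 * 0"
      using elim(1,3) by (intro tendsto_add ennreal_tendsto_cmult) auto
    then have l: "(\<lambda>k. 2 * ?D k \<omega> + 2 * sqdist (Zk k) Z \<omega>) \<longlonglongrightarrow> 0" by simp
    have le: "\<forall>k. sqdist (simple_process (n k) (\<tau> k) (H k)) Z \<omega> \<le> 2 * ?D k \<omega> + 2 * sqdist (Zk k) Z \<omega>"
      using sqdist_triangle[OF simple_process_predictable[OF s] ito_predictable[OF Ik] Z] elim(5) by simp
    have "(\<lambda>k. sqdist (simple_process (n k) (\<tau> k) (H k)) Z \<omega>) \<longlonglongrightarrow> 0"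
      by (rule tendsto_sandwich[OF always_eventually always_eventually[OF le] tendsto_const l]) simp
    moreover have "uniform_limit {0..T} (\<lambda>k t. simple_integral W (n k) (\<tau> k) (H k) t \<omega>) (\<lambda>t. I t \<omega>) sequentially"
      unfolding uniform_limit_iff
    proof (intro allI impI)
      fix e :: real assume e: "0 < e"
      have "\<forall>\<^sub>F k in sequentially. ?S k \<omega> < ennreal (e/2)" using order_tendstoD(2)[OF elim(2), of "ennreal (e/2)"] e by simp
      moreover have "\<forall>\<^sub>F k in sequentially. \<forall>x\<in>{0..T}. dist (Ik k x \<omega>) (I x \<omega>) < e/2"
        using elim(4) e unfolding uniform_limit_iff by (meson half_gt_zero)
      ultimately show "\<forall>\<^sub>F k in sequentially. \<forall>x\<in>{0..T}. dist (simple_integral W (n k) (\<tau> k) (H k) x \<omega>) (I x \<omega>) < e"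
      proof eventually_elim
        case (elim k)
        show ?case
        proof
          fix x assume x: "x \<in> {0..T}"
          have "ennreal \<bar>simple_integral W (n k) (\<tau> k) (H k) x \<omega> - Ik k x \<omega>\<bar> < ennreal (e/2)"
            by (rule le_less_trans[OF SUP_upper[of x "{0..T}" "\<lambda>t. ennreal \<bar>simple_integral W (n k) (\<tau> k) (H k) t \<omega> - Ik k t \<omega>\<bar>"] elim(1)]) (rule x)
          then have "\<bar>simple_integral W (n k) (\<tau> k) (H k) x \<omega> - Ik k x \<omega>\<bar> < e/2" by (simp add: ennreal_less_iff)
          then show "dist (simple_integral W (n k) (\<tau> k) (H k) x \<omega>) (I x \<omega>) < e"
            using elim(2)[rule_format, OF x] unfolding dist_real_def by linarith
        qed
      qed
    qed
    ultimately show ?case unfolding ito_conv_def by simp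
  qed
  from ito_integralI[OF Z sq _ s this] show ?thesis using c by blast
qed

lemma ito_diff:
  assumes 1: "ito_integral M T W Z I" and 2: "ito_integral M T W Z' I'"
  shows "ito_integral M T W (\<lambda>s \<omega>. Z s \<omega> - Z' s \<omega>) (\<lambda>s \<omega>. I s \<omega> - I' s \<omega>)"
proof -
  obtain n \<tau> H where s: "\<And>k. simple_integrand M T W (n k) (\<tau> k) (H k)" and c: "AE \<omega> in P. ito_conv n \<tau> H Z I \<omega>"
    using ito_approx[OF 1] by blast
  obtain n' \<tau>' H' where s': "\<And>k. simple_integrand M T W (n' k) (\<tau>' k) (H' k)" and c': "AE \<omega> in P. ito_conv n' \<tau>' H' Z' I' \<omega>"
    using ito_approx[OF 2] by blast
  let ?Q = "\<lambda>k m \<sigma> G. simple_integrand M T W m \<sigma> G \<and>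
    (\<forall>s \<omega>. simple_process m \<sigma> G s \<omega> = simple_process (n k) (\<tau> k) (H k) s \<omega> - simple_process (n' k) (\<tau>' k) (H' k) s \<omega>) \<and>
    (\<forall>s \<omega>. simple_integral W m \<sigma> G s \<omega> = simple_integral W (n k) (\<tau> k) (H k) s \<omega> - simple_integral W (n' k) (\<tau>' k) (H' k) s \<omega>)"
  have "\<forall>k. \<exists>m \<sigma> G. ?Q k m \<sigma> G" using simple_diff[OF s s'] by metis
  from choice3[OF this] obtain m \<sigma> G where G: "\<forall>k. ?Q k (m k) (\<sigma> k) (G k)" by blast
  note Z = ito_predictable[OF 1] and Z' = ito_predictable[OF 2]
  show ?thesis
  proof (rule ito_integralI[where n = m and \<tau> = \<sigma> and H = G])
    show "predictable M T W (\<lambda>s \<omega>. Z s \<omega> - Z' s \<omega>)" using predictable_diff[OF Z Z'] .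
    show "AE \<omega> in P. sq_int (\<lambda>s \<omega>. Z s \<omega> - Z' s \<omega>) \<omega>"
      using ito_sq_int[OF 1] ito_sq_int[OF 2] AE_space by eventually_elim (simp add: sq_int_diff[OF Z Z'])
    show "continuous_on {0..T} (\<lambda>t. I t \<omega> - I' t \<omega>)" if "\<omega> \<in> space M" for \<omega>
      using ito_cont[OF 1 that] ito_cont[OF 2 that] by (rule continuous_on_diff)
    show "simple_integrand M T W (m k) (\<sigma> k) (G k)" for k using G by blast
    show "AE \<omega> in P. ito_conv m \<sigma> G (\<lambda>s \<omega>. Z s \<omega> - Z' s \<omega>) (\<lambda>s \<omega>. I s \<omega> - I' s \<omega>) \<omega>"
      using c c' AE_space
    proof eventually_elim
      case (elim \<omega>)
      let ?X = "\<lambda>k. simple_process (n k) (\<tau> k) (H k)" and ?X' = "\<lambda>k. simple_process (n' k) (\<tau>' k) (H' k)"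
      have le: "sqdist (simple_process (m k) (\<sigma> k) (G k)) (\<lambda>s \<omega>. Z s \<omega> - Z' s \<omega>) \<omega>
          \<le> 2 * sqdist (?X k) Z \<omega> + 2 * sqdist (?X' k) Z' \<omega>" for k
      proof -
        have p: "predictable M T W (\<lambda>s \<omega>. ?X k s \<omega> - Z s \<omega>)" "predictable M T W (\<lambda>s \<omega>. ?X' k s \<omega> - Z' s \<omega>)"
          using predictable_diff[OF simple_process_predictable[OF s] Z] predictable_diff[OF simple_process_predictable[OF s'] Z'] by auto
        have "sqdist (simple_process (m k) (\<sigma> k) (G k)) (\<lambda>s \<omega>. Z s \<omega> - Z' s \<omega>) \<omega>
          = sqdist (\<lambda>s \<omega>. ?X k s \<omega> - Z s \<omega>) (\<lambda>s \<omega>. ?X' k s \<omega> - Z' s \<omega>) \<omega>"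
          unfolding sqdist_def
        proof (intro nn_integral_cong)
          fix t
          have "simple_process (m k) (\<sigma> k) (G k) t \<omega> - (Z t \<omega> - Z' t \<omega>) = (?X k t \<omega> - Z t \<omega>) - (?X' k t \<omega> - Z' t \<omega>)"
            using G by simp
          then show "ennreal ((norm (simple_process (m k) (\<sigma> k) (G k) t \<omega> - (Z t \<omega> - Z' t \<omega>)))\<^sup>2) * indicator {0..T} t
            = ennreal ((norm ((?X k t \<omega> - Z t \<omega>) - (?X' k t \<omega> - Z' t \<omega>)))\<^sup>2) * indicator {0..T} t"
            by (simp only:)
        qed
        also have "\<dots> \<le> 2 * sqdist (\<lambda>s \<omega>. ?X k s \<omega> - Z s \<omega>) (\<lambda>_ _. 0) \<omega> + 2 * sqdist (\<lambda>_ _. 0) (\<lambda>s \<omega>. ?X' k s \<omega> - Z' s \<omega>) \<omega>"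
          using elim(3) by (intro sqdist_triangle p predictable_0) simp
        also have "\<dots> = 2 * sqdist (?X k) Z \<omega> + 2 * sqdist (?X' k) Z' \<omega>"
          unfolding sqdist_def by (simp add: norm_minus_commute)
        finally show ?thesis .
      qed
      have "(\<lambda>k. 2 * sqdist (?X k) Z \<omega> + 2 * sqdist (?X' k) Z' \<omega>) \<longlonglongrightarrow> 2 * 0 + 2 * 0"
        using elim(1,2) unfolding ito_conv_def by (intro tendsto_add ennreal_tendsto_cmult) auto
      then have l: "(\<lambda>k. 2 * sqdist (?X k) Z \<omega> + 2 * sqdist (?X' k) Z' \<omega>) \<longlonglongrightarrow> 0" by simp
      have "(\<lambda>k. sqdist (simple_process (m k) (\<sigma> k) (G k)) (\<lambda>s \<omega>. Z s \<omega> - Z' s \<omega>) \<omega>) \<longlonglongrightarrow> 0"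
        by (rule tendsto_sandwich[OF always_eventually always_eventually tendsto_const l]) (use le in auto)
      moreover have "uniform_limit {0..T} (\<lambda>k t. simple_integral W (m k) (\<sigma> k) (G k) t \<omega>) (\<lambda>t. I t \<omega> - I' t \<omega>) sequentially"
        using G elim(1,2) unfolding ito_conv_def by (simp add: uniform_limit_minus)
      ultimately show ?case unfolding ito_conv_def by simp
    qed
  qed
qed

text \<open>Because \<open>\<sigma>\<close> has finitely many values \<open>r\<close>, the set of
  times after \<open>\<sigma>\<close> is a finite union of predictable rectangles, the product of
  \<open>{r<..T}\<close> with the event that \<open>\<sigma>\<close> is at most
  \<open>r\<close>.\<close>

lemma stop_predictable:
  fixes Z :: "real \<Rightarrow> 'w \<Rightarrow> real^'d"
  assumes Z: "predictable M T W Z" and R: "finite R" "R \<subseteq> {0..T}"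
    and \<sigma>: "\<And>\<omega>. \<omega> \<in> space M \<Longrightarrow> \<sigma> \<omega> \<in> R" "\<And>t. t \<in> {0..T} \<Longrightarrow> {\<omega>\<in>space M. \<sigma> \<omega> \<le> t} \<in> sets (F t)"
  shows "predictable M T W (\<lambda>s \<omega>. if s \<le> \<sigma> \<omega> then Z s \<omega> else 0)"
proof -
  let ?\<P> = "predictable_sigma T (space M) F"
  have "{r<..T} \<times> {\<omega>\<in>space M. \<sigma> \<omega> \<le> r} \<in> sets ?\<P>" if "r \<in> R" for r
  proof (cases "r < T")
    case True
    then show ?thesis using that R \<sigma>(2)[of r] by (intro predictable_rect) auto
  qed simp
  then have "(\<Union>r\<in>R. {r<..T} \<times> {\<omega>\<in>space M. \<sigma> \<omega> \<le> r}) \<in> sets ?\<P>" using R(1) by (intro sets.finite_UN) auto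
  moreover have "(\<Union>r\<in>R. {r<..T} \<times> {\<omega>\<in>space M. \<sigma> \<omega> \<le> r}) = {v\<in>space ?\<P>. \<sigma> (snd v) < fst v}"
  proof (intro set_eqI iffI)
    fix v assume "v \<in> (\<Union>r\<in>R. {r<..T} \<times> {\<omega>\<in>space M. \<sigma> \<omega> \<le> r})"
    then show "v \<in> {v\<in>space ?\<P>. \<sigma> (snd v) < fst v}"
      using R(2) unfolding space_predictable by (auto simp: subset_iff intro: less_imp_le le_less_trans)
  next
    fix v assume v: "v \<in> {v\<in>space ?\<P>. \<sigma> (snd v) < fst v}"
    then have "\<sigma> (snd v) \<in> R" "v \<in> {\<sigma> (snd v)<..T} \<times> {\<omega>\<in>space M. \<sigma> \<omega> \<le> \<sigma> (snd v)}"
      using \<sigma>(1)[of "snd v"] unfolding space_predictable by (auto simp: mem_Times_iff)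
    then show "v \<in> (\<Union>r\<in>R. {r<..T} \<times> {\<omega>\<in>space M. \<sigma> \<omega> \<le> r})" by blast
  qed
  ultimately have "{v\<in>space ?\<P>. \<sigma> (snd v) < fst v} \<in> sets ?\<P>" by simp
  from sets.compl_sets[OF this] have "{v\<in>space ?\<P>. fst v \<le> \<sigma> (snd v)} \<in> sets ?\<P>"
    by (rule back_subst[of "\<lambda>A. A \<in> sets ?\<P>"]) auto
  then show ?thesis using Z unfolding split_def by (intro measurable_If) auto
qed

text \<open>Stopping shrinks the distance between integrands, and uniform convergence of the
  integrals on \<open>{0..T}\<close> covers their values at the random time
  \<open>min s (\<sigma> \<omega>)\<close>. So the stopped approximations of \<open>Z\<close>
  approximate the stopped \<open>Z\<close>.\<close>

lemma ito_stop:
  assumes I: "ito_integral M T W Z I" and R: "finite R" "R \<subseteq> {0..T}"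
    and \<sigma>: "\<And>\<omega>. \<omega> \<in> space M \<Longrightarrow> \<sigma> \<omega> \<in> R" "\<And>t. t \<in> {0..T} \<Longrightarrow> {\<omega>\<in>space M. \<sigma> \<omega> \<le> t} \<in> sets (F t)"
  shows "ito_integral M T W (\<lambda>s \<omega>. if s \<le> \<sigma> \<omega> then Z s \<omega> else 0) (\<lambda>s \<omega>. I (min s (\<sigma> \<omega>)) \<omega>)"
proof -
  note Z = ito_predictable[OF I]
  obtain n \<tau> H where s: "\<And>k. simple_integrand M T W (n k) (\<tau> k) (H k)" and c: "AE \<omega> in P. ito_conv n \<tau> H Z I \<omega>"
    using ito_approx[OF I] by blast
  let ?Q = "\<lambda>k m \<rho> G. simple_integrand M T W m \<rho> G \<and>
    (\<forall>s. \<forall>\<omega>\<in>space M. simple_process m \<rho> G s \<omega> = (if s \<le> \<sigma> \<omega> then simple_process (n k) (\<tau> k) (H k) s \<omega> else 0)) \<and>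
    (\<forall>s. \<forall>\<omega>\<in>space M. simple_integral W m \<rho> G s \<omega> = simple_integral W (n k) (\<tau> k) (H k) (min s (\<sigma> \<omega>)) \<omega>)"
  have "\<exists>m \<rho> G. ?Q k m \<rho> G" for k
    by (rule simple_stop[where \<sigma> = \<sigma>, OF s[of k] R]) (use \<sigma> in blast)+
  then have "\<forall>k. \<exists>m \<rho> G. ?Q k m \<rho> G" by blast
  from choice3[OF this] obtain m \<rho> G where G: "\<forall>k. ?Q k (m k) (\<rho> k) (G k)" by blast
  let ?Z = "\<lambda>s \<omega>. if s \<le> \<sigma> \<omega> then Z s \<omega> else 0"
  have p: "predictable M T W ?Z" by (rule stop_predictable[OF Z R \<sigma>])
  show ?thesis
  proof (rule ito_integralI[where n = m and \<tau> = \<rho> and H = G, OF p])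
    show "AE \<omega> in P. sq_int ?Z \<omega>"
      using ito_sq_int[OF I] AE_space
    proof eventually_elim
      case (elim \<omega>)
      have "sqdist ?Z (\<lambda>_ _. 0) \<omega> \<le> sqdist Z (\<lambda>_ _. 0) \<omega>"
        unfolding sqdist_def by (intro nn_integral_mono) (auto simp: indicator_def)
      then show ?case using sq_int_iff[OF p, of \<omega>] sq_int_iff[OF Z, of \<omega>] elim by auto
    qed
    show "continuous_on {0..T} (\<lambda>t. I (min t (\<sigma> \<omega>)) \<omega>)" if "\<omega> \<in> space M" for \<omega>
      using subsetD[OF R(2) \<sigma>(1)[OF that]]
      by (intro continuous_on_compose2[OF ito_cont[OF I that]] continuous_intros) auto
    show "simple_integrand M T W (m k) (\<rho> k) (G k)" for k using G by blast
    show "AE \<omega> in P. ito_conv m \<rho> G ?Z (\<lambda>s \<omega>. I (min s (\<sigma> \<omega>)) \<omega>) \<omega>"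
      using c AE_space
    proof eventually_elim
      case (elim \<omega>)
      have \<omega>: "\<omega> \<in> space M" using elim(2) by simp
      let ?X = "\<lambda>k. simple_process (n k) (\<tau> k) (H k)"
      have le: "sqdist (simple_process (m k) (\<rho> k) (G k)) ?Z \<omega> \<le> sqdist (?X k) Z \<omega>" for k
        unfolding sqdist_def using G \<omega> by (intro nn_integral_mono) (auto simp: indicator_def)
      have l: "(\<lambda>k. sqdist (?X k) Z \<omega>) \<longlonglongrightarrow> 0" using elim(1) by (simp add: ito_conv_def)
      have "(\<lambda>k. sqdist (simple_process (m k) (\<rho> k) (G k)) ?Z \<omega>) \<longlonglongrightarrow> 0"
        by (rule tendsto_sandwich[OF always_eventually always_eventually tendsto_const l]) (use le in auto)
      moreover have "uniform_limit {0..T} (\<lambda>k t. simple_integral W (m k) (\<rho> k) (G k) t \<omega>) (\<lambda>t. I (min t (\<sigma> \<omega>)) \<omega>) sequentially"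
        unfolding uniform_limit_iff
      proof (intro allI impI)
        fix e :: real assume "0 < e"
        then have "\<forall>\<^sub>F k in sequentially. \<forall>x\<in>{0..T}. dist (simple_integral W (n k) (\<tau> k) (H k) x \<omega>) (I x \<omega>) < e"
          using elim(1) unfolding ito_conv_def uniform_limit_iff by blast
        then show "\<forall>\<^sub>F k in sequentially. \<forall>x\<in>{0..T}. dist (simple_integral W (m k) (\<rho> k) (G k) x \<omega>) (I (min x (\<sigma> \<omega>)) \<omega>) < e"
        proof eventually_elim
          case (elim k)
          show ?case
          proof
            fix x assume "x \<in> {0..T}"
            then have "min x (\<sigma> \<omega>) \<in> {0..T}" using \<sigma>(1)[OF \<omega>] R(2) by auto
            then show "dist (simple_integral W (m k) (\<rho> k) (G k) x \<omega>) (I (min x (\<sigma> \<omega>)) \<omega>) < e"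
              using elim G \<omega> by simp
          qed
        qed
      qed
      ultimately show ?case unfolding ito_conv_def by simp
    qed
  qed
qed

section \<open>Exponential martingales\<close>

text \<open>The exponent of the exponential martingale between \<open>t\<close> and \<open>u\<close>
  for an elementary integral truncated at level \<open>R\<close>. It approximates
  \<open>lexp\<close>, and the second moment of its exponential is bounded in terms of
  \<open>l\<close> and \<open>R\<close> alone.\<close>

definition trexp :: "real \<Rightarrow> real \<Rightarrow> nat \<Rightarrow> (nat \<Rightarrow> real) \<Rightarrow> (nat \<Rightarrow> 'w \<Rightarrow> real^'d) \<Rightarrow> real \<Rightarrow> real \<Rightarrow> 'w \<Rightarrow> real" where
  "trexp l R n \<tau> H t u \<omega> =
     l * (simple_integral W n \<tau> (trunc_integrand \<tau> H R) u \<omega> - simple_integral W n \<tau> (trunc_integrand \<tau> H R) t \<omega>)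
     - l\<^sup>2 / 2 * (simple_qv n \<tau> (trunc_integrand \<tau> H R) u \<omega> - simple_qv n \<tau> (trunc_integrand \<tau> H R) t \<omega>)"

text \<open>By \<open>trunc_stopped\<close> the truncated integral is the elementary one at the time
  \<open>min u \<rho>\<close>. As convergence is uniform in time, the elementary integral may be
  replaced there by \<open>I\<close>, whatever \<open>\<rho>\<close> is. The time
  \<open>\<rho>\<close> depends on \<open>k\<close> and need not converge, which is why it is only
  asserted to exist; on paths with quadratic variation below \<open>R\<close> it is eventually
  \<open>T\<close>.\<close>

lemma trunc_close:
  assumes s: "\<And>k. simple_integrand M T W (n k) (\<tau> k) (H k)" and Z: "predictable M T W Z"
    and conv: "ito_conv n \<tau> H Z I \<omega>" and sq: "sq_int Z \<omega>" and \<omega>: "\<omega> \<in> space M"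
    and R: "0 \<le> R" and t: "0 \<le> t" "t \<le> u" "u \<le> T" and e: "0 < e"
  shows "\<forall>\<^sub>F k in sequentially. \<exists>\<rho>\<in>{0..T}. (qv Z T \<omega> < R \<longrightarrow> \<rho> = T) \<and>
     \<bar>trexp l R (n k) (\<tau> k) (H k) t u \<omega>
      - (l * (I (min u \<rho>) \<omega> - I (min t \<rho>) \<omega>) - l\<^sup>2 / 2 * (qv Z (min u \<rho>) \<omega> - qv Z (min t \<rho>) \<omega>))\<bar> \<le> e"
proof -
  \<comment> \<open>An increment involves two times, so its error is at most \<open>2 * d\<close>,
    and the error of the exponent is at most \<open>(2 * \<bar>l\<bar> + l\<^sup>2) * d\<close>. The
    summand 1 keeps the denominator positive for \<open>l = 0\<close>.\<close>
  define d where "d = e / (2 * \<bar>l\<bar> + l\<^sup>2 + 1)"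
  have c0: "0 < 2 * \<bar>l\<bar> + l\<^sup>2 + 1" by (intro add_nonneg_pos) auto
  then have d: "0 < d" "(2 * \<bar>l\<bar> + l\<^sup>2) * d \<le> e"
    using e by (simp_all add: d_def pos_divide_le_eq algebra_simps)
  have u1: "\<forall>\<^sub>F k in sequentially. \<forall>x\<in>{0..T}. dist (simple_integral W (n k) (\<tau> k) (H k) x \<omega>) (I x \<omega>) < d"
    using conv d unfolding ito_conv_def uniform_limit_iff by blast
  have ul: "uniform_limit {0..T} (\<lambda>k t. qv (simple_process (n k) (\<tau> k) (H k)) t \<omega>) (\<lambda>t. qv Z t \<omega>) sequentially"
    using conv by (intro qv_uniform_limit simple_process_predictable s Z \<omega> sq) (simp add: ito_conv_def)
  then have u2: "\<forall>\<^sub>F k in sequentially. \<forall>x\<in>{0..T}. dist (qv (simple_process (n k) (\<tau> k) (H k)) x \<omega>) (qv Z x \<omega>) < d"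
    using d unfolding uniform_limit_iff by blast
  have "(\<lambda>k. qv (simple_process (n k) (\<tau> k) (H k)) T \<omega>) \<longlonglongrightarrow> qv Z T \<omega>"
    using tendsto_uniform_limitI[OF ul, of T] T_pos by simp
  then have u3: "\<forall>\<^sub>F k in sequentially. qv Z T \<omega> < R \<longrightarrow> qv (simple_process (n k) (\<tau> k) (H k)) T \<omega> < R"
    using order_tendstoD(2)[of _ "qv Z T \<omega>" sequentially R] by (cases "qv Z T \<omega> < R") auto
  show ?thesis
    using u1 u2 u3
  proof eventually_elim
    case (elim k)
    obtain \<rho> where \<rho>: "0 \<le> \<rho>" "\<rho> \<le> T"
      "\<And>t. simple_integral W (n k) (\<tau> k) (trunc_integrand (\<tau> k) (H k) R) t \<omega> = simple_integral W (n k) (\<tau> k) (H k) (min t \<rho>) \<omega>"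
      "\<And>t. simple_qv (n k) (\<tau> k) (trunc_integrand (\<tau> k) (H k) R) t \<omega> = simple_qv (n k) (\<tau> k) (H k) (min t \<rho>) \<omega>"
      "simple_qv (n k) (\<tau> k) (H k) T \<omega> \<le> R \<Longrightarrow> \<rho> = T"
      using trunc_stopped[OF s[of k] R, of \<omega>] by metis
    have q: "\<bar>simple_integral W (n k) (\<tau> k) (H k) x \<omega> - I x \<omega>\<bar> \<le> d"
      "\<bar>simple_qv (n k) (\<tau> k) (H k) x \<omega> - qv Z x \<omega>\<bar> \<le> d" if "x \<in> {0..T}" for x
      using elim(1,2) that simple_qv_eq[OF s, of x] by (auto simp: dist_real_def less_imp_le)
    have tri: "\<bar>a - b - (a' - b')\<bar> \<le> 2 * d" if "\<bar>a - a'\<bar> \<le> d" "\<bar>b - b'\<bar> \<le> d" for a b a' b' :: real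
      using that by linarith
    have x: "min u \<rho> \<in> {0..T}" "min t \<rho> \<in> {0..T}" using t \<rho> by auto
    show ?case
    proof (intro bexI conjI)
      show "qv Z T \<omega> < R \<longrightarrow> \<rho> = T"
        using elim(3) \<rho>(5) simple_qv_eq[OF s, of T k] T_pos by auto
      let ?a = "simple_integral W (n k) (\<tau> k) (H k) (min u \<rho>) \<omega> - simple_integral W (n k) (\<tau> k) (H k) (min t \<rho>) \<omega> - (I (min u \<rho>) \<omega> - I (min t \<rho>) \<omega>)"
      let ?b = "simple_qv (n k) (\<tau> k) (H k) (min u \<rho>) \<omega> - simple_qv (n k) (\<tau> k) (H k) (min t \<rho>) \<omega> - (qv Z (min u \<rho>) \<omega> - qv Z (min t \<rho>) \<omega>)"
      have ab: "\<bar>?a\<bar> \<le> 2 * d" "\<bar>?b\<bar> \<le> 2 * d" using tri[OF q(1)[OF x(1)] q(1)[OF x(2)]] tri[OF q(2)[OF x(1)] q(2)[OF x(2)]] by auto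
      have "\<bar>l * ?a - l\<^sup>2 / 2 * ?b\<bar> \<le> \<bar>l\<bar> * \<bar>?a\<bar> + l\<^sup>2 / 2 * \<bar>?b\<bar>"
        using abs_triangle_ineq4[of "l * ?a" "l\<^sup>2 / 2 * ?b"] by (simp add: abs_mult)
      also have "\<dots> \<le> \<bar>l\<bar> * (2 * d) + l\<^sup>2 / 2 * (2 * d)" using ab by (intro add_mono mult_left_mono) auto
      also have "\<dots> = (2 * \<bar>l\<bar> + l\<^sup>2) * d" by (simp add: algebra_simps)
      finally have "\<bar>l * ?a - l\<^sup>2 / 2 * ?b\<bar> \<le> e" using d(2) by simp
      then show "\<bar>trexp l R (n k) (\<tau> k) (H k) t u \<omega>
      - (l * (I (min u \<rho>) \<omega> - I (min t \<rho>) \<omega>) - l\<^sup>2 / 2 * (qv Z (min u \<rho>) \<omega> - qv Z (min t \<rho>) \<omega>))\<bar> \<le> e"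
        unfolding trexp_def \<rho>(3,4) by (simp add: algebra_simps)
    qed (use \<rho> in auto)
  qed
qed

text \<open>The last claim is a Fatou lemma in the reverse direction, which needs uniform
  integrability. Truncation supplies it: doubling the exponent gives the exponent for
  \<open>2 * l\<close> plus \<open>l\<^sup>2\<close> times an increment of the quadratic variation,
  which is at most \<open>R\<close>, so the exponentials have second moments at most
  \<open>exp (l\<^sup>2 * R)\<close>.\<close>

lemma exp_trunc_upper:
  fixes G :: "'w \<Rightarrow> ennreal" and l :: real
  assumes s: "\<And>k. simple_integrand M T W (n k) (\<tau> k) (H k)"
    and R: "0 \<le> R" and t: "0 \<le> t" "t \<le> u" "u \<le> T" and B: "B \<in> sets (F t)"
  shows "trexp l R (n k) (\<tau> k) (H k) t u \<in> borel_measurable P"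
    and "(\<integral>\<^sup>+\<omega>. indicator B \<omega> * ennreal (exp (trexp l R (n k) (\<tau> k) (H k) t u \<omega>)) \<partial>P) = emeasure P B"
    and "AE \<omega> in P. limsup (\<lambda>k. indicator B \<omega> * ennreal (exp (trexp l R (n k) (\<tau> k) (H k) t u \<omega>))) \<le> G \<omega> \<Longrightarrow> emeasure P B \<le> (\<integral>\<^sup>+\<omega>. G \<omega> \<partial>P)"
proof -
  define X where "X k = trexp l R (n k) (\<tau> k) (H k) t u" for k
  let ?H = "\<lambda>k. trunc_integrand (\<tau> k) (H k) R"
  have sH: "simple_integrand M T W (n k) (\<tau> k) (?H k)" for k using trunc_simple[OF s] .
  have ut: "u \<in> {0..T}" "t \<in> {0..T}" using t by auto
  have qm: "simple_qv (n k) (\<tau> k) (?H k) v \<in> borel_measurable P" if "v \<in> {0..T}" for k v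
  proof -
    have "simple_qv (n k) (\<tau> k) (?H k) v = qv (simple_process (n k) (\<tau> k) (?H k)) v"
      using simple_qv_eq[OF sH] that by auto
    then show ?thesis using qv_measurable[OF simple_process_predictable[OF sH]] that by simp
  qed
  note [measurable] = simple_integral_P[OF sH ut(1)] simple_integral_P[OF sH ut(2)] qm[OF ut(1)] qm[OF ut(2)]
  have X[measurable]: "X k \<in> borel_measurable P" for k unfolding X_def trexp_def by measurable
  then show "trexp l R (n k) (\<tau> k) (H k) t u \<in> borel_measurable P" by (simp add: X_def)
  have [measurable]: "B \<in> sets P" using sets_FD[OF B] t by simp
  have eq: "(\<integral>\<^sup>+\<omega>. indicator B \<omega> * ennreal (exp (X k \<omega>)) \<partial>P) = emeasure P B" for k
    unfolding X_def trexp_def by (rule simple_exp_martingale[OF sH t B])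
  then show "(\<integral>\<^sup>+\<omega>. indicator B \<omega> * ennreal (exp (trexp l R (n k) (\<tau> k) (H k) t u \<omega>)) \<partial>P) = emeasure P B"
    by (simp add: X_def)
  have sq: "(\<integral>\<^sup>+\<omega>. ennreal (exp (2 * X k \<omega>)) \<partial>P) \<le> ennreal (exp (l\<^sup>2 * R))" for k
  proof -
    let ?Y = "\<lambda>\<omega>. (2 * l) * (simple_integral W (n k) (\<tau> k) (?H k) u \<omega> - simple_integral W (n k) (\<tau> k) (?H k) t \<omega>)
       - (2 * l)\<^sup>2 / 2 * (simple_qv (n k) (\<tau> k) (?H k) u \<omega> - simple_qv (n k) (\<tau> k) (?H k) t \<omega>)"
    have "exp (2 * X k \<omega>) \<le> exp (l\<^sup>2 * R) * exp (?Y \<omega>)" for \<omega>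
    proof -
      have "simple_qv (n k) (\<tau> k) (?H k) u \<omega> - simple_qv (n k) (\<tau> k) (?H k) t \<omega> \<le> R"
        using trunc_simple_qv[OF s[of k] R, of \<omega>] simple_qv_mono[OF sH[of k], of u T \<omega>] simple_qv_mono[OF sH[of k], of 0 t \<omega>]
          simple_qv_0[OF sH, of k \<omega>] t by simp
      then have "l\<^sup>2 * (simple_qv (n k) (\<tau> k) (?H k) u \<omega> - simple_qv (n k) (\<tau> k) (?H k) t \<omega>) \<le> l\<^sup>2 * R"
        by (intro mult_left_mono) auto
      then show ?thesis unfolding X_def trexp_def mult_exp_exp exp_le_cancel_iff
        by (simp add: power_mult_distrib algebra_simps)
    qed
    then have "(\<integral>\<^sup>+\<omega>. ennreal (exp (2 * X k \<omega>)) \<partial>P) \<le> (\<integral>\<^sup>+\<omega>. ennreal (exp (l\<^sup>2 * R)) * (indicator (space M) \<omega> * ennreal (exp (?Y \<omega>))) \<partial>P)"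
      by (intro nn_integral_mono) (simp add: ennreal_mult[symmetric] ennreal_leI)
    also have "\<dots> = ennreal (exp (l\<^sup>2 * R)) * (\<integral>\<^sup>+\<omega>. indicator (space M) \<omega> * ennreal (exp (?Y \<omega>)) \<partial>P)"
      using sets.top[of P] by (intro nn_integral_cmult borel_measurable_times_ennreal borel_measurable_indicator) (simp, measurable)
    also have "(\<integral>\<^sup>+\<omega>. indicator (space M) \<omega> * ennreal (exp (?Y \<omega>)) \<partial>P) = emeasure P (space M)"
      using sets.top[of "F t"] by (intro simple_exp_martingale[OF sH t]) simp
    also have "\<dots> = 1" using P.emeasure_space_1 by simp
    finally show ?thesis by simp
  qed
  assume "AE \<omega> in P. limsup (\<lambda>k. indicator B \<omega> * ennreal (exp (trexp l R (n k) (\<tau> k) (H k) t u \<omega>))) \<le> G \<omega>"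
  then have lim: "AE \<omega> in P. limsup (\<lambda>k. indicator B \<omega> * ennreal (exp (X k \<omega>))) \<le> G \<omega>" by (simp add: X_def)
  \<comment> \<open>Cutting the exponentials at \<open>c\<close> makes the dominated form of the
    reverse Fatou lemma applicable. Above \<open>c\<close> one has
    \<open>exp x \<le> exp (2 * x) / c\<close>, so the cut costs at most
    \<open>exp (l\<^sup>2 * R) / c\<close>, which vanishes as \<open>c\<close> tends to
    infinity.\<close>
  have bnd: "emeasure P B \<le> (\<integral>\<^sup>+\<omega>. G \<omega> \<partial>P) + ennreal (exp (l\<^sup>2 * R) / c)" if c: "0 < c" for c :: real
  proof -
    let ?m = "\<lambda>k \<omega>. min (indicator B \<omega> * ennreal (exp (X k \<omega>))) (ennreal c)"
    have "emeasure P B \<le> (\<integral>\<^sup>+\<omega>. ?m k \<omega> \<partial>P) + ennreal (exp (l\<^sup>2 * R) / c)" for k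
    proof -
      have "indicator B \<omega> * ennreal (exp (X k \<omega>)) \<le> ?m k \<omega> + ennreal (1/c) * ennreal (exp (2 * X k \<omega>))" for \<omega>
      proof (cases "exp (X k \<omega>) \<le> c")
        case True
        then show ?thesis by (auto simp: indicator_def min_def ennreal_leI add_increasing2)
      next
        case False
        then have "exp (X k \<omega>) \<le> (1/c) * exp (2 * X k \<omega>)"
          using c by (simp add: field_simps exp_double power2_eq_square)
        then have "ennreal (exp (X k \<omega>)) \<le> ennreal (1/c) * ennreal (exp (2 * X k \<omega>))"
          using c by (simp add: ennreal_mult[symmetric] ennreal_leI)
        then show ?thesis by (auto simp: indicator_def intro: add_increasing)
      qed
      then have "emeasure P B \<le> (\<integral>\<^sup>+\<omega>. ?m k \<omega> + ennreal (1/c) * ennreal (exp (2 * X k \<omega>)) \<partial>P)"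
        unfolding eq[of k, symmetric] by (rule nn_integral_mono)
      also have "\<dots> = (\<integral>\<^sup>+\<omega>. ?m k \<omega> \<partial>P) + ennreal (1/c) * (\<integral>\<^sup>+\<omega>. ennreal (exp (2 * X k \<omega>)) \<partial>P)"
        by (simp add: nn_integral_add nn_integral_cmult)
      also have "\<dots> \<le> (\<integral>\<^sup>+\<omega>. ?m k \<omega> \<partial>P) + ennreal (1/c) * ennreal (exp (l\<^sup>2 * R))"
        by (intro add_left_mono mult_left_mono sq) auto
      finally show ?thesis using c by (simp add: ennreal_mult[symmetric])
    qed
    then have "emeasure P B - ennreal (exp (l\<^sup>2 * R) / c) \<le> (\<integral>\<^sup>+\<omega>. ?m k \<omega> \<partial>P)" for k
      by (simp add: ennreal_minus_le_iff add.commute)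
    then have "emeasure P B - ennreal (exp (l\<^sup>2 * R) / c) \<le> limsup (\<lambda>k. \<integral>\<^sup>+\<omega>. ?m k \<omega> \<partial>P)"
      by (intro le_Limsup) auto
    also have "limsup (\<lambda>k. \<integral>\<^sup>+\<omega>. ?m k \<omega> \<partial>P) \<le> (\<integral>\<^sup>+\<omega>. limsup (\<lambda>k. ?m k \<omega>) \<partial>P)"
      by (rule nn_integral_limsup[where w = "\<lambda>_. ennreal c"]) (auto simp: ennreal_mult_less_top P.emeasure_space_1[simplified])
    also have "\<dots> \<le> (\<integral>\<^sup>+\<omega>. G \<omega> \<partial>P)"
    proof (rule nn_integral_mono_AE)
      show "AE \<omega> in P. limsup (\<lambda>k. ?m k \<omega>) \<le> G \<omega>"
        using lim
      proof eventually_elim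
        case (elim \<omega>)
        have "limsup (\<lambda>k. ?m k \<omega>) \<le> limsup (\<lambda>k. indicator B \<omega> * ennreal (exp (X k \<omega>)))"
          by (intro Limsup_mono always_eventually) simp
        then show ?case using elim by (rule order_trans)
      qed
    qed
    finally show ?thesis by (simp add: ennreal_minus_le_iff add.commute)
  qed
  show "emeasure P B \<le> (\<integral>\<^sup>+\<omega>. G \<omega> \<partial>P)"
  proof (rule tendsto_lowerbound[where F = at_top])
    have "((\<lambda>c. (\<integral>\<^sup>+\<omega>. G \<omega> \<partial>P) + ennreal (exp (l\<^sup>2 * R) / c)) \<longlongrightarrow> (\<integral>\<^sup>+\<omega>. G \<omega> \<partial>P) + ennreal 0) at_top"
      by (intro tendsto_add tendsto_const tendsto_ennrealI tendsto_divide_0[OF tendsto_const] filterlim_at_top_imp_at_infinity filterlim_ident)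
    then show "((\<lambda>c. (\<integral>\<^sup>+\<omega>. G \<omega> \<partial>P) + ennreal (exp (l\<^sup>2 * R) / c)) \<longlongrightarrow> (\<integral>\<^sup>+\<omega>. G \<omega> \<partial>P)) at_top" by simp
    show "\<forall>\<^sub>F c in at_top. emeasure P B \<le> (\<integral>\<^sup>+\<omega>. G \<omega> \<partial>P) + ennreal (exp (l\<^sup>2 * R) / c)"
      using eventually_gt_at_top[of 0] by eventually_elim (rule bnd)
  qed simp
qed

declare emeasure_completion [simp del]

text \<open>The logarithm of the stochastic exponential of \<open>l * I\<close>, normalised to start
  at time \<open>t\<close>.\<close>

definition lexp :: "real \<Rightarrow> (real \<Rightarrow> 'w \<Rightarrow> real^'d) \<Rightarrow> (real \<Rightarrow> 'w \<Rightarrow> real) \<Rightarrow> real \<Rightarrow> real \<Rightarrow> 'w \<Rightarrow> real" where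
  "lexp l Z I t u \<omega> = l * (I u \<omega> - I t \<omega>) - l\<^sup>2 / 2 * (qv Z u \<omega> - qv Z t \<omega>)"

lemma lexp_measurable:
  assumes "ito_integral M T W Z I" "0 \<le> t" "t \<le> u" "u \<le> T"
  shows "lexp l Z I t u \<in> borel_measurable P"
proof -
  have [measurable]: "I u \<in> borel_measurable P" "I t \<in> borel_measurable P" "qv Z u \<in> borel_measurable P" "qv Z t \<in> borel_measurable P"
    using assms ito_P[OF assms(1)] qv_measurable[OF ito_predictable[OF assms(1)]] by auto
  show ?thesis unfolding lexp_def by measurable
qed

text \<open>With quadratic variation at most \<open>R\<close>, truncation at the strictly larger
  level \<open>R'\<close> is eventually inactive and the exponents converge. Fatou's lemma gives one
  inequality and \<open>exp_trunc_upper\<close> the other.\<close>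

lemma exp_martingale:
  assumes I: "ito_integral M T W Z I" and t: "0 \<le> t" "t \<le> u" "u \<le> T" and B: "B \<in> sets (F t)"
    and R: "AE \<omega> in P. qv Z T \<omega> \<le> R"
  shows "(\<integral>\<^sup>+\<omega>. indicator B \<omega> * ennreal (exp (lexp l Z I t u \<omega>)) \<partial>P) = emeasure P B"
proof -
  obtain n \<tau> H where s: "\<And>k. simple_integrand M T W (n k) (\<tau> k) (H k)" and conv: "AE \<omega> in P. ito_conv n \<tau> H Z I \<omega>"
    using ito_approx[OF I] by blast
  define R' where "R' = \<bar>R\<bar> + 1"
  define X where "X k = trexp l R' (n k) (\<tau> k) (H k) t u" for k
  have R': "0 \<le> R'" by (simp add: R'_def)
  note up = exp_trunc_upper[where n = n and \<tau> = \<tau> and H = H and l = l, OF s R' t B, folded X_def]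
  have lim: "AE \<omega> in P. (\<lambda>k. indicator B \<omega> * ennreal (exp (X k \<omega>))) \<longlonglongrightarrow> indicator B \<omega> * ennreal (exp (lexp l Z I t u \<omega>))"
    using conv ito_sq_int[OF I] R AE_space
  proof eventually_elim
    case (elim \<omega>)
    have "(\<lambda>k. X k \<omega>) \<longlonglongrightarrow> lexp l Z I t u \<omega>"
      unfolding tendsto_iff
    proof (intro allI impI)
      fix e :: real assume e: "0 < e"
      have "\<forall>\<^sub>F k in sequentially. \<exists>\<rho>\<in>{0..T}. (qv Z T \<omega> < R' \<longrightarrow> \<rho> = T) \<and>
        \<bar>X k \<omega> - (l * (I (min u \<rho>) \<omega> - I (min t \<rho>) \<omega>) - l\<^sup>2 / 2 * (qv Z (min u \<rho>) \<omega> - qv Z (min t \<rho>) \<omega>))\<bar> \<le> e/2"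
        unfolding X_def using elim e by (intro trunc_close[OF s ito_predictable[OF I]] R' t) auto
      then show "\<forall>\<^sub>F k in sequentially. dist (X k \<omega>) (lexp l Z I t u \<omega>) < e"
      proof eventually_elim
        case (elim k)
        have "qv Z T \<omega> < R'" using \<open>qv Z T \<omega> \<le> R\<close> by (simp add: R'_def)
        then show ?case using elim e t by (auto simp: dist_real_def lexp_def)
      qed
    qed
    then show ?case by (auto intro!: tendsto_ennrealI tendsto_exp simp: indicator_def)
  qed
  have [measurable]: "X k \<in> borel_measurable P" for k using up(1) .
  have [measurable]: "B \<in> sets P" using sets_FD[OF B] t by simp
  show ?thesis
  proof (rule antisym)
    have "(\<integral>\<^sup>+\<omega>. indicator B \<omega> * ennreal (exp (lexp l Z I t u \<omega>)) \<partial>P) = (\<integral>\<^sup>+\<omega>. liminf (\<lambda>k. indicator B \<omega> * ennreal (exp (X k \<omega>))) \<partial>P)"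
      using lim by (intro nn_integral_cong_AE) (auto elim!: eventually_mono dest: lim_imp_Liminf[rotated])
    also have "\<dots> \<le> liminf (\<lambda>k. \<integral>\<^sup>+\<omega>. indicator B \<omega> * ennreal (exp (X k \<omega>)) \<partial>P)"
      by (rule nn_integral_liminf) measurable
    finally show "(\<integral>\<^sup>+\<omega>. indicator B \<omega> * ennreal (exp (lexp l Z I t u \<omega>)) \<partial>P) \<le> emeasure P B"
      unfolding up(2) by (simp add: Liminf_const)
    show "emeasure P B \<le> (\<integral>\<^sup>+\<omega>. indicator B \<omega> * ennreal (exp (lexp l Z I t u \<omega>)) \<partial>P)"
      using lim by (intro up(3)) (auto elim!: eventually_mono dest: lim_imp_Limsup[rotated])
  qed
qed

text \<open>The quadratic variation may be unbounded here. Where it stays below \<open>R\<close> the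
  truncated exponents converge. Elsewhere on \<open>B\<close> they are eventually within 1 of the
  original exponent at a stopped time, hence at most \<open>\<bar>C\<bar> + 1\<close>. That event
  has a probability tending to 0 as \<open>R\<close> grows, while its contribution is weighted by a
  constant.\<close>

lemma exp_submartingale:
  assumes I: "ito_integral M T W Z I" and t: "0 \<le> t" "t \<le> T" and B: "B \<in> sets (F t)"
    and C: "AE \<omega> in P. \<omega> \<in> B \<longrightarrow> (\<forall>u\<in>{t..T}. lexp l Z I t u \<omega> \<le> C)"
  shows "emeasure P B \<le> (\<integral>\<^sup>+\<omega>. indicator B \<omega> * ennreal (exp (lexp l Z I t T \<omega>)) \<partial>P)"
proof -
  obtain n \<tau> H where s: "\<And>k. simple_integrand M T W (n k) (\<tau> k) (H k)" and conv: "AE \<omega> in P. ito_conv n \<tau> H Z I \<omega>"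
    using ito_approx[OF I] by blast
  let ?E = "\<lambda>\<omega>. indicator B \<omega> * ennreal (exp (lexp l Z I t T \<omega>))"
  have [measurable]: "B \<in> sets P" using sets_FD[OF B] t by simp
  have [measurable]: "lexp l Z I t T \<in> borel_measurable P" using lexp_measurable[OF I t(1,2)] by simp
  have [measurable]: "qv Z T \<in> borel_measurable P" using qv_measurable[OF ito_predictable[OF I]] by simp
  let ?A = "\<lambda>R. {\<omega>\<in>space P. real R \<le> qv Z T \<omega>}"
  have A: "?A R \<in> sets P" for R by measurable
  have main: "emeasure P B \<le> (\<integral>\<^sup>+\<omega>. ?E \<omega> \<partial>P) + ennreal (exp (\<bar>C\<bar> + 1)) * emeasure P (?A R)" for R :: nat
  proof -
    define X where "X k = trexp l (real R) (n k) (\<tau> k) (H k) t T" for k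
    have "emeasure P B \<le> (\<integral>\<^sup>+\<omega>. ?E \<omega> + ennreal (exp (\<bar>C\<bar> + 1)) * indicator (?A R) \<omega> \<partial>P)"
    proof (rule exp_trunc_upper(3)[where n = n and \<tau> = \<tau> and H = H and l = l and R = "real R", OF s _ t(1,2) order_refl B, folded X_def])
      show "AE \<omega> in P. limsup (\<lambda>k. indicator B \<omega> * ennreal (exp (X k \<omega>))) \<le> ?E \<omega> + ennreal (exp (\<bar>C\<bar> + 1)) * indicator (?A R) \<omega>"
        using conv ito_sq_int[OF I] C AE_space
      proof eventually_elim
        case (elim \<omega>)
        have cl: "\<forall>\<^sub>F k in sequentially. \<exists>\<rho>\<in>{0..T}. (qv Z T \<omega> < R \<longrightarrow> \<rho> = T) \<and>
          \<bar>X k \<omega> - (l * (I (min T \<rho>) \<omega> - I (min t \<rho>) \<omega>) - l\<^sup>2 / 2 * (qv Z (min T \<rho>) \<omega> - qv Z (min t \<rho>) \<omega>))\<bar> \<le> e"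
          if e: "0 < e" for e
          unfolding X_def using elim e t by (intro trunc_close[OF s ito_predictable[OF I]]) auto
        show ?case
        proof (cases "\<omega> \<in> B")
          case True
          show ?thesis
          proof (cases "qv Z T \<omega> < R")
            case lt: True
            have "(\<lambda>k. X k \<omega>) \<longlonglongrightarrow> lexp l Z I t T \<omega>"
              unfolding tendsto_iff
            proof (intro allI impI)
              fix e :: real assume e: "0 < e"
              show "\<forall>\<^sub>F k in sequentially. dist (X k \<omega>) (lexp l Z I t T \<omega>) < e"
                using cl[OF half_gt_zero[OF e]]
                by eventually_elim (use lt e t in \<open>auto simp: dist_real_def lexp_def\<close>)
            qed
            then have "(\<lambda>k. indicator B \<omega> * ennreal (exp (X k \<omega>))) \<longlonglongrightarrow> ?E \<omega>"
              using True by (auto intro!: tendsto_ennrealI tendsto_exp)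
            then have "limsup (\<lambda>k. indicator B \<omega> * ennreal (exp (X k \<omega>))) = ?E \<omega>"
              by (rule lim_imp_Limsup[rotated]) simp
            then show ?thesis by simp
          next
            case False
            have "\<forall>\<^sub>F k in sequentially. indicator B \<omega> * ennreal (exp (X k \<omega>)) \<le> ennreal (exp (\<bar>C\<bar> + 1))"
              using cl[OF zero_less_one]
            proof eventually_elim
              case (elim k)
              then obtain \<rho> where \<rho>: "\<rho> \<in> {0..T}" "\<bar>X k \<omega> - (l * (I (min T \<rho>) \<omega> - I (min t \<rho>) \<omega>) - l\<^sup>2 / 2 * (qv Z (min T \<rho>) \<omega> - qv Z (min t \<rho>) \<omega>))\<bar> \<le> 1"
                by blast
              have "l * (I (min T \<rho>) \<omega> - I (min t \<rho>) \<omega>) - l\<^sup>2 / 2 * (qv Z (min T \<rho>) \<omega> - qv Z (min t \<rho>) \<omega>) \<le> \<bar>C\<bar>"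
              \<comment> \<open>If the truncation acts before \<open>t\<close>, the increment is 0,
                which may exceed a negative \<open>C\<close>; this is why
                \<open>\<bar>C\<bar>\<close> is the bound.\<close>
              proof (cases "\<rho> \<le> t")
                case True
                then show ?thesis using t by simp
              next
                case False
                then have "lexp l Z I t \<rho> \<omega> \<le> C" using \<open>\<omega> \<in> B \<longrightarrow> _\<close> \<open>\<omega> \<in> B\<close> \<rho> by auto
                then show ?thesis using False \<rho> by (simp add: lexp_def)
              qed
              then have "X k \<omega> \<le> \<bar>C\<bar> + 1" using \<rho>(2) by linarith
              then show ?case using True by (simp add: ennreal_leI)
            qed
            then have "limsup (\<lambda>k. indicator B \<omega> * ennreal (exp (X k \<omega>))) \<le> ennreal (exp (\<bar>C\<bar> + 1))"
              by (rule Limsup_bounded)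
            also have "\<dots> \<le> ?E \<omega> + ennreal (exp (\<bar>C\<bar> + 1)) * indicator (?A R) \<omega>"
              using False elim(4) by (simp add: add_increasing)
            finally show ?thesis .
          qed
        next
          case False
          then show ?thesis by (simp add: Limsup_const)
        qed
      qed
    qed simp
    also have "\<dots> = (\<integral>\<^sup>+\<omega>. ?E \<omega> \<partial>P) + ennreal (exp (\<bar>C\<bar> + 1)) * emeasure P (?A R)"
      by (subst nn_integral_add) (use A[of R] in \<open>simp_all add: nn_integral_cmult_indicator\<close>)
    finally show ?thesis .
  qed
  have "(\<lambda>R. emeasure P (?A R)) \<longlonglongrightarrow> emeasure P (\<Inter>R. ?A R)"
    using A by (intro Lim_emeasure_decseq) (auto simp: decseq_def intro: order_trans[rotated])
  also have "(\<Inter>R. ?A R) = {}"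
  proof -
    have "\<exists>R. \<not> real R \<le> x" for x :: real using reals_Archimedean2[of x] by (auto simp: not_le)
    then show ?thesis by blast
  qed
  finally have "(\<lambda>R. emeasure P (?A R)) \<longlonglongrightarrow> 0" by simp
  then have "(\<lambda>R. ennreal (exp (\<bar>C\<bar> + 1)) * emeasure P (?A R)) \<longlonglongrightarrow> ennreal (exp (\<bar>C\<bar> + 1)) * 0"
    by (intro ennreal_tendsto_cmult) auto
  then have l: "(\<lambda>R. (\<integral>\<^sup>+\<omega>. ?E \<omega> \<partial>P) + ennreal (exp (\<bar>C\<bar> + 1)) * emeasure P (?A R)) \<longlonglongrightarrow> (\<integral>\<^sup>+\<omega>. ?E \<omega> \<partial>P) + 0"
    by (intro tendsto_add tendsto_const) simp
  show ?thesis using LIMSEQ_le_const[OF l, of "emeasure P B"] main by auto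
qed

end

section \<open>Mean and isometry\<close>

lemma abs_le_exp_abs: "\<bar>x\<bar> \<le> exp \<bar>x::real\<bar>"
  using exp_ge_add_one_self[of "\<bar>x\<bar>"] by linarith

lemma abs_mult_exp_le: "\<bar>x\<bar> * exp \<bar>x\<bar> \<le> exp (2 * \<bar>x::real\<bar>)"
  using mult_right_mono[OF abs_le_exp_abs[of x], of "exp \<bar>x\<bar>"] by (simp add: mult_exp_exp)

lemma abs_exp_diff_le: "\<bar>exp a - exp (- a)\<bar> \<le> 2 * \<bar>a\<bar> * exp \<bar>a::real\<bar>"
proof -
  have *: "exp b - exp (-b) \<le> 2 * b * exp b" if "0 \<le> b" for b :: real
  proof -
    have "(1 - 2 * b) * exp b \<le> exp (-2*b) * exp b" using exp_ge_add_one_self[of "-2*b"] by (intro mult_right_mono) auto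
    also have "\<dots> = exp (-b)" by (simp add: mult_exp_exp)
    finally show ?thesis by (simp add: algebra_simps)
  qed
  show ?thesis
  proof (cases "0 \<le> a")
    case True then show ?thesis using *[of a] by simp
  next
    case False then show ?thesis using *[of "-a"] by simp
  qed
qed

lemma exp_minus_one_limit:
  fixes y :: real
  assumes "a \<longlonglongrightarrow> 0" "\<And>k::nat. a k \<noteq> 0"
  shows "(\<lambda>k. (exp (y * a k) - 1) / a k) \<longlonglongrightarrow> y"
proof -
  have "((\<lambda>h. exp (y * h)) has_field_derivative exp (y * 0) * y) (at 0)"
    by (auto intro!: derivative_eq_intros)
  from DERIV_D[OF this] have "((\<lambda>h. (exp (y * h) - 1) / h) \<longlongrightarrow> y) (at 0)" by simp
  moreover have "filterlim a (at 0) sequentially" using assms by (auto simp: filterlim_at)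
  ultimately show ?thesis by (rule filterlim_compose)
qed

text \<open>The mean and the isometry are the first and second derivatives at \<open>l = 0\<close> of the exponential martingale;
  they are taken along symmetric difference quotients, which have simple dominating functions.\<close>

definition sinh_quot :: "real \<Rightarrow> real \<Rightarrow> real" where
  "sinh_quot x l = (exp (l * x) - exp (- (l * x))) / (2 * l)"

lemma sinh_quot_limit:
  assumes "a \<longlonglongrightarrow> 0" "\<And>k::nat. a k \<noteq> 0"
  shows "(\<lambda>k. sinh_quot x (a k)) \<longlonglongrightarrow> x"
proof -
  have "(\<lambda>k. ((exp (x * a k) - 1) / a k - (exp (- x * a k) - 1) / a k) / 2) \<longlonglongrightarrow> (x - - x) / 2"
    using exp_minus_one_limit[OF assms, of x] exp_minus_one_limit[OF assms, of "- x"]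
    by (intro tendsto_divide tendsto_diff tendsto_const) auto
  then show ?thesis using assms(2) by (simp add: sinh_quot_def diff_divide_distrib mult.commute)
qed

lemma sinh_quot_bound:
  assumes "0 < l" "l \<le> 1"
  shows "\<bar>sinh_quot x l\<bar> \<le> \<bar>x\<bar> * exp \<bar>x\<bar>"
proof -
  have "\<bar>sinh_quot x l\<bar> \<le> (2 * \<bar>l * x\<bar> * exp \<bar>l * x\<bar>) / (2 * l)"
    unfolding sinh_quot_def abs_divide using assms divide_right_mono[OF abs_exp_diff_le[of "l * x"], of "2 * l"] by simp
  also have "\<dots> = \<bar>x\<bar> * exp (l * \<bar>x\<bar>)" using assms by (simp add: abs_mult)
  also have "\<dots> \<le> \<bar>x\<bar> * exp \<bar>x\<bar>" using assms by (intro mult_left_mono) (auto simp: mult_left_le_one_le)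
  finally show ?thesis .
qed

text \<open>The half-angle identity, by which \<open>exp y + exp (- y) - 2\<close> is the square of
  \<open>exp (y / 2) - exp (- (y / 2))\<close>, turns the second difference quotient into a square
  of \<open>sinh_quot\<close>. So one limit and one bound serve for both derivatives.\<close>

lemma exp_second_order:
  assumes "l \<noteq> 0"
  shows "(exp (l * x - l\<^sup>2 / 2 * q) - exp (- (l * x) - l\<^sup>2 / 2 * q)) / (2 * l) = exp (- q / 2 * l\<^sup>2) * sinh_quot x l"
    "(exp (l * x - l\<^sup>2 / 2 * q) + exp (- (l * x) - l\<^sup>2 / 2 * q) - 2) / l\<^sup>2
      = exp (- q / 2 * l\<^sup>2) * (sinh_quot x (l / 2))\<^sup>2 + 2 * ((exp (- q / 2 * l\<^sup>2) - 1) / l\<^sup>2)"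
proof -
  let ?c = "exp (- q / 2 * l\<^sup>2)" and ?y = "exp (l / 2 * x)"
  have e: "exp (l * x - l\<^sup>2 / 2 * q) = ?c * exp (l * x)" "exp (- (l * x) - l\<^sup>2 / 2 * q) = ?c * exp (- (l * x))"
    by (simp_all add: mult_exp_exp algebra_simps)
  show "(exp (l * x - l\<^sup>2 / 2 * q) - exp (- (l * x) - l\<^sup>2 / 2 * q)) / (2 * l) = ?c * sinh_quot x l"
    unfolding e sinh_quot_def by (simp add: algebra_simps)
  have y: "exp (l * x) = ?y\<^sup>2" "exp (- (l * x)) = (exp (- (l / 2 * x)))\<^sup>2" "?y * exp (- (l / 2 * x)) = 1"
    by (simp_all add: power2_eq_square mult_exp_exp)
  have "exp (l * x) + exp (- (l * x)) - 2 = (?y - exp (- (l / 2 * x)))\<^sup>2"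
    unfolding power2_diff y(1,2) using y(3) by simp
  also have "\<dots> = l\<^sup>2 * (sinh_quot x (l / 2))\<^sup>2"
    using assms by (simp add: sinh_quot_def power_divide)
  finally have s: "exp (l * x) + exp (- (l * x)) = l\<^sup>2 * (sinh_quot x (l / 2))\<^sup>2 + 2" by simp
  have "?c * exp (l * x) + ?c * exp (- (l * x)) - 2 = ?c * (exp (l * x) + exp (- (l * x))) - 2" by (simp add: distrib_left)
  also have "\<dots> = l\<^sup>2 * (?c * (sinh_quot x (l / 2))\<^sup>2) + 2 * (?c - 1)" unfolding s by (simp add: algebra_simps)
  finally have f: "?c * exp (l * x) + ?c * exp (- (l * x)) - 2 = l\<^sup>2 * (?c * (sinh_quot x (l / 2))\<^sup>2) + 2 * (?c - 1)" .
  show "(exp (l * x - l\<^sup>2 / 2 * q) + exp (- (l * x) - l\<^sup>2 / 2 * q) - 2) / l\<^sup>2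
      = ?c * (sinh_quot x (l / 2))\<^sup>2 + 2 * ((?c - 1) / l\<^sup>2)"
    unfolding e f using assms by (simp add: add_divide_distrib)
qed

context brownian
begin

context
  fixes Z I R t u
  assumes I: "ito_integral M T W Z I" and t: "0 \<le> t" "t \<le> u" "u \<le> T"
    and R: "AE \<omega> in P. qv Z T \<omega> \<le> R"
begin

private definition "x \<omega> = I u \<omega> - I t \<omega>"
private definition "q \<omega> = qv Z u \<omega> - qv Z t \<omega>"

private lemma x[measurable]: "x \<in> borel_measurable P"
  unfolding x_def[abs_def] using ito_P[OF I] t by (intro borel_measurable_diff) auto

private lemma q[measurable]: "q \<in> borel_measurable P"
  unfolding q_def[abs_def] using qv_measurable[OF ito_predictable[OF I]] t by (intro borel_measurable_diff) auto

private lemma qR: "AE \<omega> in P. 0 \<le> q \<omega> \<and> q \<omega> \<le> R"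
  using R ito_sq_int[OF I]
proof eventually_elim
  case (elim \<omega>)
  then show ?case using qv_mono[of Z \<omega> t u] qv_mono[of Z \<omega> u T] qv_nonneg[of Z t \<omega>] t unfolding q_def by auto
qed

private lemma mart: "B \<in> sets (F t) \<Longrightarrow> (\<integral>\<^sup>+\<omega>. indicator B \<omega> * ennreal (exp (l * x \<omega> - l\<^sup>2 / 2 * q \<omega>)) \<partial>P) = emeasure P B"
  using exp_martingale[OF I t _ R, of B l] by (simp add: lexp_def x_def q_def)

private lemma martI: "B \<in> sets (F t) \<Longrightarrow> integrable P (\<lambda>\<omega>. indicator B \<omega> * exp (l * x \<omega> - l\<^sup>2 / 2 * q \<omega>))"
  "B \<in> sets (F t) \<Longrightarrow> (\<integral>\<omega>. indicator B \<omega> * exp (l * x \<omega> - l\<^sup>2 / 2 * q \<omega>) \<partial>P) = measure P B"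
proof -
  assume B: "B \<in> sets (F t)"
  have [measurable]: "B \<in> sets P" using sets_FD[OF B] t by simp
  have e: "(\<integral>\<^sup>+\<omega>. ennreal (indicator B \<omega> * exp (l * x \<omega> - l\<^sup>2 / 2 * q \<omega>)) \<partial>P) = ennreal (measure P B)"
    using mart[OF B, of l] by (simp add: ennreal_mult' ennreal_indicator P.emeasure_eq_measure)
  show "integrable P (\<lambda>\<omega>. indicator B \<omega> * exp (l * x \<omega> - l\<^sup>2 / 2 * q \<omega>))"
    by (rule integrableI_nn_integral_finite[OF _ _ e]) auto
  show "(\<integral>\<omega>. indicator B \<omega> * exp (l * x \<omega> - l\<^sup>2 / 2 * q \<omega>) \<partial>P) = measure P B"
    by (rule integral_eq_nn_integral[THEN trans]) (use e in auto)
qed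

text \<open>Since the quadratic variation is bounded, it can be removed from the exponent at the
  cost of a constant factor, and the increment has exponential moments of every order. They dominate
  the difference quotients below.\<close>

private lemma exp_x: "integrable P (\<lambda>\<omega>. exp (l * x \<omega>))"
proof (rule Bochner_Integration.integrable_bound)
  have "space M \<in> sets (F t)" using sets.top[of "F t"] by simp
  from martI(1)[OF this, of l]
  show "integrable P (\<lambda>\<omega>. exp (l\<^sup>2 / 2 * R) * (indicator (space M) \<omega> * exp (l * x \<omega> - l\<^sup>2 / 2 * q \<omega>)))" by simp
  show "AE \<omega> in P. norm (exp (l * x \<omega>)) \<le> norm (exp (l\<^sup>2 / 2 * R) * (indicator (space M) \<omega> * exp (l * x \<omega> - l\<^sup>2 / 2 * q \<omega>)))"
    using qR AE_space
  proof eventually_elim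
    case (elim \<omega>)
    then have "l\<^sup>2 / 2 * q \<omega> \<le> l\<^sup>2 / 2 * R" by (intro mult_left_mono) auto
    then show ?case using elim by (simp add: mult_exp_exp)
  qed
qed measurable

private lemma exp_abs_x: "integrable P (\<lambda>\<omega>. exp (l * \<bar>x \<omega>\<bar>))"
proof (rule Bochner_Integration.integrable_bound)
  show "integrable P (\<lambda>\<omega>. exp (l * x \<omega>) + exp ((-l) * x \<omega>))" by (intro Bochner_Integration.integrable_add exp_x)
  show "AE \<omega> in P. norm (exp (l * \<bar>x \<omega>\<bar>)) \<le> norm (exp (l * x \<omega>) + exp ((-l) * x \<omega>))"

  proof (rule AE_I2)
    fix \<omega>
    have "0 \<le> exp (l * x \<omega>)" "0 \<le> exp ((-l) * x \<omega>)" by simp_all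
    then show "norm (exp (l * \<bar>x \<omega>\<bar>)) \<le> norm (exp (l * x \<omega>) + exp ((-l) * x \<omega>))"
      by (cases "0 \<le> x \<omega>") (simp_all add: abs_of_nonneg del: exp_ge_zero)
  qed
qed measurable

lemma ito_integrable: "integrable P (\<lambda>\<omega>. I u \<omega> - I t \<omega>)"
proof (rule Bochner_Integration.integrable_bound[OF exp_abs_x[of 1]])
  show "(\<lambda>\<omega>. I u \<omega> - I t \<omega>) \<in> borel_measurable P" using x by (simp add: x_def[abs_def])
  show "AE \<omega> in P. norm (I u \<omega> - I t \<omega>) \<le> norm (exp (1 * \<bar>x \<omega>\<bar>))"
    using abs_le_exp_abs by (auto simp: x_def)
qed

lemma ito_sq_integrable: "integrable P (\<lambda>\<omega>. (I u \<omega> - I t \<omega>)\<^sup>2)"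
proof (rule Bochner_Integration.integrable_bound[OF exp_abs_x[of 2]])
  show "(\<lambda>\<omega>. (I u \<omega> - I t \<omega>)\<^sup>2) \<in> borel_measurable P" using x unfolding x_def[abs_def] by measurable
  show "AE \<omega> in P. norm ((I u \<omega> - I t \<omega>)\<^sup>2) \<le> norm (exp (2 * \<bar>x \<omega>\<bar>))"
  proof (rule AE_I2)
    fix \<omega>
    have "\<bar>x \<omega>\<bar>\<^sup>2 \<le> (exp \<bar>x \<omega>\<bar>)\<^sup>2" using abs_le_exp_abs by (intro power_mono) auto
    then show "norm ((I u \<omega> - I t \<omega>)\<^sup>2) \<le> norm (exp (2 * \<bar>x \<omega>\<bar>))" by (simp add: x_def exp_double)
  qed
qed

lemma ito_mean_set:
  assumes B: "B \<in> sets (F t)"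
  shows "(\<integral>\<omega>. indicator B \<omega> * (I u \<omega> - I t \<omega>) \<partial>P) = 0"
proof -
  have [measurable]: "B \<in> sets P" using sets_FD[OF B] t by simp
  define a :: "nat \<Rightarrow> real" where "a k = inverse (real (Suc k))" for k
  have a: "a \<longlonglongrightarrow> 0" "a k \<noteq> 0" "0 < a k" "a k \<le> 1" for k
    using LIMSEQ_inverse_real_of_nat by (auto simp: a_def[abs_def] inverse_le_1_iff)
  let ?f = "\<lambda>l \<omega>. indicator B \<omega> * exp (l * x \<omega> - l\<^sup>2 / 2 * q \<omega>) :: real"
  let ?g = "\<lambda>k \<omega>. (?f (a k) \<omega> - ?f (- a k) \<omega>) / (2 * a k)"
  have g: "?g k \<omega> = indicator B \<omega> * (exp (- q \<omega> / 2 * (a k)\<^sup>2) * sinh_quot (x \<omega>) (a k))" for k \<omega>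
    using exp_second_order(1)[OF a(2)[of k], of "x \<omega>" "q \<omega>"] by (simp add: indicator_def)
  have "(\<lambda>k. \<integral>\<omega>. ?g k \<omega> \<partial>P) \<longlonglongrightarrow> (\<integral>\<omega>. indicator B \<omega> * x \<omega> \<partial>P)"
  proof (rule integral_dominated_convergence[OF _ _ exp_abs_x[of 2]])
    show "AE \<omega> in P. (\<lambda>k. ?g k \<omega>) \<longlonglongrightarrow> indicator B \<omega> * x \<omega>"
    proof (rule AE_I2)
      fix \<omega>
      have "(\<lambda>k. exp (- q \<omega> / 2 * (a k)\<^sup>2)) \<longlonglongrightarrow> exp (- q \<omega> / 2 * 0\<^sup>2)"
        by (intro tendsto_exp tendsto_mult tendsto_const tendsto_power a)
      then have "(\<lambda>k. indicator B \<omega> * (exp (- q \<omega> / 2 * (a k)\<^sup>2) * sinh_quot (x \<omega>) (a k))) \<longlonglongrightarrow> indicator B \<omega> * (exp (- q \<omega> / 2 * 0\<^sup>2) * x \<omega>)"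
        by (intro tendsto_mult tendsto_const sinh_quot_limit a)
      then show "(\<lambda>k. ?g k \<omega>) \<longlonglongrightarrow> indicator B \<omega> * x \<omega>" unfolding g by simp
    qed
    show "AE \<omega> in P. norm (?g k \<omega>) \<le> exp (2 * \<bar>x \<omega>\<bar>)" for k
      using qR
    proof eventually_elim
      case (elim \<omega>)
      have "exp (- q \<omega> / 2 * (a k)\<^sup>2) \<le> 1" using elim by simp
      moreover have "\<bar>sinh_quot (x \<omega>) (a k)\<bar> \<le> exp (2 * \<bar>x \<omega>\<bar>)"
        using order_trans[OF sinh_quot_bound[OF a(3,4)] abs_mult_exp_le] .
      ultimately have "\<bar>indicator B \<omega>\<bar> * (\<bar>exp (- q \<omega> / 2 * (a k)\<^sup>2)\<bar> * \<bar>sinh_quot (x \<omega>) (a k)\<bar>) \<le> 1 * (1 * exp (2 * \<bar>x \<omega>\<bar>))"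
        by (intro mult_mono) (auto simp: indicator_def)
      then show ?case unfolding g real_norm_def abs_mult by simp
    qed
  qed measurable
  moreover have "(\<integral>\<omega>. ?g k \<omega> \<partial>P) = 0" for k
    using martI[OF B, of "a k"] martI[OF B, of "- a k"] by (simp only: integral_divide_zero Bochner_Integration.integral_diff) simp
  ultimately have "(\<integral>\<omega>. indicator B \<omega> * x \<omega> \<partial>P) = 0" by (simp only: LIMSEQ_const_iff)
  then show ?thesis by (simp add: x_def)
qed

lemma ito_isometry_set:
  assumes B: "B \<in> sets (F t)"
  shows "(\<integral>\<omega>. indicator B \<omega> * (I u \<omega> - I t \<omega>)\<^sup>2 \<partial>P) = (\<integral>\<omega>. indicator B \<omega> * (qv Z u \<omega> - qv Z t \<omega>) \<partial>P)"
    "integrable P (\<lambda>\<omega>. qv Z u \<omega> - qv Z t \<omega>)"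
proof -
  have [measurable]: "B \<in> sets P" using sets_FD[OF B] t by simp
  have iq: "integrable P q"
  proof (rule P.integrable_const_bound[OF _ q])
    show "AE \<omega> in P. norm (q \<omega>) \<le> R" using qR by eventually_elim auto
  qed
  then show "integrable P (\<lambda>\<omega>. qv Z u \<omega> - qv Z t \<omega>)" by (simp add: q_def[abs_def])
  define a :: "nat \<Rightarrow> real" where "a k = inverse (real (Suc k))" for k
  have a: "a \<longlonglongrightarrow> 0" "a k \<noteq> 0" "0 < a k" "a k \<le> 1" for k
    using LIMSEQ_inverse_real_of_nat by (auto simp: a_def[abs_def] inverse_le_1_iff)
  have a2: "(\<lambda>k. (a k)\<^sup>2) \<longlonglongrightarrow> 0" "(a k)\<^sup>2 \<noteq> 0" "(\<lambda>k. a k / 2) \<longlonglongrightarrow> 0" "a k / 2 \<noteq> 0" "0 < a k / 2" "a k / 2 \<le> 1" for k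
    using tendsto_power[OF a(1), of 2] tendsto_divide[OF a(1) tendsto_const[of 2]] a(2)[of k] a(3)[of k] a(4)[of k] by auto
  let ?f = "\<lambda>l \<omega>. indicator B \<omega> * exp (l * x \<omega> - l\<^sup>2 / 2 * q \<omega>) :: real"
  let ?g = "\<lambda>k \<omega>. (?f (a k) \<omega> + ?f (- a k) \<omega> - 2 * indicator B \<omega>) / (a k)\<^sup>2"
  let ?h = "\<lambda>k \<omega>. exp (- q \<omega> / 2 * (a k)\<^sup>2) * (sinh_quot (x \<omega>) (a k / 2))\<^sup>2"
  let ?j = "\<lambda>k \<omega>. 2 * ((exp (- q \<omega> / 2 * (a k)\<^sup>2) - 1) / (a k)\<^sup>2)"
  have g: "?g k \<omega> = indicator B \<omega> * (?h k \<omega> + ?j k \<omega>)" for k \<omega>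
    using exp_second_order(2)[OF a(2)[of k], of "x \<omega>" "q \<omega>"] by (simp add: indicator_def)
  have "(\<lambda>k. \<integral>\<omega>. ?g k \<omega> \<partial>P) \<longlonglongrightarrow> (\<integral>\<omega>. indicator B \<omega> * ((x \<omega>)\<^sup>2 - q \<omega>) \<partial>P)"
  proof (rule integral_dominated_convergence[where w = "\<lambda>\<omega>. exp (4 * \<bar>x \<omega>\<bar>) + R"])
    show "integrable P (\<lambda>\<omega>. exp (4 * \<bar>x \<omega>\<bar>) + R)" by (intro Bochner_Integration.integrable_add exp_abs_x) simp
    show "AE \<omega> in P. (\<lambda>k. ?g k \<omega>) \<longlonglongrightarrow> indicator B \<omega> * ((x \<omega>)\<^sup>2 - q \<omega>)"
    proof (rule AE_I2)
      fix \<omega>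
      have "(\<lambda>k. exp (- q \<omega> / 2 * (a k)\<^sup>2)) \<longlonglongrightarrow> exp (- q \<omega> / 2 * 0)"
        by (intro tendsto_exp tendsto_mult tendsto_const a2)
      then have "(\<lambda>k. indicator B \<omega> * (?h k \<omega> + ?j k \<omega>)) \<longlonglongrightarrow> indicator B \<omega> * (exp (- q \<omega> / 2 * 0) * (x \<omega>)\<^sup>2 + 2 * (- q \<omega> / 2))"
        by (intro tendsto_mult[OF tendsto_const] tendsto_add tendsto_mult[of _ "exp (- q \<omega> / 2 * 0)"] tendsto_power sinh_quot_limit exp_minus_one_limit a2)
      then show "(\<lambda>k. ?g k \<omega>) \<longlonglongrightarrow> indicator B \<omega> * ((x \<omega>)\<^sup>2 - q \<omega>)" unfolding g by simp
    qed
    show "AE \<omega> in P. norm (?g k \<omega>) \<le> exp (4 * \<bar>x \<omega>\<bar>) + R" for k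
      using qR
    proof eventually_elim
      case (elim \<omega>)
      have "\<bar>sinh_quot (x \<omega>) (a k / 2)\<bar>\<^sup>2 \<le> (exp (2 * \<bar>x \<omega>\<bar>))\<^sup>2"
        using order_trans[OF sinh_quot_bound[OF a2(5,6)] abs_mult_exp_le] by (intro power_mono) auto
      then have s: "(sinh_quot (x \<omega>) (a k / 2))\<^sup>2 \<le> exp (4 * \<bar>x \<omega>\<bar>)"
        by (simp add: exp_double[symmetric])
      have c: "exp (- q \<omega> / 2 * (a k)\<^sup>2) \<le> 1" using elim by simp
      have h: "0 \<le> ?h k \<omega>" "?h k \<omega> \<le> exp (4 * \<bar>x \<omega>\<bar>)"
        using mult_mono[OF c s] by simp_all
      \<comment> \<open>By \<open>1 + y \<le> exp y\<close> the correction \<open>?j\<close> lies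
        between \<open>- q \<omega>\<close> and 0, so \<open>R\<close> dominates it for all
        \<open>k\<close>.\<close>
      have "2 * ((- q \<omega> / 2 * (a k)\<^sup>2) / (a k)\<^sup>2) \<le> ?j k \<omega>"
        using exp_ge_add_one_self[of "- q \<omega> / 2 * (a k)\<^sup>2"] by (intro mult_left_mono divide_right_mono) auto
      then have j1: "- q \<omega> \<le> ?j k \<omega>" using a(2)[of k] by simp
      have j2: "?j k \<omega> \<le> 0" using c by (intro mult_nonneg_nonpos divide_nonpos_nonneg) auto
      have "\<bar>?h k \<omega> + ?j k \<omega>\<bar> \<le> exp (4 * \<bar>x \<omega>\<bar>) + R" using h j1 j2 elim by linarith
      then have "\<bar>indicator B \<omega>\<bar> * \<bar>?h k \<omega> + ?j k \<omega>\<bar> \<le> 1 * (exp (4 * \<bar>x \<omega>\<bar>) + R)"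
        by (intro mult_mono) (auto simp: indicator_def)
      then show ?case unfolding g real_norm_def abs_mult by simp
    qed
  qed measurable
  moreover have "(\<integral>\<omega>. ?g k \<omega> \<partial>P) = 0" for k
  proof -
    have "integrable P (\<lambda>\<omega>. 2 * indicat_real B \<omega>)" "(\<integral>\<omega>. 2 * indicat_real B \<omega> \<partial>P) = 2 * measure P B"
      using \<open>B \<in> sets P\<close> sets.sets_into_space[OF \<open>B \<in> sets P\<close>] by (simp_all add: less_top[symmetric] Int_absorb2)
    then show ?thesis using martI[OF B, of "a k"] martI[OF B, of "- a k"]
      by (simp only: integral_divide_zero Bochner_Integration.integral_diff Bochner_Integration.integral_add Bochner_Integration.integrable_add) simp
  qed
  ultimately have "(\<integral>\<omega>. indicator B \<omega> * ((x \<omega>)\<^sup>2 - q \<omega>) \<partial>P) = 0" by (simp only: LIMSEQ_const_iff)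
  moreover have "integrable P (\<lambda>\<omega>. indicator B \<omega> * (x \<omega>)\<^sup>2)" "integrable P (\<lambda>\<omega>. indicator B \<omega> * q \<omega>)"
    using integrable_mult_indicator[OF \<open>B \<in> sets P\<close> ito_sq_integrable] integrable_mult_indicator[OF \<open>B \<in> sets P\<close> iq]
    by (simp_all add: x_def q_def)
  ultimately show "(\<integral>\<omega>. indicator B \<omega> * (I u \<omega> - I t \<omega>)\<^sup>2 \<partial>P) = (\<integral>\<omega>. indicator B \<omega> * (qv Z u \<omega> - qv Z t \<omega>) \<partial>P)"
    by (simp add: right_diff_distrib x_def q_def)
qed

text \<open>Zero mean on all sets of \<open>F t\<close> says that the conditional expectation
  vanishes; a bounded factor known at time \<open>t\<close> can then be pulled out.\<close>

lemma ito_mean: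
  assumes X: "X \<in> borel_measurable (F t)" "AE \<omega> in P. \<bar>X \<omega>\<bar> \<le> c"
  shows "integrable P (\<lambda>\<omega>. X \<omega> * (I u \<omega> - I t \<omega>))" "(\<integral>\<omega>. X \<omega> * (I u \<omega> - I t \<omega>) \<partial>P) = 0"
proof -
  have [measurable]: "X \<in> borel_measurable P" using F_P[OF X(1)] t by simp
  have [measurable]: "(\<lambda>\<omega>. I u \<omega> - I t \<omega>) \<in> borel_measurable P" using ito_integrable by simp
  show i: "integrable P (\<lambda>\<omega>. X \<omega> * (I u \<omega> - I t \<omega>))"
  proof (rule Bochner_Integration.integrable_bound)
    show "integrable P (\<lambda>\<omega>. c * (I u \<omega> - I t \<omega>))" using ito_integrable by simp
    show "AE \<omega> in P. norm (X \<omega> * (I u \<omega> - I t \<omega>)) \<le> norm (c * (I u \<omega> - I t \<omega>))"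
      using X(2) by eventually_elim (auto simp: abs_mult intro!: mult_right_mono)
  qed measurable
  have sub: "subalgebra P (F t)" using sets_F_sub[of t] t by (auto simp: subalgebra_def)
  interpret S: finite_measure_subalgebra P "F t" by unfold_locales (rule sub)
  have "AE \<omega> in P. real_cond_exp P (F t) (\<lambda>\<omega>. I u \<omega> - I t \<omega>) \<omega> = 0"
    using ito_mean_set ito_integrable by (intro S.real_cond_exp_charact) (auto simp: set_lebesgue_integral_def)
  then have "(\<integral>\<omega>. X \<omega> * real_cond_exp P (F t) (\<lambda>\<omega>. I u \<omega> - I t \<omega>) \<omega> \<partial>P) = 0"
    by (intro integral_eq_zero_AE) (auto elim!: eventually_mono)
  then show "(\<integral>\<omega>. X \<omega> * (I u \<omega> - I t \<omega>) \<partial>P) = 0"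
    using S.real_cond_exp_intg(2)[OF i X(1)] by simp
qed

end

section \<open>Stopping at grid times\<close>

lemma qv_stop:
  assumes "0 \<le> \<sigma> \<omega>" "0 \<le> u"
  shows "qv (\<lambda>s \<omega>. if s \<le> \<sigma> \<omega> then Z s \<omega> else 0) u \<omega> = qv Z (min u (\<sigma> \<omega>)) \<omega>"
  unfolding qv_def set_lebesgue_integral_def
  by (intro Bochner_Integration.integral_cong) (auto simp: indicator_def)

text \<open>The default \<open>T\<close> makes the minimum exist and covers the case that none of
  the events occurs. If each \<open>D s\<close> is known at time \<open>s\<close>, this is a
  stopping time with finitely many values, as \<open>ito_stop\<close> demands.\<close>

definition hit :: "real set \<Rightarrow> (real \<Rightarrow> 'w set) \<Rightarrow> 'w \<Rightarrow> real" where
  "hit R D \<omega> = Min (insert T {s\<in>R. \<omega> \<in> D s})"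

lemma hit:
  assumes R: "finite R" "R \<subseteq> {0..T}"
  shows "hit R D \<omega> \<in> insert T R" "hit R D \<omega> \<in> {0..T}" "s \<in> R \<Longrightarrow> \<omega> \<in> D s \<Longrightarrow> hit R D \<omega> \<le> s"
    "hit R D \<omega> = T \<or> \<omega> \<in> D (hit R D \<omega>)"
proof -
  have f: "finite (insert T {s\<in>R. \<omega> \<in> D s})" using R by auto
  have m: "hit R D \<omega> \<in> insert T {s\<in>R. \<omega> \<in> D s}" unfolding hit_def using Min_in[OF f] by blast
  then show "hit R D \<omega> \<in> insert T R" "hit R D \<omega> = T \<or> \<omega> \<in> D (hit R D \<omega>)" by auto
  show "hit R D \<omega> \<in> {0..T}" using m R(2) T_pos by auto
  show "s \<in> R \<Longrightarrow> \<omega> \<in> D s \<Longrightarrow> hit R D \<omega> \<le> s" unfolding hit_def using f by (intro Min_le) auto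
qed

lemma hit_F:
  assumes R: "finite R" "R \<subseteq> {0..T}" and D: "\<And>s. s \<in> R \<Longrightarrow> D s \<in> sets (F s)" and t: "t \<in> {0..T}"
  shows "{\<omega>\<in>space M. hit R D \<omega> \<le> t} \<in> sets (F t)"
proof (cases "t = T")
  case True
  then have "{\<omega>\<in>space M. hit R D \<omega> \<le> t} = space (F t)" using hit(2)[OF R] by auto
  then show ?thesis by (simp only: sets.top)
next
  case False
  have "{\<omega>\<in>space M. hit R D \<omega> \<le> t} = (\<Union>s\<in>{s\<in>R. s \<le> t}. D s)"
  proof (intro set_eqI iffI)
    fix \<omega> assume "\<omega> \<in> {\<omega>\<in>space M. hit R D \<omega> \<le> t}"
    then have "hit R D \<omega> \<in> R" "\<omega> \<in> D (hit R D \<omega>)" "hit R D \<omega> \<le> t"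
      using hit(1)[OF R, of D \<omega>] hit(4)[OF R, of D \<omega>] False t by auto
    then show "\<omega> \<in> (\<Union>s\<in>{s\<in>R. s \<le> t}. D s)" by blast
  next
    fix \<omega> assume "\<omega> \<in> (\<Union>s\<in>{s\<in>R. s \<le> t}. D s)"
    then obtain s where s: "s \<in> R" "s \<le> t" "\<omega> \<in> D s" by auto
    then show "\<omega> \<in> {\<omega>\<in>space M. hit R D \<omega> \<le> t}"
      using hit(3)[OF R s(1), of \<omega> D] s(3) sets.sets_into_space[OF D[OF s(1)]] by auto
  qed
  moreover have "(\<Union>s\<in>{s\<in>R. s \<le> t}. D s) \<in> sets (F t)"
    using R(1) D sets_F_mono by (intro sets.finite_UN) auto
  ultimately show ?thesis by simp
qed

lemma ito_hit:
  assumes I: "ito_integral M T W Z I" and R: "finite R" "R \<subseteq> {0..T}" and D: "\<And>s. s \<in> R \<Longrightarrow> D s \<in> sets (F s)"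
  shows "ito_integral M T W (\<lambda>s \<omega>. if s \<le> hit R D \<omega> then Z s \<omega> else 0) (\<lambda>s \<omega>. I (min s (hit R D \<omega>)) \<omega>)"
  using hit(1)[OF R] hit_F[OF R D] R T_pos by (intro ito_stop[OF I, of "insert T R"]) auto

text \<open>Dyadic, so that the grids increase with \<open>p\<close> and hitting times on them
  decrease; the first point is \<open>t\<close> because stopping takes place on
  \<open>{t..T}\<close>.\<close>

definition grid :: "real \<Rightarrow> nat \<Rightarrow> real set" where
  "grid t p = (\<lambda>j. t + (T - t) * real j / 2^p) ` {..2^p}"

lemma grid:
  assumes "t \<in> {0..T}"
  shows "finite (grid t p)" "grid t p \<subseteq> {t..T}" "grid t p \<subseteq> {0..T}" "t \<in> grid t p" "T \<in> grid t p"
proof -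
  show "finite (grid t p)" by (simp add: grid_def)
  show 1: "grid t p \<subseteq> {t..T}"
  proof
    fix x assume "x \<in> grid t p"
    then obtain j where j: "j \<le> 2^p" "x = t + (T - t) * (real j / 2^p)" by (auto simp: grid_def)
    have "real j \<le> real (2^p)" using j(1) by (rule of_nat_mono)
    then have "0 \<le> real j / 2^p" "real j / 2^p \<le> 1" by auto
    then have "0 \<le> (T - t) * (real j / 2^p)" "(T - t) * (real j / 2^p) \<le> (T - t) * 1"
      using assms by (intro mult_nonneg_nonneg mult_left_mono; simp)+
    then show "x \<in> {t..T}" using j by auto
  qed
  then show "grid t p \<subseteq> {0..T}" using assms by auto
  show "t \<in> grid t p" unfolding grid_def by (rule image_eqI[of _ _ 0]) auto
  show "T \<in> grid t p" unfolding grid_def by (rule image_eqI[of _ _ "2^p"]) auto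
qed

lemma grid_mono: "p \<le> q \<Longrightarrow> grid t p \<subseteq> grid t q"
proof
  fix x assume pq: "p \<le> q" and "x \<in> grid t p"
  then obtain j where j: "j \<le> 2^p" "x = t + (T - t) * real j / 2^p" by (auto simp: grid_def)
  have "(2::nat)^q = 2^p * 2^(q-p)" "(2::real)^q = 2^p * 2^(q-p)" using pq by (simp_all add: power_add[symmetric])
  then have "j * 2^(q-p) \<le> 2^q" "x = t + (T - t) * real (j * 2^(q-p)) / 2^q" using j by auto
  then show "x \<in> grid t q" unfolding grid_def by blast
qed

lemma grid_dense:
  assumes "t \<in> {0..T}" "t \<le> a" "a < b" "b \<le> T"
  obtains p x where "x \<in> grid t p" "a < x" "x < b"
proof -
  have tT: "0 < T - t" using assms by auto
  define \<alpha> where "\<alpha> = (a - t) / (T - t)"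
  define \<beta> where "\<beta> = (b - t) / (T - t)"
  have ab: "0 \<le> \<alpha>" "\<alpha> < \<beta>" "\<beta> \<le> 1" using assms tT by (auto simp: \<alpha>_def \<beta>_def divide_strict_right_mono)
  obtain p where p: "1 / (\<beta> - \<alpha>) < 2^p" using real_arch_pow[of 2] by auto
  then have p': "1 < (\<beta> - \<alpha>) * 2^p" using ab by (simp add: field_simps)
  define j where "j = nat (\<lfloor>\<alpha> * 2^p\<rfloor> + 1)"
  have fl: "0 \<le> \<lfloor>\<alpha> * 2^p\<rfloor>" using ab by simp
  then have rj: "real j = of_int \<lfloor>\<alpha> * 2^p\<rfloor> + 1" by (simp add: j_def)
  have 1: "\<alpha> * 2^p < real j" "real j \<le> \<alpha> * 2^p + 1" unfolding rj by linarith+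
  have 2: "real j < \<beta> * 2^p" using 1(2) p' by (simp add: algebra_simps)
  also have "\<dots> \<le> 1 * 2^p" using ab by (intro mult_right_mono) auto
  finally have "real j \<le> real (2^p)" by simp
  then have jp: "j \<le> 2^p" by (simp only: of_nat_le_iff)
  have x: "\<alpha> < real j / 2^p" "real j / 2^p < \<beta>" using 1 2 by (simp_all add: field_simps)
  show ?thesis
  proof (rule that)
    show "t + (T - t) * real j / 2^p \<in> grid t p" using jp by (auto simp: grid_def)
    have "(T - t) * \<alpha> < (T - t) * (real j / 2^p)" "(T - t) * (real j / 2^p) < (T - t) * \<beta>"
      using mult_strict_left_mono[OF x(1) tT] mult_strict_left_mono[OF x(2) tT] by simp_all
    moreover have "(T - t) * \<alpha> = a - t" "(T - t) * \<beta> = b - t" using tT by (auto simp: \<alpha>_def \<beta>_def)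
    ultimately show "a < t + (T - t) * real j / 2^p" "t + (T - t) * real j / 2^p < b" by auto
  qed
qed

text \<open>Kolmogorov's argument: stop at the first grid time at which the integral has moved by
  more than \<open>c\<close>. If there is such a time, the stopped terminal value has moved by more
  than \<open>c\<close>, and by the isometry its second moment is the mean quadratic variation up to
  the stopping time. Refining the grid exhausts the event by continuity of the paths.\<close>

lemma ito_max:
  assumes I: "ito_integral M T W Z I" and R: "AE \<omega> in P. qv Z T \<omega> \<le> R" and c: "0 < c"
  shows "measure P {\<omega>\<in>space P. ennreal c < (SUP t\<in>{0..T}. ennreal \<bar>I t \<omega> - I 0 \<omega>\<bar>)} \<le> (\<integral>\<omega>. qv Z T \<omega> \<partial>P) / c\<^sup>2"
proof -
  let ?D = "\<lambda>s. {\<omega>\<in>space M. c < \<bar>I s \<omega> - I 0 \<omega>\<bar>}"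
  have t0: "(0::real) \<in> {0..T}" using T_pos by simp
  have D: "?D s \<in> sets (F s)" if "s \<in> {0..T}" for s
  proof -
    have [measurable]: "I s \<in> borel_measurable (F s)" "I 0 \<in> borel_measurable (F s)"
      using ito_F[OF I] F_mono[OF ito_F[OF I t0]] that by auto
    have "{\<omega>\<in>space (F s). c < \<bar>I s \<omega> - I 0 \<omega>\<bar>} \<in> sets (F s)" by measurable
    then show ?thesis by simp
  qed
  let ?A = "\<lambda>p. \<Union>s\<in>grid 0 p. ?D s"
  have Am: "?A p \<in> sets P" for p
  proof (intro sets.finite_UN grid(1)[OF t0])
    fix s assume "s \<in> grid 0 p"
    then have "s \<in> {0..T}" using grid(3)[OF t0] by blast
    then show "?D s \<in> sets P" using sets_FD[OF D] by simp
  qed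
  have q0: "integrable P (qv Z T)"
    using ito_isometry_set(2)[OF I order_refl _ order_refl R, of "space M"] sets.top[of "F 0"] T_pos by (simp add: qv_0)
  have bound: "measure P (?A p) \<le> (\<integral>\<omega>. qv Z T \<omega> \<partial>P) / c\<^sup>2" for p
  proof -
    note Gr = grid(1,3)[OF t0, of p]
    let ?h = "hit (grid 0 p) ?D" and ?Z = "\<lambda>s \<omega>. if s \<le> hit (grid 0 p) ?D \<omega> then Z s \<omega> else 0"
      and ?J = "\<lambda>s \<omega>. I (min s (hit (grid 0 p) ?D \<omega>)) \<omega>"
    have J: "ito_integral M T W ?Z ?J" using D Gr by (intro ito_hit[OF I Gr]) auto
    have qs: "qv ?Z T \<omega> = qv Z (?h \<omega>) \<omega>" for \<omega>
      using hit(2)[OF Gr, of ?D \<omega>] T_pos by (subst qv_stop) (auto simp: min_absorb2)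
    have le: "AE \<omega> in P. qv ?Z T \<omega> \<le> qv Z T \<omega>"
      using ito_sq_int[OF I]
    proof eventually_elim
      case (elim \<omega>)
      then show ?case unfolding qs using hit(2)[OF Gr, of ?D \<omega>] by (intro qv_mono) auto
    qed
    have R': "AE \<omega> in P. qv ?Z T \<omega> \<le> R" using le R by eventually_elim simp
    note iso = ito_isometry_set[OF J order_refl _ order_refl R', of "space M"] and sqi = ito_sq_integrable[OF J order_refl _ order_refl R']
    have top: "space M \<in> sets (F 0)" using sets.top[of "F 0"] by simp
    have "measure P (?A p) \<le> measure P {\<omega>\<in>space P. c\<^sup>2 \<le> (?J T \<omega> - ?J 0 \<omega>)\<^sup>2}"
    proof (rule P.finite_measure_mono)
      show "?A p \<subseteq> {\<omega>\<in>space P. c\<^sup>2 \<le> (?J T \<omega> - ?J 0 \<omega>)\<^sup>2}"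
      proof
        fix \<omega> assume "\<omega> \<in> ?A p"
        then obtain s where s: "s \<in> grid 0 p" "\<omega> \<in> ?D s" by auto
        have "\<omega> \<in> ?D (?h \<omega>)" using hit(3)[OF Gr, of s \<omega> ?D] hit(4)[OF Gr, of ?D \<omega>] s Gr(2) by auto
        moreover have "min T (?h \<omega>) = ?h \<omega>" "min 0 (?h \<omega>) = 0" using hit(2)[OF Gr, of ?D \<omega>] by auto
        ultimately have "c \<le> \<bar>?J T \<omega> - ?J 0 \<omega>\<bar>" "\<omega> \<in> space M" by auto
        then show "\<omega> \<in> {\<omega>\<in>space P. c\<^sup>2 \<le> (?J T \<omega> - ?J 0 \<omega>)\<^sup>2}"
          using power_mono[of c "\<bar>?J T \<omega> - ?J 0 \<omega>\<bar>" 2] c by auto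
      qed
      have [measurable]: "(\<lambda>\<omega>. (?J T \<omega> - ?J 0 \<omega>)\<^sup>2) \<in> borel_measurable P" using sqi T_pos by auto
      show "{\<omega>\<in>space P. c\<^sup>2 \<le> (?J T \<omega> - ?J 0 \<omega>)\<^sup>2} \<in> sets P" by measurable
    qed
    also have "\<dots> \<le> (\<integral>\<omega>. (?J T \<omega> - ?J 0 \<omega>)\<^sup>2 \<partial>P) / c\<^sup>2"
      using sqi T_pos c by (intro integral_Markov_inequality_measure[where A = "{}"]) auto
    also have "(\<integral>\<omega>. (?J T \<omega> - ?J 0 \<omega>)\<^sup>2 \<partial>P) = (\<integral>\<omega>. indicator (space M) \<omega> * (?J T \<omega> - ?J 0 \<omega>)\<^sup>2 \<partial>P)"
      by (intro Bochner_Integration.integral_cong) auto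
    also have "\<dots> = (\<integral>\<omega>. indicator (space M) \<omega> * (qv ?Z T \<omega> - qv ?Z 0 \<omega>) \<partial>P)"
      using iso(1) top T_pos by simp
    also have "\<dots> = (\<integral>\<omega>. qv ?Z T \<omega> - qv ?Z 0 \<omega> \<partial>P)"
      by (intro Bochner_Integration.integral_cong) auto
    also have "\<dots> \<le> (\<integral>\<omega>. qv Z T \<omega> \<partial>P)"
      using iso(2) top T_pos q0 le by (intro integral_mono_AE) (auto simp: qv_0)
    finally show ?thesis using c by (simp add: divide_right_mono)
  qed
  have inc: "incseq ?A" using grid_mono by (fastforce simp: incseq_def)
  have "(\<lambda>p. measure P (?A p)) \<longlonglongrightarrow> measure P (\<Union>p. ?A p)"
    using Am by (intro P.finite_Lim_measure_incseq inc) auto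
  then have lim: "measure P (\<Union>p. ?A p) \<le> (\<integral>\<omega>. qv Z T \<omega> \<partial>P) / c\<^sup>2"
    by (rule LIMSEQ_le_const2) (use bound in auto)
  have "{\<omega>\<in>space P. ennreal c < (SUP t\<in>{0..T}. ennreal \<bar>I t \<omega> - I 0 \<omega>\<bar>)} \<subseteq> (\<Union>p. ?A p)"
  proof
    fix \<omega> assume "\<omega> \<in> {\<omega>\<in>space P. ennreal c < (SUP t\<in>{0..T}. ennreal \<bar>I t \<omega> - I 0 \<omega>\<bar>)}"
    then have \<omega>: "\<omega> \<in> space M" and "ennreal c < (SUP t\<in>{0..T}. ennreal \<bar>I t \<omega> - I 0 \<omega>\<bar>)" by auto
    then obtain t where t: "t \<in> {0..T}" "c < \<bar>I t \<omega> - I 0 \<omega>\<bar>"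
      using c by (auto simp: less_SUP_iff ennreal_less_iff)
    show "\<omega> \<in> (\<Union>p. ?A p)"
    proof (cases "t = T")
      case True
      then show ?thesis using t \<omega> grid(5)[OF t0, of 0] by blast
    next
      case False
      have "continuous_on {0..T} (\<lambda>s. \<bar>I s \<omega> - I 0 \<omega>\<bar>)"
        using ito_cont[OF I \<omega>] by (intro continuous_intros)
      then have "((\<lambda>s. \<bar>I s \<omega> - I 0 \<omega>\<bar>) \<longlongrightarrow> \<bar>I t \<omega> - I 0 \<omega>\<bar>) (at t within {0..T})"
        using t(1) by (simp add: continuous_on_def)
      from order_tendstoD(1)[OF this t(2)]
      obtain d where d: "0 < d" "\<And>s. s \<in> {0..T} \<Longrightarrow> s \<noteq> t \<Longrightarrow> dist s t < d \<Longrightarrow> c < \<bar>I s \<omega> - I 0 \<omega>\<bar>"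
        unfolding eventually_at by blast
      obtain p x where "x \<in> grid 0 p" "t < x" "x < min T (t + d)"
        by (rule grid_dense[OF t0, of t "min T (t + d)"]) (use False t(1) d(1) in auto)
      then have "x \<in> grid 0 p" "\<omega> \<in> ?D x" using d(2)[of x] t(1) \<omega> by (auto simp: dist_real_def)
      then show ?thesis by blast
    qed
  qed
  then have "measure P {\<omega>\<in>space P. ennreal c < (SUP t\<in>{0..T}. ennreal \<bar>I t \<omega> - I 0 \<omega>\<bar>)} \<le> measure P (\<Union>p. ?A p)"
    using Am by (intro P.finite_measure_mono) auto
  then show ?thesis using lim by simp
qed

section \<open>The energy estimate\<close>

text \<open>Left-point step processes are predictable and converge to a process with continuous
  paths. Time 0 is treated apart because the intervals \<open>{s<..t}\<close> leave it out.\<close>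

lemma predictable_continuous:
  fixes X :: "real \<Rightarrow> 'w \<Rightarrow> real"
  assumes X: "\<And>t. t \<in> {0..T} \<Longrightarrow> X t \<in> borel_measurable (F t)"
    and c: "\<And>\<omega>. \<omega> \<in> space M \<Longrightarrow> continuous_on {0..T} (\<lambda>t. X t \<omega>)"
  shows "predictable M T W X"
proof -
  let ?P = "predictable_sigma T (space M) F"
  define s where "s p j = T * real j / real (Suc p)" for p j
  have s01: "s p 0 = 0" "s p (Suc p) = T" for p by (auto simp: s_def)
  have smono: "i \<le> j \<Longrightarrow> s p i \<le> s p j" for p i j using T_pos by (simp add: s_def divide_right_mono)
  have sT: "j \<le> Suc p \<Longrightarrow> s p j \<in> {0..T}" for p j using smono[of 0 j p] smono[of j "Suc p" p] s01[of p] by auto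
  define Y where "Y p v = (if fst v = 0 then X 0 (snd v) else \<Sum>j<Suc p. indicator {s p j<..s p (Suc j)} (fst v) *\<^sub>R X (s p j) (snd v))" for p v
  have "(\<lambda>(t,\<omega>). X t \<omega>) \<in> borel_measurable ?P"
  proof (rule borel_measurable_LIMSEQ_metric)
    fix p
    have z: "{v \<in> space ?P. fst v = 0} \<in> sets ?P"
    proof -
      have "{v \<in> space ?P. fst v = 0} = {0} \<times> space (F 0)" using T_pos by (auto simp: space_predictable)
      then show ?thesis using predictable_rect0[OF sets.top] by simp
    qed
    have 0: "(\<lambda>v. X 0 (snd v)) \<in> borel_measurable (restrict_space ?P {v. fst v = 0})"
    proof (rule measurableI)
      fix A :: "real set" assume A: "A \<in> sets borel"
      have "X 0 -` A \<inter> space M \<in> sets (F 0)" using measurable_sets[OF X A, of 0] T_pos by simp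
      from predictable_rect0[OF this]
      have "{0} \<times> (X 0 -` A \<inter> space M) \<in> sets (restrict_space ?P {v. fst v = 0})"
        unfolding sets_restrict_space by (rule rev_image_eqI) auto
      moreover have "(\<lambda>v. X 0 (snd v)) -` A \<inter> space (restrict_space ?P {v. fst v = 0}) = {0} \<times> (X 0 -` A \<inter> space M)"
        using T_pos by (auto simp: space_restrict_space space_predictable)
      ultimately show "(\<lambda>v. X 0 (snd v)) -` A \<inter> space (restrict_space ?P {v. fst v = 0}) \<in> sets (restrict_space ?P {v. fst v = 0})" by simp
    qed simp
    have 1: "(\<lambda>v. \<Sum>j<Suc p. indicator {s p j<..s p (Suc j)} (fst v) *\<^sub>R X (s p j) (snd v)) \<in> borel_measurable ?P"
    proof (intro borel_measurable_sum)
      fix j assume "j \<in> {..<Suc p}"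
      then show "(\<lambda>v. indicator {s p j<..s p (Suc j)} (fst v) *\<^sub>R X (s p j) (snd v)) \<in> borel_measurable ?P"
        using step_predictable[of "s p j" "s p (Suc j)" "X (s p j)"] X[of "s p j"] sT[of j p] sT[of "Suc j" p] by (simp add: split_def)
    qed
    show "Y p \<in> borel_measurable ?P"
      unfolding Y_def using z 0 measurable_restrict_space1[OF 1]
      by (intro measurable_If_restrict_space_iff[THEN iffD2] conjI) auto
  next
    fix v assume v: "v \<in> space ?P"
    obtain t \<omega> where tw: "v = (t, \<omega>)" "t \<in> {0..T}" "\<omega> \<in> space M" using v by (auto simp: space_predictable)
    show "(\<lambda>p. Y p v) \<longlonglongrightarrow> (case v of (t, \<omega>) \<Rightarrow> X t \<omega>)"
    proof (cases "t = 0")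
      case True then show ?thesis by (simp add: Y_def tw)
    next
      case False
      then have t: "0 < t" using tw by auto
      have ex: "\<exists>j<Suc p. s p j < t \<and> t \<le> s p (Suc j)" for p
      proof -
        let ?j = "LEAST j. t \<le> s p j"
        have Tp: "t \<le> s p (Suc p)" using s01 tw by simp
        have j: "t \<le> s p ?j" using Tp by (rule LeastI)
        then have "?j \<noteq> 0" using t s01(1)[of p] by (intro notI) simp
        then obtain i where i: "?j = Suc i" using not0_implies_Suc by blast
        have "\<not> t \<le> s p i" using not_less_Least[of i "\<lambda>j. t \<le> s p j"] i by simp
        moreover have "Suc i \<le> Suc p" using Least_le[of "\<lambda>j. t \<le> s p j", OF Tp] i by simp
        ultimately show ?thesis using j i by (intro exI[of _ i]) auto
      qed
      then obtain j where j: "\<And>p. j p < Suc p" "\<And>p. s p (j p) < t" "\<And>p. t \<le> s p (Suc (j p))" by metis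
      have Y: "Y p v = X (s p (j p)) \<omega>" for p
      proof -
        have e: "indicator {s p i<..s p (Suc i)} t *\<^sub>R X (s p i) \<omega> = (if i = j p then X (s p (j p)) \<omega> else 0)" for i
        proof -
          have "i \<noteq> j p \<Longrightarrow> \<not> (s p i < t \<and> t \<le> s p (Suc i))"
            using j(2,3)[of p] smono[of "Suc i" "j p" p] smono[of "Suc (j p)" i p] by (cases "i < j p") auto
          then show ?thesis using j(2,3)[of p] by (auto simp: indicator_def)
        qed
        have "Y p v = (\<Sum>i<Suc p. if i = j p then X (s p (j p)) \<omega> else 0)"
          unfolding Y_def tw fst_conv snd_conv e using False by (simp del: sum.lessThan_Suc)
        then show ?thesis using j(1)[of p] by simp
      qed
      have b: "t - T / real (Suc p) \<le> s p (j p)" for p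
      proof -
        have "s p (Suc (j p)) = s p (j p) + T / real (Suc p)"
          unfolding s_def add_divide_distrib[symmetric] by (simp add: distrib_left)
        then show ?thesis using j(3)[of p] by simp
      qed
      have "(\<lambda>p. t - T / real (Suc p)) \<longlonglongrightarrow> t - 0"
        using tendsto_mult[OF tendsto_const[of T] LIMSEQ_inverse_real_of_nat] by (intro tendsto_diff tendsto_const) (simp add: divide_inverse)
      then have l: "(\<lambda>p. t - T / real (Suc p)) \<longlonglongrightarrow> t" by simp
      have "(\<lambda>p. s p (j p)) \<longlonglongrightarrow> t"
        by (rule tendsto_sandwich[OF always_eventually always_eventually l tendsto_const]) (use b j(2) in \<open>auto intro: less_imp_le\<close>)
      moreover have "\<forall>p. s p (j p) \<in> {0..T}" using j(1) sT less_imp_le by blast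
      ultimately have "(\<lambda>p. X (s p (j p)) \<omega>) \<longlonglongrightarrow> X t \<omega>"
        by (intro continuous_on_tendsto_compose[OF c[OF tw(3)] _ tw(2)] always_eventually)
      then show ?thesis by (simp only: Y) (simp add: tw)
    qed
  qed
  then show ?thesis .
qed

text \<open>A discrete substitute for Ito's formula applied to the square of \<open>X\<close>. Over
  a fine partition the isometry turns the left side into a sum of squared increments of
  \<open>I\<close>, which are increments of \<open>X\<close> plus a remainder. Summation leaves four
  parts: boundary terms of the square of \<open>X\<close>; a sum of mean 0; the remainders weighted
  with \<open>X\<close>, at most \<open>e\<close> times the variation; and the squared remainders.
  The last are of the order of the mesh thanks to the Lipschitz bound \<open>c\<close>, which
  therefore does not appear in the conclusion.\<close>

lemma energy:
  assumes I: "ito_integral M T W Z I" and R: "AE \<omega> in P. qv Z T \<omega> \<le> R" and t: "t \<in> {0..T}" and B: "B \<in> sets (F t)"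
    and X: "\<And>s. s \<in> {0..T} \<Longrightarrow> X s \<in> borel_measurable (F s)"
    and Xe: "AE \<omega> in P. \<forall>s\<in>{0..T}. \<bar>X s \<omega>\<bar> \<le> e"
    and G: "integrable P G" and c: "0 \<le> c"
    and eq: "AE \<omega> in P. \<exists>V. (\<forall>a b. t \<le> a \<longrightarrow> a \<le> b \<longrightarrow> b \<le> T \<longrightarrow>
        \<bar>(I b \<omega> - I a \<omega>) - (X b \<omega> - X a \<omega>)\<bar> \<le> min (V b - V a) (c * (b - a))) \<and> V T - V t \<le> G \<omega>"
  shows "(\<integral>\<omega>. indicator B \<omega> * (qv Z T \<omega> - qv Z t \<omega>) \<partial>P) \<le> 2 * e\<^sup>2 * measure P B + 4 * e * (\<integral>\<omega>. indicator B \<omega> * G \<omega> \<partial>P)"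
proof -
  have BP[measurable]: "B \<in> sets P" using sets_FD[OF B] t by simp
  have iB: "integrable P (\<lambda>\<omega>. indicator B \<omega> * f \<omega>)" if "integrable P f" for f :: "'w \<Rightarrow> real"
    using integrable_mult_indicator[OF BP that] by simp
  have mB: "(\<integral>\<omega>. indicator B \<omega> * d \<partial>P) = d * measure P B" for d :: real
    using sets.sets_into_space[OF BP] by (simp add: Int_absorb2)
  have e0: "0 \<le> e"
  proof -
    have "AE \<omega> in P. 0 \<le> e" using Xe by eventually_elim (use t in force)
    then show ?thesis by simp
  qed
  let ?E = "\<integral>\<omega>. indicator B \<omega> * (qv Z T \<omega> - qv Z t \<omega>) \<partial>P"
  have main: "?E \<le> 2 * e\<^sup>2 * measure P B + 4 * e * (\<integral>\<omega>. indicator B \<omega> * G \<omega> \<partial>P) + 2 * (c * T)\<^sup>2 / real (Suc p)" for p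
  proof -
    define h where "h = (T - t) / real (Suc p)"
    define s where "s j = t + h * real j" for j
    have h: "0 \<le> h" "h \<le> T / real (Suc p)" using t by (auto simp: h_def divide_right_mono)
    have s01: "s 0 = t" "s (Suc p) = T" by (auto simp: s_def h_def simp del: of_nat_Suc)
    have smono: "i \<le> j \<Longrightarrow> s i \<le> s j" for i j using h by (simp add: s_def mult_left_mono)
    have sT: "j \<le> Suc p \<Longrightarrow> t \<le> s j \<and> s j \<le> T" for j using smono[of 0 j] smono[of j "Suc p"] s01 by auto
    have step: "s j \<le> s (Suc j)" "s (Suc j) - s j = h" for j using smono[of j "Suc j"] by (auto simp: s_def algebra_simps)
    let ?N = "\<lambda>j \<omega>. I (s (Suc j)) \<omega> - I (s j) \<omega>"
    have BF: "B \<in> sets (F (s j))" if "j \<le> Suc p" for j using B sets_F_mono[of t "s j"] sT[OF that] by auto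
    have st: "0 \<le> s j" "s j \<le> s (Suc j)" "s (Suc j) \<le> T" if "j < Suc p" for j
      using sT[of j] sT[of "Suc j"] step(1) that t by auto
    note int = ito_integrable[OF I st R] and sqi = ito_sq_integrable[OF I st R] and iso = ito_isometry_set[OF I st R]
    have iX: "integrable P (\<lambda>\<omega>. (indicator B \<omega> * X (s j) \<omega>) * ?N j \<omega>)"
      "(\<integral>\<omega>. (indicator B \<omega> * X (s j) \<omega>) * ?N j \<omega> \<partial>P) = 0" if j: "j < Suc p" for j
    proof -
      have sj: "s j \<in> {0..T}" using sT[of j] j t by auto
      have m: "(\<lambda>\<omega>. indicator B \<omega> * X (s j) \<omega>) \<in> borel_measurable (F (s j))"
        using BF[of j] X[OF sj] j by (intro borel_measurable_times borel_measurable_indicator) auto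
      have b: "AE \<omega> in P. \<bar>indicator B \<omega> * X (s j) \<omega>\<bar> \<le> e"
        using Xe by eventually_elim (use sj e0 in \<open>auto simp: indicator_def\<close>)
      show "integrable P (\<lambda>\<omega>. (indicator B \<omega> * X (s j) \<omega>) * ?N j \<omega>)"
        "(\<integral>\<omega>. (indicator B \<omega> * X (s j) \<omega>) * ?N j \<omega> \<partial>P) = 0"
        using ito_mean[OF I st[OF j] R m b] by auto
    qed
    have "?E = (\<integral>\<omega>. (\<Sum>j<Suc p. indicator B \<omega> * (qv Z (s (Suc j)) \<omega> - qv Z (s j) \<omega>)) \<partial>P)"
    proof -
      have "(\<Sum>j<Suc p. qv Z (s (Suc j)) \<omega> - qv Z (s j) \<omega>) = qv Z T \<omega> - qv Z t \<omega>" for \<omega>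
        using sum_lessThan_telescope[of "\<lambda>j. qv Z (s j) \<omega>" "Suc p"] s01 by simp
      then show ?thesis unfolding sum_distrib_left[symmetric] by simp
    qed
    also have "\<dots> = (\<Sum>j<Suc p. \<integral>\<omega>. indicator B \<omega> * (qv Z (s (Suc j)) \<omega> - qv Z (s j) \<omega>) \<partial>P)"
      using iso(2)[OF _ _ _ BF] by (intro Bochner_Integration.integral_sum iB) auto
    also have "\<dots> = (\<Sum>j<Suc p. \<integral>\<omega>. indicator B \<omega> * (?N j \<omega>)\<^sup>2 \<partial>P)"
      using iso(1)[OF _ _ _ BF] by (intro sum.cong) auto
    also have "\<dots> = (\<integral>\<omega>. (\<Sum>j<Suc p. indicator B \<omega> * (?N j \<omega>)\<^sup>2) \<partial>P)"
      using sqi by (intro Bochner_Integration.integral_sum[symmetric] iB) auto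
    also have "\<dots> \<le> (\<integral>\<omega>. indicator B \<omega> * (2 * e\<^sup>2 + 2 * (c * T)\<^sup>2 / real (Suc p)) + 4 * e * (indicator B \<omega> * G \<omega>)
        - (\<Sum>j<Suc p. 4 * ((indicator B \<omega> * X (s j) \<omega>) * ?N j \<omega>)) \<partial>P)"
    proof (rule integral_mono_AE)
      show "integrable P (\<lambda>\<omega>. \<Sum>j<Suc p. indicator B \<omega> * (?N j \<omega>)\<^sup>2)"
        using sqi by (intro Bochner_Integration.integrable_sum iB) auto
      show "integrable P (\<lambda>\<omega>. indicator B \<omega> * (2 * e\<^sup>2 + 2 * (c * T)\<^sup>2 / real (Suc p)) + 4 * e * (indicator B \<omega> * G \<omega>)
        - (\<Sum>j<Suc p. 4 * ((indicator B \<omega> * X (s j) \<omega>) * ?N j \<omega>)))"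
        using iX(1) G
        by (intro Bochner_Integration.integrable_diff Bochner_Integration.integrable_add Bochner_Integration.integrable_sum integrable_mult_right iB) auto
      show "AE \<omega> in P. (\<Sum>j<Suc p. indicator B \<omega> * (?N j \<omega>)\<^sup>2) \<le> indicator B \<omega> * (2 * e\<^sup>2 + 2 * (c * T)\<^sup>2 / real (Suc p)) + 4 * e * (indicator B \<omega> * G \<omega>)
        - (\<Sum>j<Suc p. 4 * ((indicator B \<omega> * X (s j) \<omega>) * ?N j \<omega>))"
        using Xe eq
      proof eventually_elim
        case (elim \<omega>)
        then obtain V where V: "\<And>a b. t \<le> a \<Longrightarrow> a \<le> b \<Longrightarrow> b \<le> T \<Longrightarrow>
          \<bar>(I b \<omega> - I a \<omega>) - (X b \<omega> - X a \<omega>)\<bar> \<le> min (V b - V a) (c * (b - a))" "V T - V t \<le> G \<omega>" by blast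
        let ?x = "\<lambda>j. X (s j) \<omega>"
        have one: "(?N j \<omega>)\<^sup>2 \<le> 2 * ((?x (Suc j))\<^sup>2 - (?x j)\<^sup>2) - 4 * (?x j * ?N j \<omega>) + 4 * e * (V (s (Suc j)) - V (s j)) + 2 * (c * h)\<^sup>2"
          if j: "j < Suc p" for j
        proof -
          define r where "r = ?N j \<omega> - (?x (Suc j) - ?x j)"
          have "\<bar>r\<bar> \<le> min (V (s (Suc j)) - V (s j)) (c * (s (Suc j) - s j))"
            unfolding r_def using sT[of j] sT[of "Suc j"] step(1) j by (intro V(1)) auto
          then have r: "\<bar>r\<bar> \<le> V (s (Suc j)) - V (s j)" "\<bar>r\<bar> \<le> c * h" unfolding step(2) by auto
          have "\<bar>?x j\<bar> \<le> e" using elim(1) sT[of j] j t by auto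
          then have "?x j * r \<le> e * (V (s (Suc j)) - V (s j))"
            using mult_mono[OF _ r(1), of "\<bar>?x j\<bar>" e] abs_ge_self[of "?x j * r"] e0 by (simp add: abs_mult)
          moreover have "r\<^sup>2 \<le> (c * h)\<^sup>2" using power_mono[OF r(2), of 2] by simp
          moreover have "(?N j \<omega>)\<^sup>2 \<le> 2 * ((?x (Suc j))\<^sup>2 - (?x j)\<^sup>2) - 4 * (?x j * ?N j \<omega>) + 4 * (?x j * r) + 2 * r\<^sup>2"
          proof -
            \<comment> \<open>The right side is \<open>2 * d\<^sup>2 + 2 * r\<^sup>2\<close>,
              rearranged so that \<open>a\<close> enters through a difference of squares, which
              telescopes, and through the product \<open>a * (d + r)\<close> with the increment of
              the integral, which has mean 0.\<close>
            have "(d + r)\<^sup>2 \<le> 2 * ((a + d)\<^sup>2 - a\<^sup>2) - 4 * (a * (d + r)) + 4 * (a * r) + 2 * r\<^sup>2" for a d :: real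
              using zero_le_power2[of "d - r"] by (simp add: power2_eq_square algebra_simps)
            from this[of "?x (Suc j) - ?x j" "?x j"] show ?thesis by (simp add: r_def)
          qed
          ultimately show ?thesis by linarith
        qed
        have "(\<Sum>j<Suc p. (?N j \<omega>)\<^sup>2) \<le> (\<Sum>j<Suc p. 2 * ((?x (Suc j))\<^sup>2 - (?x j)\<^sup>2) - 4 * (?x j * ?N j \<omega>) + 4 * e * (V (s (Suc j)) - V (s j)) + 2 * (c * h)\<^sup>2)"
          by (intro sum_mono one) simp
        also have "\<dots> = 2 * ((?x (Suc p))\<^sup>2 - (?x 0)\<^sup>2) - (\<Sum>j<Suc p. 4 * (?x j * ?N j \<omega>)) + 4 * e * (V T - V t) + real (Suc p) * (2 * (c * h)\<^sup>2)"
        proof -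
          have tel: "(\<Sum>j<Suc p. f (Suc j)) - (\<Sum>j<Suc p. f j) = f (Suc p) - f 0" for f :: "nat \<Rightarrow> real"
            unfolding sum_subtractf[symmetric] by (rule sum_lessThan_telescope)
          show ?thesis
            unfolding sum.distrib sum_subtractf sum_distrib_left[symmetric] tel[of "\<lambda>j. (?x j)\<^sup>2"] tel[of "\<lambda>j. V (s j)"] s01
              sum_constant card_lessThan by (simp only: mult_ac)
        qed
        also have "\<dots> \<le> 2 * e\<^sup>2 - (\<Sum>j<Suc p. 4 * (?x j * ?N j \<omega>)) + 4 * e * G \<omega> + 2 * (c * T)\<^sup>2 / real (Suc p)"
        proof -
          have "\<bar>?x (Suc p)\<bar> \<le> e" using elim(1) s01 T_pos by auto
          then have "(?x (Suc p))\<^sup>2 \<le> e\<^sup>2" using power_mono[of "\<bar>?x (Suc p)\<bar>" e 2] by simp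
          moreover have "0 \<le> (?x 0)\<^sup>2" by simp
          moreover have "4 * e * (V T - V t) \<le> 4 * e * G \<omega>" using V(2) e0 by (intro mult_left_mono) auto
          moreover have "real (Suc p) * (2 * (c * h)\<^sup>2) \<le> 2 * (c * T)\<^sup>2 / real (Suc p)"
          proof -
            have "(c * h)\<^sup>2 \<le> (c * (T / real (Suc p)))\<^sup>2" using h c by (intro power_mono mult_left_mono) auto
            then have "real (Suc p) * (2 * (c * h)\<^sup>2) \<le> real (Suc p) * (2 * (c * (T / real (Suc p)))\<^sup>2)" by (intro mult_left_mono) auto
            also have "\<dots> = 2 * (c * T)\<^sup>2 / real (Suc p)" by (simp add: power2_eq_square del: of_nat_Suc)
            finally show ?thesis .
          qed
          moreover have "2 * (a - b) - S + g + d \<le> 2 * a' - S + g' + d'" if "a \<le> a'" "0 \<le> b" "g \<le> g'" "d \<le> d'"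
            for a b S g d a' g' d' :: real
            by (intro add_mono that diff_right_mono) (use that in simp)
          ultimately show ?thesis by blast
        qed
        finally have "(\<Sum>j<Suc p. (?N j \<omega>)\<^sup>2) \<le> 2 * e\<^sup>2 - (\<Sum>j<Suc p. 4 * (?x j * ?N j \<omega>)) + 4 * e * G \<omega> + 2 * (c * T)\<^sup>2 / real (Suc p)" .
        then show ?case by (cases "\<omega> \<in> B") (simp_all add: algebra_simps)
      qed
    qed
    also have "\<dots> = (2 * e\<^sup>2 + 2 * (c * T)\<^sup>2 / real (Suc p)) * measure P B + 4 * e * (\<integral>\<omega>. indicator B \<omega> * G \<omega> \<partial>P)
        - (\<Sum>j<Suc p. 4 * (\<integral>\<omega>. (indicator B \<omega> * X (s j) \<omega>) * ?N j \<omega> \<partial>P))"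
    proof -
      have 1: "integrable P (\<lambda>\<omega>. indicator B \<omega> * (2 * e\<^sup>2 + 2 * (c * T)\<^sup>2 / real (Suc p)))" by (rule iB) simp
      have 2: "integrable P (\<lambda>\<omega>. 4 * e * (indicator B \<omega> * G \<omega>))" using iB[OF G] by simp
      have 3: "integrable P (\<lambda>\<omega>. 4 * ((indicator B \<omega> * X (s j) \<omega>) * ?N j \<omega>))" if "j \<in> {..<Suc p}" for j
        using iX(1)[of j] that by simp
      have 4: "integrable P (\<lambda>\<omega>. \<Sum>j<Suc p. 4 * ((indicator B \<omega> * X (s j) \<omega>) * ?N j \<omega>))"
        by (rule Bochner_Integration.integrable_sum[OF 3])
      have 5: "(\<integral>\<omega>. (\<Sum>j<Suc p. 4 * ((indicator B \<omega> * X (s j) \<omega>) * ?N j \<omega>)) \<partial>P) = (\<Sum>j<Suc p. 4 * (\<integral>\<omega>. (indicator B \<omega> * X (s j) \<omega>) * ?N j \<omega> \<partial>P))"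
        using Bochner_Integration.integral_sum[OF 3] by (simp only: integral_mult_right_zero)
      show ?thesis
        by (subst Bochner_Integration.integral_diff[OF Bochner_Integration.integrable_add[OF 1 2] 4], subst Bochner_Integration.integral_add[OF 1 2])
          (simp only: 5 mB integral_mult_right_zero)
    qed
    also have "\<dots> = (2 * e\<^sup>2 + 2 * (c * T)\<^sup>2 / real (Suc p)) * measure P B + 4 * e * (\<integral>\<omega>. indicator B \<omega> * G \<omega> \<partial>P)"
      using iX(2) by (simp del: of_nat_Suc)
    also have "\<dots> \<le> 2 * e\<^sup>2 * measure P B + 4 * e * (\<integral>\<omega>. indicator B \<omega> * G \<omega> \<partial>P) + 2 * (c * T)\<^sup>2 / real (Suc p)"
      using mult_left_mono[of "measure P B" 1 "2 * (c * T)\<^sup>2 / real (Suc p)"] by (simp add: distrib_right del: of_nat_Suc)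
    finally show ?thesis .
  qed
  have "(\<lambda>p. 2 * (c * T)\<^sup>2 * inverse (real (Suc p))) \<longlonglongrightarrow> 2 * (c * T)\<^sup>2 * 0"
    by (intro tendsto_mult tendsto_const LIMSEQ_inverse_real_of_nat)
  then have "(\<lambda>p. 2 * e\<^sup>2 * measure P B + 4 * e * (\<integral>\<omega>. indicator B \<omega> * G \<omega> \<partial>P) + 2 * (c * T)\<^sup>2 / real (Suc p)) \<longlonglongrightarrow>
      2 * e\<^sup>2 * measure P B + 4 * e * (\<integral>\<omega>. indicator B \<omega> * G \<omega> \<partial>P) + 0"
    by (intro tendsto_add tendsto_const) (simp add: divide_inverse)
  then have l: "(\<lambda>p. 2 * e\<^sup>2 * measure P B + 4 * e * (\<integral>\<omega>. indicator B \<omega> * G \<omega> \<partial>P) + 2 * (c * T)\<^sup>2 / real (Suc p)) \<longlonglongrightarrow>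
      2 * e\<^sup>2 * measure P B + 4 * e * (\<integral>\<omega>. indicator B \<omega> * G \<omega> \<partial>P)" by simp
  show ?thesis by (rule LIMSEQ_le_const[OF l]) (use main in auto)
qed

end

section \<open>Equations and drivers\<close>

lemma sup_dist_self: "0 \<le> t \<Longrightarrow> sup_dist t w w = 0"
  unfolding sup_dist_def by simp

lemma continuous_set_integral:
  fixes g :: "real \<Rightarrow> real"
  assumes g: "set_integrable lborel {0..T} g"
  shows "continuous_on {0..T} (\<lambda>t. LBINT s:{t..T}. g s)"
proof -
  have i: "set_integrable lborel {a..b} g" if "0 \<le> a" "b \<le> T" for a b
    using g by (rule set_integrable_subset) (use that in auto)
  have e: "(LBINT s:{t..T}. g s) = integral {0..T} g - integral {0..t} g" if "t \<in> {0..T}" for t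
  proof -
    have "g integrable_on {0..T}" using set_borel_integral_eq_integral(1)[OF g] .
    then have "integral {0..t} g + integral {t..T} g = integral {0..T} g"
      using that by (intro Henstock_Kurzweil_Integration.integral_combine) auto
    then show ?thesis using set_borel_integral_eq_integral(2)[OF i, of t T] that by simp
  qed
  have "continuous_on {0..T} (\<lambda>t. integral {0..T} g - integral {0..t} g)"
    by (intro continuous_on_diff continuous_on_const indefinite_integral_continuous_1 set_borel_integral_eq_integral(1)[OF g])
  then show ?thesis by (subst continuous_on_cong[OF refl e])
qed

text \<open>With the integrating factor \<open>exp (K * s)\<close> the function \<open>w\<close> is
  nondecreasing, and its end values give the bound. The integral of \<open>u\<close> is estimated
  rather than \<open>u\<close> itself, so that \<open>G\<close> enters through its time integral,
  whose conditional mean can be controlled later.\<close>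

lemma gronwall_backward:
  fixes u G :: "real \<Rightarrow> real"
  assumes u: "continuous_on {t..T} u" and G: "continuous_on {t..T} G" "\<And>s. s \<in> {t..T} \<Longrightarrow> 0 \<le> G s"
    and tT: "0 \<le> t" "t \<le> T" and K: "0 \<le> K" and le: "\<And>s. s \<in> {t..T} \<Longrightarrow> u s \<le> G s + K * integral {s..T} u"
  shows "integral {t..T} u \<le> exp (K * T) * integral {t..T} G"
proof -
  define E where "E s = exp (K * s)" for s :: real
  define w where "w s = E s * (integral {t..T} u - integral {t..s} u) + integral {t..s} (\<lambda>r. E r * G r)" for s
  have EG: "continuous_on {t..T} (\<lambda>r. E r * G r)" unfolding E_def by (intro continuous_intros G)
  have ui: "integral {s..T} u = integral {t..T} u - integral {t..s} u" if "s \<in> {t..T}" for s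
    using Henstock_Kurzweil_Integration.integral_combine[of t s T u] integrable_continuous_real[OF u] that by auto
  have d: "(w has_real_derivative K * E s * (integral {t..T} u - integral {t..s} u) - E s * u s + E s * G s) (at s within {t..T})"
    if s: "s \<in> {t..T}" for s
  proof -
    have 1: "((\<lambda>s. integral {t..s} u) has_real_derivative u s) (at s within {t..T})"
      by (rule integral_has_real_derivative[OF u s])
    have 2: "((\<lambda>s. integral {t..s} (\<lambda>r. E r * G r)) has_real_derivative E s * G s) (at s within {t..T})"
      by (rule integral_has_real_derivative[OF EG s])
    have 3: "(E has_real_derivative K * E s) (at s within {t..T})"
      unfolding E_def[abs_def] by (auto intro!: derivative_eq_intros)
    show ?thesis unfolding w_def[abs_def]
      by (rule derivative_eq_intros 1 2 3 refl)+ (simp add: algebra_simps)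
  qed
  have "w t \<le> w T"
  proof (rule DERIV_nonneg_imp_increasing_open[of t T w])
    show "continuous_on {t..T} w" using d by (intro DERIV_continuous_on) auto
    fix s assume s: "t < s" "s < T"
    then have "(w has_real_derivative K * E s * (integral {t..T} u - integral {t..s} u) - E s * u s + E s * G s) (at s)"
      using d[of s] at_within_interior[of s "{t..T}"] by simp
    moreover have "0 \<le> E s * (G s + K * (integral {t..T} u - integral {t..s} u) - u s)"
      using le[of s] ui[of s] s by (intro mult_nonneg_nonneg) (auto simp: E_def)
    then have "0 \<le> K * E s * (integral {t..T} u - integral {t..s} u) - E s * u s + E s * G s"
      by (simp add: algebra_simps)
    ultimately show "\<exists>y. (w has_real_derivative y) (at s) \<and> 0 \<le> y" by blast
  qed (rule tT)
  then have "E t * integral {t..T} u \<le> integral {t..T} (\<lambda>r. E r * G r)" by (simp add: w_def)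
  also have "\<dots> \<le> integral {t..T} (\<lambda>r. E T * G r)"
    using G K by (intro integral_le integrable_continuous_real EG continuous_intros) (auto simp: E_def mult_left_mono mult_right_mono)
  also have "\<dots> = E T * integral {t..T} G" by simp
  finally have 1: "E t * integral {t..T} u \<le> E T * integral {t..T} G" .
  have G0: "0 \<le> integral {t..T} G" using G integrable_continuous_real by (intro Henstock_Kurzweil_Integration.integral_nonneg) auto
  show ?thesis
  proof (cases "0 \<le> integral {t..T} u")
    case True
    have "1 \<le> E t" using K tT by (simp add: E_def)
    then have "1 * integral {t..T} u \<le> E t * integral {t..T} u" using True by (rule mult_right_mono)
    then show ?thesis using 1 by (simp add: E_def)
  next
    case False
    then have "integral {t..T} u \<le> 0" by simp
    also have "0 \<le> exp (K * T) * integral {t..T} G" using G0 by simp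
    finally show ?thesis .
  qed
qed

context brownian
begin

lemma qv_bounded:
  assumes b: "\<And>s. s \<in> {0..T} \<Longrightarrow> norm (Z s \<omega>) \<le> a" and sq: "sq_int Z \<omega>"
  shows "qv Z T \<omega> \<le> a\<^sup>2 * T"
proof -
  have "qv Z T \<omega> \<le> (LBINT s:{0..T}. a\<^sup>2)"
    unfolding qv_def
  proof (rule set_integral_mono)
    show "set_integrable lborel {0..T} (\<lambda>s. (norm (Z s \<omega>))\<^sup>2)" using sq by (simp add: sq_int_def)
    show "set_integrable lborel {0..T} (\<lambda>s. a\<^sup>2)" unfolding set_integrable_def by (simp add: emeasure_lborel_Icc_eq)
    show "(norm (Z s \<omega>))\<^sup>2 \<le> a\<^sup>2" if "s \<in> {0..T}" for s using b[OF that] by (intro power_mono) auto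
  qed
  then show ?thesis using T_pos by (simp add: set_lebesgue_integral_def mult.commute)
qed

abbreviation path :: "'w \<Rightarrow> real \<Rightarrow> real^'d" where "path \<equiv> sample_path T W"

lemma path_space: "\<omega> \<in> space M \<Longrightarrow> path \<omega> \<in> path_space T"
  using W_cont[of \<omega>] continuous_on_cong[OF refl, of "{0..T}" "path \<omega>" "\<lambda>t. W t \<omega>"]
  unfolding path_space_def by (simp add: sample_path_def)

lemma bsde_equationD:
  assumes "bsde_equation M T W f' \<xi> Y Z A"
  obtains I where "ito_integral M T W Z I"
    "AE \<omega> in P. set_integrable lborel {0..T} (\<lambda>s. f' s (path \<omega>) (Y s \<omega>) (Z s \<omega>))"
    "AE \<omega> in P. \<forall>t\<in>{0..T}. Y t \<omega> = \<xi> \<omega> + (LBINT s:{t..T}. f' s (path \<omega>) (Y s \<omega>) (Z s \<omega>)) - (I T \<omega> - I t \<omega>) + A T \<omega> - A t \<omega>"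
    "AE \<omega> in P. \<forall>a b. 0 \<le> a \<longrightarrow> a \<le> b \<longrightarrow> b \<le> T \<longrightarrow>
       I b \<omega> - I a \<omega> = Y b \<omega> - Y a \<omega> + (LBINT s:{a..b}. f' s (path \<omega>) (Y s \<omega>) (Z s \<omega>)) + (A b \<omega> - A a \<omega>)"
proof -
  from assms obtain I where I: "ito_integral M T W Z I"
    and i: "AE \<omega> in P. set_integrable lborel {0..T} (\<lambda>s. f' s (path \<omega>) (Y s \<omega>) (Z s \<omega>))"
    and e: "AE \<omega> in P. \<forall>t\<in>{0..T}. Y t \<omega> = \<xi> \<omega> + (LBINT s:{t..T}. f' s (path \<omega>) (Y s \<omega>) (Z s \<omega>)) - (I T \<omega> - I t \<omega>) + A T \<omega> - A t \<omega>"
    unfolding bsde_equation_def by blast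
  show ?thesis
  proof (rule that[OF I i e])
    show "AE \<omega> in P. \<forall>a b. 0 \<le> a \<longrightarrow> a \<le> b \<longrightarrow> b \<le> T \<longrightarrow>
       I b \<omega> - I a \<omega> = Y b \<omega> - Y a \<omega> + (LBINT s:{a..b}. f' s (path \<omega>) (Y s \<omega>) (Z s \<omega>)) + (A b \<omega> - A a \<omega>)"
      using i e
    proof eventually_elim
      case (elim \<omega>)
      show ?case
      proof (intro allI impI)
        fix a b assume ab: "0 \<le> a" "a \<le> b" "b \<le> T"
        then show "I b \<omega> - I a \<omega> = Y b \<omega> - Y a \<omega> + (LBINT s:{a..b}. f' s (path \<omega>) (Y s \<omega>) (Z s \<omega>)) + (A b \<omega> - A a \<omega>)"
          using elim(2)[rule_format, of a] elim(2)[rule_format, of b] set_integral_split[OF elim(1) ab order_refl] by simp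
      qed
    qed
  qed
qed

text \<open>Countably many null sets suffice for the grid times, and limits from the right along
  grid points reach every time before \<open>T\<close>. The time \<open>T\<close> itself is a grid
  point.\<close>

lemma AE_all_times:
  fixes X :: "real \<Rightarrow> 'w \<Rightarrow> real"
  assumes le: "\<And>t. t \<in> {0..T} \<Longrightarrow> AE \<omega> in P. X t \<omega> \<le> g t" and g: "continuous_on {0..T} g"
    and rc: "AE \<omega> in P. \<forall>t\<in>{0..<T}. ((\<lambda>r. X r \<omega>) \<longlongrightarrow> X t \<omega>) (at_right t)"
  shows "AE \<omega> in P. \<forall>t\<in>{0..T}. X t \<omega> \<le> g t"
proof -
  have t0: "(0::real) \<in> {0..T}" using T_pos by simp
  have "AE \<omega> in P. \<forall>p. \<forall>x\<in>grid 0 p. X x \<omega> \<le> g x"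
    unfolding AE_all_countable
  proof (intro allI AE_finite_allI grid(1)[OF t0])
    fix p x assume "x \<in> grid 0 p"
    then have "x \<in> {0..T}" using grid(3)[OF t0] by blast
    then show "AE \<omega> in P. X x \<omega> \<le> g x" by (rule le)
  qed
  then show ?thesis using rc
  proof eventually_elim
    case (elim \<omega>)
    show ?case
    proof
      fix t assume t: "t \<in> {0..T}"
      show "X t \<omega> \<le> g t"
      proof (cases "t = T")
        case True then show ?thesis using elim(1) grid(5)[OF t0, of 0] by blast
      next
        case False
        show ?thesis
        proof (rule ccontr)
          assume n: "\<not> X t \<omega> \<le> g t"
          have tr: "((\<lambda>r. X r \<omega> - g r) \<longlongrightarrow> X t \<omega> - g t) (at_right t)"
          proof (rule tendsto_diff)
            have "(g \<longlongrightarrow> g t) (at t within {0..T})" using g t by (simp add: continuous_on_def)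
            then have "(g \<longlongrightarrow> g t) (at t within {t..T})" by (rule tendsto_within_subset) (use t in auto)
            then show "(g \<longlongrightarrow> g t) (at_right t)" using False t by (simp add: at_within_Icc_at_right)
          qed (use elim(2) t False in auto)
          have "eventually (\<lambda>r. 0 < X r \<omega> - g r) (at_right t)" using order_tendstoD(1)[OF tr, of 0] n by simp
          then obtain b where b: "t < b" "\<And>r. t < r \<Longrightarrow> r < b \<Longrightarrow> 0 < X r \<omega> - g r"
            unfolding eventually_at_right_field by blast
          obtain p x where "x \<in> grid 0 p" "t < x" "x < min T b"
            by (rule grid_dense[OF t0, of t "min T b"]) (use False t b in auto)
          then show False using b(2)[of x] elim(1) by force
        qed
      qed
    qed
  qed
qed

end

section \<open>Consequences of the conditions on the driver\<close>

locale bsde = brownian M T W for M :: "'w measure" and T :: real and W :: "real \<Rightarrow> 'w \<Rightarrow> real^'d" +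
  fixes f :: "'d driver_fun"
  assumes f: "driver T f" "f1 T f" "f2 T f" "f3 T f" "f4 T f" "f5 T f"
begin

text \<open>The Lipschitz constant in \<open>y\<close> from (f3) for equal paths, fixed once so that
  all estimates share it.\<close>

definition K :: real where
  "K = (SOME K. 0 \<le> K \<and> (\<forall>t\<in>{0..T}. \<forall>w\<in>path_space T. \<forall>y1 y2 z. \<bar>f t w y1 z - f t w y2 z\<bar> \<le> K * \<bar>y1 - y2\<bar>))"

lemma K: "0 \<le> K" "t \<in> {0..T} \<Longrightarrow> w \<in> path_space T \<Longrightarrow> \<bar>f t w y1 z - f t w y2 z\<bar> \<le> K * \<bar>y1 - y2\<bar>"
proof -
  obtain k where k: "0 \<le> k" "\<And>t w1 w2 y1 y2 z. t \<in> {0..T} \<Longrightarrow> w1 \<in> path_space T \<Longrightarrow> w2 \<in> path_space T \<Longrightarrow>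
      \<bar>f t w1 y1 z - f t w2 y2 z\<bar> \<le> k * (sup_dist t w1 w2 + \<bar>y1 - y2\<bar>)"
    using f(4) unfolding f3_def by blast
  have "0 \<le> k \<and> (\<forall>t\<in>{0..T}. \<forall>w\<in>path_space T. \<forall>y1 y2 z. \<bar>f t w y1 z - f t w y2 z\<bar> \<le> k * \<bar>y1 - y2\<bar>)"
    using k(1) k(2)[of _ w w for w] by (auto simp: sup_dist_self)
  then have "0 \<le> K \<and> (\<forall>t\<in>{0..T}. \<forall>w\<in>path_space T. \<forall>y1 y2 z. \<bar>f t w y1 z - f t w y2 z\<bar> \<le> K * \<bar>y1 - y2\<bar>)"
    unfolding K_def by (rule someI)
  then show "0 \<le> K" "t \<in> {0..T} \<Longrightarrow> w \<in> path_space T \<Longrightarrow> \<bar>f t w y1 z - f t w y2 z\<bar> \<le> K * \<bar>y1 - y2\<bar>" by auto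
qed

lemma f_lipschitz:
  assumes "0 \<le> a"
  obtains b where "0 \<le> b" "\<And>t w y z1 z2. t \<in> {0..T} \<Longrightarrow> w \<in> path_space T \<Longrightarrow> norm z1 \<le> a \<Longrightarrow> norm z2 \<le> a \<Longrightarrow>
    \<bar>f t w y z1 - f t w y z2\<bar> \<le> b * norm (z1 - z2)"
  using f(5) assms unfolding f4_def by (meson max.boundedI)

text \<open>Difference quotients of a convex function along a ray increase. The slope from
  \<open>z1\<close> towards \<open>z\<close> is therefore at least the slope over a step of length
  at most 1, which stays in the ball of radius \<open>a + 1\<close>, where (f4) gives the constant
  \<open>b\<close>. The lower bound is linear in \<open>z\<close> on the whole space even when
  \<open>f\<close> grows faster.\<close>

lemma f_subgradient_bound:
  assumes a: "0 \<le> a"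
  obtains b where "0 \<le> b" "\<And>t w y z1 z. t \<in> {0..T} \<Longrightarrow> w \<in> path_space T \<Longrightarrow> norm z1 \<le> a \<Longrightarrow>
    f t w y z1 - b * norm (z - z1) \<le> f t w y z"
proof -
  obtain b where b: "0 \<le> b" "\<And>t w y z1 z2. t \<in> {0..T} \<Longrightarrow> w \<in> path_space T \<Longrightarrow> norm z1 \<le> a + 1 \<Longrightarrow> norm z2 \<le> a + 1 \<Longrightarrow>
    \<bar>f t w y z1 - f t w y z2\<bar> \<le> b * norm (z1 - z2)"
    using f_lipschitz[of "a + 1"] a by auto
  show ?thesis
  proof (rule that[OF b(1)])
    fix t y and w :: "real \<Rightarrow> real^'d" and z1 z :: "real^'d" assume tw: "t \<in> {0..T}" "w \<in> path_space T" "norm z1 \<le> a"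
    \<comment> \<open>The summand 1 covers the case \<open>z = z1\<close> and makes both
      \<open>h\<close> and the length \<open>h * norm (z - z1)\<close> of the step at most
      1.\<close>
    define h where "h = 1 / (norm (z - z1) + 1)"
    have "0 < norm (z - z1) + 1" by (intro add_nonneg_pos) auto
    then have h: "0 < h" "h \<le> 1" "h * norm (z - z1) \<le> 1" by (simp_all add: h_def pos_divide_le_eq)
    let ?z = "(1 - h) *\<^sub>R z1 + h *\<^sub>R z"
    have zd: "?z - z1 = h *\<^sub>R (z - z1)" by (simp add: algebra_simps)
    have "norm ?z \<le> norm z1 + norm (?z - z1)" using norm_triangle_ineq[of z1 "?z - z1"] by simp
    also have "\<dots> \<le> a + 1" unfolding zd using tw(3) h by simp
    finally have "\<bar>f t w y ?z - f t w y z1\<bar> \<le> b * norm (?z - z1)" using tw a by (intro b(2)) auto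
    then have 1: "f t w y z1 - h * (b * norm (z - z1)) \<le> f t w y ?z" unfolding zd using h by (simp add: mult_ac abs_le_iff)
    have "convex_on UNIV (\<lambda>z. f t w y z)" using f(2) tw unfolding f1_def by blast
    then have "f t w y ?z \<le> (1 - h) * f t w y z1 + h * f t w y z"
      using h by (intro convex_onD) auto
    then have "h * (f t w y z1 - b * norm (z - z1)) \<le> h * f t w y z" using 1 by (simp add: algebra_simps)
    then show "f t w y z1 - b * norm (z - z1) \<le> f t w y z" using h by simp
  qed
qed

lemma f_growth:
  assumes a: "0 \<le> a"
  obtains c where "0 \<le> c" "\<And>t w y z. t \<in> {0..T} \<Longrightarrow> w \<in> path_space T \<Longrightarrow> norm z \<le> a \<Longrightarrow> \<bar>f t w y z\<bar> \<le> c + K * \<bar>y\<bar>"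
proof -
  obtain b where b: "0 \<le> b" "\<And>t w y z1 z2. t \<in> {0..T} \<Longrightarrow> w \<in> path_space T \<Longrightarrow> norm z1 \<le> a \<Longrightarrow> norm z2 \<le> a \<Longrightarrow>
    \<bar>f t w y z1 - f t w y z2\<bar> \<le> b * norm (z1 - z2)"
    using f_lipschitz[OF a] by blast
  obtain c0 where c0: "\<And>t w. t \<in> {0..T} \<Longrightarrow> w \<in> path_space T \<Longrightarrow> \<bar>f t w 0 0\<bar> \<le> c0"
    using f(3) unfolding f2_def bdd_above_def by blast
  show ?thesis
  proof (rule that[of "\<bar>c0\<bar> + b * a"])
    fix t y and w :: "real \<Rightarrow> real^'d" and z :: "real^'d" assume tw: "t \<in> {0..T}" "w \<in> path_space T" "norm z \<le> (a::real)"
    have "\<bar>f t w 0 z - f t w 0 0\<bar> \<le> b * norm (z - 0)" using tw a by (intro b(2)) auto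
    also have "\<dots> \<le> b * a" using tw b(1) by (intro mult_left_mono) auto
    finally show "\<bar>f t w y z\<bar> \<le> \<bar>c0\<bar> + b * a + K * \<bar>y\<bar>"
      using K(2)[OF tw(1,2), of y z 0] c0[OF tw(1,2)] by simp
  qed (use a b in simp)
qed

lemma f_lower:
  assumes "0 \<le> c"
  obtains C where "0 \<le> C" "\<And>t w y z. t \<in> {0..T} \<Longrightarrow> w \<in> path_space T \<Longrightarrow> \<bar>y\<bar> \<le> c \<Longrightarrow> - C \<le> f t w y z"
proof -
  obtain m where m: "\<And>t w y z. t \<in> {0..T} \<Longrightarrow> w \<in> path_space T \<Longrightarrow> y \<in> {-c..c} \<Longrightarrow> m \<le> f t w y z"
  proof -
    have "bdd_below {f t w y z | t w y z. t \<in> {0..T} \<and> w \<in> path_space T \<and> y \<in> {-c..c}}"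
      using f(6) assms unfolding f5_def by simp
    then obtain m where "\<And>x. x \<in> {f t w y z | t w y z. t \<in> {0..T} \<and> w \<in> path_space T \<and> y \<in> {-c..c}} \<Longrightarrow> m \<le> x"
      unfolding bdd_below_def by blast
    then show ?thesis using that by blast
  qed
  show ?thesis
  proof (rule that[of "\<bar>m\<bar>"])
    fix t y and w :: "real \<Rightarrow> real^'d" and z :: "real^'d" assume "t \<in> {0..T}" "w \<in> path_space T" "\<bar>y\<bar> \<le> c"
    then have "m \<le> f t w y z" by (intro m) auto
    then show "- \<bar>m\<bar> \<le> f t w y z" by linarith
  qed simp
qed

lemma f_continuous:
  assumes tw: "t \<in> {0..T}" "w \<in> path_space T" and y: "y \<longlonglongrightarrow> y0" and z: "z \<longlonglongrightarrow> z0"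
  shows "(\<lambda>k. f t w (y k) (z k)) \<longlonglongrightarrow> f t w y0 z0"
proof -
  obtain a where a: "0 < a" "\<And>k. norm (z k) \<le> a" using convergent_imp_Bseq[OF convergentI[OF z]] by (auto elim: BseqE)
  have z0: "norm z0 \<le> a" using LIMSEQ_le_const2[OF tendsto_norm[OF z]] a by blast
  obtain b where b: "0 \<le> b" "\<And>t w y z1 z2. t \<in> {0..T} \<Longrightarrow> w \<in> path_space T \<Longrightarrow> norm z1 \<le> a \<Longrightarrow> norm z2 \<le> a \<Longrightarrow>
    \<bar>f t w y z1 - f t w y z2\<bar> \<le> b * norm (z1 - z2)"
    using f_lipschitz[of a] a by auto
  have "(\<lambda>k. K * \<bar>y k - y0\<bar> + b * norm (z k - z0)) \<longlonglongrightarrow> K * \<bar>y0 - y0\<bar> + b * norm (z0 - z0)"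
    by (intro tendsto_intros y z)
  then have l: "(\<lambda>k. K * \<bar>y k - y0\<bar> + b * norm (z k - z0)) \<longlonglongrightarrow> 0" by simp
  show ?thesis
  proof (rule Lim_transform_bound[OF _ l, THEN LIM_zero_cancel])
    show "\<forall>\<^sub>F k in sequentially. norm (f t w (y k) (z k) - f t w y0 z0) \<le> norm (K * \<bar>y k - y0\<bar> + b * norm (z k - z0))"
    proof (rule always_eventually, rule allI)
      fix k
      have "\<bar>f t w (y k) (z k) - f t w y0 z0\<bar> \<le> K * \<bar>y k - y0\<bar> + b * norm (z k - z0)"
        using K(2)[OF tw, of "y k" "z k" y0] b(2)[OF tw a(2) z0, of y0 k] by linarith
      then show "norm (f t w (y k) (z k) - f t w y0 z0) \<le> norm (K * \<bar>y k - y0\<bar> + b * norm (z k - z0))" by simp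
    qed
  qed
qed

text \<open>The coordinate process evaluated along \<open>path\<close> is \<open>W\<close>, so
  predictable rectangles of path space pull back to predictable rectangles. Hence a driver evaluated
  along Brownian paths is predictable, which \<open>drift_predictable\<close> records.\<close>

lemma path_predictable:
  "(\<lambda>v. (fst v, path (snd v))) \<in> measurable (predictable_sigma T (space M) F)
     (predictable_sigma T (path_space T) (natural_filtration (path_space T) (\<lambda>s w. w s)))"
proof -
  let ?N = "natural_filtration (path_space T) (\<lambda>s w. w s) :: real \<Rightarrow> (real \<Rightarrow> real^'d) measure"
  have path: "path -` A \<inter> space M \<in> sets (F s)" if "s \<le> T" "A \<in> sets (?N s)" for s A
  proof -
    have "path \<in> measurable (F s) (?N s)"
      unfolding natural_filtration_def
    proof (rule measurable_measure_of)
      fix y :: "(real \<Rightarrow> real^'d) set" assume "y \<in> {(\<lambda>w. w r) -` A \<inter> path_space T |r A. r \<in> {0..s} \<and> A \<in> sets borel}"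
      then obtain r A where y: "y = (\<lambda>w. w r) -` A \<inter> path_space T" "r \<in> {0..s}" "A \<in> sets borel" by blast
      have "path -` y \<inter> space (F s) = W r -` A \<inter> space (F s)"
        using y \<open>s \<le> T\<close> path_space by (auto simp: sample_path_def)
      then show "path -` y \<inter> space (F s) \<in> sets (F s)" using measurable_sets[OF W_F[OF y(2)] y(3)] by simp
    qed (use path_space in auto)
    from measurable_sets[OF this that(2)] show ?thesis by simp
  qed
  show ?thesis
    unfolding predictable_sigma_def[of T "path_space T"]
  proof (rule measurable_measure_of)
    show "{{0} \<times> A |A. A \<in> sets (?N 0)} \<union> {{s<..t} \<times> A |s t A. 0 \<le> s \<and> s < t \<and> t \<le> T \<and> A \<in> sets (?N s)} \<subseteq> Pow ({0..T} \<times> path_space T)"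
      using T_pos sets.sets_into_space[of _ "?N s" for s] by fastforce
    show "(\<lambda>v. (fst v, path (snd v))) \<in> space (predictable_sigma T (space M) F) \<rightarrow> {0..T} \<times> path_space T"
      using path_space by (auto simp: space_predictable)
    fix y assume "y \<in> {{0} \<times> A |A. A \<in> sets (?N 0)} \<union> {{s<..t} \<times> A |s t A. 0 \<le> s \<and> s < t \<and> t \<le> T \<and> A \<in> sets (?N s)}"
    then consider A where "y = {0} \<times> A" "A \<in> sets (?N 0)"
      | s t A where "y = {s<..t} \<times> A" "0 \<le> s" "s < t" "t \<le> T" "A \<in> sets (?N s)" by blast
    then show "(\<lambda>v. (fst v, path (snd v))) -` y \<inter> space (predictable_sigma T (space M) F) \<in> sets (predictable_sigma T (space M) F)"
    proof cases
      case 1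
      then have "(\<lambda>v. (fst v, path (snd v))) -` y \<inter> space (predictable_sigma T (space M) F) = {0} \<times> (path -` A \<inter> space M)"
        using T_pos by (auto simp: space_predictable)
      then show ?thesis using predictable_rect0[OF path[OF _ 1(2)]] T_pos by simp
    next
      case 2
      then have "(\<lambda>v. (fst v, path (snd v))) -` y \<inter> space (predictable_sigma T (space M) F) = {s<..t} \<times> (path -` A \<inter> space M)"
        by (auto simp: space_predictable)
      then show ?thesis using predictable_rect[OF 2(2,3,4) path[OF _ 2(5)]] 2 by simp
    qed
  qed
qed

lemma drift_predictable:
  assumes Y: "predictable M T W Y" and Z: "predictable M T W Z"
  shows "predictable M T W (\<lambda>t \<omega>. f t (path \<omega>) (Y t \<omega>) (Z t \<omega>))"
proof -
  let ?P = "predictable_sigma T (space M) F"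
  have "(\<lambda>v. Y (fst v) (snd v)) \<in> borel_measurable ?P" "(\<lambda>v. Z (fst v) (snd v)) \<in> borel_measurable ?P"
    using Y Z by (simp_all add: split_def)
  then have "(\<lambda>v. ((fst v, path (snd v)), (Y (fst v) (snd v), Z (fst v) (snd v)))) \<in> measurable ?P
      (predictable_sigma T (path_space T) (natural_filtration (path_space T) (\<lambda>s w. w s)) \<Otimes>\<^sub>M (borel \<Otimes>\<^sub>M borel))"
    by (intro measurable_Pair path_predictable)
  from measurable_compose[OF this f(1)[unfolded driver_def]] show ?thesis by (simp add: split_def)
qed

end

lemma rcll_continuous:
  assumes "continuous_on {0..T} x"
  shows "rcll T x"
  unfolding rcll_def
proof (intro conjI ballI)
  fix t assume t: "t \<in> {0..<T}"
  have "(x \<longlongrightarrow> x t) (at t within {0..T})" using assms t by (auto simp: continuous_on_def)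
  then have "(x \<longlongrightarrow> x t) (at t within {t..T})" by (rule tendsto_within_subset) (use t in auto)
  then show "(x \<longlongrightarrow> x t) (at_right t)" using t by (simp add: at_within_Icc_at_right)
next
  fix t assume t: "t \<in> {0<..T}"
  have "(x \<longlongrightarrow> x t) (at t within {0..T})" using assms t by (auto simp: continuous_on_def)
  then have "(x \<longlongrightarrow> x t) (at t within {0..t})" by (rule tendsto_within_subset) (use t in auto)
  then show "\<exists>l. (x \<longlongrightarrow> l) (at_left t)" using t by (auto simp: at_within_Icc_at_left)
qed

lemma rcll_right: "rcll T x \<Longrightarrow> t \<in> {0..<T} \<Longrightarrow> (x \<longlongrightarrow> x t) (at_right t)"
  by (simp add: rcll_def)

section \<open>Boundedness of solutions\<close>

context brownian
begin

lemma equation_continuous: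
  assumes "bsde_equation M T W f' \<xi> Y Z (\<lambda>_ _. 0)"
  shows "AE \<omega> in P. continuous_on {0..T} (\<lambda>t. Y t \<omega>)"
proof -
  obtain I where I: "ito_integral M T W Z I"
    and i: "AE \<omega> in P. set_integrable lborel {0..T} (\<lambda>s. f' s (path \<omega>) (Y s \<omega>) (Z s \<omega>))"
    and e: "AE \<omega> in P. \<forall>t\<in>{0..T}. Y t \<omega> = \<xi> \<omega> + (LBINT s:{t..T}. f' s (path \<omega>) (Y s \<omega>) (Z s \<omega>)) - (I T \<omega> - I t \<omega>) + 0 - 0"
    by (rule bsde_equationD[OF assms])
  show ?thesis using i e AE_space
  proof eventually_elim
    case (elim \<omega>)
    have "continuous_on {0..T} (\<lambda>t. \<xi> \<omega> + (LBINT s:{t..T}. f' s (path \<omega>) (Y s \<omega>) (Z s \<omega>)) - (I T \<omega> - I t \<omega>) + 0 - 0)"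
      using elim(3) by (intro continuous_intros continuous_set_integral[OF elim(1)] ito_cont[OF I]) simp
    then show ?case by (subst continuous_on_cong[OF refl elim(2)[rule_format]])
  qed
qed

text \<open>From \<open>\<bar>y\<bar> \<le> 1 + y\<^sup>2\<close> and the isometry at each time,
  followed by Fubini's theorem. In terms of conditional expectations: given \<open>F t\<close>, the
  mean of \<open>\<Phi>\<close> is at most \<open>T * (1 + R)\<close>.\<close>

lemma ito_abs_time_integral:
  assumes I: "ito_integral M T W Z I" and R: "AE \<omega> in P. qv Z T \<omega> \<le> R" and t: "t \<in> {0..T}"
  defines "\<Phi> \<equiv> \<lambda>\<omega>. LBINT s:{t..T}. \<bar>I T \<omega> - I s \<omega>\<bar>"
  shows "integrable P \<Phi>" "B \<in> sets (F t) \<Longrightarrow> (\<integral>\<omega>. indicator B \<omega> * \<Phi> \<omega> \<partial>P) \<le> T * (1 + R) * measure P B"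
proof -
  interpret L: finite_measure L by (rule finite_L)
  interpret PL: pair_sigma_finite P L ..
  have R0: "0 \<le> R"
  proof -
    have "AE \<omega> in P. 0 \<le> R" using R by eventually_elim (use qv_nonneg order_trans in blast)
    then show ?thesis by simp
  qed
  have TT: "T \<in> {0..T}" using T_pos by simp
  have c: "continuous_on {0..T} (\<lambda>s. \<bar>I T \<omega> - I s \<omega>\<bar>)" if "\<omega> \<in> space M" for \<omega>
    by (intro continuous_intros ito_cont[OF I that])
  have "predictable M T W I" by (rule predictable_continuous[OF ito_F[OF I] ito_cont[OF I]])
  from measurable_compose[OF measurable_pair_swap' predictable_pair[OF this]]
  have [measurable]: "(\<lambda>v. I (snd v) (fst v)) \<in> borel_measurable (P \<Otimes>\<^sub>M L)" by (simp add: split_def)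
  have [measurable]: "I T \<in> borel_measurable P" using ito_P[OF I TT] .
  have [measurable]: "snd \<in> borel_measurable (P \<Otimes>\<^sub>M L)"
    by (rule measurable_compose[OF measurable_snd]) (rule measurable_restrict_space1, simp)
  let ?d = "\<lambda>v. indicator {t..T} (snd v) * \<bar>I T (fst v) - I (snd v) (fst v)\<bar> :: real"
  have d[measurable]: "?d \<in> borel_measurable (P \<Otimes>\<^sub>M L)" by measurable
  have \<Phi>L: "\<Phi> \<omega> = (\<integral>s. ?d (\<omega>, s) \<partial>L)" for \<omega>
    unfolding \<Phi>_def set_lebesgue_integral_def using t
    by (subst integral_restrict_space) (auto intro!: Bochner_Integration.integral_cong simp: indicator_def)
  have \<Phi>m[measurable]: "\<Phi> \<in> borel_measurable P"
    unfolding \<Phi>L by (rule L.borel_measurable_lebesgue_integral) (simp add: split_def)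
  have \<Phi>0: "0 \<le> \<Phi> \<omega>" for \<omega> unfolding \<Phi>_def by (rule set_integral_nonneg) simp
  have \<Phi>n: "ennreal (\<Phi> \<omega>) = (\<integral>\<^sup>+s. ennreal (?d (\<omega>, s)) \<partial>L)" if "\<omega> \<in> space M" for \<omega>
  proof -
    have "set_integrable lborel {0..T} (\<lambda>s. \<bar>I T \<omega> - I s \<omega>\<bar>)" using c[OF that] by (rule borel_integrable_atLeastAtMost')
    then have "set_integrable lborel {t..T} (\<lambda>s. \<bar>I T \<omega> - I s \<omega>\<bar>)" by (rule set_integrable_subset) (use t in auto)
    moreover have "(\<lambda>s. indicator {0..T} s *\<^sub>R ?d (\<omega>, s)) = (\<lambda>s. indicator {t..T} s *\<^sub>R \<bar>I T \<omega> - I s \<omega>\<bar>)"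
      using t by (auto simp: fun_eq_iff indicator_def)
    ultimately have "integrable L (\<lambda>s. ?d (\<omega>, s))"
      by (subst integrable_restrict_space) (simp_all add: set_integrable_def)
    then show ?thesis unfolding \<Phi>L by (intro nn_integral_eq_integral[symmetric]) auto
  qed
  have main: "(\<integral>\<^sup>+\<omega>. ennreal (indicator B \<omega> * \<Phi> \<omega>) \<partial>P) \<le> ennreal (T * (1 + R) * measure P B)" if B: "B \<in> sets (F t)" for B
  proof -
    have [measurable]: "B \<in> sets P" using sets_FD[OF B] t by simp
    have one: "(\<integral>\<^sup>+\<omega>. ennreal (indicator B \<omega> * ?d (\<omega>, s)) \<partial>P) \<le> ennreal ((1 + R) * measure P B)" for s
    proof (cases "s \<in> {t..T}")
      case True
      then have s: "0 \<le> s" "s \<le> T" using t by auto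
      have Bs: "B \<in> sets (F s)" using B sets_F_mono True by auto
      have sq: "integrable P (\<lambda>\<omega>. indicator B \<omega> * (I T \<omega> - I s \<omega>)\<^sup>2)"
        using integrable_mult_indicator[OF \<open>B \<in> sets P\<close> ito_sq_integrable[OF I s order_refl R]] by simp
      have iB: "integrable P (indicator B :: 'w \<Rightarrow> real)" by (simp add: less_top[symmetric])
      have q: "integrable P (\<lambda>\<omega>. indicator B \<omega> * (qv Z T \<omega> - qv Z s \<omega>))"
        using integrable_mult_indicator[OF \<open>B \<in> sets P\<close> ito_isometry_set(2)[OF I s order_refl R Bs]] by simp
      have "(\<integral>\<omega>. indicator B \<omega> * (qv Z T \<omega> - qv Z s \<omega>) \<partial>P) \<le> (\<integral>\<omega>. R * indicator B \<omega> \<partial>P)"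
      proof (intro integral_mono_AE q integrable_mult_right iB)
        show "AE \<omega> in P. indicator B \<omega> * (qv Z T \<omega> - qv Z s \<omega>) \<le> R * indicator B \<omega>"
          using R
        proof eventually_elim
          case (elim \<omega>)
          then have "qv Z T \<omega> - qv Z s \<omega> \<le> R" using qv_nonneg[of Z s \<omega>] by linarith
          then show ?case by (simp add: indicator_def)
        qed
      qed
      also have "\<dots> = R * measure P B" using sets.sets_into_space[of B P] by (simp add: Int_absorb2)
      finally have qb: "(\<integral>\<omega>. indicator B \<omega> * (I T \<omega> - I s \<omega>)\<^sup>2 \<partial>P) \<le> R * measure P B"
        using ito_isometry_set(1)[OF I s order_refl R Bs] by simp
      have "(\<integral>\<^sup>+\<omega>. ennreal (indicator B \<omega> * ?d (\<omega>, s)) \<partial>P) \<le> (\<integral>\<^sup>+\<omega>. ennreal (indicator B \<omega> + indicator B \<omega> * (I T \<omega> - I s \<omega>)\<^sup>2) \<partial>P)"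
      proof (intro nn_integral_mono ennreal_leI)
        fix \<omega>
        have "\<bar>y\<bar> \<le> 1 + y\<^sup>2" for y :: real using zero_le_power2[of "\<bar>y\<bar> - 1"] by (simp add: power2_diff)
        then show "indicator B \<omega> * ?d (\<omega>, s) \<le> indicator B \<omega> + indicator B \<omega> * (I T \<omega> - I s \<omega>)\<^sup>2"
          using True by (auto simp: indicator_def)
      qed
      also have "\<dots> = ennreal (\<integral>\<omega>. indicator B \<omega> + indicator B \<omega> * (I T \<omega> - I s \<omega>)\<^sup>2 \<partial>P)"
        using iB sq by (intro nn_integral_eq_integral) auto
      also have "\<dots> \<le> ennreal ((1 + R) * measure P B)"
        using iB sq qb sets.sets_into_space[of B P] by (intro ennreal_leI) (simp add: Int_absorb2 distrib_right)
      finally show ?thesis .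
    next
      case False then show ?thesis by simp
    qed
    have "(\<integral>\<^sup>+\<omega>. ennreal (indicator B \<omega> * \<Phi> \<omega>) \<partial>P) = (\<integral>\<^sup>+\<omega>. \<integral>\<^sup>+s. ennreal (indicator B \<omega> * ?d (\<omega>, s)) \<partial>L \<partial>P)"
      using \<Phi>n by (intro nn_integral_cong) (auto simp: indicator_def)
    also have "\<dots> = (\<integral>\<^sup>+s. \<integral>\<^sup>+\<omega>. ennreal (indicator B \<omega> * ?d (\<omega>, s)) \<partial>P \<partial>L)"
      using PL.Fubini[of "\<lambda>v. ennreal (indicator B (fst v) * ?d v)"] by simp
    also have "\<dots> \<le> (\<integral>\<^sup>+s. ennreal ((1 + R) * measure P B) \<partial>L)" by (intro nn_integral_mono one)
    also have "\<dots> = ennreal ((1 + R) * measure P B) * ennreal T"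
      using T_pos by (simp add: emeasure_restrict_space space_L emeasure_lborel_Icc_eq)
    also have "\<dots> = ennreal (T * (1 + R) * measure P B)" using T_pos R0 by (simp add: ennreal_mult' mult_ac)
    finally show ?thesis .
  qed
  have sp: "space M \<in> sets (F t)" using sets.top[of "F t"] by simp
  have eqn: "(\<integral>\<^sup>+\<omega>. ennreal (\<Phi> \<omega>) \<partial>P) = (\<integral>\<^sup>+\<omega>. ennreal (indicator (space M) \<omega> * \<Phi> \<omega>) \<partial>P)"
    by (intro nn_integral_cong) simp
  show int: "integrable P \<Phi>"
  proof (rule integrableI_bounded)
    have "(\<integral>\<^sup>+\<omega>. ennreal (norm (\<Phi> \<omega>)) \<partial>P) \<le> ennreal (T * (1 + R) * measure P (space M))"
      using main[OF sp] unfolding eqn[symmetric] using \<Phi>0 by simp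
    then show "(\<integral>\<^sup>+\<omega>. ennreal (norm (\<Phi> \<omega>)) \<partial>P) < \<infinity>" by (rule le_less_trans) simp
  qed simp
  assume B: "B \<in> sets (F t)"
  have [measurable]: "B \<in> sets P" using sets_FD[OF B] t by simp
  have iB: "integrable P (\<lambda>\<omega>. indicator B \<omega> * \<Phi> \<omega>)"
    using integrable_mult_indicator[OF \<open>B \<in> sets P\<close> int] by simp
  have "ennreal (\<integral>\<omega>. indicator B \<omega> * \<Phi> \<omega> \<partial>P) \<le> ennreal (T * (1 + R) * measure P B)"
    using main[OF B] nn_integral_eq_integral[OF iB] \<Phi>0 by simp
  then show "(\<integral>\<omega>. indicator B \<omega> * \<Phi> \<omega> \<partial>P) \<le> T * (1 + R) * measure P B"
    using T_pos R0 by (subst (asm) ennreal_le_iff) auto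
qed

end

context bsde
begin

text \<open>With \<open>Z\<close> bounded the drift grows at most linearly in \<open>Y\<close>, and
  the pathwise Gronwall inequality bounds \<open>Y t\<close> by constants, the time integral of
  \<open>\<bar>I T \<omega> - I s \<omega>\<bar>\<close> and an increment of \<open>I\<close>. Given
  \<open>F t\<close>, the conditional mean of this random bound is at most a constant, while
  \<open>Y t\<close> is known at time \<open>t\<close>.\<close>

lemma solution_bounded:
  assumes sol: "bsde_solution M T W f \<xi> Y Z" and Zb: "bounded_process M T Z" and \<xi>b: "AE \<omega> in P. \<bar>\<xi> \<omega>\<bar> \<le> c"
  shows "bounded_process M T Y"
proof -
  have Y: "predictable M T W Y" and Z: "predictable M T W Z" and eq: "bsde_equation M T W f \<xi> Y Z (\<lambda>_ _. 0)"
    using sol by (auto simp: bsde_solution_def)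
  obtain a0 where a0: "AE \<omega> in P. \<forall>t\<in>{0..T}. norm (Z t \<omega>) \<le> a0" using Zb by (auto simp: bounded_process_def)
  define a where "a = \<bar>a0\<bar>"
  have a: "0 \<le> a" "AE \<omega> in P. \<forall>t\<in>{0..T}. norm (Z t \<omega>) \<le> a"
    using a0 by (auto simp: a_def elim!: eventually_mono intro: order_trans[OF _ abs_ge_self])
  obtain C1 where C1: "0 \<le> C1" "\<And>t w y z. t \<in> {0..T} \<Longrightarrow> w \<in> path_space T \<Longrightarrow> norm z \<le> a \<Longrightarrow> \<bar>f t w y z\<bar> \<le> C1 + K * \<bar>y\<bar>"
    using f_growth[OF a(1)] by blast
  obtain I where I: "ito_integral M T W Z I"
    and fi: "AE \<omega> in P. set_integrable lborel {0..T} (\<lambda>s. f s (path \<omega>) (Y s \<omega>) (Z s \<omega>))"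
    and e: "AE \<omega> in P. \<forall>t\<in>{0..T}. Y t \<omega> = \<xi> \<omega> + (LBINT s:{t..T}. f s (path \<omega>) (Y s \<omega>) (Z s \<omega>)) - (I T \<omega> - I t \<omega>) + 0 - 0"
    by (rule bsde_equationD[OF eq])
  have R: "AE \<omega> in P. qv Z T \<omega> \<le> a\<^sup>2 * T"
    using a(2) ito_sq_int[OF I] by eventually_elim (rule qv_bounded, blast)
  have Yc: "AE \<omega> in P. continuous_on {0..T} (\<lambda>t. Y t \<omega>)" by (rule equation_continuous[OF eq])
  define c0 where "c0 = \<bar>c\<bar> + C1 * T"
  define D where "D = K * exp (K * T)"
  \<comment> \<open>The conditional mean of the pathwise bound: the increment of \<open>I\<close>
    has mean 0, and the time integral of \<open>\<bar>I T \<omega> - I s \<omega>\<bar>\<close> has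
    mean at most \<open>T * (1 + a\<^sup>2 * T)\<close>, as the quadratic variation is at most
    \<open>a\<^sup>2 * T\<close>.\<close>
  define C where "C = c0 + D * (c0 * T + T * (1 + a\<^sup>2 * T))"
  have D: "0 \<le> D" using K(1) by (simp add: D_def)
  have c0: "0 \<le> c0" using C1 T_pos by (simp add: c0_def)
  have step: "AE \<omega> in P. \<bar>Y t \<omega>\<bar> \<le> C" if t: "t \<in> {0..T}" for t
  proof -
    let ?\<Phi> = "\<lambda>\<omega>. LBINT s:{t..T}. \<bar>I T \<omega> - I s \<omega>\<bar>"
    note \<Phi> = ito_abs_time_integral[OF I R t]
    have pw: "AE \<omega> in P. \<sigma> * Y t \<omega> \<le> c0 + D * (c0 * T + ?\<Phi> \<omega>) - \<sigma> * (I T \<omega> - I t \<omega>)"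
      if \<sigma>: "\<bar>\<sigma>\<bar> = 1" for \<sigma> :: real
      using a(2) fi e Yc \<xi>b AE_space
    proof eventually_elim
      case (elim \<omega>)
      have \<omega>: "\<omega> \<in> space M" using elim(6) by simp
      define u where "u s = \<bar>Y s \<omega>\<bar>" for s
      define G where "G s = c0 + \<bar>I T \<omega> - I s \<omega>\<bar>" for s
      have u: "continuous_on {t..T} u" unfolding u_def[abs_def]
        using t by (intro continuous_intros continuous_on_subset[OF elim(4)]) auto
      have G: "continuous_on {t..T} G" unfolding G_def[abs_def]
        using t by (intro continuous_intros continuous_on_subset[OF ito_cont[OF I \<omega>]]) auto
      have fb: "\<bar>LBINT r:{s..T}. f r (path \<omega>) (Y r \<omega>) (Z r \<omega>)\<bar> \<le> C1 * T + K * integral {s..T} u" if s: "s \<in> {t..T}" for s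
      proof -
        have sub: "set_integrable lborel {s..T} (\<lambda>r. f r (path \<omega>) (Y r \<omega>) (Z r \<omega>))"
          using elim(2) by (rule set_integrable_subset) (use s t in auto)
        have us: "continuous_on {s..T} u" using u by (rule continuous_on_subset) (use s in auto)
        then have ui: "set_integrable lborel {s..T} u" by (rule borel_integrable_atLeastAtMost')
        have ci: "set_integrable lborel {s..T} (\<lambda>r. C1)" unfolding set_integrable_def by (simp add: emeasure_lborel_Icc_eq)
        have "\<bar>LBINT r:{s..T}. f r (path \<omega>) (Y r \<omega>) (Z r \<omega>)\<bar> \<le> (LBINT r:{s..T}. \<bar>f r (path \<omega>) (Y r \<omega>) (Z r \<omega>)\<bar>)"
          using set_integral_norm_bound[OF sub] by simp
        also have "\<dots> \<le> (LBINT r:{s..T}. C1 + K * u r)"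
        proof (rule set_integral_mono)
          show "set_integrable lborel {s..T} (\<lambda>r. \<bar>f r (path \<omega>) (Y r \<omega>) (Z r \<omega>)\<bar>)" using sub by (rule set_integrable_abs)
          show "set_integrable lborel {s..T} (\<lambda>r. C1 + K * u r)" using ui ci by (intro set_integral_add set_integrable_mult_right) auto
          show "\<bar>f r (path \<omega>) (Y r \<omega>) (Z r \<omega>)\<bar> \<le> C1 + K * u r" if "r \<in> {s..T}" for r
            unfolding u_def using that s t elim(1) path_space[OF \<omega>] by (intro C1(2)) auto
        qed
        also have "\<dots> = C1 * (T - s) + K * integral {s..T} u"
          using ui ci s set_borel_integral_eq_integral(2)[OF ui] by (simp add: set_integral_add set_lebesgue_integral_def[of _ _ "\<lambda>_. C1"])
        also have "\<dots> \<le> C1 * T + K * integral {s..T} u" using C1(1) s t by (intro add_right_mono mult_left_mono) auto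
        finally show ?thesis .
      qed
      have "integral {t..T} u \<le> exp (K * T) * integral {t..T} G"
      proof (rule gronwall_backward[OF u G])
        show "u s \<le> G s + K * integral {s..T} u" if s: "s \<in> {t..T}" for s
        proof -
          have "Y s \<omega> = \<xi> \<omega> + (LBINT r:{s..T}. f r (path \<omega>) (Y r \<omega>) (Z r \<omega>)) - (I T \<omega> - I s \<omega>)"
            using elim(3)[rule_format, of s] s t by simp
          then have "u s \<le> \<bar>\<xi> \<omega>\<bar> + \<bar>LBINT r:{s..T}. f r (path \<omega>) (Y r \<omega>) (Z r \<omega>)\<bar> + \<bar>I T \<omega> - I s \<omega>\<bar>"
            unfolding u_def by linarith
          then show ?thesis using fb[OF s] elim(5) unfolding G_def c0_def by linarith
        qed
        show "0 \<le> G s" for s using c0 by (simp add: G_def)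
      qed (use t K in auto)
      also have "integral {t..T} G = c0 * (T - t) + ?\<Phi> \<omega>"
      proof -
        have ci: "continuous_on {t..T} (\<lambda>s. \<bar>I T \<omega> - I s \<omega>\<bar>)"
          using t by (intro continuous_intros continuous_on_subset[OF ito_cont[OF I \<omega>]]) auto
        have "integral {t..T} G = integral {t..T} (\<lambda>s. c0) + integral {t..T} (\<lambda>s. \<bar>I T \<omega> - I s \<omega>\<bar>)"
          unfolding G_def[abs_def] by (intro Henstock_Kurzweil_Integration.integral_add integrable_continuous_real ci continuous_on_const)
        then show ?thesis using t set_borel_integral_eq_integral(2)[OF borel_integrable_atLeastAtMost'[OF ci]] by simp
      qed
      also have "\<dots> \<le> c0 * T + ?\<Phi> \<omega>" using c0 t by (intro add_right_mono mult_left_mono) auto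
      finally have "integral {t..T} u \<le> exp (K * T) * (c0 * T + ?\<Phi> \<omega>)" by simp
      then have "K * integral {t..T} u \<le> K * (exp (K * T) * (c0 * T + ?\<Phi> \<omega>))" using K(1) by (rule mult_left_mono)
      then have 1: "K * integral {t..T} u \<le> D * (c0 * T + ?\<Phi> \<omega>)" by (simp add: D_def)
      have 2: "\<bar>LBINT r:{t..T}. f r (path \<omega>) (Y r \<omega>) (Z r \<omega>)\<bar> \<le> C1 * T + K * integral {t..T} u" using fb[of t] t by simp
      have "Y t \<omega> = \<xi> \<omega> + (LBINT r:{t..T}. f r (path \<omega>) (Y r \<omega>) (Z r \<omega>)) - (I T \<omega> - I t \<omega>)"
        using elim(3)[rule_format, of t] t by simp
      then have "\<sigma> * Y t \<omega> = \<sigma> * \<xi> \<omega> + \<sigma> * (LBINT r:{t..T}. f r (path \<omega>) (Y r \<omega>) (Z r \<omega>)) - \<sigma> * (I T \<omega> - I t \<omega>)"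
        by (simp only: ring_distribs)
      moreover have "\<sigma> * x \<le> \<bar>x\<bar>" for x using abs_ge_self[of "\<sigma> * x"] \<sigma> by (simp add: abs_mult)
      ultimately have "\<sigma> * Y t \<omega> \<le> \<bar>\<xi> \<omega>\<bar> + \<bar>LBINT r:{t..T}. f r (path \<omega>) (Y r \<omega>) (Z r \<omega>)\<bar> - \<sigma> * (I T \<omega> - I t \<omega>)"
        by (simp add: add_mono)
      then show ?case using 1 2 elim(5) unfolding c0_def by linarith
    qed
    have "AE \<omega> in P. \<sigma> * Y t \<omega> \<le> C" if \<sigma>: "\<bar>\<sigma>\<bar> = 1" for \<sigma> :: real
    proof -
      have [measurable]: "Y t \<in> borel_measurable (F t)" using predictable_F[OF Y t] .
      have YP[measurable]: "Y t \<in> borel_measurable P" using predictable_P[OF Y t] .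
      \<comment> \<open>Integrability of \<open>Y t\<close> is not known beforehand, so the excess
        over \<open>C\<close> is tested on sets where \<open>\<sigma> * Y t \<omega>\<close> is at
        most \<open>n\<close>.\<close>
      have "AE \<omega> in P. \<not> (C < \<sigma> * Y t \<omega> \<and> \<sigma> * Y t \<omega> \<le> real n)" for n
      proof -
        define B where "B = {\<omega>\<in>space (F t). C < \<sigma> * Y t \<omega> \<and> \<sigma> * Y t \<omega> \<le> real n}"
        have B: "B \<in> sets (F t)" unfolding B_def by measurable
        have BP[measurable]: "B \<in> sets P" using sets_FD[OF B] t by simp
        have iB: "integrable P (\<lambda>\<omega>. indicator B \<omega> * g \<omega>)" if "integrable P g" for g :: "'w \<Rightarrow> real"
          using integrable_mult_indicator[OF BP that] by simp
        have mB: "(\<integral>\<omega>. indicator B \<omega> * d \<partial>P) = d * measure P B" for d :: real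
          using sets.sets_into_space[OF BP] by (simp add: Int_absorb2)
        have t': "0 \<le> t" "t \<le> T" using t by auto
        have j: "integrable P (\<lambda>\<omega>. I T \<omega> - I t \<omega>)" by (rule ito_integrable[OF I t' order_refl R])
        let ?h = "\<lambda>\<omega>. indicator B \<omega> * (c0 + D * c0 * T) + D * (indicator B \<omega> * ?\<Phi> \<omega>) - \<sigma> * (indicator B \<omega> * (I T \<omega> - I t \<omega>))"
        have hi: "integrable P (\<lambda>\<omega>. indicator B \<omega> * (c0 + D * c0 * T))" "integrable P (\<lambda>\<omega>. D * (indicator B \<omega> * ?\<Phi> \<omega>))"
          "integrable P (\<lambda>\<omega>. \<sigma> * (indicator B \<omega> * (I T \<omega> - I t \<omega>)))"
          by (intro iB integrable_mult_right \<Phi>(1) j P.integrable_const)+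
        have nn: "0 \<le> indicator B \<omega> * (\<sigma> * Y t \<omega> - C)" for \<omega> by (auto simp: indicator_def B_def)
        have ii: "integrable P (\<lambda>\<omega>. indicator B \<omega> * (\<sigma> * Y t \<omega> - C))"
        proof (rule P.integrable_const_bound[of _ "\<bar>real n\<bar> + \<bar>C\<bar>"])
          show "AE \<omega> in P. norm (indicator B \<omega> * (\<sigma> * Y t \<omega> - C)) \<le> \<bar>real n\<bar> + \<bar>C\<bar>"
            by (rule AE_I2) (auto simp: indicator_def B_def)
        qed measurable
        have "(\<integral>\<omega>. indicator B \<omega> * (\<sigma> * Y t \<omega> - C) \<partial>P) \<le> (\<integral>\<omega>. ?h \<omega> - indicator B \<omega> * C \<partial>P)"
        proof (rule integral_mono_AE[OF ii])
          show "integrable P (\<lambda>\<omega>. ?h \<omega> - indicator B \<omega> * C)"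
            by (intro Bochner_Integration.integrable_diff Bochner_Integration.integrable_add hi iB P.integrable_const)
          show "AE \<omega> in P. indicator B \<omega> * (\<sigma> * Y t \<omega> - C) \<le> ?h \<omega> - indicator B \<omega> * C"
            using pw[OF \<sigma>] by eventually_elim (auto simp: indicator_def algebra_simps)
        qed
        also have "\<dots> = (c0 + D * c0 * T) * measure P B + D * (\<integral>\<omega>. indicator B \<omega> * ?\<Phi> \<omega> \<partial>P) - \<sigma> * (\<integral>\<omega>. indicator B \<omega> * (I T \<omega> - I t \<omega>) \<partial>P) - C * measure P B"
          using hi by (simp only: Bochner_Integration.integral_diff Bochner_Integration.integral_add Bochner_Integration.integrable_diff Bochner_Integration.integrable_add iB P.integrable_const mB integral_mult_right_zero)
        also have "\<dots> \<le> (c0 + D * c0 * T) * measure P B + D * (T * (1 + a\<^sup>2 * T) * measure P B) - C * measure P B"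
          using \<Phi>(2)[OF B] ito_mean_set[OF I t' order_refl R B] D by (simp add: mult_left_mono)
        also have "\<dots> = 0" by (simp add: C_def algebra_simps)
        finally have "(\<integral>\<omega>. indicator B \<omega> * (\<sigma> * Y t \<omega> - C) \<partial>P) = 0"
          by (intro antisym Bochner_Integration.integral_nonneg nn)
        then have "AE \<omega> in P. indicator B \<omega> * (\<sigma> * Y t \<omega> - C) = 0"
          using integral_nonneg_eq_0_iff_AE[OF ii] nn by simp
        then show ?thesis using AE_space by eventually_elim (auto simp: B_def indicator_def split: if_splits)
      qed
      then have "AE \<omega> in P. \<forall>n. \<not> (C < \<sigma> * Y t \<omega> \<and> \<sigma> * Y t \<omega> \<le> real n)" by (simp only: AE_all_countable) simp
      then show ?thesis by eventually_elim (metis not_le real_arch_simple)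
    qed
    from this[of 1] this[of "-1"] have "AE \<omega> in P. Y t \<omega> \<le> C" "AE \<omega> in P. - Y t \<omega> \<le> C" by simp_all
    then show ?thesis by eventually_elim auto
  qed
  have "AE \<omega> in P. \<forall>t\<in>{0..T}. \<bar>Y t \<omega>\<bar> \<le> C"
  proof (rule AE_all_times[OF step continuous_on_const])
    show "AE \<omega> in P. \<forall>t\<in>{0..<T}. ((\<lambda>r. \<bar>Y r \<omega>\<bar>) \<longlongrightarrow> \<bar>Y t \<omega>\<bar>) (at_right t)"
      using Yc by eventually_elim (intro ballI tendsto_rabs rcll_right[of T] rcll_continuous)
  qed
  then show ?thesis unfolding bounded_process_def by auto
qed

section \<open>Comparison\<close>

lemma hit_antimono:
  assumes "finite R'" "R \<subseteq> R'" "R' \<subseteq> {0..T}"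
  shows "hit R' D \<omega> \<le> hit R D \<omega>"
proof -
  have R: "finite R" "R \<subseteq> {0..T}" using assms finite_subset by auto
  show ?thesis
    using hit(4)[OF R, of D \<omega>] hit(1)[OF R, of D \<omega>] hit(2)[OF assms(1,3), of D \<omega>] hit(3)[OF assms(1,3), of "hit R D \<omega>" \<omega> D] assms(2)
    by auto
qed

text \<open>The hitting times decrease to a limit \<open>S\<close>. From \<open>t\<close> up to
  \<open>S\<close> the process is nonnegative: a negative value would persist to the right and be
  seen at a point of a fine grid. So only the shrinking interval between \<open>S\<close> and the
  hitting time can contribute.\<close>

lemma hit_negative_part:
  fixes U :: "real \<Rightarrow> 'w \<Rightarrow> real"
  assumes t: "t \<in> {0..T}" and \<omega>: "\<omega> \<in> space M"
    and Um: "(\<lambda>s. U s \<omega>) \<in> borel_measurable L" and bd: "\<And>s. s \<in> {0..T} \<Longrightarrow> \<bar>U s \<omega>\<bar> \<le> c"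
    and rc: "\<And>s. s \<in> {0..<T} \<Longrightarrow> ((\<lambda>r. U r \<omega>) \<longlongrightarrow> U s \<omega>) (at_right s)"
  shows "(\<lambda>p. LBINT s:{t..hit (grid t p) (\<lambda>s. {\<omega>\<in>space M. U s \<omega> \<le> 0}) \<omega>}. max 0 (- U s \<omega>)) \<longlonglongrightarrow> 0"
proof -
  let ?h = "\<lambda>p. hit (grid t p) (\<lambda>s. {\<omega>\<in>space M. U s \<omega> \<le> 0}) \<omega>"
  note g = grid[OF t]
  have hT: "?h p \<in> {t..T}" for p using hit(1)[OF g(1,3), of p "\<lambda>s. {\<omega>\<in>space M. U s \<omega> \<le> 0}" \<omega>] g(2)[of p] t by auto
  have dec: "p \<le> q \<Longrightarrow> ?h q \<le> ?h p" for p q by (intro hit_antimono g grid_mono)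
  define S where "S = Inf (range ?h)"
  have bdd: "bdd_below (range ?h)" by (rule bdd_belowI[of _ t]) (use hT in auto)
  have ST: "S \<le> ?h p" for p unfolding S_def by (intro cInf_lower bdd) auto
  let ?f = "\<lambda>p s. indicator {t..?h p} s *\<^sub>R max 0 (- U s \<omega>)"
  have m: "?f p \<in> borel_measurable lborel" for p
  proof -
    have "(\<lambda>s. indicator {t..?h p} s *\<^sub>R max 0 (- U s \<omega>)) = (\<lambda>s. indicator {t..?h p} s *\<^sub>R (indicator {0..T} s *\<^sub>R max 0 (- U s \<omega>)))"
      using hT[of p] t by (auto simp: indicator_def fun_eq_iff)
    moreover have "(\<lambda>s. max 0 (- U s \<omega>)) \<in> borel_measurable L" using Um by measurable
    from set_borel_L[OF this] have "(\<lambda>s. indicator {0..T} s *\<^sub>R max 0 (- U s \<omega>)) \<in> borel_measurable lborel"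
      by (simp add: set_borel_measurable_def)
    ultimately show ?thesis by simp
  qed
  have "(\<lambda>p. integral\<^sup>L lborel (?f p)) \<longlonglongrightarrow> integral\<^sup>L lborel (\<lambda>s::real. 0)"
  proof (rule integral_dominated_convergence[where w = "\<lambda>s. indicator {0..T} s *\<^sub>R c" and s = ?f and f = "\<lambda>_. 0"])
    show "?f p \<in> borel_measurable lborel" for p by (rule m)
    show "integrable lborel (\<lambda>s. indicator {0..T} s *\<^sub>R c)" by (simp add: emeasure_lborel_Icc_eq)
    show "AE s in lborel. norm (?f p s) \<le> indicator {0..T} s *\<^sub>R c" for p
    proof (rule AE_I2)
      fix s show "norm (?f p s) \<le> indicator {0..T} s *\<^sub>R c"
        using hT[of p] t bd[of s] by (auto simp: indicator_def)
    qed
    show "AE s in lborel. (\<lambda>p. ?f p s) \<longlonglongrightarrow> 0"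
      using AE_lborel_singleton[of S]
    proof eventually_elim
      case (elim s)
      show ?case
      proof (cases "S < s")
        case True
        then obtain p where "?h p < s" using cInf_lessD[of "range ?h" s] unfolding S_def by auto
        then have "\<forall>q\<ge>p. ?f q s = 0"
          using dec[of p] by (fastforce simp: indicator_def)
        then have "eventually (\<lambda>q. ?f q s = 0) sequentially" unfolding eventually_sequentially by blast
        then show ?thesis by (rule tendsto_eventually)
      next
        case False
        then have s: "s < S" using elim by simp
        have "0 \<le> U s \<omega>" if ts: "t \<le> s"
        proof (rule ccontr)
          assume n: "\<not> 0 \<le> U s \<omega>"
          have sT: "s < T" using s ST[of 0] hT[of 0] by auto
          have "eventually (\<lambda>r. U r \<omega> < 0) (at_right s)" using order_tendstoD(2)[OF rc[of s], of 0] n sT ts t by auto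
          then obtain b where b: "s < b" "\<And>r. s < r \<Longrightarrow> r < b \<Longrightarrow> U r \<omega> < 0" unfolding eventually_at_right_field by blast
          obtain p x where x: "x \<in> grid t p" "s < x" "x < min S b"
            by (rule grid_dense[OF t, of s "min S b"]) (use ts s b ST[of 0] hT[of 0] in auto)
          then have "?h p \<le> x" using b(2)[of x] \<omega> by (intro hit(3)[OF g(1,3)]) auto
          then show False using ST[of p] x by auto
        qed
        then have "?f p s = 0" for p by (auto simp: indicator_def)
        then show ?thesis by (simp only: tendsto_const)
      qed
    qed
  qed simp
  then show ?thesis by (simp add: set_lebesgue_integral_def)
qed

lemma bounded_integrable:
  fixes h :: "real \<Rightarrow> real"
  assumes h: "h \<in> borel_measurable L" "\<And>s. s \<in> {0..T} \<Longrightarrow> \<bar>h s\<bar> \<le> d"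
  shows "set_integrable lborel {0..T} h"
proof (rule set_integrable_bound[of lborel "{0..T}" "\<lambda>_. d"])
  show "set_integrable lborel {0..T} (\<lambda>_. d)" unfolding set_integrable_def by (simp add: emeasure_lborel_Icc_eq)
qed (use set_borel_L[OF h(1)] h(2) in force)+

lemma norm_integrable:
  assumes "sq_int Z \<omega>" "(\<lambda>s. Z s \<omega>) \<in> borel_measurable L"
  shows "set_integrable lborel {0..T} (\<lambda>s. norm (Z s \<omega>))"
proof (rule set_integrable_bound)
  show "set_integrable lborel {0..T} (\<lambda>s. 1 + (norm (Z s \<omega>))\<^sup>2)"
    using assms(1) bounded_integrable[of "\<lambda>_. 1" 1] by (intro set_integral_add(1)) (auto simp: sq_int_def)
  have "norm x \<le> 1 + (norm x)\<^sup>2" for x :: "real^'d"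
  proof -
    have "2 * norm x \<le> (norm x)\<^sup>2 + 1" using zero_le_power2[of "norm x - 1"] by (simp add: power2_diff)
    then show ?thesis using norm_ge_zero[of x] by linarith
  qed
  then show "AE x in lborel. x \<in> {0..T} \<longrightarrow> norm (norm (Z x \<omega>)) \<le> norm (1 + (norm (Z x \<omega>))\<^sup>2)" by simp
qed (use set_borel_L[of "\<lambda>s. norm (Z s \<omega>)"] assms(2) in simp)

text \<open>If \<open>U t\<close> exceeded the bound by \<open>2 * d\<close> on \<open>B\<close>, then up to the first grid time at which \<open>U \<le> 0\<close> the
  exponent \<open>lexp l\<close> would stay bounded above and end below \<open>-1\<close> once \<open>l\<close> is large, since the term
  \<open>b * norm \<zeta>\<close> is absorbed by the quadratic variation; this contradicts the submartingale inequality.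
  Only grid times are available for stopping, so \<open>U\<close> may become negative in between; that error
  vanishes with the mesh.\<close>

lemma comparison_step:
  fixes U :: "real \<Rightarrow> 'w \<Rightarrow> real"
  assumes I: "ito_integral M T W \<zeta> N" and U: "predictable M T W U" and t: "t \<in> {0..T}"
    and b: "0 \<le> b" and k: "0 \<le> k" and e: "0 \<le> e"
    and m: "continuous_on {0..T} m" "\<And>s. s \<in> {0..T} \<Longrightarrow> 0 \<le> m s"
    and rc: "AE \<omega> in P. \<forall>s\<in>{0..<T}. ((\<lambda>r. U r \<omega>) \<longlongrightarrow> U s \<omega>) (at_right s)"
    and bd: "AE \<omega> in P. \<forall>s\<in>{0..T}. \<bar>U s \<omega>\<bar> \<le> c"
    and ter: "AE \<omega> in P. U T \<omega> \<le> e" and um: "AE \<omega> in P. \<forall>s\<in>{0..T}. U s \<omega> \<le> m s"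
    and inc: "AE \<omega> in P. \<forall>u v. 0 \<le> u \<longrightarrow> u \<le> v \<longrightarrow> v \<le> T \<longrightarrow>
      N v \<omega> - N u \<omega> \<le> U v \<omega> - U u \<omega> + (LBINT s:{u..v}. k * \<bar>U s \<omega>\<bar> + b * norm (\<zeta> s \<omega>))"
  shows "AE \<omega> in P. U t \<omega> \<le> e + k * (LBINT s:{t..T}. m s)"
proof -
  note g = grid[OF t]
  define m' where "m' = (LBINT s:{t..T}. m s)"
  have mi: "set_integrable lborel {u..v} m" if "0 \<le> u" "v \<le> T" for u v
    using borel_integrable_atLeastAtMost'[OF m(1)] by (rule set_integrable_subset) (use that in auto)
  have m'0: "0 \<le> m'" unfolding m'_def using m(2) t by (intro set_integral_nonneg) auto
  have c0: "0 \<le> c"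
  proof -
    have "AE \<omega> in P. 0 \<le> c" using bd by eventually_elim (use t in force)
    then show ?thesis by simp
  qed
  define J where "J v \<omega> = (LBINT s:{t..v}. max 0 (- U s \<omega>))" for v \<omega>
  have UL: "(\<lambda>s. U s \<omega>) \<in> borel_measurable L" if "\<omega> \<in> space M" for \<omega> using predictable_section[OF U that] .
  have lb: "AE \<omega> in P. \<forall>v\<in>{t..T}. lexp l \<zeta> N t v \<omega> \<le> l * (U v \<omega> - U t \<omega> + k * m' + k * J v \<omega>) + b\<^sup>2 * T / 2 \<and> J v \<omega> \<le> c * T"
    if l: "0 < l" for l
    using bd um inc ito_sq_int[OF I] AE_space
  proof eventually_elim
    case (elim \<omega>)
    have \<omega>: "\<omega> \<in> space M" using elim(5) by simp
    have [measurable]: "(\<lambda>s. U s \<omega>) \<in> borel_measurable L" "(\<lambda>s. \<zeta> s \<omega>) \<in> borel_measurable L"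
      using UL[OF \<omega>] predictable_section[OF ito_predictable[OF I] \<omega>] by auto
    have iU: "set_integrable lborel {0..T} (\<lambda>s. \<bar>U s \<omega>\<bar>)" using elim(1) by (intro bounded_integrable[of _ c]) auto
    have iJ: "set_integrable lborel {0..T} (\<lambda>s. max 0 (- U s \<omega>))" using elim(1) c0 by (intro bounded_integrable[of _ c]) (auto simp: abs_le_iff)
    have iq: "set_integrable lborel {0..T} (\<lambda>s. (norm (\<zeta> s \<omega>))\<^sup>2)" using elim(4) by (simp add: sq_int_def)
    have iz: "set_integrable lborel {0..T} (\<lambda>s. norm (\<zeta> s \<omega>))" using elim(4) by (rule norm_integrable) simp
    show ?case
    proof
      fix v assume v: "v \<in> {t..T}"
      have sub: "set_integrable lborel {t..v} h" if "set_integrable lborel {0..T} h" for h :: "real \<Rightarrow> real"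
        using that by (rule set_integrable_subset) (use v t in auto)
      note i = sub[OF iU] sub[OF iJ] sub[OF iq] sub[OF iz]
      have im: "set_integrable lborel {t..v} m" using mi v t by auto
      have ic: "set_integrable lborel {t..v} (\<lambda>_. b\<^sup>2 / 2 :: real)" unfolding set_integrable_def by (simp add: emeasure_lborel_Icc_eq)
      have qd: "qv \<zeta> v \<omega> - qv \<zeta> t \<omega> = (LBINT s:{t..v}. (norm (\<zeta> s \<omega>))\<^sup>2)" using qv_diff[OF elim(4)] v t by auto
      have "N v \<omega> - N t \<omega> \<le> U v \<omega> - U t \<omega> + (LBINT s:{t..v}. k * \<bar>U s \<omega>\<bar> + b * norm (\<zeta> s \<omega>))" using elim(3) v t by auto
      then have "l * (N v \<omega> - N t \<omega>) \<le> l * (U v \<omega> - U t \<omega> + (LBINT s:{t..v}. k * \<bar>U s \<omega>\<bar> + b * norm (\<zeta> s \<omega>)))"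
        using l by (intro mult_left_mono) auto
      then have "lexp l \<zeta> N t v \<omega> \<le> l * (U v \<omega> - U t \<omega>) + (l * (LBINT s:{t..v}. k * \<bar>U s \<omega>\<bar> + b * norm (\<zeta> s \<omega>)) - l\<^sup>2 / 2 * (LBINT s:{t..v}. (norm (\<zeta> s \<omega>))\<^sup>2))"
        unfolding lexp_def qd by (simp add: distrib_left)
      also have "l * (LBINT s:{t..v}. k * \<bar>U s \<omega>\<bar> + b * norm (\<zeta> s \<omega>)) - l\<^sup>2 / 2 * (LBINT s:{t..v}. (norm (\<zeta> s \<omega>))\<^sup>2)
        = (LBINT s:{t..v}. l * (k * \<bar>U s \<omega>\<bar> + b * norm (\<zeta> s \<omega>)) - l\<^sup>2 / 2 * (norm (\<zeta> s \<omega>))\<^sup>2)"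
        using i by (subst set_integral_diff(2)) (auto intro!: set_integral_add(1) set_integrable_mult_right)
      also have "\<dots> \<le> (LBINT s:{t..v}. (l * k) * (m s + max 0 (- U s \<omega>)) + b\<^sup>2 / 2)"
      proof (rule set_integral_mono)
        show "set_integrable lborel {t..v} (\<lambda>s. l * (k * \<bar>U s \<omega>\<bar> + b * norm (\<zeta> s \<omega>)) - l\<^sup>2 / 2 * (norm (\<zeta> s \<omega>))\<^sup>2)"
          using i by (intro set_integral_diff(1) set_integrable_mult_right set_integral_add(1)) auto
        show "set_integrable lborel {t..v} (\<lambda>s. (l * k) * (m s + max 0 (- U s \<omega>)) + b\<^sup>2 / 2)"
          using i im ic by (intro set_integrable_mult_right set_integral_add(1)) auto
        fix s assume s: "s \<in> {t..v}"
        \<comment> \<open>The bound \<open>m\<close> controls only the positive part of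
          \<open>U\<close>; the integral of the negative part is carried along as
          \<open>J\<close>.\<close>
        have "\<bar>U s \<omega>\<bar> \<le> m s + max 0 (- U s \<omega>)" using elim(2) m(2)[of s] s v t by (auto simp: max_def)
        then have 1: "(l * k) * \<bar>U s \<omega>\<bar> \<le> (l * k) * (m s + max 0 (- U s \<omega>))" using l k by (intro mult_left_mono) auto
        \<comment> \<open>Completing the square leaves \<open>b\<^sup>2 / 2\<close>, which does not
          depend on \<open>l\<close>; this is what allows \<open>l\<close> to be taken large
          afterwards.\<close>
        have 2: "l * (b * norm (\<zeta> s \<omega>)) - l\<^sup>2 / 2 * (norm (\<zeta> s \<omega>))\<^sup>2 \<le> b\<^sup>2 / 2"
          using zero_le_power2[of "l * norm (\<zeta> s \<omega>) - b"] by (simp add: power2_diff power_mult_distrib algebra_simps)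
        have "l * (k * \<bar>U s \<omega>\<bar> + b * norm (\<zeta> s \<omega>)) = (l * k) * \<bar>U s \<omega>\<bar> + l * (b * norm (\<zeta> s \<omega>))" by (simp add: algebra_simps)
        then show "l * (k * \<bar>U s \<omega>\<bar> + b * norm (\<zeta> s \<omega>)) - l\<^sup>2 / 2 * (norm (\<zeta> s \<omega>))\<^sup>2 \<le> (l * k) * (m s + max 0 (- U s \<omega>)) + b\<^sup>2 / 2"
          using 1 2 by linarith
      qed
      also have "\<dots> = (l * k) * ((LBINT s:{t..v}. m s) + J v \<omega>) + b\<^sup>2 / 2 * (v - t)"
      proof -
        have "(LBINT s:{t..v}. b\<^sup>2 / 2) = b\<^sup>2 / 2 * (v - t)" using v by (simp add: set_lebesgue_integral_def)
        then show ?thesis using i im ic by (simp add: set_integral_add J_def)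
      qed
      also have "\<dots> \<le> (l * k) * (m' + J v \<omega>) + b\<^sup>2 / 2 * T"
      proof -
        have "(LBINT s:{t..T}. m s) = (LBINT s:{t..v}. m s) + (LBINT s:{v..T}. m s)"
          using set_integral_split[OF mi[of 0 T], of t v T] t v by auto
        moreover have "0 \<le> (LBINT s:{v..T}. m s)" using m(2) t v by (intro set_integral_nonneg) auto
        ultimately have "(LBINT s:{t..v}. m s) \<le> m'" by (simp add: m'_def)
        then show ?thesis using l k t v by (intro add_mono mult_left_mono) auto
      qed
      finally have A: "lexp l \<zeta> N t v \<omega> \<le> l * (U v \<omega> - U t \<omega> + k * m' + k * J v \<omega>) + b\<^sup>2 * T / 2"
        by (simp add: algebra_simps)
      have "J v \<omega> \<le> (LBINT s:{t..v}. c)"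
        unfolding J_def
      proof (rule set_integral_mono[OF i(2)])
        show "set_integrable lborel {t..v} (\<lambda>_. c)" unfolding set_integrable_def by (simp add: emeasure_lborel_Icc_eq)
        show "max 0 (- U s \<omega>) \<le> c" if "s \<in> {t..v}" for s using elim(1) c0 that v t by (auto simp: abs_le_iff)
      qed
      also have "\<dots> = c * (v - t)" using v by (simp add: set_lebesgue_integral_def)
      also have "\<dots> \<le> c * T" using c0 v t by (intro mult_left_mono) auto
      finally show "lexp l \<zeta> N t v \<omega> \<le> l * (U v \<omega> - U t \<omega> + k * m' + k * J v \<omega>) + b\<^sup>2 * T / 2 \<and> J v \<omega> \<le> c * T" using A by simp
    qed
  qed
  have "AE \<omega> in P. \<not> (e + k * m' + 2 * d < U t \<omega>)" if d: "0 < d" for d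
  proof -
    define B where "B = {\<omega>\<in>space (F t). e + k * m' + 2 * d < U t \<omega>}"
    have [measurable]: "U t \<in> borel_measurable (F t)" using predictable_F[OF U t] .
    have B: "B \<in> sets (F t)" unfolding B_def by measurable
    have BP[measurable]: "B \<in> sets P" using sets_FD[OF B] t by simp
    \<comment> \<open>Chosen so that a drop of \<open>d\<close> gives the exponent
      \<open>- l * d + b\<^sup>2 * T / 2 = - 1\<close>. Of the assumed excess \<open>2 * d\<close>,
      one \<open>d\<close> is reserved for the error \<open>k * J\<close>.\<close>
    define l where "l = (b\<^sup>2 * T / 2 + 1) / d"
    have l: "0 < l" "l * d = b\<^sup>2 * T / 2 + 1" using d T_pos by (simp_all add: l_def add_nonneg_pos)
    let ?D = "\<lambda>s. {\<omega>\<in>space M. U s \<omega> \<le> 0}"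
    let ?h = "\<lambda>p. hit (grid t p) ?D"
    have hT: "?h p \<omega> \<in> {t..T}" for p \<omega> using hit(1)[OF g(1,3), of p ?D \<omega>] g(2)[of p] t by auto
    have D: "?D s \<in> sets (F s)" if "s \<in> grid t p" for s p
    proof -
      have "s \<in> {0..T}" using that g(3) by blast
      then have [measurable]: "U s \<in> borel_measurable (F s)" by (rule predictable_F[OF U])
      have "{\<omega>\<in>space (F s). U s \<omega> \<le> 0} \<in> sets (F s)" by measurable
      then show ?thesis by simp
    qed
    let ?Z = "\<lambda>p s \<omega>. if s \<le> ?h p \<omega> then \<zeta> s \<omega> else 0" and ?N = "\<lambda>p s \<omega>. N (min s (?h p \<omega>)) \<omega>"
    have J: "ito_integral M T W (?Z p) (?N p)" for p by (rule ito_hit[OF I g(1,3) D])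
    have st: "lexp l (?Z p) (?N p) t u \<omega> = lexp l \<zeta> N t (min u (?h p \<omega>)) \<omega>" if "u \<in> {t..T}" for p u \<omega>
      using that hT[of p \<omega>] t qv_stop[of "?h p" \<omega> u \<zeta>] qv_stop[of "?h p" \<omega> t \<zeta>] by (simp add: lexp_def)
    define C where "C = l * (2 * c + k * m' + k * (c * T)) + b\<^sup>2 * T / 2"
    have Cb: "AE \<omega> in P. \<forall>u\<in>{t..T}. lexp l (?Z p) (?N p) t u \<omega> \<le> C" for p
      using lb[OF l(1)] bd
    proof eventually_elim
      case (elim \<omega>)
      show ?case
      proof
        fix u assume u: "u \<in> {t..T}"
        let ?v = "min u (?h p \<omega>)"
        have v: "?v \<in> {t..T}" using u hT[of p \<omega>] by auto
        have "U ?v \<omega> - U t \<omega> \<le> 2 * c" using elim(2)[rule_format, of ?v] elim(2)[rule_format, of t] v t by auto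
        moreover have "k * J ?v \<omega> \<le> k * (c * T)" using elim(1) v k by (intro mult_left_mono) auto
        ultimately have "l * (U ?v \<omega> - U t \<omega> + k * m' + k * J ?v \<omega>) \<le> l * (2 * c + k * m' + k * (c * T))"
          using l by (intro mult_left_mono) auto
        then show "lexp l (?Z p) (?N p) t u \<omega> \<le> C" unfolding st[OF u] C_def using elim(1) v by fastforce
      qed
    qed
    let ?u = "\<lambda>p \<omega>. indicator B \<omega> * ennreal (exp (lexp l (?Z p) (?N p) t T \<omega>))"
    have um: "?u p \<in> borel_measurable P" for p
    proof -
      have [measurable]: "lexp l (?Z p) (?N p) t T \<in> borel_measurable P" using t T_pos by (intro lexp_measurable[OF J]) auto
      show ?thesis by measurable
    qed
    have "emeasure P B \<le> (\<integral>\<^sup>+\<omega>. ?u p \<omega> \<partial>P)" for p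
      using Cb[of p] t B by (intro exp_submartingale[OF J, of t B l p C]) (auto elim!: eventually_mono)
    then have "emeasure P B \<le> limsup (\<lambda>p. \<integral>\<^sup>+\<omega>. ?u p \<omega> \<partial>P)" by (intro le_Limsup) auto
    also have "\<dots> \<le> (\<integral>\<^sup>+\<omega>. limsup (\<lambda>p. ?u p \<omega>) \<partial>P)"
    proof (rule nn_integral_limsup[where w = "\<lambda>_. ennreal (exp C)", OF um])
      show "AE \<omega> in P. ?u p \<omega> \<le> ennreal (exp C)" for p
        using Cb[of p] by eventually_elim (use t in \<open>auto simp: indicator_def intro!: ennreal_leI\<close>)
    qed (simp_all add: P.emeasure_space_1[simplified])
    also have "\<dots> \<le> (\<integral>\<^sup>+\<omega>. ennreal (exp (-1)) * indicator B \<omega> \<partial>P)"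
    proof (rule nn_integral_mono_AE)
      show "AE \<omega> in P. limsup (\<lambda>p. ?u p \<omega>) \<le> ennreal (exp (-1)) * indicator B \<omega>"
        using lb[OF l(1)] rc bd ter AE_space
      proof eventually_elim
        case (elim \<omega>)
        have \<omega>: "\<omega> \<in> space M" using elim(5) by simp
        show ?case
        proof (cases "\<omega> \<in> B")
          case True
          have "(\<lambda>p. J (?h p \<omega>) \<omega>) \<longlonglongrightarrow> 0"
            unfolding J_def using elim(2,3) by (intro hit_negative_part[where c = c] t \<omega> UL[OF \<omega>]) auto
          then have "(\<lambda>p. k * J (?h p \<omega>) \<omega>) \<longlonglongrightarrow> k * 0" by (rule tendsto_mult[OF tendsto_const])
          then have "eventually (\<lambda>p. k * J (?h p \<omega>) \<omega> < d) sequentially" using order_tendstoD(2)[of _ "k * 0" _ d] d by simp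
          then have "eventually (\<lambda>p. ?u p \<omega> \<le> ennreal (exp (-1))) sequentially"
          proof eventually_elim
            case (elim p)
            have "U (?h p \<omega>) \<omega> \<le> e"
              using hit(4)[OF g(1,3), of p ?D \<omega>] \<open>U T \<omega> \<le> e\<close> e by auto
            moreover have "e + k * m' + 2 * d < U t \<omega>" using True by (simp add: B_def)
            ultimately have "U (?h p \<omega>) \<omega> - U t \<omega> + k * m' + k * J (?h p \<omega>) \<omega> \<le> - d" using elim by linarith
            then have "l * (U (?h p \<omega>) \<omega> - U t \<omega> + k * m' + k * J (?h p \<omega>) \<omega>) \<le> l * (- d)" using l by (intro mult_left_mono) auto
            moreover have "lexp l \<zeta> N t (?h p \<omega>) \<omega> \<le> l * (U (?h p \<omega>) \<omega> - U t \<omega> + k * m' + k * J (?h p \<omega>) \<omega>) + b\<^sup>2 * T / 2"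
              using \<open>\<forall>v\<in>{t..T}. lexp l \<zeta> N t v \<omega> \<le> _ v \<and> _ v\<close> hT by blast
            ultimately have "lexp l \<zeta> N t (?h p \<omega>) \<omega> \<le> -1" using l(2) by simp
            then show ?case using True st[of T p \<omega>] hT[of p \<omega>] t by (auto intro!: ennreal_leI)
          qed
          then show ?thesis using True by (simp add: Limsup_bounded)
        next
          case False
          then show ?thesis by (simp add: Limsup_const)
        qed
      qed
    qed
    also have "\<dots> = ennreal (exp (-1)) * emeasure P B" by (simp add: nn_integral_cmult_indicator)
    finally have "measure P B \<le> exp (-1) * measure P B" by (simp add: P.emeasure_eq_measure ennreal_mult[symmetric])
    moreover have "exp (-1) < (1::real)" by simp
    ultimately have "measure P B = 0"
      using mult_strict_right_mono[of "exp (-1)" 1 "measure P B"] measure_nonneg[of P B] by (cases "measure P B = 0") auto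
    then have "B \<in> null_sets P" by (simp add: null_sets_def P.emeasure_eq_measure)
    from AE_not_in[OF this] AE_space show ?thesis by eventually_elim (simp add: B_def)
  qed
  then have "AE \<omega> in P. \<forall>n. \<not> (e + k * m' + 2 * (1 / real (Suc n)) < U t \<omega>)"
    unfolding AE_all_countable by (intro allI) (metis of_nat_0_less_iff zero_less_Suc zero_less_divide_1_iff)
  then show ?thesis
  proof eventually_elim
    case (elim \<omega>)
    have "(\<lambda>n. e + k * m' + 2 * (1 / real (Suc n))) \<longlonglongrightarrow> e + k * m' + 2 * 0"
      using LIMSEQ_inverse_real_of_nat by (intro tendsto_add tendsto_mult tendsto_const) (simp add: inverse_eq_divide)
    from LIMSEQ_le_const[OF this, of "U t \<omega>"] elim show ?case by (auto simp: m'_def not_less)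
  qed
qed

text \<open>The rate \<open>2 * k\<close> makes the iteration contract: \<open>k\<close> times the
  integral of \<open>exp (2 * k * (T - s))\<close> over \<open>{t..T}\<close> is
  \<open>(exp (2 * k * (T - t)) - 1) / 2\<close>, less than half of the bound at time
  \<open>t\<close>. The a priori bound \<open>c\<close> is thus halved in each round and leaves no
  trace in the limit; neither does \<open>b\<close>, which governs only the choice of
  \<open>l\<close> in \<open>comparison_step\<close>.\<close>

lemma comparison_abstract:
  fixes U :: "real \<Rightarrow> 'w \<Rightarrow> real"
  assumes I: "ito_integral M T W \<zeta> N" and U: "predictable M T W U"
    and b: "0 \<le> b" and k: "0 \<le> k" and e: "0 \<le> e"
    and rc: "AE \<omega> in P. \<forall>s\<in>{0..<T}. ((\<lambda>r. U r \<omega>) \<longlongrightarrow> U s \<omega>) (at_right s)"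
    and bd: "AE \<omega> in P. \<forall>s\<in>{0..T}. \<bar>U s \<omega>\<bar> \<le> c" and ter: "AE \<omega> in P. U T \<omega> \<le> e"
    and inc: "AE \<omega> in P. \<forall>u v. 0 \<le> u \<longrightarrow> u \<le> v \<longrightarrow> v \<le> T \<longrightarrow>
      N v \<omega> - N u \<omega> \<le> U v \<omega> - U u \<omega> + (LBINT s:{u..v}. k * \<bar>U s \<omega>\<bar> + b * norm (\<zeta> s \<omega>))"
  shows "AE \<omega> in P. \<forall>s\<in>{0..T}. U s \<omega> \<le> e * exp (2 * k * (T - s))"
proof -
  have c0: "0 \<le> c"
  proof -
    have "AE \<omega> in P. 0 \<le> c" using bd by eventually_elim (use T_pos in force)
    then show ?thesis by simp
  qed
  \<comment> \<open>\<open>comparison_step\<close> maps the bound \<open>\<theta> * exp (2 * k * (T - s))\<close> to the same one with \<open>max e (\<theta> / 2)\<close>.\<close>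
  define \<theta> where "\<theta> j = max e (c / 2^j)" for j :: nat
  have \<theta>0: "0 \<le> \<theta> j" for j using e by (simp add: \<theta>_def)
  have "AE \<omega> in P. \<forall>s\<in>{0..T}. U s \<omega> \<le> \<theta> j * exp (2 * k * (T - s))" for j
  proof (induction j)
    case 0
    show ?case using bd
    proof eventually_elim
      case (elim \<omega>)
      show ?case
      proof
        fix s assume s: "s \<in> {0..T}"
        have "1 \<le> exp (2 * k * (T - s))" using k s by simp
        then have "\<theta> 0 * 1 \<le> \<theta> 0 * exp (2 * k * (T - s))" using \<theta>0 by (intro mult_left_mono) auto
        moreover have "U s \<omega> \<le> \<theta> 0" using elim s by (force simp: \<theta>_def max_def abs_le_iff)
        ultimately show "U s \<omega> \<le> \<theta> 0 * exp (2 * k * (T - s))" by simp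
      qed
    qed
  next
    case (Suc j)
    let ?m = "\<lambda>s. \<theta> j * exp (2 * k * (T - s))"
    have mc: "continuous_on S ?m" for S by (intro continuous_intros)
    show ?case
    proof (rule AE_all_times[OF _ _ rc])
      show "continuous_on {0..T} (\<lambda>s. \<theta> (Suc j) * exp (2 * k * (T - s)))" by (intro continuous_intros)
      fix t assume t: "t \<in> {0..T}"
      have "k * (LBINT s:{t..T}. ?m s) = \<theta> j / 2 * (exp (2 * k * (T - t)) - 1)"
      proof -
        have "((\<lambda>s. k * ?m s) has_integral (- \<theta> j / 2 * exp (2 * k * (T - T)) - (- \<theta> j / 2 * exp (2 * k * (T - t))))) {t..T}"
          using t by (intro fundamental_theorem_of_calculus)
            (auto intro!: derivative_eq_intros simp: has_real_derivative_iff_has_vector_derivative[symmetric])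
        then have 1: "integral {t..T} (\<lambda>s. k * ?m s) = \<theta> j / 2 * (exp (2 * k * (T - t)) - 1)"
          by (subst integral_unique, assumption) (simp add: algebra_simps)
        have "k * (LBINT s:{t..T}. ?m s) = (LBINT s:{t..T}. k * ?m s)" by (rule set_integral_mult_right[symmetric])
        also have "\<dots> = integral {t..T} (\<lambda>s. k * ?m s)"
          by (intro set_borel_integral_eq_integral borel_integrable_atLeastAtMost' continuous_intros)
        finally show ?thesis using 1 by (rule trans)
      qed
      moreover have "e + \<theta> j / 2 * (E - 1) \<le> \<theta> (Suc j) * E" if E: "1 \<le> E" for E
      proof -
        have 1: "e \<le> \<theta> (Suc j)" "\<theta> j / 2 \<le> \<theta> (Suc j)" using e by (auto simp: \<theta>_def max_def)
        have "\<theta> j / 2 * (E - 1) \<le> \<theta> (Suc j) * (E - 1)" using 1 E by (intro mult_right_mono) auto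
        moreover have "\<theta> (Suc j) * E = \<theta> (Suc j) * (E - 1) + \<theta> (Suc j)" by (simp add: algebra_simps)
        ultimately show ?thesis using 1 by linarith
      qed
      moreover have "1 \<le> exp (2 * k * (T - t))" using k t by simp
      ultimately have *: "e + k * (LBINT s:{t..T}. ?m s) \<le> \<theta> (Suc j) * exp (2 * k * (T - t))" by metis
      have "AE \<omega> in P. U t \<omega> \<le> e + k * (LBINT s:{t..T}. ?m s)"
        using \<theta>0 by (intro comparison_step[OF I U t b k e mc _ rc bd ter Suc.IH inc]) auto
      then show "AE \<omega> in P. U t \<omega> \<le> \<theta> (Suc j) * exp (2 * k * (T - t))"
        by eventually_elim (use * in linarith)
    qed
  qed
  then have "AE \<omega> in P. \<forall>j. \<forall>s\<in>{0..T}. U s \<omega> \<le> \<theta> j * exp (2 * k * (T - s))" unfolding AE_all_countable by simp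
  then show ?thesis
  proof eventually_elim
    case (elim \<omega>)
    show ?case
    proof
      fix s assume s: "s \<in> {0..T}"
      have "(\<lambda>j. c * (1/2)^j) \<longlonglongrightarrow> c * 0" by (intro tendsto_mult tendsto_const LIMSEQ_power_zero) simp
      then have "\<theta> \<longlonglongrightarrow> max e 0" unfolding \<theta>_def[abs_def] by (intro tendsto_max tendsto_const) (simp add: power_divide)
      then have "(\<lambda>j. \<theta> j * exp (2 * k * (T - s))) \<longlonglongrightarrow> e * exp (2 * k * (T - s))"
        using e by (intro tendsto_mult tendsto_const) simp
      then show "U s \<omega> \<le> e * exp (2 * k * (T - s))" by (rule LIMSEQ_le_const) (use elim s in auto)
    qed
  qed
qed

end

lemma set_integral_singleton: "(LBINT s:{a::real}. g s) = (0::real)"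
proof -
  have "AE s in lborel. indicator {a} s *\<^sub>R g s = 0" using AE_lborel_singleton[of a] by eventually_elim (auto simp: indicator_def)
  then show ?thesis unfolding set_lebesgue_integral_def by (rule integral_eq_zero_AE)
qed

context bsde
begin

lemma comparison:
  assumes eq: "bsde_equation M T W f \<xi> Y Z (\<lambda>_ _. 0)" and Y: "predictable M T W Y"
    and Yb: "bounded_process M T Y" and Zb: "bounded_process M T Z"
    and eq': "bsde_equation M T W f' \<xi>' Y' Z' A'" and Y': "predictable M T W Y'"
    and Yb': "bounded_process M T Y'" and rc': "AE \<omega> in P. rcll T (\<lambda>t. Y' t \<omega>)" and A': "AE \<omega> in P. mono_on {0..T} (\<lambda>t. A' t \<omega>)"
    and ff': "\<And>t w y z. t \<in> {0..T} \<Longrightarrow> w \<in> path_space T \<Longrightarrow> f t w y z \<le> f' t w y z"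
    and e: "0 \<le> e" and \<xi>: "AE \<omega> in P. \<xi> \<omega> \<le> \<xi>' \<omega> + e"
  shows "AE \<omega> in P. \<forall>s\<in>{0..T}. Y s \<omega> \<le> Y' s \<omega> + e * exp (2 * K * (T - s))"
proof -
  obtain I where I: "ito_integral M T W Z I"
    "AE \<omega> in P. set_integrable lborel {0..T} (\<lambda>s. f s (path \<omega>) (Y s \<omega>) (Z s \<omega>))"
    "AE \<omega> in P. \<forall>t\<in>{0..T}. Y t \<omega> = \<xi> \<omega> + (LBINT s:{t..T}. f s (path \<omega>) (Y s \<omega>) (Z s \<omega>)) - (I T \<omega> - I t \<omega>) + 0 - 0"
    "AE \<omega> in P. \<forall>a b. 0 \<le> a \<longrightarrow> a \<le> b \<longrightarrow> b \<le> T \<longrightarrow>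
       I b \<omega> - I a \<omega> = Y b \<omega> - Y a \<omega> + (LBINT s:{a..b}. f s (path \<omega>) (Y s \<omega>) (Z s \<omega>)) + (0 - 0)"
    by (rule bsde_equationD[OF eq])
  obtain I' where I': "ito_integral M T W Z' I'"
    "AE \<omega> in P. set_integrable lborel {0..T} (\<lambda>s. f' s (path \<omega>) (Y' s \<omega>) (Z' s \<omega>))"
    "AE \<omega> in P. \<forall>t\<in>{0..T}. Y' t \<omega> = \<xi>' \<omega> + (LBINT s:{t..T}. f' s (path \<omega>) (Y' s \<omega>) (Z' s \<omega>)) - (I' T \<omega> - I' t \<omega>) + A' T \<omega> - A' t \<omega>"
    "AE \<omega> in P. \<forall>a b. 0 \<le> a \<longrightarrow> a \<le> b \<longrightarrow> b \<le> T \<longrightarrow>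
       I' b \<omega> - I' a \<omega> = Y' b \<omega> - Y' a \<omega> + (LBINT s:{a..b}. f' s (path \<omega>) (Y' s \<omega>) (Z' s \<omega>)) + (A' b \<omega> - A' a \<omega>)"
    by (rule bsde_equationD[OF eq'])
  obtain c c' a0 where bds: "AE \<omega> in P. \<forall>t\<in>{0..T}. \<bar>Y t \<omega>\<bar> \<le> c" "AE \<omega> in P. \<forall>t\<in>{0..T}. \<bar>Y' t \<omega>\<bar> \<le> c'"
      "AE \<omega> in P. \<forall>t\<in>{0..T}. norm (Z t \<omega>) \<le> a0"
    using Yb Yb' Zb by (auto simp: bounded_process_def)
  obtain b where b: "0 \<le> b" "\<And>t w y z1 z. t \<in> {0..T} \<Longrightarrow> w \<in> path_space T \<Longrightarrow> norm z1 \<le> max 0 a0 \<Longrightarrow>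
      f t w y z1 - b * norm (z - z1) \<le> f t w y z"
    by (rule f_subgradient_bound[of "max 0 a0"]) auto
  let ?U = "\<lambda>s \<omega>. Y s \<omega> - Y' s \<omega>" and ?Z = "\<lambda>s \<omega>. Z s \<omega> - Z' s \<omega>" and ?N = "\<lambda>s \<omega>. I s \<omega> - I' s \<omega>"
  have N: "ito_integral M T W ?Z ?N" by (rule ito_diff[OF I(1) I'(1)])
  have U: "predictable M T W ?U" by (rule predictable_diff[OF Y Y'])
  have "AE \<omega> in P. \<forall>s\<in>{0..T}. ?U s \<omega> \<le> e * exp (2 * K * (T - s))"
  proof (rule comparison_abstract[OF N U b(1) K(1) e])
    show "AE \<omega> in P. \<forall>s\<in>{0..<T}. ((\<lambda>r. ?U r \<omega>) \<longlongrightarrow> ?U s \<omega>) (at_right s)"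
      using equation_continuous[OF eq] rc' by eventually_elim (intro ballI tendsto_diff; rule rcll_right[of T]; simp add: rcll_continuous)
    show "AE \<omega> in P. \<forall>s\<in>{0..T}. \<bar>?U s \<omega>\<bar> \<le> c + c'"
      using bds(1,2) by eventually_elim (fastforce intro: order_trans[OF abs_triangle_ineq4] add_mono)
    show "AE \<omega> in P. ?U T \<omega> \<le> e"
      using I(3) I'(3) \<xi>
    proof eventually_elim
      case (elim \<omega>)
      show ?case using elim(1,2)[rule_format, of T] elim(3) T_pos by (simp add: set_integral_singleton)
    qed
    show "AE \<omega> in P. \<forall>u v. 0 \<le> u \<longrightarrow> u \<le> v \<longrightarrow> v \<le> T \<longrightarrow>
      ?N v \<omega> - ?N u \<omega> \<le> ?U v \<omega> - ?U u \<omega> + (LBINT s:{u..v}. K * \<bar>?U s \<omega>\<bar> + b * norm (?Z s \<omega>))"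
      using I(2,4) I'(2,4) A' bds ito_sq_int[OF N] AE_space
    proof eventually_elim
      case (elim \<omega>)
      have \<omega>: "\<omega> \<in> space M" using elim(10) by simp
      note w = path_space[OF \<omega>]
      have [measurable]: "(\<lambda>s. ?U s \<omega>) \<in> borel_measurable L" "(\<lambda>s. ?Z s \<omega>) \<in> borel_measurable L"
        using predictable_section[OF U \<omega>] predictable_section[OF ito_predictable[OF N] \<omega>] by auto
      have iU: "set_integrable lborel {0..T} (\<lambda>s. \<bar>?U s \<omega>\<bar>)"
        using elim(6,7) by (intro bounded_integrable[of _ "c + c'"]) (fastforce intro: order_trans[OF abs_triangle_ineq4] add_mono)+
      have iZ: "set_integrable lborel {0..T} (\<lambda>s. norm (?Z s \<omega>))" using elim(9) by (rule norm_integrable) simp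
      let ?g = "\<lambda>s. f s (path \<omega>) (Y s \<omega>) (Z s \<omega>)" and ?g' = "\<lambda>s. f' s (path \<omega>) (Y' s \<omega>) (Z' s \<omega>)"
      have le: "?g s - ?g' s \<le> K * \<bar>?U s \<omega>\<bar> + b * norm (?Z s \<omega>)" if s: "s \<in> {0..T}" for s
      proof -
        \<comment> \<open>First \<open>y\<close> is changed, then \<open>z\<close> by the linear
          lower bound based at \<open>Z\<close>, and finally the driver. In this order the base
          point of the convexity estimate is the bounded process \<open>Z\<close>, and
          \<open>Z'\<close> may be arbitrary.\<close>
        have "?g s - f s (path \<omega>) (Y' s \<omega>) (Z s \<omega>) \<le> K * \<bar>?U s \<omega>\<bar>" using K(2)[OF s w, of "Y s \<omega>" "Z s \<omega>" "Y' s \<omega>"] by (rule abs_le_D1)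
        moreover have "f s (path \<omega>) (Y' s \<omega>) (Z s \<omega>) - b * norm (Z' s \<omega> - Z s \<omega>) \<le> f s (path \<omega>) (Y' s \<omega>) (Z' s \<omega>)"
          using elim(8) s by (intro b(2)[OF s w] max.coboundedI2) auto
        ultimately show ?thesis using ff'[OF s w, of "Y' s \<omega>" "Z' s \<omega>"] by (simp add: norm_minus_commute)
      qed
      show ?case
      proof (intro allI impI)
        fix u v assume uv: "0 \<le> u" "u \<le> v" "v \<le> T"
        have sub: "set_integrable lborel {u..v} h" if "set_integrable lborel {0..T} h" for h :: "real \<Rightarrow> real"
          using that by (rule set_integrable_subset) (use uv in auto)
        have "(LBINT s:{u..v}. ?g s) - (LBINT s:{u..v}. ?g' s) = (LBINT s:{u..v}. ?g s - ?g' s)"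
          using sub[OF elim(1)] sub[OF elim(3)] by (rule set_integral_diff(2)[symmetric])
        also have "\<dots> \<le> (LBINT s:{u..v}. K * \<bar>?U s \<omega>\<bar> + b * norm (?Z s \<omega>))"
          using sub[OF elim(1)] sub[OF elim(3)] sub[OF iU] sub[OF iZ] le uv
          by (intro set_integral_mono set_integral_diff(1) set_integral_add(1) set_integrable_mult_right) auto
        finally have 1: "(LBINT s:{u..v}. ?g s) - (LBINT s:{u..v}. ?g' s) \<le> (LBINT s:{u..v}. K * \<bar>?U s \<omega>\<bar> + b * norm (?Z s \<omega>))" .
        \<comment> \<open>The increasing process of the supersolution enters with the sign that
          favours the inequality.\<close>
        have 2: "A' u \<omega> \<le> A' v \<omega>" using elim(5) uv by (auto simp: mono_on_def)
        have "I v \<omega> - I u \<omega> = Y v \<omega> - Y u \<omega> + (LBINT s:{u..v}. ?g s) + (0 - 0)"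
          "I' v \<omega> - I' u \<omega> = Y' v \<omega> - Y' u \<omega> + (LBINT s:{u..v}. ?g' s) + (A' v \<omega> - A' u \<omega>)"
          using elim(2,4) uv by blast+
        then show "?N v \<omega> - ?N u \<omega> \<le> ?U v \<omega> - ?U u \<omega> + (LBINT s:{u..v}. K * \<bar>?U s \<omega>\<bar> + b * norm (?Z s \<omega>))"
          using 1 2 by linarith
      qed
    qed
  qed
  then show ?thesis by eventually_elim (auto simp: algebra_simps)
qed

end

section \<open>Limits of stochastic integrals\<close>

lemma nn_set_integral_eq_integral:
  fixes h :: "'a \<Rightarrow> real"
  assumes h: "set_integrable N A h" and nn: "\<And>s. s \<in> A \<Longrightarrow> 0 \<le> h s"
  shows "(\<integral>\<^sup>+s\<in>A. ennreal (h s) \<partial>N) = ennreal (LINT s:A|N. h s)"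
proof -
  have "(\<integral>\<^sup>+s\<in>A. ennreal (h s) \<partial>N) = (\<integral>\<^sup>+s. ennreal (indicator A s *\<^sub>R h s) \<partial>N)"
    by (intro nn_integral_cong) (auto simp: indicator_def)
  also have "\<dots> = ennreal (LINT s:A|N. h s)"
    unfolding set_lebesgue_integral_def using h nn
    by (intro nn_integral_eq_integral) (auto simp: set_integrable_def indicator_def)
  finally show ?thesis .
qed

text \<open>The weights \<open>2^j\<close> force the increments below a geometric sequence with
  ratio \<open>sqrt (1/2)\<close>, so they are absolutely summable.\<close>

lemma convergent_fast:
  fixes x :: "nat \<Rightarrow> 'b::banach"
  assumes "(\<Sum>j. ennreal (2^j * (norm (x (Suc j) - x j))\<^sup>2)) < \<infinity>"
  shows "convergent x"
proof -
  obtain c where c: "(\<Sum>j. ennreal (2^j * (norm (x (Suc j) - x j))\<^sup>2)) = ennreal c" "0 \<le> c"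
    using assms unfolding infinity_ennreal_def less_top_ennreal by blast
  have n: "norm (x (Suc j) - x j) \<le> sqrt c * sqrt (1/2) ^ j" for j
  proof -
    have "ennreal (2^j * (norm (x (Suc j) - x j))\<^sup>2) \<le> ennreal c"
      unfolding c(1)[symmetric] by (rule sum_le_suminf[of _ "{j}", simplified]) auto
    then have "2^j * (norm (x (Suc j) - x j))\<^sup>2 \<le> c" using c(2) by simp
    then have "(norm (x (Suc j) - x j))\<^sup>2 \<le> c * (1/2)^j" by (simp add: field_simps)
    then have "norm (x (Suc j) - x j) \<le> sqrt (c * (1/2)^j)" by (rule real_le_rsqrt)
    then show ?thesis by (simp only: real_sqrt_mult real_sqrt_power)
  qed
  have s: "summable (\<lambda>j. sqrt c * sqrt (1/2) ^ j)" by (intro summable_mult summable_geometric) (simp add: real_sqrt_divide)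
  have "summable (\<lambda>j. x (Suc j) - x j)" by (rule summable_comparison_test'[OF s]) (rule n)
  then have "convergent (\<lambda>n. x 0 + (\<Sum>j<n. x (Suc j) - x j))"
    by (simp add: summable_iff_convergent convergent_add_const_iff)
  then show ?thesis by (simp add: sum_lessThan_telescope)
qed

context brownian
begin

text \<open>The case of \<open>energy\<close> in which the remainder is the time integral of a drift
  \<open>h\<close>; the variation is then the primitive \<open>V\<close> of its absolute
  value.\<close>

lemma energy_drift:
  assumes I: "ito_integral M T W Z I" and R: "AE \<omega> in P. qv Z T \<omega> \<le> R" and t: "t \<in> {0..T}" and B: "B \<in> sets (F t)"
    and X: "\<And>s. s \<in> {0..T} \<Longrightarrow> X s \<in> borel_measurable (F s)"
    and Xe: "AE \<omega> in P. \<forall>s\<in>{0..T}. \<bar>X s \<omega>\<bar> \<le> e"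
    and G: "integrable P G" and c: "0 \<le> c"
    and h: "AE \<omega> in P. set_integrable lborel {0..T} (h \<omega>) \<and> (\<forall>s\<in>{0..T}. \<bar>h \<omega> s\<bar> \<le> c) \<and> (LBINT s:{t..T}. \<bar>h \<omega> s\<bar>) \<le> G \<omega>"
    and eq: "AE \<omega> in P. \<forall>a b. 0 \<le> a \<longrightarrow> a \<le> b \<longrightarrow> b \<le> T \<longrightarrow> I b \<omega> - I a \<omega> = X b \<omega> - X a \<omega> + (LBINT s:{a..b}. h \<omega> s)"
  shows "(\<integral>\<omega>. indicator B \<omega> * (qv Z T \<omega> - qv Z t \<omega>) \<partial>P) \<le> 2 * e\<^sup>2 * measure P B + 4 * e * (\<integral>\<omega>. indicator B \<omega> * G \<omega> \<partial>P)"
proof (rule energy[OF I R t B X Xe G c])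
  show "AE \<omega> in P. \<exists>V. (\<forall>a b. t \<le> a \<longrightarrow> a \<le> b \<longrightarrow> b \<le> T \<longrightarrow>
        \<bar>(I b \<omega> - I a \<omega>) - (X b \<omega> - X a \<omega>)\<bar> \<le> min (V b - V a) (c * (b - a))) \<and> V T - V t \<le> G \<omega>"
    using h eq
  proof eventually_elim
    case (elim \<omega>)
    have ia: "set_integrable lborel {0..T} (\<lambda>s. \<bar>h \<omega> s\<bar>)" using elim(1) by (simp add: set_integrable_abs)
    define V where "V u = (LBINT s:{0..u}. \<bar>h \<omega> s\<bar>)" for u
    have V: "V b - V a = (LBINT s:{a..b}. \<bar>h \<omega> s\<bar>)" if "0 \<le> a" "a \<le> b" "b \<le> T" for a b
      using set_integral_split[OF ia, of 0 a b] that by (simp add: V_def)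
    show ?case
    proof (intro exI[of _ V] conjI allI impI)
      show "V T - V t \<le> G \<omega>" using V[of t T] elim(1) t by simp
      fix a b assume ab: "t \<le> a" "a \<le> b" "b \<le> T"
      have i: "set_integrable lborel {a..b} (h \<omega>)" "set_integrable lborel {a..b} (\<lambda>s. \<bar>h \<omega> s\<bar>)"
        using elim(1) ia by (auto elim!: set_integrable_subset) (use ab t in auto)
      have ic: "set_integrable lborel {a..b} (\<lambda>_. c)" unfolding set_integrable_def by (simp add: emeasure_lborel_Icc_eq)
      have "(I b \<omega> - I a \<omega>) - (X b \<omega> - X a \<omega>) = (LBINT s:{a..b}. h \<omega> s)" using elim(2) ab t by auto
      moreover have "\<bar>LBINT s:{a..b}. h \<omega> s\<bar> \<le> V b - V a"
        using set_integral_norm_bound[OF i(1)] V[of a b] ab t by simp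
      moreover have "V b - V a \<le> (LBINT s:{a..b}. c)"
        using V[of a b] ab t elim(1) by (auto intro!: set_integral_mono i ic)
      moreover have "(LBINT s:{a..b}. c) = c * (b - a)" using ab by (simp add: set_lebesgue_integral_def)
      ultimately show "\<bar>(I b \<omega> - I a \<omega>) - (X b \<omega> - X a \<omega>)\<bar> \<le> min (V b - V a) (c * (b - a))" by simp
    qed
  qed
qed

text \<open>Progressive measurability: restricted to times up to \<open>t\<close>, a predictable
  rectangle that starts at \<open>s < t\<close> involves only \<open>F s\<close>, which is contained
  in \<open>F t\<close>, and one that starts later leaves no trace. So integration over time can be
  carried out within \<open>F t\<close>.\<close>

lemma time_integral_F:
  fixes X :: "real \<Rightarrow> 'w \<Rightarrow> real"
  assumes X: "predictable M T W X" and t: "t \<in> {0..T}"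
  shows "(\<lambda>\<omega>. LBINT s:{0..t}. X s \<omega>) \<in> borel_measurable (F t)"
proof -
  let ?N = "restrict_space lborel {0..t}"
  have "finite_measure ?N"
    by (intro finite_measureI) (use t in \<open>simp add: emeasure_restrict_space space_restrict_space emeasure_lborel_Icc_eq\<close>)
  then interpret N: sigma_finite_measure ?N by (rule finite_measure.axioms)
  have sN: "A \<in> sets borel \<Longrightarrow> A \<subseteq> {0..t} \<Longrightarrow> A \<in> sets ?N" for A by (auto simp: sets_restrict_space image_iff)
  have sp: "space (?N \<Otimes>\<^sub>M F t) = {0..t} \<times> space M" by (simp add: space_pair_measure space_restrict_space)
  have "(\<lambda>v. v) \<in> measurable (?N \<Otimes>\<^sub>M F t) (predictable_sigma T (space M) F)"
    unfolding predictable_sigma_def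
  proof (rule measurable_measure_of[OF predictable_gen])
    fix y assume "y \<in> {{0} \<times> A | A. A \<in> sets (F 0)} \<union> {{s<..u} \<times> A | s u A. 0 \<le> s \<and> s < u \<and> u \<le> T \<and> A \<in> sets (F s)}"
    then consider A where "y = {0} \<times> A" "A \<in> sets (F 0)" | s u A where "y = {s<..u} \<times> A" "0 \<le> s" "s < u" "A \<in> sets (F s)" by blast
    then show "(\<lambda>v. v) -` y \<inter> space (?N \<Otimes>\<^sub>M F t) \<in> sets (?N \<Otimes>\<^sub>M F t)"
    proof cases
      case 1
      then have "(\<lambda>v. v) -` y \<inter> space (?N \<Otimes>\<^sub>M F t) = {0} \<times> A" using sets.sets_into_space[of A "F 0"] t by (auto simp: sp)
      then show ?thesis using 1 sets_F_mono[of 0 t] t by (auto intro!: pair_measureI sN)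
    next
      case 2
      have "(\<lambda>v. v) -` y \<inter> space (?N \<Otimes>\<^sub>M F t) = {s<..min u t} \<times> A"
        using 2 sets.sets_into_space[of A "F s"] by (auto simp: sp)
      moreover have "{s<..min u t} \<times> A \<in> sets (?N \<Otimes>\<^sub>M F t)"
      proof (cases "s < t")
        case True
        then show ?thesis using 2 sets_F_mono[of s t] by (intro pair_measureI sN) auto
      qed simp
      ultimately show ?thesis by simp
    qed
  qed (use t in \<open>auto simp: sp\<close>)
  from measurable_compose[OF this X] have m: "(\<lambda>v. X (fst v) (snd v)) \<in> borel_measurable (?N \<Otimes>\<^sub>M F t)" by (simp add: split_def)
  have "(\<lambda>\<omega>. \<integral>s. X s \<omega> \<partial>?N) \<in> borel_measurable (F t)"
    using measurable_compose[OF measurable_pair_swap' m] by (intro N.borel_measurable_lebesgue_integral) (simp add: split_def)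
  then show ?thesis by (simp add: integral_restrict_space set_lebesgue_integral_def)
qed

lemma ito_integral_zero:
  assumes I: "ito_integral M T W Z I"
  shows "AE \<omega> in P. I 0 \<omega> = 0"
proof -
  obtain n \<tau> H where s: "\<And>k. simple_integrand M T W (n k) (\<tau> k) (H k)" and c: "AE \<omega> in P. ito_conv n \<tau> H Z I \<omega>"
    using ito_approx[OF I] by blast
  show ?thesis using c
  proof eventually_elim
    case (elim \<omega>)
    have "(\<lambda>k. simple_integral W (n k) (\<tau> k) (H k) 0 \<omega>) \<longlonglongrightarrow> I 0 \<omega>"
      using elim T_pos by (auto simp: ito_conv_def intro: tendsto_uniform_limitI)
    moreover have "simple_integral W (n k) (\<tau> k) (H k) 0 \<omega> = 0" for k
    proof -
      have "0 \<le> \<tau> k i" if "i \<le> n k" for i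
        using that
      proof (induction i)
        case (Suc i)
        then show ?case using s[of k] unfolding simple_integrand_def by (metis Suc_leD Suc_le_lessD order_trans)
      qed (use s[of k] in \<open>simp add: simple_integrand_def\<close>)
      then show ?thesis unfolding simple_integral_def by (intro sum.neutral) (simp add: min_absorb2)
    qed
    ultimately show ?case by (simp add: LIMSEQ_const_iff)
  qed
qed

text \<open>Completeness of L2 for predictable processes, with a subsequence along which convergence
  also holds almost surely at almost every time. Taking the pointwise \<open>lim\<close> of that
  subsequence keeps \<open>Z\<close> predictable, and Fatou's lemma gives the bound for the full
  sequence.\<close>

lemma predictable_L2_limit:
  assumes Zn: "\<And>n. predictable M T W (Zn n)"
    and C: "\<And>n m. (\<integral>\<^sup>+\<omega>. sqdist (Zn n) (Zn m) \<omega> \<partial>P) \<le> ennreal (\<rho> n + \<rho> m)"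
    and \<rho>: "\<rho> \<longlonglongrightarrow> 0" "\<And>n. 0 \<le> \<rho> n"
  obtains Z k where "predictable M T W Z" "strict_mono k" "\<And>j. \<rho> (k j) \<le> (1/8)^j"
    "\<And>n. (\<integral>\<^sup>+\<omega>. sqdist (Zn n) Z \<omega> \<partial>P) \<le> ennreal (\<rho> n)"
    "AE \<omega> in P. (\<lambda>j. sqdist (Zn (k j)) Z \<omega>) \<longlonglongrightarrow> 0"
    "AE \<omega> in P. AE s in L. (\<lambda>j. Zn (k j) s \<omega>) \<longlonglongrightarrow> Z s \<omega>"
proof -
  \<comment> \<open>The rate \<open>(1/8)^j\<close> leaves \<open>(1/4)^j\<close> after weighting
    with \<open>2^j\<close> here, and \<open>(1/2)^j\<close> after division by the square of the
    threshold \<open>(1/2)^j\<close> in \<open>ito_integral_limit\<close>; both are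
    summable.\<close>
  have "\<exists>N. \<forall>n\<ge>N. \<rho> n < (1/8)^j" for j using order_tendstoD(2)[OF \<rho>(1), of "(1/8)^j"] by (simp add: eventually_sequentially)
  then obtain N where N: "\<And>j n. N j \<le> n \<Longrightarrow> \<rho> n < (1/8)^j" by metis
  define k where "k j = (\<Sum>i\<le>j. Suc (N i))" for j
  have k: "strict_mono k" by (rule strict_monoI_Suc) (simp add: k_def)
  have "N j \<le> k j" for j unfolding k_def using member_le_sum[of j "{..j}" "\<lambda>i. Suc (N i)"] by simp
  then have \<rho>k: "\<rho> (k j) \<le> (1/8)^j" for j using N[of j "k j"] by (simp add: less_imp_le)
  note [measurable] = sqdist_measurable[OF Zn Zn]
  let ?d = "\<lambda>j \<omega>. sqdist (Zn (k (Suc j))) (Zn (k j)) \<omega>"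
  have "(\<integral>\<^sup>+\<omega>. (\<Sum>j. ennreal (2^j) * ?d j \<omega>) \<partial>P) = (\<Sum>j. \<integral>\<^sup>+\<omega>. ennreal (2^j) * ?d j \<omega> \<partial>P)"
    by (rule nn_integral_suminf) measurable
  also have "\<dots> = (\<Sum>j. ennreal (2^j) * (\<integral>\<^sup>+\<omega>. ?d j \<omega> \<partial>P))" by (intro suminf_cong nn_integral_cmult) measurable
  also have "\<dots> \<le> (\<Sum>j. ennreal (2 * (1/4)^j))"
  proof (intro suminf_le allI)
    fix j
    have "\<rho> (k (Suc j)) + \<rho> (k j) \<le> 2 * (1/8)^j" using \<rho>k[of j] \<rho>k[of "Suc j"] zero_le_power[of "1/8::real" j] unfolding power_Suc by linarith
    then have "(\<integral>\<^sup>+\<omega>. ?d j \<omega> \<partial>P) \<le> ennreal (2 * (1/8)^j)" using C[of "k (Suc j)" "k j"] by (meson ennreal_leI order_trans)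
    then have "ennreal (2^j) * (\<integral>\<^sup>+\<omega>. ?d j \<omega> \<partial>P) \<le> ennreal (2^j) * ennreal (2 * (1/8)^j)" by (rule mult_left_mono) simp
    also have "\<dots> = ennreal (2 * (1/4)^j)" by (simp add: ennreal_mult[symmetric] power_mult_distrib[symmetric] del: power_mult_distrib)
    finally show "ennreal (2^j) * (\<integral>\<^sup>+\<omega>. ?d j \<omega> \<partial>P) \<le> ennreal (2 * (1/4)^j)" .
  qed auto
  also have "\<dots> < \<infinity>" by (subst suminf_ennreal2) (auto intro!: summable_mult)
  finally have "(\<integral>\<^sup>+\<omega>. (\<Sum>j. ennreal (2^j) * ?d j \<omega>) \<partial>P) < \<infinity>" .
  then have "AE \<omega> in P. (\<Sum>j. ennreal (2^j) * ?d j \<omega>) \<noteq> \<infinity>" by (intro nn_integral_PInf_AE) auto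
  then have conv: "AE \<omega> in P. AE s in L. convergent (\<lambda>j. Zn (k j) s \<omega>)"
    using AE_space
  proof eventually_elim
    case (elim \<omega>)
    have [measurable]: "(\<lambda>s. Zn n s \<omega>) \<in> borel_measurable L" for n by (rule predictable_section[OF Zn]) (use elim in simp)
    have "(\<integral>\<^sup>+s. (\<Sum>j. ennreal (2^j * (norm (Zn (k (Suc j)) s \<omega> - Zn (k j) s \<omega>))\<^sup>2)) \<partial>L) = (\<Sum>j. ennreal (2^j) * ?d j \<omega>)"
      unfolding sqdist_def nn_integral_L[symmetric] by (subst nn_integral_suminf) (auto simp: ennreal_mult nn_integral_cmult)
    then have "AE s in L. (\<Sum>j. ennreal (2^j * (norm (Zn (k (Suc j)) s \<omega> - Zn (k j) s \<omega>))\<^sup>2)) \<noteq> \<infinity>"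
      using elim(1) by (intro nn_integral_PInf_AE) auto
    then show ?case by eventually_elim (simp add: convergent_fast less_top)
  qed
  define Z where "Z s \<omega> = lim (\<lambda>j. Zn (k j) s \<omega>)" for s \<omega>
  have Z: "predictable M T W Z"
    using borel_measurable_lim_metric[of "\<lambda>j (t,\<omega>). Zn (k j) t \<omega>" "predictable_sigma T (space M) F", OF Zn]
    by (simp add: Z_def[abs_def] split_def)
  have lim: "AE \<omega> in P. AE s in L. (\<lambda>j. Zn (k j) s \<omega>) \<longlonglongrightarrow> Z s \<omega>"
    using conv by eventually_elim (simp add: Z_def convergent_LIMSEQ_iff)
  note [measurable] = sqdist_measurable[OF Zn Z]
  have bd: "(\<integral>\<^sup>+\<omega>. sqdist (Zn n) Z \<omega> \<partial>P) \<le> ennreal (\<rho> n)" for n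
  proof -
    have "(\<integral>\<^sup>+\<omega>. sqdist (Zn n) Z \<omega> \<partial>P) \<le> (\<integral>\<^sup>+\<omega>. liminf (\<lambda>j. sqdist (Zn n) (Zn (k j)) \<omega>) \<partial>P)"
    proof (rule nn_integral_mono_AE)
      show "AE \<omega> in P. sqdist (Zn n) Z \<omega> \<le> liminf (\<lambda>j. sqdist (Zn n) (Zn (k j)) \<omega>)"
        using lim AE_space
      proof eventually_elim
        case (elim \<omega>)
        have [measurable]: "(\<lambda>s. Zn n s \<omega>) \<in> borel_measurable L" for n by (rule predictable_section[OF Zn]) (use elim in simp)
        have "sqdist (Zn n) Z \<omega> = (\<integral>\<^sup>+s. liminf (\<lambda>j. ennreal ((norm (Zn n s \<omega> - Zn (k j) s \<omega>))\<^sup>2)) \<partial>L)"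
          unfolding sqdist_def nn_integral_L[symmetric]
        proof (rule nn_integral_cong_AE)
          show "AE s in L. ennreal ((norm (Zn n s \<omega> - Z s \<omega>))\<^sup>2) = liminf (\<lambda>j. ennreal ((norm (Zn n s \<omega> - Zn (k j) s \<omega>))\<^sup>2))"
            using elim(1)
          proof eventually_elim
            case (elim s)
            then have "(\<lambda>j. ennreal ((norm (Zn n s \<omega> - Zn (k j) s \<omega>))\<^sup>2)) \<longlonglongrightarrow> ennreal ((norm (Zn n s \<omega> - Z s \<omega>))\<^sup>2)"
              by (intro tendsto_intros)
            then show ?case by (rule lim_imp_Liminf[symmetric, rotated]) simp
          qed
        qed
        also have "\<dots> \<le> liminf (\<lambda>j. \<integral>\<^sup>+s. ennreal ((norm (Zn n s \<omega> - Zn (k j) s \<omega>))\<^sup>2) \<partial>L)"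
          by (rule nn_integral_liminf) measurable
        finally show ?case by (simp add: sqdist_def nn_integral_L)
      qed
    qed
    also have "\<dots> \<le> liminf (\<lambda>j. \<integral>\<^sup>+\<omega>. sqdist (Zn n) (Zn (k j)) \<omega> \<partial>P)" by (rule nn_integral_liminf) measurable
    also have "\<dots> \<le> liminf (\<lambda>j. ennreal (\<rho> n + \<rho> (k j)))" by (intro Liminf_mono always_eventually allI C)
    also have "\<dots> = ennreal (\<rho> n + 0)"
      by (intro lim_imp_Liminf tendsto_ennrealI tendsto_add tendsto_const LIMSEQ_subseq_LIMSEQ[OF \<rho>(1) k, unfolded comp_def]) simp
    finally show ?thesis by simp
  qed
  have sub: "AE \<omega> in P. (\<lambda>j. sqdist (Zn (k j)) Z \<omega>) \<longlonglongrightarrow> 0"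
  proof -
    have "(\<integral>\<^sup>+\<omega>. (\<Sum>j. sqdist (Zn (k j)) Z \<omega>) \<partial>P) = (\<Sum>j. \<integral>\<^sup>+\<omega>. sqdist (Zn (k j)) Z \<omega> \<partial>P)"
      by (rule nn_integral_suminf) measurable
    also have "\<dots> \<le> (\<Sum>j. ennreal ((1/8)^j))"
      by (intro suminf_le allI order_trans[OF bd] ennreal_leI \<rho>k) auto
    also have "\<dots> < \<infinity>" by (subst suminf_ennreal2) auto
    finally have "AE \<omega> in P. (\<Sum>j. sqdist (Zn (k j)) Z \<omega>) \<noteq> \<infinity>" by (intro nn_integral_PInf_AE) auto
    then show ?thesis
    proof eventually_elim
      case (elim \<omega>)
      then have fin: "sqdist (Zn (k j)) Z \<omega> < \<infinity>" for j
        using sum_le_suminf[of "\<lambda>j. sqdist (Zn (k j)) Z \<omega>" "{j}"] by (auto simp: less_top[symmetric] top_unique)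
      then have e: "sqdist (Zn (k j)) Z \<omega> = ennreal (enn2real (sqdist (Zn (k j)) Z \<omega>))" for j by simp
      have "summable (\<lambda>j. enn2real (sqdist (Zn (k j)) Z \<omega>))"
        using elim e by (intro summable_suminf_not_top) auto
      then have "(\<lambda>j. ennreal (enn2real (sqdist (Zn (k j)) Z \<omega>))) \<longlonglongrightarrow> ennreal 0" by (intro tendsto_ennrealI summable_LIMSEQ_zero)
      then show ?case using e by simp
    qed
  qed
  show ?thesis by (rule that[OF Z k \<rho>k bd sub lim])
qed

text \<open>By the maximal inequality and the Borel-Cantelli lemma, consecutive integrals eventually
  differ by at most \<open>(1/2)^j\<close> uniformly in time. Hence they converge uniformly by the
  Weierstrass test, and \<open>ito_integral_closed\<close> recognises the limit. The bounds
  \<open>R j\<close> make the isometry available; they may grow with \<open>j\<close>, since only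
  the mean of the quadratic variation enters the estimate.\<close>

lemma ito_integral_limit:
  assumes Ik: "\<And>j. ito_integral M T W (Zk j) (Ik j)"
    and R: "\<And>j. AE \<omega> in P. qv (\<lambda>s \<omega>. Zk (Suc j) s \<omega> - Zk j s \<omega>) T \<omega> \<le> R j"
    and C: "\<And>j. (\<integral>\<^sup>+\<omega>. sqdist (Zk (Suc j)) (Zk j) \<omega> \<partial>P) \<le> ennreal (2 * (1/8)^j)"
    and Z: "predictable M T W Z" "AE \<omega> in P. sq_int Z \<omega>" and lim1: "AE \<omega> in P. (\<lambda>j. sqdist (Zk j) Z \<omega>) \<longlonglongrightarrow> 0"
  obtains I where "ito_integral M T W Z I" "AE \<omega> in P. uniform_limit {0..T} (\<lambda>j t. Ik j t \<omega>) (\<lambda>t. I t \<omega>) sequentially"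
proof -
  let ?Z = "\<lambda>j s \<omega>. Zk (Suc j) s \<omega> - Zk j s \<omega>" and ?I = "\<lambda>j t \<omega>. Ik (Suc j) t \<omega> - Ik j t \<omega>"
  have D: "ito_integral M T W (?Z j) (?I j)" for j by (rule ito_diff[OF Ik Ik])
  let ?A = "\<lambda>j. {\<omega>\<in>space P. ennreal ((1/2)^j) < (SUP t\<in>{0..T}. ennreal \<bar>?I j t \<omega> - ?I j 0 \<omega>\<bar>)}"
  have Am: "?A j \<in> sets P" for j
  proof -
    have [measurable]: "(\<lambda>\<omega>. SUP t\<in>{0..T}. ennreal \<bar>?I j t \<omega> - ?I j 0 \<omega>\<bar>) \<in> borel_measurable P"
      using ito_P[OF D] ito_cont[OF D] T_pos by (intro sup_dist_measurable) auto
    show ?thesis by measurable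
  qed
  have A: "measure P (?A j) \<le> 2 * (1/2)^j" for j
  proof -
    have qm: "integrable P (qv (?Z j) T)"
      using R[of j] qv_nonneg by (intro P.integrable_const_bound[where B = "R j"]) (auto simp: qv_measurable[OF ito_predictable[OF D]])
    have "ennreal (\<integral>\<omega>. qv (?Z j) T \<omega> \<partial>P) = (\<integral>\<^sup>+\<omega>. ennreal (qv (?Z j) T \<omega>) \<partial>P)"
      by (rule nn_integral_eq_integral[symmetric, OF qm]) (simp add: qv_nonneg)
    also have "\<dots> = (\<integral>\<^sup>+\<omega>. sqdist (Zk (Suc j)) (Zk j) \<omega> \<partial>P)"
    proof (rule nn_integral_cong_AE)
      show "AE \<omega> in P. ennreal (qv (?Z j) T \<omega>) = sqdist (Zk (Suc j)) (Zk j) \<omega>"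
        using ito_sq_int[OF D[of j]]
        by eventually_elim (simp add: sq_int_def qv_def sqdist_def nn_set_integral_eq_integral)
    qed
    also have "\<dots> \<le> ennreal (2 * (1/8)^j)" by (rule C)
    finally have "(\<integral>\<omega>. qv (?Z j) T \<omega> \<partial>P) \<le> 2 * (1/8)^j" by (subst (asm) ennreal_le_iff) auto
    then have "(\<integral>\<omega>. qv (?Z j) T \<omega> \<partial>P) / ((1/2)^j)\<^sup>2 \<le> 2 * (1/8)^j / ((1/2)^j)\<^sup>2" by (rule divide_right_mono) simp
    also have "2 * (1/8::real)^j / ((1/2)^j)\<^sup>2 = 2 * (1/2)^j"
    proof -
      have "(1/8::real)^j = (1/2)^j * ((1/2)^j * (1/2)^j)" by (simp only: power_mult_distrib[symmetric]) simp
      then show ?thesis by (simp add: power2_eq_square)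
    qed
    finally show ?thesis by (rule order_trans[OF ito_max[OF D R[of j]], rotated]) simp
  qed
  have "AE \<omega> in P. eventually (\<lambda>j. \<omega> \<in> space P - ?A j) sequentially"
  proof (rule borel_cantelli_AE1[OF Am])
    show "summable (\<lambda>j. measure P (?A j))"
    proof (rule summable_comparison_test')
      show "summable (\<lambda>j. 2 * (1/2::real)^j)" by (intro summable_mult summable_geometric) simp
      show "norm (measure P (?A j)) \<le> 2 * (1/2)^j" for j using A[of j] by simp
    qed
  qed (simp only: P.emeasure_eq_measure infinity_ennreal_def ennreal_less_top)
  moreover have "AE \<omega> in P. \<forall>j. ?I j 0 \<omega> = 0" unfolding AE_all_countable by (intro allI ito_integral_zero[OF D])
  ultimately have "AE \<omega> in P. uniform_limit {0..T} (\<lambda>j t. Ik j t \<omega>) (\<lambda>t. Ik 0 t \<omega> + (\<Sum>j. ?I j t \<omega>)) sequentially"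
  proof eventually_elim
    case (elim \<omega>)
    have "uniform_limit {0..T} (\<lambda>n t. \<Sum>j<n. ?I j t \<omega>) (\<lambda>t. \<Sum>j. ?I j t \<omega>) sequentially"
    proof (rule Weierstrass_m_test_ev)
      show "\<forall>\<^sub>F j in sequentially. \<forall>t\<in>{0..T}. norm (?I j t \<omega>) \<le> (1/2)^j"
        using elim(1)
      proof eventually_elim
        case (elim j)
        show ?case
        proof
          fix t assume "t \<in> {0..T}"
          then have "ennreal \<bar>?I j t \<omega> - ?I j 0 \<omega>\<bar> \<le> (SUP t\<in>{0..T}. ennreal \<bar>?I j t \<omega> - ?I j 0 \<omega>\<bar>)" by (rule SUP_upper)
          also have "\<dots> \<le> ennreal ((1/2)^j)" using elim by (auto simp: not_less)
          finally show "norm (?I j t \<omega>) \<le> (1/2)^j" using \<open>\<forall>j. ?I j 0 \<omega> = 0\<close> by simp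
        qed
      qed
    qed simp
    from uniform_limit_add[OF uniform_limit_const[where S = "{0..T}" and c = "\<lambda>t. Ik 0 t \<omega>"] this]
    show ?case by (simp add: sum_lessThan_telescope[of "\<lambda>j. Ik j _ \<omega>"])
  qed
  then have "\<exists>N\<in>null_sets P. \<forall>\<omega>\<in>space M - N. uniform_limit {0..T} (\<lambda>j t. Ik j t \<omega>) (\<lambda>t. Ik 0 t \<omega> + (\<Sum>j. ?I j t \<omega>)) sequentially"
    by (rule AE_E3) (intro bexI ballI, simp_all)
  then obtain N where N: "N \<in> null_sets P"
    "\<forall>\<omega>\<in>space M - N. uniform_limit {0..T} (\<lambda>j t. Ik j t \<omega>) (\<lambda>t. Ik 0 t \<omega> + (\<Sum>j. ?I j t \<omega>)) sequentially" ..
  \<comment> \<open>\<open>ito_integral\<close> asks for continuity of every path, so the limit is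
    replaced by 0 on the exceptional null set.\<close>
  define I where "I t \<omega> = (if \<omega> \<in> N then 0 else Ik 0 t \<omega> + (\<Sum>j. ?I j t \<omega>))" for t \<omega>
  have u: "uniform_limit {0..T} (\<lambda>j t. Ik j t \<omega>) (\<lambda>t. I t \<omega>) sequentially" if "\<omega> \<in> space M - N" for \<omega>
    using bspec[OF N(2) that] that by (simp add: I_def)
  have u': "AE \<omega> in P. uniform_limit {0..T} (\<lambda>j t. Ik j t \<omega>) (\<lambda>t. I t \<omega>) sequentially"
    using AE_not_in[OF N(1)] AE_space by eventually_elim (auto intro: u)
  have "ito_integral M T W Z I"
  proof (rule ito_integral_closed[OF Ik Z _ lim1 u'])
    show "continuous_on {0..T} (\<lambda>t. I t \<omega>)" if "\<omega> \<in> space M" for \<omega>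
    proof (cases "\<omega> \<in> N")
      case False
      then show ?thesis using that by (intro uniform_limit_theorem[OF _ u]) (auto simp: ito_cont[OF Ik])
    qed (simp add: I_def)
  qed
  then show ?thesis using u' by (rule that)
qed

section \<open>BMO processes\<close>

lemma tail_energy_measurable:
  assumes Z: "predictable M T W Z" and \<tau>: "\<tau> \<in> borel_measurable P" "\<And>\<omega>. \<omega> \<in> space M \<Longrightarrow> 0 \<le> \<tau> \<omega>"
  shows "(\<lambda>\<omega>. \<integral>\<^sup>+s\<in>{\<tau> \<omega>..T}. ennreal ((norm (Z s \<omega>))\<^sup>2) \<partial>lborel) \<in> borel_measurable P"
proof -
  have [measurable]: "(\<lambda>v. Z (fst v) (snd v)) \<in> borel_measurable (L \<Otimes>\<^sub>M P)" using predictable_pair[OF Z] by (simp add: split_def)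
  have [measurable]: "fst \<in> borel_measurable (L \<Otimes>\<^sub>M P)"
    by (rule measurable_compose[OF measurable_fst]) (rule measurable_restrict_space1, simp)
  note [measurable] = \<tau>(1)
  have "(\<lambda>\<omega>. \<integral>\<^sup>+s\<in>{0..T}. (if \<tau> \<omega> \<le> s then ennreal ((norm (Z s \<omega>))\<^sup>2) else 0) \<partial>lborel) \<in> borel_measurable P"
    by (rule nn_integral_time_measurable) (simp add: split_def, measurable)
  then show ?thesis
    by (rule measurable_cong[THEN iffD1, rotated]) (use \<tau>(2) in \<open>force intro!: nn_integral_cong simp: indicator_def\<close>)
qed

lemma stopping_time_P:
  assumes \<tau>: "stopping_time F \<tau>" "\<And>\<omega>. \<omega> \<in> space M \<Longrightarrow> \<tau> \<omega> \<le> T"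
  shows "\<tau> \<in> borel_measurable P"
proof (rule borel_measurableI_le)
  fix y
  show "{\<omega> \<in> space P. \<tau> \<omega> \<le> y} \<in> sets P"
  proof (cases "y \<le> T")
    case True
    have "{\<omega>\<in>space (F y). \<tau> \<omega> \<le> y} \<in> sets (F y)" using stopping_timeD[OF \<tau>(1)] by (simp add: Measurable.pred_def)
    then show ?thesis using True by (auto intro: sets_FD)
  next
    case False
    then have "{\<omega> \<in> space P. \<tau> \<omega> \<le> y} = space P" using \<tau>(2) by force
    then show ?thesis by (simp only: sets.top)
  qed
qed

text \<open>The bound at deterministic times is applied on the pieces \<open>Bi p i\<close> of
  \<open>B\<close> where \<open>\<tau>\<close> lies in a dyadic interval with right end
  \<open>q p i\<close>; each piece is known at that time. The pieces are disjoint, so the bounds add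
  up. The time of evaluation exceeds \<open>\<tau>\<close> by less than \<open>T / 2^p\<close>, and
  Fatou's lemma lets \<open>p\<close> tend to infinity.\<close>

lemma tail_energy_stopping_time:
  assumes Z: "predictable M T W Z" and \<tau>: "stopping_time F \<tau>" "\<And>\<omega>. \<omega> \<in> space M \<Longrightarrow> \<tau> \<omega> \<in> {0..T}"
    and B: "\<And>t. {\<omega>\<in>B. \<tau> \<omega> \<le> t} \<in> sets (F t)"
    and C: "\<And>t B. t \<in> {0..T} \<Longrightarrow> B \<in> sets (F t) \<Longrightarrow>
      (\<integral>\<^sup>+\<omega>. indicator B \<omega> * (\<integral>\<^sup>+s\<in>{t..T}. ennreal ((norm (Z s \<omega>))\<^sup>2) \<partial>lborel) \<partial>P) \<le> ennreal C * emeasure P B"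
  shows "(\<integral>\<^sup>+\<omega>. indicator B \<omega> * (\<integral>\<^sup>+s\<in>{\<tau> \<omega>..T}. ennreal ((norm (Z s \<omega>))\<^sup>2) \<partial>lborel) \<partial>P) \<le> ennreal C * emeasure P B"
proof -
  let ?H = "\<lambda>t \<omega>. \<integral>\<^sup>+s\<in>{t..T}. ennreal ((norm (Z s \<omega>))\<^sup>2) \<partial>lborel"
  have BM: "B \<subseteq> space M"
  proof
    fix \<omega> assume "\<omega> \<in> B"
    then have "\<omega> \<in> {\<omega>'\<in>B. \<tau> \<omega>' \<le> \<tau> \<omega>}" by simp
    then show "\<omega> \<in> space M" using sets.sets_into_space[OF B] by fastforce
  qed
  have BP: "B \<in> sets P"
  proof -
    have "{\<omega>\<in>B. \<tau> \<omega> \<le> T} = B" using BM \<tau>(2) by fastforce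
    then show ?thesis using sets_FD[OF B[of T]] by simp
  qed
  define q where "q p i = real i * (T / 2^p)" for p i :: nat
  define Bi where "Bi p i = {\<omega>\<in>B. q p i - T / 2^p < \<tau> \<omega> \<and> \<tau> \<omega> \<le> q p i}" for p i
  have q: "q p i \<in> {0..T}" if "i \<le> 2^p" for p i
  proof -
    have "real i * T \<le> 2^p * T" using that T_pos by (intro mult_right_mono) (auto simp: of_nat_le_iff[of _ "2^p", where 'a = real, simplified])
    then show ?thesis using T_pos by (simp add: q_def field_simps)
  qed
  have BF: "Bi p i \<in> sets (F (q p i))" if "i \<le> 2^p" for p i
  proof -
    have "Bi p i = {\<omega>\<in>B. \<tau> \<omega> \<le> q p i} - {\<omega>\<in>B. \<tau> \<omega> \<le> q p i - T / 2^p}" by (auto simp: Bi_def)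
    then show ?thesis using B[of "q p i"] B[of "q p i - T / 2^p"] sets_F_mono[of "q p i - T / 2^p" "q p i"] T_pos by auto
  qed
  have disj: "disjoint_family_on (Bi p) {..2^p}" for p
  proof (unfold disjoint_family_on_def, intro ballI impI)
    fix i j :: nat assume "i \<noteq> j"
    have *: "q p i \<le> q p j - T / 2^p" if "i < j" for i j
    proof -
      have "(real i + 1) * (T / 2^p) \<le> real j * (T / 2^p)" using that T_pos by (intro mult_right_mono) auto
      then show ?thesis by (simp add: q_def algebra_simps add_divide_distrib)
    qed
    show "Bi p i \<inter> Bi p j = {}" using *[of i j] *[of j i] \<open>i \<noteq> j\<close> by (cases "i < j") (auto simp: Bi_def)
  qed
  let ?h = "\<lambda>p \<omega>. \<Sum>i\<le>2^p. indicator (Bi p i) \<omega> * ?H (q p i) \<omega>"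
  have Hm: "?H (q p i) \<in> borel_measurable P" if "i \<le> 2^p" for p i
    using q[OF that] by (intro tail_energy_measurable[OF Z]) auto
  have BiP: "Bi p i \<in> sets P" if "i \<le> 2^p" for p i using BF[OF that] q[OF that] sets_FD by auto
  have hm: "?h p \<in> borel_measurable P" for p
    using Hm BiP by (intro borel_measurable_sum borel_measurable_times_ennreal borel_measurable_indicator) auto
  have hC: "(\<integral>\<^sup>+\<omega>. ?h p \<omega> \<partial>P) \<le> ennreal C * emeasure P B" for p
  proof -
    have "(\<integral>\<^sup>+\<omega>. ?h p \<omega> \<partial>P) = (\<Sum>i\<le>2^p. \<integral>\<^sup>+\<omega>. indicator (Bi p i) \<omega> * ?H (q p i) \<omega> \<partial>P)"
      using Hm BiP by (intro nn_integral_sum borel_measurable_times_ennreal borel_measurable_indicator) auto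
    also have "\<dots> \<le> (\<Sum>i\<le>2^p. ennreal C * emeasure P (Bi p i))" using q BF by (intro sum_mono C) auto
    also have "\<dots> = ennreal C * emeasure P (\<Union>i\<le>2^p. Bi p i)"
      using BiP disj by (subst sum_emeasure[symmetric]) (auto simp: sum_distrib_left)
    also have "\<dots> \<le> ennreal C * emeasure P B" using BP by (intro mult_left_mono emeasure_mono) (auto simp: Bi_def)
    finally show ?thesis .
  qed
  have le: "indicator B \<omega> * ?H (\<tau> \<omega>) \<omega> \<le> liminf (\<lambda>p. ?h p \<omega>)" if \<omega>: "\<omega> \<in> space M" for \<omega>
  proof (cases "\<omega> \<in> B")
    case True
    have [measurable]: "(\<lambda>s. Z s \<omega>) \<in> borel_measurable L" using predictable_section[OF Z \<omega>] .
    have HL: "?H t \<omega> = (\<integral>\<^sup>+s. ennreal ((norm (Z s \<omega>))\<^sup>2) * indicator {t..} s \<partial>L)" if "0 \<le> t" for t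
      unfolding nn_integral_L using that by (intro nn_integral_cong) (auto simp: indicator_def)
    have mi: "(\<lambda>s. ennreal ((norm (Z s \<omega>))\<^sup>2) * indicator {t..} s) \<in> borel_measurable L" for t
    proof -
      have [measurable]: "(\<lambda>s. s) \<in> borel_measurable L" by (rule measurable_restrict_space1) simp
      have "(\<lambda>s. ennreal ((norm (Z s \<omega>))\<^sup>2) * (if t \<le> s then 1 else 0)) \<in> borel_measurable L" by measurable
      then show ?thesis by (simp add: indicator_def[abs_def])
    qed
    have "?H (\<tau> \<omega>) \<omega> = (\<integral>\<^sup>+s. liminf (\<lambda>p. ennreal ((norm (Z s \<omega>))\<^sup>2) * indicator {\<tau> \<omega> + T / 2^p..} s) \<partial>L)"
      unfolding HL[OF \<tau>(2)[OF \<omega>, unfolded atLeastAtMost_iff, THEN conjunct1]]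
    proof (rule nn_integral_cong_AE)
      have "AE s in lborel. s \<in> {0..T} \<longrightarrow> s \<noteq> \<tau> \<omega>" using AE_lborel_singleton[of "\<tau> \<omega>"] by eventually_elim auto
      then have "AE s in L. s \<noteq> \<tau> \<omega>" by (subst AE_restrict_space_iff) auto
      then show "AE s in L. ennreal ((norm (Z s \<omega>))\<^sup>2) * indicator {\<tau> \<omega>..} s
        = liminf (\<lambda>p. ennreal ((norm (Z s \<omega>))\<^sup>2) * indicator {\<tau> \<omega> + T / 2^p..} s)"
      proof eventually_elim
        case (elim s)
        have "eventually (\<lambda>p. indicator {\<tau> \<omega> + T / 2^p..} s = (indicator {\<tau> \<omega>..} s :: ennreal)) sequentially"
        proof (cases "\<tau> \<omega> < s")
          case True
          have "(\<lambda>p. T * (1/2)^p) \<longlonglongrightarrow> T * 0" by (intro tendsto_mult tendsto_const LIMSEQ_power_zero) simp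
          then have "eventually (\<lambda>p. T * (1/2)^p < s - \<tau> \<omega>) sequentially" using True by (intro order_tendstoD(2)) auto
          then show ?thesis by eventually_elim (use True in \<open>auto simp: indicator_def power_divide\<close>)
        next
          case False
          have "\<not> \<tau> \<omega> + T / 2^p \<le> s" for p
          proof -
            have "0 < T / 2^p" using T_pos by simp
            then show ?thesis using False by linarith
          qed
          then show ?thesis using False elim by (auto simp: indicator_def)
        qed
        then have "(\<lambda>p. ennreal ((norm (Z s \<omega>))\<^sup>2) * indicator {\<tau> \<omega> + T / 2^p..} s) \<longlonglongrightarrow> ennreal ((norm (Z s \<omega>))\<^sup>2) * indicator {\<tau> \<omega>..} s"
          by (intro tendsto_eventually) (auto elim!: eventually_mono)
        then show ?case by (rule lim_imp_Liminf[symmetric, rotated]) simp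
      qed
    qed
    also have "\<dots> \<le> liminf (\<lambda>p. \<integral>\<^sup>+s. ennreal ((norm (Z s \<omega>))\<^sup>2) * indicator {\<tau> \<omega> + T / 2^p..} s \<partial>L)"
      by (rule nn_integral_liminf) (rule mi)
    also have "\<dots> = liminf (\<lambda>p. ?H (\<tau> \<omega> + T / 2^p) \<omega>)" using HL \<tau>(2)[OF \<omega>] T_pos by simp
    also have "\<dots> \<le> liminf (\<lambda>p. ?h p \<omega>)"
    proof (intro Liminf_mono always_eventually allI)
      fix p :: nat
      let ?x = "2^p * \<tau> \<omega> / T"
      \<comment> \<open>Rounding up gives the index of the dyadic interval that contains
        \<open>\<tau> \<omega>\<close>, with index 0 exactly for
        \<open>\<tau> \<omega> = 0\<close>.\<close>
      define i where "i = nat \<lceil>?x\<rceil>"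
      have x: "0 \<le> ?x" "?x \<le> 2^p" using \<tau>(2)[OF \<omega>] T_pos by (auto simp: field_simps)
      have i: "?x \<le> real i" "real i < ?x + 1"
      proof -
        have "real i = of_int \<lceil>?x\<rceil>" using x(1) by (simp add: i_def)
        then show "?x \<le> real i" "real i < ?x + 1" using ceiling_correct[of ?x] by linarith+
      qed
      have "\<lceil>?x\<rceil> \<le> 2^p" using x(2) by (simp add: ceiling_le_iff)
      then have i2: "i \<le> 2^p" by (simp add: i_def nat_le_iff)
      have "?x * (T / 2^p) \<le> q p i" unfolding q_def using i(1) T_pos by (intro mult_right_mono) auto
      then have a: "\<tau> \<omega> \<le> q p i" using T_pos by simp
      have "real i * (T / 2^p) < (?x + 1) * (T / 2^p)" using i(2) T_pos by (intro mult_strict_right_mono) auto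
      then have b: "q p i < \<tau> \<omega> + T / 2^p" using T_pos by (simp add: q_def distrib_right add_divide_distrib)
      have "?H (\<tau> \<omega> + T / 2^p) \<omega> \<le> ?H (q p i) \<omega>" using b by (intro nn_integral_mono) (auto simp: indicator_def)
      also have "\<dots> = indicator (Bi p i) \<omega> * ?H (q p i) \<omega>" using True a b by (simp add: Bi_def)
      also have "\<dots> \<le> ?h p \<omega>" using i2 by (intro member_le_sum) auto
      finally show "?H (\<tau> \<omega> + T / 2^p) \<omega> \<le> ?h p \<omega>" .
    qed
    finally show ?thesis using True by simp
  qed simp
  have "(\<integral>\<^sup>+\<omega>. indicator B \<omega> * ?H (\<tau> \<omega>) \<omega> \<partial>P) \<le> (\<integral>\<^sup>+\<omega>. liminf (\<lambda>p. ?h p \<omega>) \<partial>P)"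
    by (intro nn_integral_mono le) simp
  also have "\<dots> \<le> liminf (\<lambda>p. \<integral>\<^sup>+\<omega>. ?h p \<omega> \<partial>P)" by (rule nn_integral_liminf) (rule hm)
  also have "\<dots> \<le> liminf (\<lambda>p. ennreal C * emeasure P B)" by (intro Liminf_mono always_eventually allI hC)
  also have "\<dots> = ennreal C * emeasure P B" by (simp add: Liminf_const)
  finally show ?thesis .
qed

text \<open>A conditional expectation is determined by its integrals over the sets of
  \<open>pre_sigma \<tau>\<close>. If the conditional energy were at least
  \<open>C + 1 / real (Suc n)\<close> on such a set, the set would have to be null by
  \<open>tail_energy_stopping_time\<close>. So a bound at deterministic times is enough.\<close>

lemma bmoI:
  assumes Z: "predictable M T W Z" and C0: "0 \<le> C"
    and C: "\<And>t B. t \<in> {0..T} \<Longrightarrow> B \<in> sets (F t) \<Longrightarrow>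
      (\<integral>\<^sup>+\<omega>. indicator B \<omega> * (\<integral>\<^sup>+s\<in>{t..T}. ennreal ((norm (Z s \<omega>))\<^sup>2) \<partial>lborel) \<partial>P) \<le> ennreal C * emeasure P B"
  shows "bmo M T W Z"
  unfolding bmo_def
proof (intro conjI exI[of _ C] allI impI Z C0)
  fix \<tau> assume "stopping_time F \<tau> \<and> (\<forall>\<omega>\<in>space M. \<tau> \<omega> \<in> {0..T})"
  then have \<tau>: "stopping_time F \<tau>" "\<And>\<omega>. \<omega> \<in> space M \<Longrightarrow> \<tau> \<omega> \<in> {0..T}" by auto
  interpret filtration "space M" F by (rule filtration_augmented)
  let ?h = "\<lambda>\<omega>. \<integral>\<^sup>+s\<in>{\<tau> \<omega>..T}. ennreal ((norm (Z s \<omega>))\<^sup>2) \<partial>lborel"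
  have hm: "?h \<in> borel_measurable P" using \<tau> by (intro tail_energy_measurable[OF Z] stopping_time_P) auto
  have sub: "sets (pre_sigma \<tau>) \<subseteq> sets P"
  proof
    fix A assume A: "A \<in> sets (pre_sigma \<tau>)"
    then have "A \<subseteq> space M" using sets.sets_into_space by (fastforce simp: space_pre_sigma)
    then have "{\<omega>\<in>A. \<tau> \<omega> \<le> T} = A" using \<tau>(2) by fastforce
    then show "A \<in> sets P" using sets_FD[OF sets_pre_sigmaD[OF \<tau>(1) A, of T]] by simp
  qed
  interpret S: finite_measure_subalgebra P "pre_sigma \<tau>"
    by unfold_locales (simp add: subalgebra_def space_pre_sigma sub)
  let ?E = "nn_cond_exp P (pre_sigma \<tau>) ?h"
  have "AE \<omega> in P. ?E \<omega> < ennreal (C + 1 / real (Suc n))" for n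
  proof -
    let ?c = "C + 1 / real (Suc n)"
    define B where "B = {\<omega>\<in>space M. ennreal ?c \<le> ?E \<omega>}"
    have "{\<omega>\<in>space (pre_sigma \<tau>). ennreal ?c \<le> ?E \<omega>} \<in> sets (pre_sigma \<tau>)" by measurable
    then have B: "B \<in> sets (pre_sigma \<tau>)" by (simp add: space_pre_sigma B_def)
    have BP: "B \<in> sets P" using B sub by blast
    have "ennreal ?c * emeasure P B = (\<integral>\<^sup>+\<omega>. ennreal ?c * indicator B \<omega> \<partial>P)" using BP by (simp add: nn_integral_cmult_indicator)
    also have "\<dots> \<le> (\<integral>\<^sup>+\<omega>. indicator B \<omega> * ?E \<omega> \<partial>P)" by (intro nn_integral_mono) (auto simp: indicator_def B_def)
    also have "\<dots> = (\<integral>\<^sup>+\<omega>. indicator B \<omega> * ?h \<omega> \<partial>P)" using B hm by (intro S.nn_cond_exp_intg) auto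
    also have "\<dots> \<le> ennreal C * emeasure P B"
      using sets_pre_sigmaD[OF \<tau>(1) B] by (intro tail_energy_stopping_time[OF Z \<tau>] C) auto
    finally have "?c * measure P B \<le> C * measure P B"
      using C0 by (simp add: P.emeasure_eq_measure ennreal_mult[symmetric] del: ennreal_plus of_nat_Suc)
    then have "measure P B * (1 / real (Suc n)) \<le> 0" by (simp add: algebra_simps)
    then have "measure P B = 0" using measure_nonneg[of P B] by (simp add: divide_le_0_iff)
    then have "B \<in> null_sets P" using BP by (simp add: null_sets_def P.emeasure_eq_measure)
    from AE_not_in[OF this] AE_space show ?thesis by eventually_elim (auto simp: B_def)
  qed
  then have "AE \<omega> in P. \<forall>n. ?E \<omega> < ennreal (C + 1 / real (Suc n))" unfolding AE_all_countable by blast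
  then show "AE \<omega> in P. ?E \<omega> \<le> ennreal C"
  proof eventually_elim
    case (elim \<omega>)
    have "(\<lambda>n. ennreal (C + 1 / real (Suc n))) \<longlonglongrightarrow> ennreal (C + 0)"
      using LIMSEQ_inverse_real_of_nat by (intro tendsto_ennrealI tendsto_add tendsto_const) (simp add: inverse_eq_divide)
    from LIMSEQ_le_const[OF this, of "?E \<omega>"] elim show ?case by (auto intro: less_imp_le)
  qed
qed

section \<open>Energies as quadratic variations, and Fatou's lemma for drifts\<close>

lemma nn_integral_qv:
  assumes Z: "predictable M T W Z" and sq: "AE \<omega> in P. sq_int Z \<omega>" and R: "AE \<omega> in P. qv Z T \<omega> \<le> R" and t: "t \<in> {0..T}" and B: "B \<in> sets P"
  shows "(\<integral>\<^sup>+\<omega>. indicator B \<omega> * (\<integral>\<^sup>+s\<in>{t..T}. ennreal ((norm (Z s \<omega>))\<^sup>2) \<partial>lborel) \<partial>P)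
    = ennreal (\<integral>\<omega>. indicator B \<omega> * (qv Z T \<omega> - qv Z t \<omega>) \<partial>P)"
proof -
  have qm[measurable]: "qv Z u \<in> borel_measurable P" if "u \<in> {0..T}" for u using that by (intro qv_measurable[OF Z]) auto
  have [measurable]: "qv Z T \<in> borel_measurable P" "qv Z t \<in> borel_measurable P" using qm T_pos t by auto
  have b: "AE \<omega> in P. 0 \<le> qv Z T \<omega> - qv Z t \<omega> \<and> qv Z T \<omega> - qv Z t \<omega> \<le> R"
    using sq R
  proof eventually_elim
    case (elim \<omega>)
    then show ?case using qv_mono[OF elim(1), of t T] qv_nonneg[of Z t \<omega>] t by auto
  qed
  have i: "integrable P (\<lambda>\<omega>. indicator B \<omega> * (qv Z T \<omega> - qv Z t \<omega>))"
  proof (rule P.integrable_const_bound)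
    show "AE \<omega> in P. norm (indicator B \<omega> * (qv Z T \<omega> - qv Z t \<omega>)) \<le> R" using b by eventually_elim (auto simp: indicator_def)
    show "(\<lambda>\<omega>. indicator B \<omega> * (qv Z T \<omega> - qv Z t \<omega>)) \<in> borel_measurable P" using B by measurable
  qed
  have "ennreal (\<integral>\<omega>. indicator B \<omega> * (qv Z T \<omega> - qv Z t \<omega>) \<partial>P) = (\<integral>\<^sup>+\<omega>. ennreal (indicator B \<omega> * (qv Z T \<omega> - qv Z t \<omega>)) \<partial>P)"
    by (rule nn_integral_eq_integral[symmetric, OF i]) (use b in \<open>eventually_elim, auto simp: indicator_def\<close>)
  also have "\<dots> = (\<integral>\<^sup>+\<omega>. indicator B \<omega> * (\<integral>\<^sup>+s\<in>{t..T}. ennreal ((norm (Z s \<omega>))\<^sup>2) \<partial>lborel) \<partial>P)"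
  proof (rule nn_integral_cong_AE)
    show "AE \<omega> in P. ennreal (indicator B \<omega> * (qv Z T \<omega> - qv Z t \<omega>)) = indicator B \<omega> * (\<integral>\<^sup>+s\<in>{t..T}. ennreal ((norm (Z s \<omega>))\<^sup>2) \<partial>lborel)"
      using sq
    proof eventually_elim
      case (elim \<omega>)
      have "qv Z T \<omega> - qv Z t \<omega> = (LBINT s:{t..T}. (norm (Z s \<omega>))\<^sup>2)" using qv_diff[OF elim, of t T] t by auto
      moreover have "(\<integral>\<^sup>+s\<in>{t..T}. ennreal ((norm (Z s \<omega>))\<^sup>2) \<partial>lborel) = ennreal (LBINT s:{t..T}. (norm (Z s \<omega>))\<^sup>2)"
        using t by (intro nn_set_integral_eq_integral sq_int_sub[OF elim]) auto
      ultimately show ?case by (simp add: indicator_def)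
    qed
  qed
  finally show ?thesis ..
qed

lemma bounded_process_qv:
  assumes Z: "bounded_process M T Z" "AE \<omega> in P. sq_int Z \<omega>"
  obtains R where "AE \<omega> in P. qv Z T \<omega> \<le> R"
proof -
  obtain a where a: "AE \<omega> in P. \<forall>t\<in>{0..T}. norm (Z t \<omega>) \<le> a" using Z(1) by (auto simp: bounded_process_def)
  have "AE \<omega> in P. qv Z T \<omega> \<le> a\<^sup>2 * T" using a Z(2) by eventually_elim (intro qv_bounded, auto)
  then show ?thesis by (rule that)
qed

text \<open>The limit drift inherits integrability and an upper bound on its integrals because the drifts
  are bounded below; the missing mass is what the increasing process collects.\<close>

lemma fatou_drift:
  fixes g :: "nat \<Rightarrow> real \<Rightarrow> real"
  assumes g: "\<And>j. set_integrable lborel {0..T} (g j)" "\<And>j s. s \<in> {0..T} \<Longrightarrow> - C \<le> g j s"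
    and h: "h \<in> borel_measurable L" "\<And>s. s \<in> {0..T} \<Longrightarrow> - C \<le> h s"
    and lim: "AE s in L. (\<lambda>j. g j s) \<longlonglongrightarrow> h s"
    and l: "\<And>a b. 0 \<le> a \<Longrightarrow> a \<le> b \<Longrightarrow> b \<le> T \<Longrightarrow> (\<lambda>j. LBINT s:{a..b}. g j s) \<longlonglongrightarrow> l a b"
  shows "set_integrable lborel {0..T} h" "0 \<le> a \<Longrightarrow> a \<le> b \<Longrightarrow> b \<le> T \<Longrightarrow> (LBINT s:{a..b}. h s) \<le> l a b"
proof -
  have c: "set_integrable lborel {a..b} (\<lambda>_. C)" for a b :: real by (intro borel_integrable_atLeastAtMost' continuous_intros)
  have main: "set_integrable lborel {a..b} h \<and> (LBINT s:{a..b}. h s) \<le> l a b" if ab: "0 \<le> a" "a \<le> b" "b \<le> T" for a b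
  proof -
    have gi: "set_integrable lborel {a..b} (g j)" for j using g(1) by (rule set_integrable_subset) (use ab in auto)
    \<comment> \<open>Adding \<open>C\<close> makes all drifts nonnegative, as Fatou's lemma
      requires; its integral \<open>C * (b - a)\<close> is removed again at the end.\<close>
    have gp: "0 \<le> g j s + C" and hp: "0 \<le> h s + C" if "s \<in> {a..b}" for j s using g(2)[of s j] h(2)[of s] that ab by auto
    have cI: "(LBINT s:{a..b}. C) = C * (b - a)" using ab by (simp add: set_lebesgue_integral_def)
    have gn: "(\<integral>\<^sup>+s\<in>{a..b}. ennreal (g j s + C) \<partial>lborel) = ennreal ((LBINT s:{a..b}. g j s) + C * (b - a))" for j
    proof -
      have "(\<integral>\<^sup>+s\<in>{a..b}. ennreal (g j s + C) \<partial>lborel) = ennreal (LBINT s:{a..b}. g j s + C)"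
        by (intro nn_set_integral_eq_integral set_integral_add(1) gi c gp)
      then show ?thesis using set_integral_add(2)[OF gi c, of j] cI by simp
    qed
    have l0: "0 \<le> (LBINT s:{a..b}. g j s) + C * (b - a)" for j
    proof -
      have "0 \<le> (LBINT s:{a..b}. g j s + C)" by (intro set_integral_nonneg gp)
      then show ?thesis using set_integral_add(2)[OF gi c, of j] cI by simp
    qed
    have lim': "(\<lambda>j. (LBINT s:{a..b}. g j s) + C * (b - a)) \<longlonglongrightarrow> l a b + C * (b - a)" using l[OF ab] by (intro tendsto_add tendsto_const)
    have hb[measurable]: "set_borel_measurable lborel {0..T} h" by (rule set_borel_L[OF h(1)])
    have hm: "(\<lambda>s. indicator {a..b} s *\<^sub>R (h s + C)) \<in> borel_measurable lborel"
    proof -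
      have "(\<lambda>s. indicator {a..b} s *\<^sub>R (indicator {0..T} s *\<^sub>R h s + C)) \<in> borel_measurable lborel"
        using hb unfolding set_borel_measurable_def by measurable
      also have "(\<lambda>s. indicator {a..b} s *\<^sub>R (indicator {0..T} s *\<^sub>R h s + C)) = (\<lambda>s. indicator {a..b} s *\<^sub>R (h s + C))"
        using ab by (auto simp: indicator_def fun_eq_iff)
      finally show ?thesis .
    qed
    have "(\<integral>\<^sup>+s. ennreal (indicator {a..b} s *\<^sub>R (h s + C)) \<partial>lborel) \<le> (\<integral>\<^sup>+s. liminf (\<lambda>j. ennreal (indicator {a..b} s *\<^sub>R (g j s + C))) \<partial>lborel)"
    proof (rule nn_integral_mono_AE)
      have "AE s in lborel. s \<in> {0..T} \<longrightarrow> (\<lambda>j. g j s) \<longlonglongrightarrow> h s" using lim by (subst (asm) AE_restrict_space_iff) auto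
      then show "AE s in lborel. ennreal (indicator {a..b} s *\<^sub>R (h s + C)) \<le> liminf (\<lambda>j. ennreal (indicator {a..b} s *\<^sub>R (g j s + C)))"
      proof eventually_elim
        case (elim s)
        show ?case
        proof (cases "s \<in> {a..b}")
          case True
          then have "(\<lambda>j. ennreal (g j s + C)) \<longlonglongrightarrow> ennreal (h s + C)" using elim ab by (intro tendsto_ennrealI tendsto_add tendsto_const) auto
          from lim_imp_Liminf[OF _ this] show ?thesis using True by simp
        qed simp
      qed
    qed
    also have "\<dots> \<le> liminf (\<lambda>j. \<integral>\<^sup>+s. ennreal (indicator {a..b} s *\<^sub>R (g j s + C)) \<partial>lborel)"
    proof (rule nn_integral_liminf)
      show "(\<lambda>s. ennreal (indicator {a..b} s *\<^sub>R (g j s + C))) \<in> borel_measurable lborel" for j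
        using set_integral_add(1)[OF gi[of j] c] unfolding set_integrable_def by measurable
    qed
    also have "\<dots> = liminf (\<lambda>j. ennreal ((LBINT s:{a..b}. g j s) + C * (b - a)))"
      unfolding gn[symmetric] by (intro arg_cong[where f = liminf] ext nn_integral_cong) (auto simp: indicator_def)
    also have "\<dots> = ennreal (l a b + C * (b - a))" by (intro lim_imp_Liminf tendsto_ennrealI lim') simp
    finally have 1: "(\<integral>\<^sup>+s. ennreal (indicator {a..b} s *\<^sub>R (h s + C)) \<partial>lborel) \<le> ennreal (l a b + C * (b - a))" .
    have hC: "set_integrable lborel {a..b} (\<lambda>s. h s + C)"
      unfolding set_integrable_def
    proof (rule integrableI_nonneg[OF hm])
      have "0 \<le> indicator {a..b} s *\<^sub>R (h s + C)" for s
        using h(2)[of s] ab by (auto simp: indicator_def)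
      then show "AE s in lborel. 0 \<le> indicator {a..b} s *\<^sub>R (h s + C)" by simp
      show "(\<integral>\<^sup>+s. ennreal (indicator {a..b} s *\<^sub>R (h s + C)) \<partial>lborel) < \<infinity>"
        using 1 by (rule le_less_trans) simp
    qed
    have hi: "set_integrable lborel {a..b} h" using set_integral_diff(1)[OF hC c] by simp
    have "ennreal (LBINT s:{a..b}. h s + C) \<le> ennreal (l a b + C * (b - a))"
    proof -
      have "(\<integral>\<^sup>+s. ennreal (indicator {a..b} s *\<^sub>R (h s + C)) \<partial>lborel) = (\<integral>\<^sup>+s\<in>{a..b}. ennreal (h s + C) \<partial>lborel)"
        by (intro nn_integral_cong) (auto simp: indicator_def)
      also have "\<dots> = ennreal (LBINT s:{a..b}. h s + C)"
        by (intro nn_set_integral_eq_integral hC hp)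
      finally show ?thesis using 1 by simp
    qed
    moreover have "0 \<le> l a b + C * (b - a)" by (rule LIMSEQ_le_const[OF lim']) (use l0 in auto)
    ultimately have "(LBINT s:{a..b}. h s + C) \<le> l a b + C * (b - a)" by (simp add: ennreal_le_iff)
    then show ?thesis using hi set_integral_add(2)[OF hi c] cI by simp
  qed
  show "set_integrable lborel {0..T} h" using main[of 0 T] T_pos by simp
  show "0 \<le> a \<Longrightarrow> a \<le> b \<Longrightarrow> b \<le> T \<Longrightarrow> (LBINT s:{a..b}. h s) \<le> l a b" using main by simp
qed

end

section \<open>Approximating sequences\<close>

text \<open>The path functionals enter the argument only through their values: terminal conditions
  that converge uniformly with rate \<open>\<delta>\<close>, and a bound \<open>c\<close> for the
  limit.\<close>

locale bsde_approx = bsde M T W f for M :: "'w measure" and T :: real and W :: "real \<Rightarrow> 'w \<Rightarrow> real^'d" and f +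
  fixes \<xi>n :: "nat \<Rightarrow> 'w \<Rightarrow> real" and \<xi> :: "'w \<Rightarrow> real" and Yn :: "nat \<Rightarrow> real \<Rightarrow> 'w \<Rightarrow> real"
    and Zn :: "nat \<Rightarrow> real \<Rightarrow> 'w \<Rightarrow> real^'d" and \<delta> :: "nat \<Rightarrow> real" and c :: real
  assumes sol: "\<And>n. bsde_solution M T W f (\<xi>n n) (Yn n) (Zn n)" and Zb: "\<And>n. bounded_process M T (Zn n)"
    and \<delta>: "\<delta> \<longlonglongrightarrow> 0" and \<xi>\<delta>: "\<And>n \<omega>. \<omega> \<in> space M \<Longrightarrow> \<bar>\<xi>n n \<omega> - \<xi> \<omega>\<bar> \<le> \<delta> n"
    and \<xi>c: "\<And>\<omega>. \<omega> \<in> space M \<Longrightarrow> \<bar>\<xi> \<omega>\<bar> \<le> c"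
begin

lemma Yp: "predictable M T W (Yn n)" and Zp: "predictable M T W (Zn n)"
  and eq: "bsde_equation M T W f (\<xi>n n) (Yn n) (Zn n) (\<lambda>_ _. 0)"
  using sol[of n] by (simp_all add: bsde_solution_def)

lemma \<delta>_nonneg: "0 \<le> \<delta> n"
proof -
  obtain \<omega> where "\<omega> \<in> space M" using P.not_empty by auto
  from \<xi>\<delta>[OF this, of n] show ?thesis by linarith
qed

lemma Yb: "bounded_process M T (Yn n)"
proof (rule solution_bounded[OF sol Zb])
  show "AE \<omega> in P. \<bar>\<xi>n n \<omega>\<bar> \<le> c + \<delta> n"
    using AE_space
  proof eventually_elim
    case (elim \<omega>)
    then show ?case using \<xi>\<delta>[of \<omega> n] \<xi>c[of \<omega>] by simp
  qed
qed

definition E :: real where "E = exp (2 * K * T)"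

lemma E: "1 \<le> E" "s \<in> {0..T} \<Longrightarrow> 0 \<le> e \<Longrightarrow> e * exp (2 * K * (T - s)) \<le> e * E"
  using K(1) T_pos by (auto simp: E_def intro!: mult_left_mono)

text \<open>\<open>comparison\<close> is used in both directions. Its conclusion contains
  \<open>K\<close> and \<open>T\<close> but no bound on \<open>Zn\<close>, so the estimate is
  uniform in \<open>n\<close> and \<open>m\<close>.\<close>

lemma Yn_close: "AE \<omega> in P. \<forall>s\<in>{0..T}. \<bar>Yn n s \<omega> - Yn m s \<omega>\<bar> \<le> (\<delta> n + \<delta> m) * E"
proof -
  have 1: "AE \<omega> in P. \<forall>s\<in>{0..T}. Yn i s \<omega> \<le> Yn j s \<omega> + (\<delta> i + \<delta> j) * exp (2 * K * (T - s))" for i j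
  proof (rule comparison[OF eq Yp Yb Zb eq Yp Yb])
    show "AE \<omega> in P. rcll T (\<lambda>t. Yn j t \<omega>)" using equation_continuous[OF eq] by eventually_elim (rule rcll_continuous)
    show "AE \<omega> in P. \<xi>n i \<omega> \<le> \<xi>n j \<omega> + (\<delta> i + \<delta> j)"
      using AE_space
    proof eventually_elim
      case (elim \<omega>)
      then show ?case using \<xi>\<delta>[of \<omega> i] \<xi>\<delta>[of \<omega> j] by simp
    qed
  qed (use \<delta>_nonneg in \<open>auto simp: mono_on_def\<close>)
  show ?thesis using 1[of n m] 1[of m n]
  proof eventually_elim
    case (elim \<omega>)
    show ?case
    proof
      fix s assume s: "s \<in> {0..T}"
      show "\<bar>Yn n s \<omega> - Yn m s \<omega>\<bar> \<le> (\<delta> n + \<delta> m) * E"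
        using elim s E(2)[OF s, of "\<delta> n + \<delta> m"] \<delta>_nonneg[of n] \<delta>_nonneg[of m] by (fastforce simp: add.commute abs_le_iff)
    qed
  qed
qed

definition \<Delta> :: real where "\<Delta> = (SOME d. \<forall>n. \<delta> n \<le> d)"

lemma \<Delta>: "\<delta> n \<le> \<Delta>" "0 \<le> \<Delta>"
proof -
  have "Bseq \<delta>" using \<delta> by (intro convergent_imp_Bseq) (auto simp: convergent_def)
  then obtain d where "\<forall>n. norm (\<delta> n) \<le> d" by (auto simp: Bseq_def)
  then have "\<exists>d. \<forall>n. \<delta> n \<le> d" by (intro exI[of _ d]) (auto simp: abs_le_iff)
  then have "\<forall>n. \<delta> n \<le> \<Delta>" unfolding \<Delta>_def by (rule someI_ex)
  then show "\<delta> n \<le> \<Delta>" "0 \<le> \<Delta>" using \<delta>_nonneg order_trans by blast+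
qed

text \<open>The bound from \<open>solution_bounded\<close> depends on the bound for
  \<open>Zn n\<close> and so on \<open>n\<close>. It is taken for \<open>Yn 0\<close> only; by
  \<open>Yn_close\<close> the other solutions stay within a fixed distance of
  \<open>Yn 0\<close>.\<close>

lemma Yn_uniform_bound:
  obtains c1 where "0 \<le> c1" "\<And>n. AE \<omega> in P. \<forall>s\<in>{0..T}. \<bar>Yn n s \<omega>\<bar> \<le> c1"
proof -
  obtain b where b: "AE \<omega> in P. \<forall>s\<in>{0..T}. \<bar>Yn 0 s \<omega>\<bar> \<le> b" using Yb[of 0] by (auto simp: bounded_process_def)
  have d: "(\<delta> n + \<delta> 0) * E \<le> (\<Delta> + \<Delta>) * E" for n using \<Delta>(1) E(1) by (intro mult_right_mono add_mono) auto
  have "AE \<omega> in P. \<forall>s\<in>{0..T}. \<bar>Yn n s \<omega>\<bar> \<le> \<bar>b\<bar> + (\<Delta> + \<Delta>) * E" for n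
    using b Yn_close[of n 0]
  proof eventually_elim
    case (elim \<omega>)
    show ?case
    proof
      fix s assume "s \<in> {0..T}"
      then have "\<bar>Yn 0 s \<omega>\<bar> \<le> b" "\<bar>Yn n s \<omega> - Yn 0 s \<omega>\<bar> \<le> (\<delta> n + \<delta> 0) * E" using elim by auto
      then show "\<bar>Yn n s \<omega>\<bar> \<le> \<bar>b\<bar> + (\<Delta> + \<Delta>) * E" using d[of n] by linarith
    qed
  qed
  then show ?thesis using \<Delta>(2) E(1) by (intro that[of "\<bar>b\<bar> + (\<Delta> + \<Delta>) * E"]) auto
qed

abbreviation g :: "nat \<Rightarrow> 'w \<Rightarrow> real \<Rightarrow> real" where
  "g n \<omega> s \<equiv> f s (path \<omega>) (Yn n s \<omega>) (Zn n s \<omega>)"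

definition In :: "nat \<Rightarrow> real \<Rightarrow> 'w \<Rightarrow> real" where
  "In n = (SOME I. ito_integral M T W (Zn n) I \<and> (AE \<omega> in P. \<forall>a b. 0 \<le> a \<longrightarrow> a \<le> b \<longrightarrow> b \<le> T \<longrightarrow>
     I b \<omega> - I a \<omega> = Yn n b \<omega> - Yn n a \<omega> + (LBINT s:{a..b}. g n \<omega> s)))"

lemma In: "ito_integral M T W (Zn n) (In n)"
  "AE \<omega> in P. \<forall>a b. 0 \<le> a \<longrightarrow> a \<le> b \<longrightarrow> b \<le> T \<longrightarrow> In n b \<omega> - In n a \<omega> = Yn n b \<omega> - Yn n a \<omega> + (LBINT s:{a..b}. g n \<omega> s)"
proof -
  obtain I where "ito_integral M T W (Zn n) I" "AE \<omega> in P. set_integrable lborel {0..T} (g n \<omega>)"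
    "AE \<omega> in P. \<forall>t\<in>{0..T}. Yn n t \<omega> = \<xi>n n \<omega> + (LBINT s:{t..T}. g n \<omega> s) - (I T \<omega> - I t \<omega>) + 0 - 0"
    "AE \<omega> in P. \<forall>a b. 0 \<le> a \<longrightarrow> a \<le> b \<longrightarrow> b \<le> T \<longrightarrow> I b \<omega> - I a \<omega> = Yn n b \<omega> - Yn n a \<omega> + (LBINT s:{a..b}. g n \<omega> s) + (0 - 0)"
    by (rule bsde_equationD[OF eq])
  then have "\<exists>I. ito_integral M T W (Zn n) I \<and> (AE \<omega> in P. \<forall>a b. 0 \<le> a \<longrightarrow> a \<le> b \<longrightarrow> b \<le> T \<longrightarrow>
     I b \<omega> - I a \<omega> = Yn n b \<omega> - Yn n a \<omega> + (LBINT s:{a..b}. g n \<omega> s))" by (intro exI[of _ I]) simp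
  from someI_ex[OF this, folded In_def]
  show "ito_integral M T W (Zn n) (In n)"
    "AE \<omega> in P. \<forall>a b. 0 \<le> a \<longrightarrow> a \<le> b \<longrightarrow> b \<le> T \<longrightarrow> In n b \<omega> - In n a \<omega> = Yn n b \<omega> - Yn n a \<omega> + (LBINT s:{a..b}. g n \<omega> s)"
    by auto
qed

lemma gi: "AE \<omega> in P. set_integrable lborel {0..T} (g n \<omega>)"
  using eq[of n] by (simp add: bsde_equation_def)

lemma qvR: obtains R where "AE \<omega> in P. qv (Zn n) T \<omega> \<le> R"
  using bounded_process_qv[OF Zb ito_sq_int[OF In(1)]] by blast

lemma qvR_diff: obtains R where "AE \<omega> in P. qv (\<lambda>s \<omega>. Zn n s \<omega> - Zn m s \<omega>) T \<omega> \<le> R"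
proof -
  obtain a where a: "AE \<omega> in P. \<forall>t\<in>{0..T}. norm (Zn n t \<omega>) \<le> a" using Zb[of n] by (auto simp: bounded_process_def)
  obtain b where b: "AE \<omega> in P. \<forall>t\<in>{0..T}. norm (Zn m t \<omega>) \<le> b" using Zb[of m] by (auto simp: bounded_process_def)
  have "AE \<omega> in P. \<forall>t\<in>{0..T}. norm (Zn n t \<omega> - Zn m t \<omega>) \<le> a + b"
    using a b by eventually_elim (blast intro: order_trans[OF norm_triangle_ineq4] add_mono)
  then have "bounded_process M T (\<lambda>s \<omega>. Zn n s \<omega> - Zn m s \<omega>)" by (auto simp: bounded_process_def)
  then show ?thesis using bounded_process_qv ito_sq_int[OF ito_diff[OF In(1) In(1)]] that by blast
qed

text \<open>A drift bounded below by \<open>- C\<close> satisfies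
  \<open>\<bar>x\<bar> \<le> x + 2 * C\<close>, and the equation expresses its integral by
  increments of the bounded \<open>Yn n\<close> and of \<open>In n\<close>. So the total variation
  of the integrated drift has a conditional mean that is bounded uniformly in \<open>n\<close>. The
  two-sided bound \<open>k n\<close> does depend on \<open>n\<close>; it provides the Lipschitz
  condition of \<open>energy\<close>, from whose conclusion it is absent.\<close>

lemma drift_bounds:
  obtains c1 C k where "0 \<le> c1" "0 \<le> C" "\<And>n. 0 \<le> k n"
    "\<And>n. AE \<omega> in P. \<forall>s\<in>{0..T}. \<bar>Yn n s \<omega>\<bar> \<le> c1 \<and> - C \<le> g n \<omega> s \<and> \<bar>g n \<omega> s\<bar> \<le> k n"
    "\<And>t w y z. t \<in> {0..T} \<Longrightarrow> w \<in> path_space T \<Longrightarrow> \<bar>y\<bar> \<le> c1 \<Longrightarrow> - C \<le> f t w y z"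
    "\<And>n t. t \<in> {0..T} \<Longrightarrow> AE \<omega> in P. (LBINT s:{t..T}. \<bar>g n \<omega> s\<bar>) \<le> (In n T \<omega> - In n t \<omega>) + (2 * c1 + 2 * C * T)"
proof -
  obtain c1 where c1: "0 \<le> c1" "\<And>n. AE \<omega> in P. \<forall>s\<in>{0..T}. \<bar>Yn n s \<omega>\<bar> \<le> c1" by (rule Yn_uniform_bound) blast
  obtain C where C: "0 \<le> C" "\<And>t w y z. t \<in> {0..T} \<Longrightarrow> w \<in> path_space T \<Longrightarrow> \<bar>y\<bar> \<le> c1 \<Longrightarrow> - C \<le> f t w y z"
    using f_lower[OF c1(1)] by blast
  have "\<exists>k\<ge>0. AE \<omega> in P. \<forall>s\<in>{0..T}. \<bar>g n \<omega> s\<bar> \<le> k" for n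
  proof -
    obtain a where a: "AE \<omega> in P. \<forall>t\<in>{0..T}. norm (Zn n t \<omega>) \<le> a" using Zb[of n] by (auto simp: bounded_process_def)
    obtain d where d: "0 \<le> d" "\<And>t w y z. t \<in> {0..T} \<Longrightarrow> w \<in> path_space T \<Longrightarrow> norm z \<le> max 0 a \<Longrightarrow> \<bar>f t w y z\<bar> \<le> d + K * \<bar>y\<bar>"
      using f_growth[of "max 0 a"] by (metis max.cobounded1)
    have "AE \<omega> in P. \<forall>s\<in>{0..T}. \<bar>g n \<omega> s\<bar> \<le> d + K * c1"
      using a c1(2)[of n] AE_space
    proof eventually_elim
      case (elim \<omega>)
      show ?case
      proof
        fix s assume s: "s \<in> {0..T}"
        have "\<bar>g n \<omega> s\<bar> \<le> d + K * \<bar>Yn n s \<omega>\<bar>" using elim s by (intro d(2) path_space) (auto intro: max.coboundedI2)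
        also have "\<dots> \<le> d + K * c1" using elim(2) s K(1) by (intro add_left_mono mult_left_mono) auto
        finally show "\<bar>g n \<omega> s\<bar> \<le> d + K * c1" .
      qed
    qed
    then show ?thesis using d(1) K(1) c1(1) by (intro exI[of _ "d + K * c1"]) auto
  qed
  then have "\<forall>n. \<exists>k. 0 \<le> k \<and> (AE \<omega> in P. \<forall>s\<in>{0..T}. \<bar>g n \<omega> s\<bar> \<le> k)" by blast
  from choice[OF this] obtain k where k: "\<And>n. 0 \<le> k n" "\<And>n. AE \<omega> in P. \<forall>s\<in>{0..T}. \<bar>g n \<omega> s\<bar> \<le> k n" by blast
  show ?thesis
  proof (rule that[OF c1(1) C(1) k(1)])
    show b: "AE \<omega> in P. \<forall>s\<in>{0..T}. \<bar>Yn n s \<omega>\<bar> \<le> c1 \<and> - C \<le> g n \<omega> s \<and> \<bar>g n \<omega> s\<bar> \<le> k n" for n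
      using c1(2)[of n] k(2)[of n] AE_space by eventually_elim (auto intro!: C(2) path_space)
    show "AE \<omega> in P. (LBINT s:{t..T}. \<bar>g n \<omega> s\<bar>) \<le> (In n T \<omega> - In n t \<omega>) + (2 * c1 + 2 * C * T)" if t: "t \<in> {0..T}" for n t
      using b[of n] gi[of n] In(2)[of n]
    proof eventually_elim
      case (elim \<omega>)
      have i: "set_integrable lborel {t..T} (g n \<omega>)" using elim(2) by (rule set_integrable_subset) (use t in auto)
      have ic: "set_integrable lborel {t..T} (\<lambda>_. 2 * C)" by (intro borel_integrable_atLeastAtMost' continuous_intros)
      have "\<bar>g n \<omega> s\<bar> \<le> g n \<omega> s + 2 * C" if "s \<in> {t..T}" for s
      proof -
        have "- C \<le> g n \<omega> s" using elim(1) that t by auto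
        then show ?thesis using C(1) by linarith
      qed
      then have "(LBINT s:{t..T}. \<bar>g n \<omega> s\<bar>) \<le> (LBINT s:{t..T}. g n \<omega> s + 2 * C)"
        by (intro set_integral_mono set_integral_add(1) i ic set_integrable_abs)
      also have "\<dots> = (LBINT s:{t..T}. g n \<omega> s) + 2 * C * (T - t)" using set_integral_add(2)[OF i ic] t by (simp add: set_lebesgue_integral_def)
      also have "(LBINT s:{t..T}. g n \<omega> s) = (In n T \<omega> - In n t \<omega>) - (Yn n T \<omega> - Yn n t \<omega>)" using elim(3) t by auto
      also have "2 * C * (T - t) \<le> 2 * C * T" using C(1) t by (intro mult_left_mono) auto
      finally have "(LBINT s:{t..T}. \<bar>g n \<omega> s\<bar>) \<le> (In n T \<omega> - In n t \<omega>) - (Yn n T \<omega> - Yn n t \<omega>) + 2 * C * T" by simp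
      moreover have "\<bar>Yn n T \<omega>\<bar> \<le> c1" "\<bar>Yn n t \<omega>\<bar> \<le> c1" using elim(1) t T_pos by auto
      ultimately show ?case by linarith
    qed
  qed (rule C(2))
qed

text \<open>The majorant of the drift is a martingale increment plus the constant \<open>d\<close>,
  so its integral over a set \<open>B\<close> known at time \<open>t\<close> is
  \<open>d * measure P B\<close>. For a single solution this bounds the conditional energy, which
  becomes the BMO bound of the limit. For a difference, the process itself is of size
  \<open>(\<delta> n + \<delta> m) * E\<close>, and this factor makes the energy small.\<close>

lemma energy_estimates:
  obtains D where "0 \<le> D"
    "\<And>n t B. t \<in> {0..T} \<Longrightarrow> B \<in> sets (F t) \<Longrightarrow>
      (\<integral>\<^sup>+\<omega>. indicator B \<omega> * (\<integral>\<^sup>+s\<in>{t..T}. ennreal ((norm (Zn n s \<omega>))\<^sup>2) \<partial>lborel) \<partial>P) \<le> ennreal D * emeasure P B"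
    "\<And>n m. (\<integral>\<^sup>+\<omega>. sqdist (Zn n) (Zn m) \<omega> \<partial>P) \<le> ennreal (D * \<delta> n + D * \<delta> m)"
proof -
  obtain c1 C k where c: "0 \<le> c1" "0 \<le> C" "\<And>n. 0 \<le> k n"
    "\<And>n. AE \<omega> in P. \<forall>s\<in>{0..T}. \<bar>Yn n s \<omega>\<bar> \<le> c1 \<and> - C \<le> g n \<omega> s \<and> \<bar>g n \<omega> s\<bar> \<le> k n"
    "\<And>t w y z. t \<in> {0..T} \<Longrightarrow> w \<in> path_space T \<Longrightarrow> \<bar>y\<bar> \<le> c1 \<Longrightarrow> - C \<le> f t w y z"
    "\<And>n t. t \<in> {0..T} \<Longrightarrow> AE \<omega> in P. (LBINT s:{t..T}. \<bar>g n \<omega> s\<bar>) \<le> (In n T \<omega> - In n t \<omega>) + (2 * c1 + 2 * C * T)"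
    by (rule drift_bounds) blast
  define d where "d = 2 * c1 + 2 * C * T"
  have d0: "0 \<le> d" using c T_pos by (simp add: d_def)
  note [simp] = P.emeasure_space_1
  have Ii: "integrable P (\<lambda>\<omega>. In n T \<omega> - In n t \<omega>)" if "t \<in> {0..T}" for n t
    using that by (rule_tac qvR[of n]) (intro ito_integrable[OF In(1)], auto)
  have Im: "(\<integral>\<omega>. indicator B \<omega> * (In n T \<omega> - In n t \<omega>) \<partial>P) = 0" if "t \<in> {0..T}" "B \<in> sets (F t)" for n t B
    using that by (rule_tac qvR[of n]) (intro ito_mean_set[OF In(1)], auto)
  have Gi: "integrable P (\<lambda>\<omega>. In n T \<omega> - In n t \<omega> + d)" if "t \<in> {0..T}" for n t using Ii[OF that] by simp
  have BiI: "integrable P (\<lambda>\<omega>. indicator B \<omega> * X \<omega>)" if "integrable P X" "B \<in> sets P" for B and X :: "'w \<Rightarrow> real"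
    using integrable_mult_indicator[OF that(2,1)] by simp
  have Gm: "(\<integral>\<omega>. indicator B \<omega> * (In n T \<omega> - In n t \<omega> + d) \<partial>P) = d * measure P B" if t: "t \<in> {0..T}" and B: "B \<in> sets (F t)" for n t B
  proof -
    have BP: "B \<in> sets P" using sets_FD[OF B] t by simp
    have "(\<integral>\<omega>. indicator B \<omega> * (In n T \<omega> - In n t \<omega> + d) \<partial>P) = (\<integral>\<omega>. indicator B \<omega> * (In n T \<omega> - In n t \<omega>) + indicator B \<omega> * d \<partial>P)"
      by (simp add: distrib_left)
    also have "\<dots> = (\<integral>\<omega>. indicator B \<omega> * (In n T \<omega> - In n t \<omega>) \<partial>P) + (\<integral>\<omega>. indicator B \<omega> * d \<partial>P)"
      using BP by (intro Bochner_Integration.integral_add BiI Ii t) auto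
    finally show ?thesis using Im[OF t B] BP sets.sets_into_space[OF BP] by (simp add: Int_absorb2)
  qed
  \<comment> \<open>The first two terms come from a single solution, the others from a difference,
    where one factor of \<open>(\<delta> n + \<delta> m)\<^sup>2\<close> is estimated by
    \<open>2 * \<Delta>\<close>. Their sum serves both claims.\<close>
  define D where "D = 2 * c1\<^sup>2 + 4 * c1 * d + 4 * E\<^sup>2 * \<Delta> + 8 * E * d"
  have D: "0 \<le> 2 * c1\<^sup>2 + 4 * c1 * d" "0 \<le> 4 * E\<^sup>2 * \<Delta> + 8 * E * d" using c d0 E(1) \<Delta>(2) by auto
  have single: "(\<integral>\<^sup>+\<omega>. indicator B \<omega> * (\<integral>\<^sup>+s\<in>{t..T}. ennreal ((norm (Zn n s \<omega>))\<^sup>2) \<partial>lborel) \<partial>P) \<le> ennreal D * emeasure P B"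
    if t: "t \<in> {0..T}" and B: "B \<in> sets (F t)" for n t B
  proof -
    obtain R where R: "AE \<omega> in P. qv (Zn n) T \<omega> \<le> R" by (rule qvR)
    have "(\<integral>\<omega>. indicator B \<omega> * (qv (Zn n) T \<omega> - qv (Zn n) t \<omega>) \<partial>P)
      \<le> 2 * c1\<^sup>2 * measure P B + 4 * c1 * (\<integral>\<omega>. indicator B \<omega> * (In n T \<omega> - In n t \<omega> + d) \<partial>P)"
    proof (rule energy_drift[OF In(1) R t B _ _ Gi[OF t] c(3)[of n], where h = "g n"])
      show "Yn n s \<in> borel_measurable (F s)" if "s \<in> {0..T}" for s using predictable_F[OF Yp that] .
      show "AE \<omega> in P. \<forall>s\<in>{0..T}. \<bar>Yn n s \<omega>\<bar> \<le> c1" using c(4)[of n] by eventually_elim auto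
      show "AE \<omega> in P. set_integrable lborel {0..T} (g n \<omega>) \<and> (\<forall>s\<in>{0..T}. \<bar>g n \<omega> s\<bar> \<le> k n) \<and> (LBINT s:{t..T}. \<bar>g n \<omega> s\<bar>) \<le> In n T \<omega> - In n t \<omega> + d"
        using c(4)[of n] gi[of n] c(6)[OF t, of n] by eventually_elim (auto simp: d_def)
    qed (rule In(2))
    also have "\<dots> = (2 * c1\<^sup>2 + 4 * c1 * d) * measure P B" unfolding Gm[OF t B] by (simp add: algebra_simps)
    also have "\<dots> \<le> D * measure P B" using D by (intro mult_right_mono) (auto simp: D_def)
    finally show ?thesis
      using D sets_FD[OF B] t nn_integral_qv[OF Zp ito_sq_int[OF In(1)] R t]
      by (simp add: P.emeasure_eq_measure ennreal_mult[symmetric] D_def ennreal_leI del: ennreal_plus)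
  qed
  have diff: "(\<integral>\<^sup>+\<omega>. sqdist (Zn n) (Zn m) \<omega> \<partial>P) \<le> ennreal (D * \<delta> n + D * \<delta> m)" for n m
  proof -
    let ?Z = "\<lambda>s \<omega>. Zn n s \<omega> - Zn m s \<omega>" and ?I = "\<lambda>s \<omega>. In n s \<omega> - In m s \<omega>" and ?Y = "\<lambda>s \<omega>. Yn n s \<omega> - Yn m s \<omega>"
    let ?e = "(\<delta> n + \<delta> m) * E"
    let ?G = "\<lambda>\<omega>. (In n T \<omega> - In n 0 \<omega> + d) + (In m T \<omega> - In m 0 \<omega> + d)"
    obtain R where R: "AE \<omega> in P. qv ?Z T \<omega> \<le> R" by (rule qvR_diff)
    have t: "0 \<in> {0..T}" using T_pos by simp
    have B: "space M \<in> sets (F 0)" using sets.top[of "F 0"] by simp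
    have J: "ito_integral M T W ?Z ?I" by (rule ito_diff[OF In(1) In(1)])
    have G: "integrable P ?G" by (intro Bochner_Integration.integrable_add Gi t)
    have "(\<integral>\<omega>. indicator (space M) \<omega> * (qv ?Z T \<omega> - qv ?Z 0 \<omega>) \<partial>P)
      \<le> 2 * ?e\<^sup>2 * measure P (space M) + 4 * ?e * (\<integral>\<omega>. indicator (space M) \<omega> * ?G \<omega> \<partial>P)"
    proof (rule energy_drift[OF J R t B _ _ G, where h = "\<lambda>\<omega> s. g n \<omega> s - g m \<omega> s" and c = "k n + k m"])
      show "?Y s \<in> borel_measurable (F s)" if "s \<in> {0..T}" for s using predictable_F[OF Yp that] by (intro borel_measurable_diff)
      show "AE \<omega> in P. \<forall>s\<in>{0..T}. \<bar>?Y s \<omega>\<bar> \<le> ?e" by (rule Yn_close)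
      show "AE \<omega> in P. set_integrable lborel {0..T} (\<lambda>s. g n \<omega> s - g m \<omega> s) \<and> (\<forall>s\<in>{0..T}. \<bar>g n \<omega> s - g m \<omega> s\<bar> \<le> k n + k m)
        \<and> (LBINT s:{0..T}. \<bar>g n \<omega> s - g m \<omega> s\<bar>) \<le> ?G \<omega>"
        using c(4)[of n] gi[of n] c(6)[OF t, of n] c(4)[of m] gi[of m] c(6)[OF t, of m]
      proof eventually_elim
        case (elim \<omega>)
        have "(LBINT s:{0..T}. \<bar>g n \<omega> s - g m \<omega> s\<bar>) \<le> (LBINT s:{0..T}. \<bar>g n \<omega> s\<bar> + \<bar>g m \<omega> s\<bar>)"
          using elim by (intro set_integral_mono set_integrable_abs set_integral_diff(1) set_integral_add(1)) auto
        also have "\<dots> = (LBINT s:{0..T}. \<bar>g n \<omega> s\<bar>) + (LBINT s:{0..T}. \<bar>g m \<omega> s\<bar>)"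
          using elim by (intro set_integral_add(2) set_integrable_abs) auto
        finally have "(LBINT s:{0..T}. \<bar>g n \<omega> s - g m \<omega> s\<bar>) \<le> ?G \<omega>" using elim(3,6) by (simp add: d_def)
        moreover have "\<bar>g n \<omega> s - g m \<omega> s\<bar> \<le> k n + k m" if "s \<in> {0..T}" for s
          using elim(1,4) that by (intro order_trans[OF abs_triangle_ineq4] add_mono) auto
        ultimately show ?case using elim(2,5) by (auto intro: set_integral_diff(1))
      qed
      show "AE \<omega> in P. \<forall>a b. 0 \<le> a \<longrightarrow> a \<le> b \<longrightarrow> b \<le> T \<longrightarrow> ?I b \<omega> - ?I a \<omega> = ?Y b \<omega> - ?Y a \<omega> + (LBINT s:{a..b}. g n \<omega> s - g m \<omega> s)"
        using In(2)[of n] In(2)[of m] gi[of n] gi[of m]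
      proof eventually_elim
        case (elim \<omega>)
        show ?case
        proof (intro allI impI)
          fix a b assume ab: "0 \<le> a" "a \<le> b" "b \<le> T"
          have i: "set_integrable lborel {a..b} (g i \<omega>)" if "set_integrable lborel {0..T} (g i \<omega>)" for i
            using that by (rule set_integrable_subset) (use ab in auto)
          have "In n b \<omega> - In n a \<omega> = Yn n b \<omega> - Yn n a \<omega> + (LBINT s:{a..b}. g n \<omega> s)"
            "In m b \<omega> - In m a \<omega> = Yn m b \<omega> - Yn m a \<omega> + (LBINT s:{a..b}. g m \<omega> s)" using elim(1,2) ab by blast+
          then show "?I b \<omega> - ?I a \<omega> = ?Y b \<omega> - ?Y a \<omega> + (LBINT s:{a..b}. g n \<omega> s - g m \<omega> s)"
            using set_integral_diff(2)[OF i[OF elim(3)] i[OF elim(4)]] by linarith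
        qed
      qed
    qed (use c(3) in auto)
    also have "(\<integral>\<omega>. indicator (space M) \<omega> * ?G \<omega> \<partial>P) = 2 * d"
    proof -
      have "(\<integral>\<omega>. indicator (space M) \<omega> * ?G \<omega> \<partial>P) = (\<integral>\<omega>. indicator (space M) \<omega> * (In n T \<omega> - In n 0 \<omega> + d) + indicator (space M) \<omega> * (In m T \<omega> - In m 0 \<omega> + d) \<partial>P)"
        by (simp only: distrib_left)
      also have "\<dots> = (\<integral>\<omega>. indicator (space M) \<omega> * (In n T \<omega> - In n 0 \<omega> + d) \<partial>P) + (\<integral>\<omega>. indicator (space M) \<omega> * (In m T \<omega> - In m 0 \<omega> + d) \<partial>P)"
        by (intro Bochner_Integration.integral_add BiI Gi t sets_FD[OF B]) (use T_pos in auto)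
      finally show ?thesis unfolding Gm[OF t B] using P.prob_space by simp
    qed
    also have "2 * ?e\<^sup>2 * measure P (space M) + 4 * ?e * (2 * d) = 2 * E\<^sup>2 * ((\<delta> n + \<delta> m) * (\<delta> n + \<delta> m)) + 8 * E * d * (\<delta> n + \<delta> m)"
      using P.prob_space by (simp add: power2_eq_square algebra_simps)
    also have "\<dots> \<le> 2 * E\<^sup>2 * ((\<Delta> + \<Delta>) * (\<delta> n + \<delta> m)) + 8 * E * d * (\<delta> n + \<delta> m)"
      using \<Delta> \<delta>_nonneg d0 E(1) by (intro add_mono mult_left_mono mult_right_mono order_refl) auto
    also have "\<dots> = (4 * E\<^sup>2 * \<Delta> + 8 * E * d) * (\<delta> n + \<delta> m)" by (simp add: algebra_simps)
    also have "\<dots> \<le> D * (\<delta> n + \<delta> m)" using D \<delta>_nonneg by (intro mult_right_mono) (auto simp: D_def)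
    finally have "(\<integral>\<omega>. indicator (space M) \<omega> * (qv ?Z T \<omega> - qv ?Z 0 \<omega>) \<partial>P) \<le> D * \<delta> n + D * \<delta> m" by (simp add: distrib_left)
    then have "(\<integral>\<^sup>+\<omega>. indicator (space M) \<omega> * (\<integral>\<^sup>+s\<in>{0..T}. ennreal ((norm (?Z s \<omega>))\<^sup>2) \<partial>lborel) \<partial>P) \<le> ennreal (D * \<delta> n + D * \<delta> m)"
      unfolding nn_integral_qv[OF ito_predictable[OF J] ito_sq_int[OF J] R t sets_FD[OF B less_imp_le[OF T_pos]]] by (rule ennreal_leI)
    also have "(\<integral>\<^sup>+\<omega>. indicator (space M) \<omega> * (\<integral>\<^sup>+s\<in>{0..T}. ennreal ((norm (?Z s \<omega>))\<^sup>2) \<partial>lborel) \<partial>P) = (\<integral>\<^sup>+\<omega>. sqdist (Zn n) (Zn m) \<omega> \<partial>P)"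
      by (intro nn_integral_cong) (simp add: sqdist_def)
    finally show ?thesis .
  qed
  show ?thesis using D by (intro that[of D] single diff) (auto simp: D_def)
qed

end

section \<open>The limit and its increasing process\<close>

context bsde_approx
begin

lemma Yn_terminal: "AE \<omega> in P. Yn n T \<omega> = \<xi>n n \<omega>"
proof -
  obtain I where "ito_integral M T W (Zn n) I" "AE \<omega> in P. set_integrable lborel {0..T} (g n \<omega>)"
    and 1: "AE \<omega> in P. \<forall>t\<in>{0..T}. Yn n t \<omega> = \<xi>n n \<omega> + (LBINT s:{t..T}. g n \<omega> s) - (I T \<omega> - I t \<omega>) + 0 - 0"
    and "AE \<omega> in P. \<forall>a b. 0 \<le> a \<longrightarrow> a \<le> b \<longrightarrow> b \<le> T \<longrightarrow> I b \<omega> - I a \<omega> = Yn n b \<omega> - Yn n a \<omega> + (LBINT s:{a..b}. g n \<omega> s) + (0 - 0)"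
    by (rule bsde_equationD[OF eq])
  from 1 show ?thesis
  proof eventually_elim
    case (elim \<omega>)
    from bspec[OF this, of T] T_pos show ?case by (simp add: set_integral_singleton)
  qed
qed

lemma \<xi>_measurable: "\<xi> \<in> borel_measurable (F T)"
proof (rule borel_measurable_LIMSEQ_real)
  fix n show "\<xi>n n \<in> borel_measurable (F T)" using sol[of n] by (simp add: bsde_solution_def)
next
  fix \<omega> assume "\<omega> \<in> space (F T)"
  then have "\<And>n. norm (\<xi>n n \<omega> - \<xi> \<omega>) \<le> \<delta> n" using \<xi>\<delta> by simp
  then have "(\<lambda>n. \<xi>n n \<omega> - \<xi> \<omega>) \<longlonglongrightarrow> 0" by (intro Lim_null_comparison[OF _ \<delta>] always_eventually allI)
  then show "(\<lambda>n. \<xi>n n \<omega>) \<longlonglongrightarrow> \<xi> \<omega>" by (rule LIM_zero_cancel)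
qed

text \<open>A pointwise \<open>lim\<close> of predictable real processes is predictable whether or
  not the sequence converges; by \<open>Y_close\<close> it is the genuine limit outside a null
  set.\<close>

definition Y :: "real \<Rightarrow> 'w \<Rightarrow> real" where "Y s \<omega> = lim (\<lambda>n. Yn n s \<omega>)"

lemma Y_predictable: "predictable M T W Y"
  using borel_measurable_lim_metric[of "\<lambda>n (t,\<omega>). Yn n t \<omega>" "predictable_sigma T (space M) F", OF Yp]
  by (simp add: Y_def[abs_def] split_def)

lemma Y_close: "AE \<omega> in P. \<forall>n. \<forall>s\<in>{0..T}. \<bar>Yn n s \<omega> - Y s \<omega>\<bar> \<le> \<delta> n * E"
proof -
  have "AE \<omega> in P. \<forall>n m. \<forall>s\<in>{0..T}. \<bar>Yn n s \<omega> - Yn m s \<omega>\<bar> \<le> (\<delta> n + \<delta> m) * E"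
    unfolding AE_all_countable by (intro allI Yn_close)
  then show ?thesis
  proof eventually_elim
    case (elim \<omega>)
    show ?case
    proof (intro allI ballI)
      fix n s assume s: "s \<in> {0..T}"
      have "Cauchy (\<lambda>n. Yn n s \<omega>)"
      proof (rule metric_CauchyI)
        fix e :: real assume e: "0 < e"
        have "eventually (\<lambda>n. \<delta> n < e / (2 * E)) sequentially" using \<delta> e E(1) by (intro order_tendstoD(2)) auto
        then obtain N where N: "\<And>n. N \<le> n \<Longrightarrow> \<delta> n < e / (2 * E)" by (auto simp: eventually_sequentially)
        show "\<exists>N. \<forall>m\<ge>N. \<forall>n\<ge>N. dist (Yn m s \<omega>) (Yn n s \<omega>) < e"
        proof (intro exI[of _ N] allI impI)
          fix m n assume mn: "N \<le> m" "N \<le> n"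
          have "dist (Yn m s \<omega>) (Yn n s \<omega>) \<le> (\<delta> m + \<delta> n) * E" using elim s by (simp add: dist_real_def)
          also have "\<dots> < (e / (2 * E) + e / (2 * E)) * E" using N[OF mn(1)] N[OF mn(2)] E(1) by (intro mult_strict_right_mono) auto
          also have "\<dots> = e" using E(1) by (simp add: field_simps)
          finally show "dist (Yn m s \<omega>) (Yn n s \<omega>) < e" .
        qed
      qed
      then have l: "(\<lambda>m. Yn m s \<omega>) \<longlonglongrightarrow> Y s \<omega>" by (simp add: Y_def Cauchy_convergent_iff convergent_LIMSEQ_iff)
      have "(\<lambda>m. \<bar>Yn n s \<omega> - Yn m s \<omega>\<bar>) \<longlonglongrightarrow> \<bar>Yn n s \<omega> - Y s \<omega>\<bar>" by (intro tendsto_intros l)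
      moreover have "(\<lambda>m. (\<delta> n + \<delta> m) * E) \<longlonglongrightarrow> (\<delta> n + 0) * E" by (intro tendsto_intros \<delta>)
      ultimately have "\<bar>Yn n s \<omega> - Y s \<omega>\<bar> \<le> (\<delta> n + 0) * E" by (rule LIMSEQ_le) (use elim s in auto)
      then show "\<bar>Yn n s \<omega> - Y s \<omega>\<bar> \<le> \<delta> n * E" by simp
    qed
  qed
qed

lemma \<delta>E: "(\<lambda>n. \<delta> n * E) \<longlonglongrightarrow> 0"
  using tendsto_mult_right[OF \<delta>, of E] by simp

lemma Y_limit: "AE \<omega> in P. uniform_limit {0..T} (\<lambda>n s. Yn n s \<omega>) (\<lambda>s. Y s \<omega>) sequentially"
  using Y_close
proof eventually_elim
  case (elim \<omega>)
  show ?case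
  proof (rule uniform_limitI)
    fix e :: real assume "0 < e"
    then have "eventually (\<lambda>n. \<delta> n * E < e) sequentially" using \<delta>E by (intro order_tendstoD(2)) auto
    then show "\<forall>\<^sub>F n in sequentially. \<forall>s\<in>{0..T}. dist (Yn n s \<omega>) (Y s \<omega>) < e"
      by eventually_elim (use elim in \<open>auto simp: dist_real_def intro: le_less_trans\<close>)
  qed
qed

lemma Y_continuous: "AE \<omega> in P. continuous_on {0..T} (\<lambda>s. Y s \<omega>)"
proof -
  have "AE \<omega> in P. \<forall>n. continuous_on {0..T} (\<lambda>s. Yn n s \<omega>)" unfolding AE_all_countable by (intro allI equation_continuous[OF eq])
  with Y_limit show ?thesis
  proof eventually_elim
    case (elim \<omega>)
    show ?case by (rule uniform_limit_theorem[OF _ elim(1)]) (use elim(2) in auto)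
  qed
qed

lemma Y_terminal: "AE \<omega> in P. Y T \<omega> = \<xi> \<omega>"
proof -
  have "AE \<omega> in P. \<forall>n. Yn n T \<omega> = \<xi>n n \<omega>" unfolding AE_all_countable by (intro allI Yn_terminal)
  then show ?thesis using Y_close AE_space
  proof eventually_elim
    case (elim \<omega>)
    have "\<bar>Y T \<omega> - \<xi> \<omega>\<bar> \<le> \<delta> n * E + \<delta> n" for n
    proof -
      have "\<bar>Yn n T \<omega> - Y T \<omega>\<bar> \<le> \<delta> n * E" "\<bar>\<xi>n n \<omega> - \<xi> \<omega>\<bar> \<le> \<delta> n" using elim(2,3) T_pos \<xi>\<delta> by auto
      then show ?thesis using elim(1) by (simp add: abs_le_iff)
    qed
    moreover have "(\<lambda>n. \<delta> n * E + \<delta> n) \<longlonglongrightarrow> 0 + 0" by (intro tendsto_add \<delta>E \<delta>)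
    ultimately have "\<bar>Y T \<omega> - \<xi> \<omega>\<bar> \<le> 0 + 0" by (intro LIMSEQ_le_const[where a = "\<bar>Y T \<omega> - \<xi> \<omega>\<bar>"]) auto
    then show ?case by simp
  qed
qed

lemma Y_bounded: "bounded_process M T Y"
proof -
  obtain c1 where "0 \<le> c1" and c1: "\<And>n. AE \<omega> in P. \<forall>s\<in>{0..T}. \<bar>Yn n s \<omega>\<bar> \<le> c1" by (rule Yn_uniform_bound) blast
  have "AE \<omega> in P. \<forall>s\<in>{0..T}. \<bar>Y s \<omega>\<bar> \<le> c1 + \<delta> 0 * E"
    using c1[of 0] Y_close
  proof eventually_elim
    case (elim \<omega>)
    show ?case
    proof
      fix s assume "s \<in> {0..T}"
      then have "\<bar>Yn 0 s \<omega>\<bar> \<le> c1" "\<bar>Yn 0 s \<omega> - Y s \<omega>\<bar> \<le> \<delta> 0 * E" using elim by auto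
      then show "\<bar>Y s \<omega>\<bar> \<le> c1 + \<delta> 0 * E" by linarith
    qed
  qed
  then show ?thesis by (auto simp: bounded_process_def)
qed

text \<open>Once \<open>Y\<close>, \<open>Z\<close> and the integral process are found as limits,
  the equation leaves a single candidate for \<open>A\<close>, namely whatever is missing to balance
  it. Its increments are nonnegative by \<open>fatou_drift\<close>, applied along a subsequence for
  which the integrands converge at almost every time and the integrals uniformly.\<close>

lemma limit:
  obtains Z A \<rho> where "bsde_supersolution M T W f \<xi> Y Z A" "bmo M T W Z"
    "\<And>n. (\<integral>\<^sup>+\<omega>. sqdist (Zn n) Z \<omega> \<partial>P) \<le> ennreal (\<rho> n)" "\<rho> \<longlonglongrightarrow> 0" "\<And>n. 0 \<le> \<rho> n"
proof -
  obtain D where D: "0 \<le> D"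
    "\<And>n t B. t \<in> {0..T} \<Longrightarrow> B \<in> sets (F t) \<Longrightarrow>
      (\<integral>\<^sup>+\<omega>. indicator B \<omega> * (\<integral>\<^sup>+s\<in>{t..T}. ennreal ((norm (Zn n s \<omega>))\<^sup>2) \<partial>lborel) \<partial>P) \<le> ennreal D * emeasure P B"
    "\<And>n m. (\<integral>\<^sup>+\<omega>. sqdist (Zn n) (Zn m) \<omega> \<partial>P) \<le> ennreal (D * \<delta> n + D * \<delta> m)"
    by (rule energy_estimates) blast
  have \<rho>: "(\<lambda>n. D * \<delta> n) \<longlonglongrightarrow> 0" "\<And>n. 0 \<le> D * \<delta> n" using tendsto_mult_left[OF \<delta>, of D] D(1) \<delta>_nonneg by auto
  obtain Z k where Z: "predictable M T W Z" and k: "strict_mono k" "\<And>j. D * \<delta> (k j) \<le> (1/8)^j"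
    and bd: "\<And>n. (\<integral>\<^sup>+\<omega>. sqdist (Zn n) Z \<omega> \<partial>P) \<le> ennreal (D * \<delta> n)"
    and sub: "AE \<omega> in P. (\<lambda>j. sqdist (Zn (k j)) Z \<omega>) \<longlonglongrightarrow> 0"
    and lim: "AE \<omega> in P. AE s in L. (\<lambda>j. Zn (k j) s \<omega>) \<longlonglongrightarrow> Z s \<omega>"
    by (rule predictable_L2_limit[of Zn "\<lambda>n. D * \<delta> n", OF Zp D(3) \<rho>]) blast
  have "AE \<omega> in P. \<forall>j. sq_int (Zn (k j)) \<omega>" unfolding AE_all_countable by (intro allI ito_sq_int[OF In(1)])
  then have sq: "AE \<omega> in P. sq_int Z \<omega>" using sub AE_space
  proof eventually_elim
    case (elim \<omega>)
    have "eventually (\<lambda>j. sqdist (Zn (k j)) Z \<omega> < 1) sequentially" using elim(2) by (rule order_tendstoD) simp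
    then obtain j where "sqdist (Zn (k j)) Z \<omega> < 1" by (auto simp: eventually_sequentially)
    then have "sqdist Z (Zn (k j)) \<omega> < 1" by (simp add: sqdist_def norm_minus_commute)
    then have "sqdist Z (Zn (k j)) \<omega> < \<infinity>" by (rule less_trans) simp
    with elim show ?case by (intro sq_int_close[OF Z Zp]) auto
  qed
  have "\<forall>j. \<exists>R. AE \<omega> in P. qv (\<lambda>s \<omega>. Zn (k (Suc j)) s \<omega> - Zn (k j) s \<omega>) T \<omega> \<le> R"
    by (rule allI, rule qvR_diff) blast
  from choice[OF this] obtain R where R: "\<And>j. AE \<omega> in P. qv (\<lambda>s \<omega>. Zn (k (Suc j)) s \<omega> - Zn (k j) s \<omega>) T \<omega> \<le> R j" by blast
  have fast: "(\<integral>\<^sup>+\<omega>. sqdist (Zn (k (Suc j))) (Zn (k j)) \<omega> \<partial>P) \<le> ennreal (2 * (1/8)^j)" for j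
  proof -
    have "D * \<delta> (k (Suc j)) + D * \<delta> (k j) \<le> 2 * (1/8)^j"
      using k(2)[of j] k(2)[of "Suc j"] zero_le_power[of "1/8::real" j] unfolding power_Suc by linarith
    then show ?thesis using D(3)[of "k (Suc j)" "k j"] by (meson ennreal_leI order_trans)
  qed
  obtain I where I: "ito_integral M T W Z I" "AE \<omega> in P. uniform_limit {0..T} (\<lambda>j t. In (k j) t \<omega>) (\<lambda>t. I t \<omega>) sequentially"
    by (rule ito_integral_limit[where Zk = "\<lambda>j. Zn (k j)" and Ik = "\<lambda>j. In (k j)", OF In(1) R fast Z sq sub]) blast
  let ?h = "\<lambda>\<omega> s. f s (path \<omega>) (Y s \<omega>) (Z s \<omega>)"
  have hp: "predictable M T W (\<lambda>s \<omega>. ?h \<omega> s)" by (rule drift_predictable[OF Y_predictable Z])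
  obtain c1 C kk where c: "0 \<le> c1" "0 \<le> C" "\<And>n. 0 \<le> kk n"
    "\<And>n. AE \<omega> in P. \<forall>s\<in>{0..T}. \<bar>Yn n s \<omega>\<bar> \<le> c1 \<and> - C \<le> g n \<omega> s \<and> \<bar>g n \<omega> s\<bar> \<le> kk n"
    "\<And>t w y z. t \<in> {0..T} \<Longrightarrow> w \<in> path_space T \<Longrightarrow> \<bar>y\<bar> \<le> c1 \<Longrightarrow> - C \<le> f t w y z"
    "\<And>n t. t \<in> {0..T} \<Longrightarrow> AE \<omega> in P. (LBINT s:{t..T}. \<bar>g n \<omega> s\<bar>) \<le> (In n T \<omega> - In n t \<omega>) + (2 * c1 + 2 * C * T)"
    by (rule drift_bounds) blast
  have all: "AE \<omega> in P. \<forall>n. (\<forall>s\<in>{0..T}. \<bar>Yn n s \<omega>\<bar> \<le> c1 \<and> - C \<le> g n \<omega> s) \<and> set_integrable lborel {0..T} (g n \<omega>) \<and>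
      (\<forall>a b. 0 \<le> a \<longrightarrow> a \<le> b \<longrightarrow> b \<le> T \<longrightarrow> In n b \<omega> - In n a \<omega> = Yn n b \<omega> - Yn n a \<omega> + (LBINT s:{a..b}. g n \<omega> s))"
    unfolding AE_all_countable
  proof
    fix n
    show "AE \<omega> in P. (\<forall>s\<in>{0..T}. \<bar>Yn n s \<omega>\<bar> \<le> c1 \<and> - C \<le> g n \<omega> s) \<and> set_integrable lborel {0..T} (g n \<omega>) \<and>
      (\<forall>a b. 0 \<le> a \<longrightarrow> a \<le> b \<longrightarrow> b \<le> T \<longrightarrow> In n b \<omega> - In n a \<omega> = Yn n b \<omega> - Yn n a \<omega> + (LBINT s:{a..b}. g n \<omega> s))"
      using c(4)[of n] gi[of n] In(2)[of n] by eventually_elim blast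
  qed
  have good: "AE \<omega> in P. continuous_on {0..T} (\<lambda>s. Y s \<omega>) \<and> Y T \<omega> = \<xi> \<omega> \<and> set_integrable lborel {0..T} (?h \<omega>) \<and>
    (\<forall>a b. 0 \<le> a \<longrightarrow> a \<le> b \<longrightarrow> b \<le> T \<longrightarrow> (LBINT s:{a..b}. ?h \<omega> s) \<le> (I b \<omega> - I a \<omega>) - (Y b \<omega> - Y a \<omega>))"
    using all Y_limit Y_continuous Y_terminal I(2) lim AE_space
  proof eventually_elim
    case (elim \<omega>)
    have \<omega>: "\<omega> \<in> space M" using elim(7) by simp
    have Yl: "(\<lambda>j. Yn (k j) s \<omega>) \<longlonglongrightarrow> Y s \<omega>" if "s \<in> {0..T}" for s
      using LIMSEQ_subseq_LIMSEQ[OF tendsto_uniform_limitI[OF elim(2) that] k(1)] by (simp add: comp_def)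
    have Il: "(\<lambda>j. In (k j) s \<omega>) \<longlonglongrightarrow> I s \<omega>" if "s \<in> {0..T}" for s
      using tendsto_uniform_limitI[OF elim(5) that] .
    have Yc: "\<bar>Y s \<omega>\<bar> \<le> c1" if s: "s \<in> {0..T}" for s
    proof (rule LIMSEQ_le_const2)
      show "(\<lambda>j. \<bar>Yn (k j) s \<omega>\<bar>) \<longlonglongrightarrow> \<bar>Y s \<omega>\<bar>" by (intro tendsto_rabs Yl s)
    qed (use elim(1) s in auto)
    have gl: "AE s in L. (\<lambda>j. g (k j) \<omega> s) \<longlonglongrightarrow> ?h \<omega> s"
      using elim(6) AE_space
    proof eventually_elim
      case (elim s)
      then show ?case by (intro f_continuous path_space \<omega> Yl) (auto simp: space_L)
    qed
    \<comment> \<open>The equation shows that the integrated drifts converge, although their limit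
      may exceed the integral of the limit drift.\<close>
    have l: "(\<lambda>j. LBINT s:{a..b}. g (k j) \<omega> s) \<longlonglongrightarrow> (I b \<omega> - I a \<omega>) - (Y b \<omega> - Y a \<omega>)" if ab: "0 \<le> a" "a \<le> b" "b \<le> T" for a b
    proof -
      have "(LBINT s:{a..b}. g (k j) \<omega> s) = (In (k j) b \<omega> - In (k j) a \<omega>) - (Yn (k j) b \<omega> - Yn (k j) a \<omega>)" for j
      proof -
        have "In (k j) b \<omega> - In (k j) a \<omega> = Yn (k j) b \<omega> - Yn (k j) a \<omega> + (LBINT s:{a..b}. g (k j) \<omega> s)" using elim(1) ab by blast
        then show ?thesis by linarith
      qed
      then show ?thesis using ab by (simp only:) (intro tendsto_diff Il Yl; simp)
    qed
    have gj: "set_integrable lborel {0..T} (g (k j) \<omega>)" "\<And>s. s \<in> {0..T} \<Longrightarrow> - C \<le> g (k j) \<omega> s" for j using elim(1) by auto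
    have h: "?h \<omega> \<in> borel_measurable L" "\<And>s. s \<in> {0..T} \<Longrightarrow> - C \<le> ?h \<omega> s"
      using predictable_section[OF hp \<omega>] c(5) path_space[OF \<omega>] Yc by auto
    note fd = fatou_drift[of "\<lambda>j. g (k j) \<omega>", OF gj h gl l]
    show ?case using fd elim(3,4) by blast
  qed
  then have "\<exists>N\<in>null_sets P. \<forall>\<omega>\<in>space M - N. continuous_on {0..T} (\<lambda>s. Y s \<omega>) \<and> Y T \<omega> = \<xi> \<omega> \<and> set_integrable lborel {0..T} (?h \<omega>) \<and>
    (\<forall>a b. 0 \<le> a \<longrightarrow> a \<le> b \<longrightarrow> b \<le> T \<longrightarrow> (LBINT s:{a..b}. ?h \<omega> s) \<le> (I b \<omega> - I a \<omega>) - (Y b \<omega> - Y a \<omega>))"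
    by (rule AE_E3) (intro bexI ballI, simp_all)
  then obtain N where N: "N \<in> null_sets P"
    and gd: "\<And>\<omega>. \<omega> \<in> space M - N \<Longrightarrow> continuous_on {0..T} (\<lambda>s. Y s \<omega>) \<and> Y T \<omega> = \<xi> \<omega> \<and> set_integrable lborel {0..T} (?h \<omega>) \<and>
    (\<forall>a b. 0 \<le> a \<longrightarrow> a \<le> b \<longrightarrow> b \<le> T \<longrightarrow> (LBINT s:{a..b}. ?h \<omega> s) \<le> (I b \<omega> - I a \<omega>) - (Y b \<omega> - Y a \<omega>))" by blast
  have offN: "AE \<omega> in P. \<omega> \<in> space M - N" using AE_not_in[OF N] AE_space by eventually_elim simp
  \<comment> \<open>The equation solved for \<open>A\<close>. The value 0 on \<open>N\<close> makes
    every path continuous, so that \<open>predictable_continuous\<close> applies.\<close>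
  define A where "A t \<omega> = (if \<omega> \<in> N then 0 else Y 0 \<omega> - Y t \<omega> - (LBINT s:{0..t}. ?h \<omega> s) + I t \<omega> - I 0 \<omega>)" for t \<omega>
  have AF: "A t \<in> borel_measurable (F t)" if t: "t \<in> {0..T}" for t
  proof -
    have 0: "0 \<in> {0..T}" using T_pos by simp
    have [measurable]: "Y t \<in> borel_measurable (F t)" "I t \<in> borel_measurable (F t)" "(\<lambda>\<omega>. LBINT s:{0..t}. ?h \<omega> s) \<in> borel_measurable (F t)"
      using predictable_F[OF Y_predictable t] ito_F[OF I(1) t] time_integral_F[OF hp t] by auto
    have [measurable]: "Y 0 \<in> borel_measurable (F t)" "I 0 \<in> borel_measurable (F t)"
      using predictable_F[OF Y_predictable 0, THEN F_mono] ito_F[OF I(1) 0, THEN F_mono] t by auto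
    have [measurable]: "N \<in> sets (F t)" using N null_F by blast
    show ?thesis unfolding A_def[abs_def] by measurable
  qed
  have Ac: "continuous_on {0..T} (\<lambda>t. A t \<omega>)" if \<omega>: "\<omega> \<in> space M" for \<omega>
  proof (cases "\<omega> \<in> N")
    case False
    then have gN: "continuous_on {0..T} (\<lambda>s. Y s \<omega>)" "set_integrable lborel {0..T} (?h \<omega>)" using gd \<omega> by auto
    have "continuous_on {0..T} (\<lambda>t. Y 0 \<omega> - Y t \<omega> - ((LBINT s:{0..T}. ?h \<omega> s) - (LBINT s:{t..T}. ?h \<omega> s)) + I t \<omega> - I 0 \<omega>)"
      by (intro continuous_intros gN(1) ito_cont[OF I(1) \<omega>] continuous_set_integral[OF gN(2)])
    then show ?thesis
      by (rule continuous_on_cong[THEN iffD1, rotated 2])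
        (use False set_integral_split[OF gN(2), of 0 _ T] in \<open>auto simp: A_def\<close>)
  qed (simp add: A_def)
  have Ap: "predictable M T W A" by (rule predictable_continuous[OF AF Ac])
  have Ainc: "A b \<omega> - A a \<omega> = (I b \<omega> - I a \<omega>) - (Y b \<omega> - Y a \<omega>) - (LBINT s:{a..b}. ?h \<omega> s)"
    if "\<omega> \<in> space M - N" "0 \<le> a" "a \<le> b" "b \<le> T" for \<omega> a b
    using that gd[OF that(1)] set_integral_split[of "?h \<omega>" 0 a b] by (simp add: A_def)
  have "bsde_supersolution M T W f \<xi> Y Z A"
    unfolding bsde_supersolution_def bsde_equation_def
  proof (intro conjI \<xi>_measurable Y_predictable Z Ap exI[of _ I] I(1))
    show "AE \<omega> in P. rcll T (\<lambda>t. Y t \<omega>)" using Y_continuous by eventually_elim (rule rcll_continuous)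
    show "AE \<omega> in P. mono_on {0..T} (\<lambda>t. A t \<omega>) \<and> rcll T (\<lambda>t. A t \<omega>) \<and> A 0 \<omega> = 0"
      using offN
    proof eventually_elim
      case (elim \<omega>)
      have "A a \<omega> \<le> A b \<omega>" if "0 \<le> a" "a \<le> b" "b \<le> T" for a b
      proof -
        have "(LBINT s:{a..b}. ?h \<omega> s) \<le> (I b \<omega> - I a \<omega>) - (Y b \<omega> - Y a \<omega>)" using gd[OF elim] that by blast
        then show ?thesis using Ainc[OF elim that] by linarith
      qed
      moreover have "rcll T (\<lambda>t. A t \<omega>)" using elim by (intro rcll_continuous Ac) simp
      moreover have "A 0 \<omega> = 0" using elim by (simp add: A_def set_integral_singleton)
      ultimately show ?case by (auto simp: mono_on_def)
    qed
    show "AE \<omega> in P. set_integrable lborel {0..T} (?h \<omega>)" using offN by eventually_elim (use gd in blast)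
    show "AE \<omega> in P. set_integrable lborel {0..T} (\<lambda>s. (norm (Z s \<omega>))\<^sup>2)" using sq by (simp add: sq_int_def)
    show "AE \<omega> in P. \<forall>t\<in>{0..T}. Y t \<omega> = \<xi> \<omega> + (LBINT s:{t..T}. ?h \<omega> s) - (I T \<omega> - I t \<omega>) + A T \<omega> - A t \<omega>"
      using offN
    proof eventually_elim
      case (elim \<omega>)
      show ?case
      proof
        fix t assume t: "t \<in> {0..T}"
        have "Y T \<omega> = \<xi> \<omega>" using gd[OF elim] by blast
        then show "Y t \<omega> = \<xi> \<omega> + (LBINT s:{t..T}. ?h \<omega> s) - (I T \<omega> - I t \<omega>) + A T \<omega> - A t \<omega>" using Ainc[OF elim, of t T] t by simp
      qed
    qed
  qed
  moreover have "bmo M T W Z"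
  \<comment> \<open>The uniform conditional energy bound for \<open>Zn\<close> passes to the limit
    by Fatou's lemma, first in time and then over the sample space.\<close>
  proof (rule bmoI[OF Z D(1)])
    fix t B assume t: "t \<in> {0..T}" and B: "B \<in> sets (F t)"
    let ?H = "\<lambda>V \<omega>. \<integral>\<^sup>+s\<in>{t..T}. ennreal ((norm (V s \<omega>))\<^sup>2) \<partial>lborel"
    have "(\<integral>\<^sup>+\<omega>. indicator B \<omega> * ?H Z \<omega> \<partial>P) \<le> (\<integral>\<^sup>+\<omega>. liminf (\<lambda>j. indicator B \<omega> * ?H (Zn (k j)) \<omega>) \<partial>P)"
    proof (rule nn_integral_mono_AE)
      show "AE \<omega> in P. indicator B \<omega> * ?H Z \<omega> \<le> liminf (\<lambda>j. indicator B \<omega> * ?H (Zn (k j)) \<omega>)"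
        using lim AE_space
      proof eventually_elim
        case (elim \<omega>)
        have [measurable]: "(\<lambda>s. Zn (k j) s \<omega>) \<in> borel_measurable L" for j using elim(2) by (intro predictable_section[OF Zp]) simp
        have [measurable]: "(\<lambda>s. s) \<in> borel_measurable L" by (rule measurable_restrict_space1) simp
        have HL: "?H V \<omega> = (\<integral>\<^sup>+s. ennreal ((norm (V s \<omega>))\<^sup>2) * (if t \<le> s then 1 else 0) \<partial>L)" for V :: "real \<Rightarrow> 'w \<Rightarrow> real^'d"
          unfolding nn_integral_L using t by (intro nn_integral_cong) (auto simp: indicator_def)
        have "?H Z \<omega> \<le> (\<integral>\<^sup>+s. liminf (\<lambda>j. ennreal ((norm (Zn (k j) s \<omega>))\<^sup>2) * (if t \<le> s then 1 else 0)) \<partial>L)"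
          unfolding HL
        proof (rule nn_integral_mono_AE)
          show "AE s in L. ennreal ((norm (Z s \<omega>))\<^sup>2) * (if t \<le> s then 1 else 0) \<le> liminf (\<lambda>j. ennreal ((norm (Zn (k j) s \<omega>))\<^sup>2) * (if t \<le> s then 1 else 0))"
            using elim(1)
          proof eventually_elim
            case (elim s)
            then have "(\<lambda>j. ennreal ((norm (Zn (k j) s \<omega>))\<^sup>2)) \<longlonglongrightarrow> ennreal ((norm (Z s \<omega>))\<^sup>2)" by (intro tendsto_intros)
            from lim_imp_Liminf[OF _ this] show ?case by simp
          qed
        qed
        also have "\<dots> \<le> liminf (\<lambda>j. ?H (Zn (k j)) \<omega>)" unfolding HL by (rule nn_integral_liminf) measurable
        finally show ?case by (auto simp: indicator_def)
      qed
    qed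
    also have "\<dots> \<le> liminf (\<lambda>j. \<integral>\<^sup>+\<omega>. indicator B \<omega> * ?H (Zn (k j)) \<omega> \<partial>P)"
    proof (rule nn_integral_liminf)
      have "?H (Zn (k j)) \<in> borel_measurable P" for j using t by (intro tail_energy_measurable[OF Zp]) auto
      then show "(\<lambda>\<omega>. indicator B \<omega> * ?H (Zn (k j)) \<omega>) \<in> borel_measurable P" for j
        using sets_FD[OF B] t by (intro borel_measurable_times_ennreal borel_measurable_indicator) auto
    qed
    also have "\<dots> \<le> liminf (\<lambda>j. ennreal D * emeasure P B)" by (intro Liminf_mono always_eventually allI D(2) t B)
    also have "\<dots> = ennreal D * emeasure P B" by (simp add: Liminf_const)
    finally show "(\<integral>\<^sup>+\<omega>. indicator B \<omega> * ?H Z \<omega> \<partial>P) \<le> ennreal D * emeasure P B" .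
  qed
  ultimately show ?thesis using bd \<rho> by (rule that)
qed

text \<open>\<open>comparison\<close> asks for a solution with bounded \<open>Z\<close>, so it is
  applied to the approximating \<open>Yn n\<close>; the loss \<open>\<delta> n\<close> in the
  terminal values disappears in the limit.\<close>

lemma comparison_from_above:
  assumes eq': "bsde_supersolution M T W f' \<xi>' Y' Z' A'" and b': "bounded_process M T Y'"
    and ff': "\<And>t w y z. t \<in> {0..T} \<Longrightarrow> w \<in> path_space T \<Longrightarrow> f t w y z \<le> f' t w y z"
    and \<xi>\<xi>': "AE \<omega> in P. \<xi> \<omega> \<le> \<xi>' \<omega>"
  shows "AE \<omega> in P. \<forall>t\<in>{0..T}. Y t \<omega> \<le> Y' t \<omega>"
proof -
  have S: "bsde_equation M T W f' \<xi>' Y' Z' A'" "predictable M T W Y'" "AE \<omega> in P. rcll T (\<lambda>t. Y' t \<omega>)" "AE \<omega> in P. mono_on {0..T} (\<lambda>t. A' t \<omega>)"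
    using eq' by (auto simp: bsde_supersolution_def elim: eventually_mono)
  have "AE \<omega> in P. \<forall>n. \<forall>s\<in>{0..T}. Yn n s \<omega> \<le> Y' s \<omega> + \<delta> n * exp (2 * K * (T - s))"
    unfolding AE_all_countable
  proof
    fix n
    have "AE \<omega> in P. \<xi>n n \<omega> \<le> \<xi>' \<omega> + \<delta> n"
      using \<xi>\<xi>' AE_space
    proof eventually_elim
      case (elim \<omega>)
      then show ?case using \<xi>\<delta>[of \<omega> n] by simp
    qed
    then show "AE \<omega> in P. \<forall>s\<in>{0..T}. Yn n s \<omega> \<le> Y' s \<omega> + \<delta> n * exp (2 * K * (T - s))"
      by (intro comparison[OF eq Yp Yb Zb S(1,2) b' S(3,4)] ff' \<delta>_nonneg)
  qed
  then show ?thesis using Y_limit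
  proof eventually_elim
    case (elim \<omega>)
    show ?case
    proof
      fix t assume t: "t \<in> {0..T}"
      have "(\<lambda>n. Y' t \<omega> + \<delta> n * exp (2 * K * (T - t))) \<longlonglongrightarrow> Y' t \<omega> + 0 * exp (2 * K * (T - t))" by (intro tendsto_intros \<delta>)
      with tendsto_uniform_limitI[OF elim(2) t] have "Y t \<omega> \<le> Y' t \<omega> + 0 * exp (2 * K * (T - t))"
        by (rule LIMSEQ_le) (use elim(1) t in auto)
      then show "Y t \<omega> \<le> Y' t \<omega>" by simp
    qed
  qed
qed

section \<open>The theorem\<close>

text \<open>An almost sure bound controls the essential supremum once the function is measurable.
  The supremum over time is measurable for continuous paths, and \<open>X\<close> has these off a
  null set; setting \<open>X\<close> to 0 there alters the supremum on a null set only.\<close>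

lemma esssup_sup_le:
  fixes X :: "real \<Rightarrow> 'w \<Rightarrow> real"
  assumes X: "predictable M T W X" and c: "AE \<omega> in P. continuous_on {0..T} (\<lambda>t. X t \<omega>)" and b: "AE \<omega> in P. \<forall>t\<in>{0..T}. \<bar>X t \<omega>\<bar> \<le> b"
  shows "esssup P (\<lambda>\<omega>. SUP t\<in>{0..T}. ennreal \<bar>X t \<omega>\<bar>) \<le> ennreal b"
proof -
  from c have "\<exists>N\<in>null_sets P. \<forall>\<omega>\<in>space M - N. continuous_on {0..T} (\<lambda>t. X t \<omega>)"
    by (rule AE_E3) (intro bexI ballI, simp_all)
  then obtain N where N: "N \<in> null_sets P" and Nc: "\<And>\<omega>. \<omega> \<in> space M - N \<Longrightarrow> continuous_on {0..T} (\<lambda>t. X t \<omega>)" by blast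
  define V where "V t \<omega> = (if \<omega> \<in> N then 0 else X t \<omega>)" for t \<omega>
  have "(\<lambda>\<omega>. SUP t\<in>{0..T}. ennreal \<bar>V t \<omega>\<bar>) \<in> borel_measurable P"
  proof (rule SUP_abs_measurable)
    show "V t \<in> borel_measurable P" if "t \<in> {0..T}" for t
    proof -
      have [measurable]: "X t \<in> borel_measurable P" "N \<in> sets P" using predictable_P[OF X that] N by auto
      show ?thesis unfolding V_def[abs_def] by measurable
    qed
    show "continuous_on {0..T} (\<lambda>t. V t \<omega>)" if "\<omega> \<in> space P" for \<omega>
      using Nc[of \<omega>] that by (cases "\<omega> \<in> N") (auto simp: V_def)
  qed (use T_pos in simp)
  moreover have "AE \<omega> in P. (SUP t\<in>{0..T}. ennreal \<bar>V t \<omega>\<bar>) = (SUP t\<in>{0..T}. ennreal \<bar>X t \<omega>\<bar>)"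
    using AE_not_in[OF N] by eventually_elim (simp add: V_def)
  ultimately have m: "(\<lambda>\<omega>. SUP t\<in>{0..T}. ennreal \<bar>X t \<omega>\<bar>) \<in> borel_measurable P" by (rule P_AE_eq)
  show ?thesis
  proof (rule esssup_I[OF m])
    show "AE \<omega> in P. (SUP t\<in>{0..T}. ennreal \<bar>X t \<omega>\<bar>) \<le> ennreal b"
      using b by eventually_elim (intro SUP_least ennreal_leI, blast)
  qed
qed

text \<open>In place of the Cauchy-Schwarz inequality,
  \<open>sqrt x \<le> \<eta> + x / \<eta>\<close> is integrated. A value of \<open>\<eta>\<close>
  near \<open>sqrt \<rho>\<close> balances both terms, and \<open>\<epsilon>\<close> keeps it
  positive when \<open>\<rho> = 0\<close>.\<close>

lemma nn_integral_sqrt_sqdist: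
  assumes X: "predictable M T W X" and Z: "predictable M T W Z" and \<rho>: "0 \<le> \<rho>" "(\<integral>\<^sup>+\<omega>. sqdist X Z \<omega> \<partial>P) \<le> ennreal \<rho>" and \<epsilon>: "0 < \<epsilon>"
  shows "(\<integral>\<^sup>+\<omega>. ennreal (sqrt (LBINT s:{0..T}. (norm (X s \<omega> - Z s \<omega>))\<^sup>2)) \<partial>P) \<le> ennreal (2 * sqrt \<rho> + \<epsilon>)"
proof -
  define \<eta> where "\<eta> = sqrt \<rho> + \<epsilon>"
  have \<eta>: "0 < \<eta>" using \<rho>(1) \<epsilon> by (simp add: \<eta>_def add_nonneg_pos)
  note [measurable] = sqdist_measurable[OF X Z]
  have "ennreal (sqrt (LBINT s:{0..T}. (norm (X s \<omega> - Z s \<omega>))\<^sup>2)) \<le> ennreal \<eta> + ennreal (1 / \<eta>) * sqdist X Z \<omega>" for \<omega>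
  proof -
    let ?x = "LBINT s:{0..T}. (norm (X s \<omega> - Z s \<omega>))\<^sup>2"
    have x: "0 \<le> ?x" by (intro set_integral_nonneg) simp
    have le: "ennreal ?x \<le> sqdist X Z \<omega>"
    proof (cases "set_integrable lborel {0..T} (\<lambda>s. (norm (X s \<omega> - Z s \<omega>))\<^sup>2)")
      case True
      then show ?thesis by (simp add: sqdist_def nn_set_integral_eq_integral)
    next
      \<comment> \<open>Without integrability the Bochner integral is 0 by convention.\<close>
      case False
      then show ?thesis by (simp add: set_integrable_def set_lebesgue_integral_def not_integrable_integral_eq)
    qed
    have "sqrt ?x \<le> \<eta> + 1 / \<eta> * ?x"
    proof (cases "sqrt ?x \<le> \<eta>")
      case True
      have "0 \<le> 1 / \<eta> * ?x" using \<eta> x by simp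
      then show ?thesis using True by linarith
    next
      case False
      then have "\<eta> * sqrt ?x \<le> sqrt ?x * sqrt ?x" using x by (intro mult_right_mono) auto
      then have "\<eta> * sqrt ?x \<le> ?x" using x by simp
      then have "sqrt ?x \<le> 1 / \<eta> * ?x" using \<eta> by (simp add: field_simps)
      then show ?thesis using \<eta> by linarith
    qed
    then have "ennreal (sqrt ?x) \<le> ennreal (\<eta> + 1 / \<eta> * ?x)" by (rule ennreal_leI)
    also have "\<dots> = ennreal \<eta> + ennreal (1 / \<eta>) * ennreal ?x" using \<eta> x by (simp add: ennreal_mult[symmetric])
    also have "\<dots> \<le> ennreal \<eta> + ennreal (1 / \<eta>) * sqdist X Z \<omega>" by (intro add_left_mono mult_left_mono le) simp
    finally show ?thesis .
  qed
  then have "(\<integral>\<^sup>+\<omega>. ennreal (sqrt (LBINT s:{0..T}. (norm (X s \<omega> - Z s \<omega>))\<^sup>2)) \<partial>P) \<le> (\<integral>\<^sup>+\<omega>. ennreal \<eta> + ennreal (1 / \<eta>) * sqdist X Z \<omega> \<partial>P)"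
    by (intro nn_integral_mono)
  also have "\<dots> = ennreal \<eta> + ennreal (1 / \<eta>) * (\<integral>\<^sup>+\<omega>. sqdist X Z \<omega> \<partial>P)"
    by (simp add: nn_integral_add nn_integral_cmult P.emeasure_space_1[simplified])
  also have "\<dots> \<le> ennreal \<eta> + ennreal (1 / \<eta>) * ennreal \<rho>" by (intro add_left_mono mult_left_mono \<rho>(2)) simp
  also have "\<dots> = ennreal (\<eta> + \<rho> / \<eta>)" using \<eta> \<rho>(1) by (simp add: ennreal_mult[symmetric])
  also have "\<dots> \<le> ennreal (2 * sqrt \<rho> + \<epsilon>)"
  proof (rule ennreal_leI)
    have "\<rho> = sqrt \<rho> * sqrt \<rho>" using \<rho>(1) by simp
    also have "\<dots> \<le> sqrt \<rho> * \<eta>" using \<epsilon> \<rho>(1) by (intro mult_left_mono) (auto simp: \<eta>_def)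
    finally have "\<rho> / \<eta> \<le> sqrt \<rho>" using \<eta> by (simp add: pos_divide_le_eq)
    then show "\<eta> + \<rho> / \<eta> \<le> 2 * sqrt \<rho> + \<epsilon>" by (simp add: \<eta>_def)
  qed
  finally show ?thesis .
qed

end

theorem theorem2p5:
  fixes M :: "'w measure" and T :: real and W :: "real \<Rightarrow> 'w \<Rightarrow> real^'d"
    and f :: "'d driver_fun"
    and \<phi>n :: "nat \<Rightarrow> (real \<Rightarrow> real^'d) \<Rightarrow> real" and \<phi> :: "(real \<Rightarrow> real^'d) \<Rightarrow> real"
    and Yn :: "nat \<Rightarrow> real \<Rightarrow> 'w \<Rightarrow> real" and Zn :: "nat \<Rightarrow> real \<Rightarrow> 'w \<Rightarrow> real^'d"
  assumes "prob_space M" and "0 < T" and "brownian_motion M T W"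
    and "driver T f" and "f1 T f" and "f2 T f" and "f3 T f" and "f4 T f" and "f5 T f"
    and "\<And>n. bounded (\<phi>n n ` path_space T)" and "\<And>n. path_lipschitz T (\<phi>n n)"
    and "bounded (\<phi> ` path_space T)"
    and "(\<lambda>n. SUP w\<in>path_space T. \<bar>\<phi>n n w - \<phi> w\<bar>) \<longlonglongrightarrow> 0"
    and "\<And>n. bsde_solution M T W f (\<lambda>\<omega>. \<phi>n n (sample_path T W \<omega>)) (Yn n) (Zn n)"
    and "\<And>n. bounded_process M T (Zn n)"
  shows "\<exists>Y Z A.
      bsde_supersolution M T W f (\<lambda>\<omega>. \<phi> (sample_path T W \<omega>)) Y Z A \<and>
      bounded_process M T Y \<and>
      (AE \<omega> in completion M. continuous_on {0..T} (\<lambda>t. Y t \<omega>)) \<and>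
      bmo M T W Z \<and>
      (\<lambda>n. esssup (completion M) (\<lambda>\<omega>. SUP t\<in>{0..T}. ennreal \<bar>Yn n t \<omega> - Y t \<omega>\<bar>)) \<longlonglongrightarrow> 0 \<and>
      (\<lambda>n. \<integral>\<^sup>+\<omega>. ennreal (sqrt (LBINT s:{0..T}. (norm (Zn n s \<omega> - Z s \<omega>))\<^sup>2)) \<partial>completion M)
        \<longlonglongrightarrow> 0 \<and>
      (increasing_in_y T f \<or> decreasing_in_y T f \<longrightarrow>
        bounded_comparison_from_above M T W f (\<lambda>\<omega>. \<phi> (sample_path T W \<omega>)) Y Z A \<and>
        minimal_bounded_supersolution M T W f (\<lambda>\<omega>. \<phi> (sample_path T W \<omega>)) Y Z A)"
proof -
  define \<delta> where "\<delta> n = (SUP w\<in>path_space T. \<bar>\<phi>n n w - \<phi> w\<bar>)" for n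
  obtain c where c: "\<And>w. w \<in> path_space T \<Longrightarrow> \<bar>\<phi> w\<bar> \<le> c" using assms(12) by (auto simp: bounded_iff)
  have \<phi>\<delta>: "\<bar>\<phi>n n w - \<phi> w\<bar> \<le> \<delta> n" if "w \<in> path_space T" for n w
  proof -
    obtain b where b: "\<And>w. w \<in> path_space T \<Longrightarrow> \<bar>\<phi>n n w\<bar> \<le> b" using assms(10)[of n] by (auto simp: bounded_iff)
    \<comment> \<open>In \<open>real\<close> a supremum is an upper bound only for sets bounded
      above; boundedness of both functionals ensures this.\<close>
    have "bdd_above ((\<lambda>w. \<bar>\<phi>n n w - \<phi> w\<bar>) ` path_space T)"
      by (rule bdd_aboveI2[where M = "b + c"]) (meson add_mono b c order_trans abs_triangle_ineq4)
    then show ?thesis unfolding \<delta>_def using that by (intro cSUP_upper)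
  qed
  interpret brownian M T W using assms(1-3) by (rule brownian.intro)
  interpret bsde_approx M T W f "\<lambda>n \<omega>. \<phi>n n (path \<omega>)" "\<lambda>\<omega>. \<phi> (path \<omega>)" Yn Zn \<delta> c
    by unfold_locales (use assms \<phi>\<delta> c path_space in \<open>auto simp: \<delta>_def[abs_def]\<close>)
  obtain Z A \<rho> where sup: "bsde_supersolution M T W f (\<lambda>\<omega>. \<phi> (path \<omega>)) Y Z A" and bmo: "bmo M T W Z"
    and \<rho>: "\<And>n. (\<integral>\<^sup>+\<omega>. sqdist (Zn n) Z \<omega> \<partial>P) \<le> ennreal (\<rho> n)" "\<rho> \<longlonglongrightarrow> 0" "\<And>n. 0 \<le> \<rho> n"
    by (rule limit) blast
  have Zp': "predictable M T W Z" using bmo by (simp add: bmo_def)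
  have convY: "(\<lambda>n. esssup P (\<lambda>\<omega>. SUP t\<in>{0..T}. ennreal \<bar>Yn n t \<omega> - Y t \<omega>\<bar>)) \<longlonglongrightarrow> 0"
  proof (rule tendsto_sandwich[where f = "\<lambda>_. 0"])
    have "esssup P (\<lambda>\<omega>. SUP t\<in>{0..T}. ennreal \<bar>Yn n t \<omega> - Y t \<omega>\<bar>) \<le> ennreal (\<delta> n * E)" for n
    proof (rule esssup_sup_le[OF predictable_diff[OF Yp Y_predictable]])
      show "AE \<omega> in P. continuous_on {0..T} (\<lambda>t. Yn n t \<omega> - Y t \<omega>)"
        using equation_continuous[OF eq] Y_continuous by eventually_elim (rule continuous_on_diff)
      show "AE \<omega> in P. \<forall>t\<in>{0..T}. \<bar>Yn n t \<omega> - Y t \<omega>\<bar> \<le> \<delta> n * E" using Y_close by eventually_elim blast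
    qed
    then show "\<forall>\<^sub>F n in sequentially. esssup P (\<lambda>\<omega>. SUP t\<in>{0..T}. ennreal \<bar>Yn n t \<omega> - Y t \<omega>\<bar>) \<le> ennreal (\<delta> n * E)" by simp
    show "(\<lambda>n. ennreal (\<delta> n * E)) \<longlonglongrightarrow> 0" using tendsto_ennrealI[OF \<delta>E] by simp
  qed auto
  have convZ: "(\<lambda>n. \<integral>\<^sup>+\<omega>. ennreal (sqrt (LBINT s:{0..T}. (norm (Zn n s \<omega> - Z s \<omega>))\<^sup>2)) \<partial>P) \<longlonglongrightarrow> 0"
  proof (rule tendsto_sandwich[where f = "\<lambda>_. 0"])
    show "\<forall>\<^sub>F n in sequentially. (\<integral>\<^sup>+\<omega>. ennreal (sqrt (LBINT s:{0..T}. (norm (Zn n s \<omega> - Z s \<omega>))\<^sup>2)) \<partial>P) \<le> ennreal (2 * sqrt (\<rho> n) + 1 / real (Suc n))"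
      by (intro always_eventually allI nn_integral_sqrt_sqdist Zp Zp' \<rho>) simp
    have "(\<lambda>n. 2 * sqrt (\<rho> n) + 1 / real (Suc n)) \<longlonglongrightarrow> 2 * sqrt 0 + 0"
      using LIMSEQ_inverse_real_of_nat by (intro tendsto_add tendsto_mult tendsto_const tendsto_real_sqrt \<rho>(2)) (simp add: inverse_eq_divide)
    from tendsto_ennrealI[OF this] show "(\<lambda>n. ennreal (2 * sqrt (\<rho> n) + 1 / real (Suc n))) \<longlonglongrightarrow> 0" by simp
  qed auto
  have bca: "bounded_comparison_from_above M T W f (\<lambda>\<omega>. \<phi> (path \<omega>)) Y Z A"
    unfolding bounded_comparison_from_above_def
  proof (intro conjI allI impI sup, elim conjE)
    fix f' \<xi>' Y' Z' A'
    assume "\<forall>t\<in>{0..T}. \<forall>w\<in>path_space T. \<forall>y z. f t w y z \<le> f' t w y z" "AE \<omega> in P. \<phi> (path \<omega>) \<le> \<xi>' \<omega>"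
      "bsde_supersolution M T W f' \<xi>' Y' Z' A'" "bounded_process M T Y'"
    then show "AE \<omega> in P. \<forall>t\<in>{0..T}. Y t \<omega> \<le> Y' t \<omega>" by (intro comparison_from_above) auto
  qed
  moreover have "minimal_bounded_supersolution M T W f (\<lambda>\<omega>. \<phi> (path \<omega>)) Y Z A"
    unfolding minimal_bounded_supersolution_def
    by (intro conjI sup Y_bounded allI impI, elim conjE, rule comparison_from_above) auto
  ultimately show ?thesis using sup Y_bounded Y_continuous bmo convY convZ by blast
qed

end
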